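(* **Setting.** Let $U\subseteq\mathbb{R}^m$ be a non-empty compact set with $0\in U$, let $\tau\ge 0$, $r\ge 0$, let $f:\mathbb{R}^n\times\mathbb{R}^m\to\mathbb{R}^n$ be a smooth vector field with $f(0,0)=0$ and let $h:\mathbb{R}^n\to\mathbb{R}^k$ be a smooth mapping with $h(0)=0$. Consider the control system with input delay $\tau$ $$\dot x(t)=f(x(t),u(t-\tau)),\qquad x(t)\in\mathbb{R}^n,\ u(t)\in U, \tag{S}$$ with sampled, delayed and corrupted measurements $$y(\tau_i)=h(x(\tau_i-r))+e(\tau_i), \tag{M}$$ where $\{\tau_i\}_{i=0}^\infty$ is a partition of $\mathbb{R}_+$ (the sampling times) and $e$ is the measurement error. **Hypotheses.** Assume all of the following. 1. There are a radially unbounded (not necessarily positive definite) function $V\in C^2(\mathbb{R}^n;\mathbb{R}_+)$, a positive definite function $W\in C^1(\mathbb{R}^n;\mathbb{R}_+)$ and a constant $R>0$ such that $\nabla V(x)f(x,u)\le -W(x)$ for all $(x,u)\in\mathbb{R}^n\times U$ with $V(x)\ge R$. 2. There are a positive definite function $P\in C^2(\mathbb{R}^n;\mathbb{R}_+)$, constants $\mu,K_1>0$ with $K_1|x|^2\le P(x)$ for all $x\in\mathbb{R}^n$ with $V(x)\le R$, and a globally Lipschitz mapping $\mathbf{k}:\mathbb{R}^n\to U$ with $\mathbf{k}(0)=0$ such that $\nabla P(x)f(x,\mathbf{k}(x))\le -2\mu|x|^2$ for all $x\in\mathbb{R}^n$ with $V(x)\le R$. 3. There are a symmetric positive definite matrix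 $Q\in\mathbb{R}^{n\times n}$, constants $\omega>0$, $b>R$ and a matrix $L\in\mathbb{R}^{n\times k}$ such that $$(z-x)'Q\bigl(f(z,u)+L(h(z)-h(x))-f(x,u)\bigr)\le-\omega|z-x|^2$$ for all $u\in U$, $z,x\in\mathbb{R}^n$ with $V(z)\le b$ and $V(x)\le R$. 4. There are constants $c\in(0,1)$ and $a$ with $R\le a<b$ such that $$\nabla V(z)\bigl(f(z,u)+L(h(z)-h(x))\bigr)\le -W(z)+(1-c)|\nabla V(z)|^2\,\frac{(z-x)'Q\bigl(f(z,u)+L(h(z)-h(x))-f(x,u)\bigr)}{\nabla V(z)Q(z-x)}$$ for all $u\in U$, $z,x\in\mathbb{R}^n$ with $a<V(z)\le b$, $\nabla V(z)Q(z-x)<0$ and $V(x)\le R$. **Definitions.** Let $p:\mathbb{R}_+\to[0,1]$ be an arbitrary locally Lipschitz function with $p(s)=1$ for all $s\ge b$ and $p(s)=0$ for all $s\le a$. Define $\varphi:\mathbb{R}^n\times\mathbb{R}^k\times\mathbb{R}^m\to\mathbb{R}_+$ by $$\varphi(z,y,u):=\max\bigl(0,\ \nabla V(z)f(z,u)+W(z)+p(V(z))\nabla V(z)L(h(z)-y)\bigr)$$ and, for $(z,y,u)\in\mathbb{R}^n\times\mathbb{R}^k\times U$, $$\hat k(z,y,u):=L(h(z)-y)\ \text{ if } V(z)\le R,\qquad \hat k(z,y,u):=L(h(z)-y)-\frac{\varphi(z,y,u)}{|\nabla V(z)|^2}(\nabla V(z))'\ \text{ if } V(z)>R .$$ Let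 $q:\mathbb{R}\to\mathbb{R}_+$ be continuously differentiable with $q(s)=1$ for $s\le1$ and $s\,q(s)\le K$ for $s\ge1$, where $K\ge1$ is a constant. Let $\psi:\mathbb{R}^n\to[1,+\infty)$ be a smooth function satisfying the implication $$V(x)\le\max(V(z),b)\ \Rightarrow\ |x|\le\psi(z).$$ Let $N>0$ be an integer, $\delta:=\frac{r+\tau}{N}$, and put $$\rho(s):=\max\{|f(z,u)|:(z,u)\in\mathbb{R}^n\times U,\ |z|\le s\},$$ $$S_1:=\{x\in\mathbb{R}^n:V(x)\le R\},\quad S_2:=\{x\in\mathbb{R}^n:V(x)\le b\},$$ $$S_3:=\{x\in\mathbb{R}^n:|x|\le K\psi(z)+\delta\rho(K\psi(z)),\ z\in S_2\},\quad S_4:=\{x\in\mathbb{R}^n:|x|\le K\psi(z),\ z\in S_2\}$$ (in $S_3,S_4$ the inequality is required for some $z\in S_2$), $$M_1^q:=\sup\left\{\frac{\left|q\left(\frac{|\xi|}{\psi(z)}\right)\xi-q\left(\frac{|x|}{\psi(z)}\right)x\right|}{|x-\xi|}:x\in S_1,\ \xi\in S_3,\ z\in S_2,\ x\ne\xi\right\},$$ $$M_1^f:=\sup\left\{\frac{|f(x,u)-f(\xi,u)|}{|x-\xi|}:x\in S_1,\ \xi\in S_4,\ u\in U,\ x\ne\xi\right\},$$ $$G_1:=\sup\left\{\frac{|\nabla h(x)f(x,u)-\nabla h(z)f(z,u)|}{|x-z|}:x\in S_1,\ z\in S_2,\ u\in U,\ x\ne z\right\},$$ $$G_2:=\sup\left\{\frac{|\hat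 k(z,y,u)-\hat k(z,w,u)|}{|y-w|}:y,w\in\mathbb{R}^k,\ z\in S_2,\ u\in U,\ y\ne w\right\},$$ $$\widetilde P:=\max\{|\nabla^2P(x)|:x\in \mathrm{co}(S_1)\},$$ where $\mathrm{co}(S_1)$ is the convex hull of $S_1$, and let $K_2\in(0,|Q|]$ be a constant with $K_2|x|^2\le x'Qx$ for all $x\in\mathbb{R}^n$. Let $T_s>0$, $\sigma>0$ be constants such that $$\sigma\le\min\left(\frac{\mu}{\sqrt n\,\widetilde P},\ \frac{c\omega}{4|Q|}\right),\qquad \delta M_1^qM_1^fe^{\sigma\delta}<1,\qquad T_sG_1e^{\sigma T_s}\sqrt{\frac{2|Q|}{K_2}}\,\frac{G_2|Q|}{c\omega}<1 .$$ **Conclusion.** There exist a constant $\Gamma>0$ and a locally Lipschitz function $C\in K_\infty$ such that for every partition $\{\tau_i\}_{i=0}^\infty$ of $\mathbb{R}_+$ with $\sup_{i\ge0}(\tau_{i+1}-\tau_i)\le T_s$, every $e\in L^\infty(\mathbb{R}_+;\mathbb{R}^k)$, $\xi_{i,0}\in L^\infty([-\delta,0);\mathbb{R}^n)$ ($i=1,\dots,N$), $(z_0,w_0)\in\mathbb{R}^n\times\mathbb{R}^k$, $x_0\in C^0([-r,0];\mathbb{R}^n)$ and $u_0\in L^\infty([-r-\tau,0);U)$, the solution of (S), (M) together with $$\dot z(t)=f(z(t),u(t-r-\tau))+\hat k(z(t),w(t),u(t-r-\tau)),\quad t\ge0,$$ $$\dot w(t)=\nabla h(z(t))f(z(t),u(t-r-\tau)),\quad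 t\in[\tau_i,\tau_{i+1}),\ i\ge0,$$ $$w(\tau_i)=y(\tau_i),\quad i\ge1,$$ $$\xi_j(t)=q\left(\frac{|\xi_{j-1}(t)|}{\psi(z(t))}\right)\xi_{j-1}(t)+\int_0^\delta f\left(q\left(\frac{|\xi_j(t+s-\delta)|}{\psi(z(t))}\right)\xi_j(t+s-\delta),\ u(t+(j-1)\delta-\tau-r+s)\right)ds,\quad t\ge0,\ j=1,\dots,N,$$ with $\xi_0(t)=z(t)$, and $$u(t)=\mathbf{k}(\xi_N(t)),\quad t\ge0,$$ with initial condition $\xi_j(\theta)=\xi_{j,0}(\theta)$ for $\theta\in[-\delta,0)$ ($j=1,\dots,N$), $(z(0),w(0))=(z_0,w_0)$, $x(\theta)=x_0(\theta)$ for $\theta\in[-r,0]$, $u(\theta)=u_0(\theta)$ for $\theta\in[-r-\tau,0)$, exists and satisfies for all $t\ge0$: $$\sup_{-r\le s\le0}|x(t+s)|+|w(t)|+|z(t)|+\sum_{j=1}^N\sup_{-\delta\le s<0}|\xi_j(t+s)|+\sup_{-r-\tau\le s<0}|u(t+s)|$$ $$\le e^{-\sigma t}\,C\left(\sup_{-r\le s\le0}|x_0(s)|+|z_0|+|w_0|+\sum_{j=1}^N\sup_{-\delta\le s<0}|\xi_{j,0}(s)|+\sup_{-r-\tau\le s<0}|u_0(s)|+\sup_{0\le s\le t}|e(s)|\right)+\Gamma\sup_{0\le s\le t}|e(s)| .$$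
   Context: $\mathbb{R}_+:=[0,+\infty)$. A partition of $\mathbb{R}_+$ is an increasing sequence $\{\tau_i\}_{i=0}^\infty$ with $\tau_0=0$ and $\lim_{i\to\infty}\tau_i=+\infty$. For a vector $x$, $x'$ is its transpose and $|x|$ its Euclidean norm; for a matrix $A$, $A'$ is its transpose and $|A|=\sup\{|Ax|:|x|=1\}$ its induced norm. The gradient $\nabla V(x)$ of a scalar function is a row vector; $\nabla h(x)$ is the Jacobian matrix of $h$; $\nabla^2P(x)$ is the Hessian matrix of $P$. A function $V:\mathbb{R}^n\to\mathbb{R}_+$ is positive definite if $V(0)=0$ and $V(x)>0$ for all $x\ne0$; it is radially unbounded if for every $M\ge0$ the set $\{x:V(x)\le M\}$ is either empty or bounded. $K_\infty$ is the class of strictly increasing continuous functions $\alpha:\mathbb{R}_+\to\mathbb{R}_+$ with $\alpha(0)=0$ and $\lim_{s\to+\infty}\alpha(s)=+\infty$. $C^k(A;\Omega)$ is the class of functions on $A$ with values in $\Omega$ and continuous derivatives of order $k$ ($C^0$: continuous functions). Differential equations driven by the measurable input $u$ are satisfied almost everywhere by absolutely continuous functions ($w$ is absolutely continuous on each sampling interval and is reset at the times $\tau_i$, $i\ge1$).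
   Formalization: Adds the hypothesis that 0 is an interior point of S_1 = {x : V(x) ≤ R}; without it the claim fails, e.g. for U = {0}, f = -x^3, V = 1 + x^2, W = 2x^4, R = 1, where S_1 = {0} and x does not decay exponentially. *)

theory Defs
  imports "HOL-Analysis.Analysis"
begin

primrec Ck :: "nat \<Rightarrow> ('a::real_normed_vector \<Rightarrow> 'b::real_normed_vector) \<Rightarrow> bool" where
  "Ck 0 g \<longleftrightarrow> continuous_on UNIV g"
| "Ck (Suc k) g \<longleftrightarrow>
     (\<forall>x. g differentiable (at x)) \<and> (\<forall>v. Ck k (\<lambda>x. frechet_derivative g (at x) v))"

definition smooth :: "('a::real_normed_vector \<Rightarrow> 'b::real_normed_vector) \<Rightarrow> bool" where
  "smooth g \<longleftrightarrow> (\<forall>k. Ck k g)"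

text \<open>The row vector \<open>\<nabla>V(x)\<close> is represented by an ordinary vector, so that the scalar
  \<open>\<nabla>V(x) v\<close> is written \<open>grad V x \<bullet> v\<close>.\<close>

definition grad :: "(real^'n \<Rightarrow> real) \<Rightarrow> real^'n \<Rightarrow> real^'n" where
  "grad V x = (\<chi> i. frechet_derivative V (at x) (axis i 1))"

definition hessian :: "(real^'n \<Rightarrow> real) \<Rightarrow> real^'n \<Rightarrow> real^'n^'n" where
  "hessian P x = jacobian (grad P) (at x)"

definition matnorm :: "real^'n^'m \<Rightarrow> real" where
  "matnorm A = onorm (\<lambda>x. A *v x)"

definition positive_definite_fun :: "(real^'n \<Rightarrow> real) \<Rightarrow> bool" where
  "positive_definite_fun V \<longleftrightarrow> V 0 = 0 \<and> (\<forall>x. x \<noteq> 0 \<longrightarrow> V x > 0)"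

definition radially_unbounded :: "(real^'n \<Rightarrow> real) \<Rightarrow> bool" where
  "radially_unbounded V \<longleftrightarrow> (\<forall>M\<ge>0. {x. V x \<le> M} = {} \<or> bounded {x. V x \<le> M})"

definition locally_lipschitz_on ::
    "'a::metric_space set \<Rightarrow> ('a \<Rightarrow> 'b::metric_space) \<Rightarrow> bool" where
  "locally_lipschitz_on A g \<longleftrightarrow> (\<forall>x\<in>A. \<exists>d>0. \<exists>M. M-lipschitz_on (cball x d \<inter> A) g)"

definition class_K_inf :: "(real \<Rightarrow> real) \<Rightarrow> bool" where
  "class_K_inf \<alpha> \<longleftrightarrow> strict_mono_on {0..} \<alpha> \<and> continuous_on {0..} \<alpha> \<and> (\<forall>s\<ge>0. \<alpha> s \<ge> 0) \<and>
     \<alpha> 0 = 0 \<and> filterlim \<alpha> at_top at_top"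

definition time_partition :: "(nat \<Rightarrow> real) \<Rightarrow> bool" where
  "time_partition ts \<longleftrightarrow> strict_mono ts \<and> ts 0 = 0 \<and> filterlim ts at_top sequentially"

text \<open>Elements of \<open>L\<^sup>\<infinity>\<close> are functions, not classes modulo null sets, and their bounds are
  pointwise suprema: the measurement error enters the closed loop through its values at the
  (countably many) sampling times, which an essential supremum does not control.\<close>

definition Linf_fun ::
    "real set \<Rightarrow> 'a set \<Rightarrow> (real \<Rightarrow> 'a::euclidean_space) \<Rightarrow> bool" where
  "Linf_fun A Y g \<longleftrightarrow>
     g \<in> borel_measurable (lebesgue_on A) \<and> bounded (g ` A) \<and> g ` A \<subseteq> Y"

text \<open>The supremum of a norm over the empty set is 0; this occurs for the index sets
  \<open>[-\<delta>,0)\<close> and \<open>[-r-\<tau>,0)\<close> when \<open>r + \<tau> = 0\<close>.\<close>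

definition sup_norm :: "real set \<Rightarrow> (real \<Rightarrow> 'a::real_normed_vector) \<Rightarrow> real" where
  "sup_norm A g = (if A = {} then 0 else SUP s\<in>A. norm (g s))"

definition abs_cont_on :: "real set \<Rightarrow> (real \<Rightarrow> 'a::real_normed_vector) \<Rightarrow> bool" where
  "abs_cont_on I g \<longleftrightarrow>
     (\<forall>\<epsilon>>0. \<exists>\<eta>>0. \<forall>D T. D division_of T \<and> T \<subseteq> I \<and> (\<Sum>J\<in>D. Sup J - Inf J) < \<eta> \<longrightarrow>
        (\<Sum>J\<in>D. norm (g (Sup J) - g (Inf J))) < \<epsilon>)"

definition ode_ae :: "real set \<Rightarrow> (real \<Rightarrow> 'a::euclidean_space) \<Rightarrow> (real \<Rightarrow> 'a) \<Rightarrow> bool" where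
  "ode_ae I y F \<longleftrightarrow> (AE t in lebesgue_on I. (y has_vector_derivative F t) (at t))"

definition phi ::
    "(real^'n \<Rightarrow> real^'m \<Rightarrow> real^'n) \<Rightarrow> (real^'n \<Rightarrow> real^'k) \<Rightarrow> (real^'n \<Rightarrow> real) \<Rightarrow>
     (real^'n \<Rightarrow> real) \<Rightarrow> (real \<Rightarrow> real) \<Rightarrow> real^'k^'n \<Rightarrow>
     real^'n \<Rightarrow> real^'k \<Rightarrow> real^'m \<Rightarrow> real" where
  "phi f h V W p L z y u =
     max 0 (grad V z \<bullet> f z u + W z + p (V z) * (grad V z \<bullet> (L *v (h z - y))))"

definition khat ::
    "(real^'n \<Rightarrow> real^'m \<Rightarrow> real^'n) \<Rightarrow> (real^'n \<Rightarrow> real^'k) \<Rightarrow> (real^'n \<Rightarrow> real) \<Rightarrow>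
     (real^'n \<Rightarrow> real) \<Rightarrow> (real \<Rightarrow> real) \<Rightarrow> real^'k^'n \<Rightarrow> real \<Rightarrow>
     real^'n \<Rightarrow> real^'k \<Rightarrow> real^'m \<Rightarrow> real^'n" where
  "khat f h V W p L R z y u =
     (if V z \<le> R then L *v (h z - y)
      else L *v (h z - y) - (phi f h V W p L z y u / (norm (grad V z))\<^sup>2) *\<^sub>R grad V z)"

text \<open>A solution for all \<open>t \<ge> 0\<close> of the plant, the inter-sample observer with correction term
  \<open>kh\<close>, the predictor and the feedback \<open>kf\<close>. The functions are total, but only their values on
  \<open>[-r,\<infinity>)\<close> for \<open>x\<close>, \<open>[0,\<infinity>)\<close> for \<open>z\<close>, \<open>w\<close> and \<open>\<xi> 0\<close>, \<open>[-\<delta>,\<infinity>)\<close> for \<open>\<xi> 1, \<dots>, \<xi> N\<close> and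
  \<open>[-r-\<tau>,\<infinity>)\<close> for \<open>u\<close> matter. Local \<open>L\<^sup>\<infinity>\<close> regularity of the \<open>\<xi> j\<close> makes the predictor
  integrals Lebesgue integrals.\<close>

definition closed_loop_solution ::
    "(real^'n \<Rightarrow> real^'m \<Rightarrow> real^'n) \<Rightarrow> (real^'n \<Rightarrow> real^'k) \<Rightarrow>
     (real^'n \<Rightarrow> real^'k \<Rightarrow> real^'m \<Rightarrow> real^'n) \<Rightarrow> (real^'n \<Rightarrow> real^'m) \<Rightarrow>
     (real \<Rightarrow> real) \<Rightarrow> (real^'n \<Rightarrow> real) \<Rightarrow> real \<Rightarrow> real \<Rightarrow> nat \<Rightarrow>
     (nat \<Rightarrow> real) \<Rightarrow> (real \<Rightarrow> real^'k) \<Rightarrow>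
     (real \<Rightarrow> real^'n) \<Rightarrow> real^'n \<Rightarrow> real^'k \<Rightarrow> (nat \<Rightarrow> real \<Rightarrow> real^'n) \<Rightarrow> (real \<Rightarrow> real^'m) \<Rightarrow>
     (real \<Rightarrow> real^'n) \<Rightarrow> (real \<Rightarrow> real^'n) \<Rightarrow> (real \<Rightarrow> real^'k) \<Rightarrow> (nat \<Rightarrow> real \<Rightarrow> real^'n) \<Rightarrow>
     (real \<Rightarrow> real^'m) \<Rightarrow> bool" where
  "closed_loop_solution f h kh kf q \<psi> \<tau> r N ts e x0 z0 w0 \<xi>0 u0 x z w \<xi> u \<longleftrightarrow>
     (let \<delta> = (r + \<tau>) / real N in
      \<comment> \<open>plant\<close>
      (\<forall>T\<ge>0. abs_cont_on {0..T} x) \<and>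
      ode_ae {0..} x (\<lambda>t. f (x t) (u (t - \<tau>))) \<and>
      \<comment> \<open>observer\<close>
      (\<forall>T\<ge>0. abs_cont_on {0..T} z) \<and>
      ode_ae {0..} z (\<lambda>t. f (z t) (u (t - r - \<tau>)) + kh (z t) (w t) (u (t - r - \<tau>))) \<and>
      (\<forall>i. abs_cont_on {ts i..<ts (Suc i)} w \<and>
           ode_ae {ts i..<ts (Suc i)} w
             (\<lambda>t. jacobian h (at (z t)) *v f (z t) (u (t - r - \<tau>)))) \<and>
      (\<forall>i\<ge>1. w (ts i) = h (x (ts i - r)) + e (ts i)) \<and>
      \<comment> \<open>predictor\<close>
      (\<forall>t\<ge>0. \<xi> 0 t = z t) \<and>
      (\<forall>j\<in>{1..N}. \<forall>T\<ge>0. Linf_fun {-\<delta>..T} UNIV (\<xi> j)) \<and>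
      (\<forall>j\<in>{1..N}. \<forall>t\<ge>0.
         \<xi> j t = q (norm (\<xi> (j - 1) t) / \<psi> (z t)) *\<^sub>R \<xi> (j - 1) t
           + integral {0..\<delta>} (\<lambda>s.
               f (q (norm (\<xi> j (t + s - \<delta>)) / \<psi> (z t)) *\<^sub>R \<xi> j (t + s - \<delta>))
                 (u (t + (real j - 1) * \<delta> - \<tau> - r + s)))) \<and>
      \<comment> \<open>feedback\<close>
      (\<forall>t\<ge>0. u t = kf (\<xi> N t)) \<and>
      \<comment> \<open>initial conditions\<close>
      (\<forall>\<theta>\<in>{-r..0}. x \<theta> = x0 \<theta>) \<and> z 0 = z0 \<and> w 0 = w0 \<and>
      (\<forall>j\<in>{1..N}. \<forall>\<theta>\<in>{-\<delta>..<0}. \<xi> j \<theta> = \<xi>0 j \<theta>) \<and>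
      (\<forall>\<theta>\<in>{-r-\<tau>..<0}. u \<theta> = u0 \<theta>))"

end

theory Submission
  imports Defs "HOL-Analysis.Analysis"
begin

text \<open>Every solution enters the region \<open>V(x) \<le> R\<close>, \<open>V(z) \<le> b\<close> after a time that depends only on the
  size of the data: \<open>V\<close> decreases along \<open>x\<close> outside \<open>S\<^sub>1\<close> by hypothesis 1, and along \<open>z\<close> outside \<open>S\<^sub>2\<close>
  because the correction term enforces this. From then on the observer error \<open>z(t) - x(t-r)\<close> decays by
  the quadratic Lyapunov function \<open>x'Qx\<close> and a small-gain argument for the sampling error, the predictor
  errors \<open>\<xi>\<^sub>j(t) - x(t-r+j\<delta>)\<close> follow one after the other by a second small-gain argument, and the plant
  is an exponentially stable system (Lyapunov function \<open>P\<close>) perturbed by the last predictor error.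
  All gains of this phase are independent of the data, which gives \<open>\<Gamma>\<close>.

  Before, the solution stays in a bounded set, on which it coincides with the solution of a globally
  Lipschitz system; a weighted-norm contraction gives existence and a bound that is linear in the data,
  with a factor depending on a bound for the data only. A locally Lipschitz majorant of these factors
  gives \<open>C\<close>.\<close>

section \<open>Absolute continuity and indefinite integrals\<close>

text \<open>The main obstacle is that part of the closed loop is not a differential equation. A
  predictor state depends on its predecessor and on \<open>z\<close> at the same instant, and a
  sample depends on \<open>x\<close> at the same instant if \<open>r = 0\<close>, so a short time
  step does not make the full right-hand side a contraction. Updating the components in their order
  of dependence leaves old values under time integrals only, and a weight \<open>exp (c * t)\<close>
  with large \<open>c\<close> then gives a contraction for all times at once. The bound linear in
  the data uses the same contraction: zero solves the system for zero data, so the weighted distance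
  to zero is halved again and again, up to a multiple of the data, starting from any crude bound.
  The two strict inequalities of the theorem are loop gains for errors weighted by
  \<open>exp (\<sigma> * t)\<close>: reaching back by \<open>Ts\<close> or \<open>\<delta>\<close>
  costs \<open>exp (\<sigma> * Ts)\<close> or \<open>exp (\<sigma> * \<delta>)\<close>. Inputs are
  merely measurable, so solutions have derivatives only almost everywhere; the Lyapunov computations
  are carried out for Lipschitz functions of time.\<close>

lemma negligible_small_open_cover:
  fixes S :: "'a::euclidean_space set"
  assumes "negligible S" "0 < e"
  obtains T where "open T" "S \<subseteq> T" "T \<in> lmeasurable" "measure lebesgue T < e"
proof -
  have S: "S \<in> null_sets lebesgue" using assms negligible_iff_null_sets by blast
  then have "S \<in> sets lebesgue" by auto
  then obtain T where T: "open T" "S \<subseteq> T" "T - S \<in> lmeasurable" "emeasure lebesgue (T - S) < ennreal e"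
    using sets_lebesgue_outer_open assms(2) by metis
  have lm: "S \<in> lmeasurable" "T = (T - S) \<union> S"
    using S T(2) by (auto simp: fmeasurableI_null_sets)
  have TM: "T \<in> lmeasurable" using lm T(3) by (metis fmeasurable.Un)
  have "measure lebesgue T = measure lebesgue (T - S)"
    using S TM by (simp add: measure_Diff_null_set fmeasurableD)
  also have "\<dots> < e"
    using T(3,4) assms(2) by (simp add: emeasure_eq_measure2 fmeasurableD2 ennreal_less_iff)
  finally show ?thesis using that T TM by blast
qed

lemma sum_length_division_le:
  fixes D :: "real set set"
  assumes "D division_of \<Union>D" "\<Union>D \<subseteq> T" "T \<in> lmeasurable"
  shows "(\<Sum>J\<in>D. Sup J - Inf J) \<le> measure lebesgue T"
proof -
  have J: "((\<lambda>x. 1::real) has_integral (Sup J - Inf J)) J" if "J \<in> D" for J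
  proof -
    from that assms(1) obtain a b where "J = cbox a b" "J \<noteq> {}" by blast
    then show ?thesis using has_integral_const_real[of "1::real" a b] by auto
  qed
  have "((\<lambda>x. 1::real) has_integral (\<Sum>J\<in>D. Sup J - Inf J)) (\<Union>D)"
    using assms(1) by (rule has_integral_combine_division) (rule J)
  moreover have "\<Union>D \<in> lmeasurable"
  proof (rule fmeasurable.finite_Union)
    show "finite D" using assms(1) by (rule division_of_finite)
    show "D \<subseteq> lmeasurable"
    proof
      fix J assume "J \<in> D"
      then obtain a b where "J = cbox a b" using assms(1) division_ofD(4) by blast
      then show "J \<in> lmeasurable" by simp
    qed
  qed
  ultimately have "(\<Sum>J\<in>D. Sup J - Inf J) = measure lebesgue (\<Union>D)"
    by (simp add: lmeasure_integral integral_unique)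
  also have "\<dots> \<le> measure lebesgue T"
    using \<open>\<Union>D \<in> lmeasurable\<close> assms by (simp add: measure_mono_fmeasurable fmeasurableD)
  finally show ?thesis .
qed

text \<open>On \<open>S\<close> the derivative says nothing about the increments of
  \<open>y\<close>. Absolute continuity supplies the missing control: the intervals tagged in
  \<open>S\<close> are confined to an open set so small that the increments over them sum to less
  than \<open>e / 2\<close>.\<close>

theorem abs_cont_FTC:
  fixes y :: "real \<Rightarrow> 'a::euclidean_space"
  assumes ac: "abs_cont_on {a..b} y" and ab: "a \<le> b" and neg: "negligible S"
    and der: "\<And>t. t \<in> {a..b} - S \<Longrightarrow> (y has_vector_derivative F t) (at t)"
  shows "(F has_integral (y b - y a)) {a..b}"
proof -
  \<comment> \<open>With the value 0 on \<open>S\<close>, a tag in \<open>S\<close> contributes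
    exactly the increment of \<open>y\<close> over its interval to the error.\<close>
  define G where "G = (\<lambda>t. if t \<in> S then 0 else F t)"
  have "(G has_integral (y b - y a)) (cbox a b)"
    unfolding has_integral
  proof safe
    fix e :: real assume e: "e > 0"
    \<comment> \<open>The errors at the remaining tags sum to \<open>e1 * (b - a)\<close>, less than
      \<open>e / 2\<close>; the \<open>+ 1\<close> covers \<open>a = b\<close>.\<close>
    define e1 where "e1 = e / (2 * (b - a + 1))"
    have e1: "e1 > 0" using e ab by (simp add: e1_def)
    have "\<forall>x. \<exists>d>0. x \<in> {a..b} - S \<longrightarrow>
         (\<forall>u. norm (u-x) < d \<longrightarrow> norm (y u - y x - (u-x) *\<^sub>R F x) \<le> e1 * norm (u-x))"
      using der[unfolded has_vector_derivative_def has_derivative_at_alt] e1 by (metis zero_less_one)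
    then obtain d where d: "\<And>x. 0 < d x"
       "\<And>x u. \<lbrakk>x \<in> {a..b} - S; norm (u-x) < d x\<rbrakk>
           \<Longrightarrow> norm (y u - y x - (u-x) *\<^sub>R F x) \<le> e1 * norm (u-x)"
      by metis
    obtain \<eta> where eta: "\<eta> > 0" "\<And>D T. D division_of T \<Longrightarrow> T \<subseteq> {a..b} \<Longrightarrow> (\<Sum>J\<in>D. Sup J - Inf J) < \<eta> \<Longrightarrow>
        (\<Sum>J\<in>D. norm (y (Sup J) - y (Inf J))) < e / 2"
      using ac e unfolding abs_cont_on_def by (meson half_gt_zero)
    obtain T where T: "open T" "S \<subseteq> T" "T \<in> lmeasurable" "measure lebesgue T < \<eta>"
      using negligible_small_open_cover[OF neg eta(1)] by blast
    define \<gamma> where "\<gamma> = (\<lambda>x. if x \<in> S then T else ball x (d x))"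
    have "gauge \<gamma>" unfolding gauge_def \<gamma>_def using T d(1) by auto
    moreover have "norm ((\<Sum>(x, k)\<in>p. measure lborel k *\<^sub>R G x) - (y b - y a)) < e"
      if p: "p tagged_division_of (cbox a b)" and fine: "\<gamma> fine p" for p
    proof -
      have fin: "finite p" using p by blast
      have ba: "b - a = (\<Sum>(x,K)\<in>p. Sup K - Inf K)" "y b - y a = (\<Sum>(x,K)\<in>p. y(Sup K) - y(Inf K))"
        using additive_tagged_division_1[where f= "\<lambda>x. x"] additive_tagged_division_1[where f= y]
            \<open>a \<le> b\<close> p by auto
      define p1 where "p1 = {(x,K) \<in> p. x \<in> S}"
      define p2 where "p2 = {(x,K) \<in> p. x \<notin> S}"
      define g where "g = (\<lambda>(x,K). measure lborel K *\<^sub>R G x - (y (Sup K) - y (Inf K)))"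
      have pp: "p = p1 \<union> p2" "p1 \<inter> p2 = {}" by (auto simp: p1_def p2_def)
      have fin12: "finite p1" "finite p2" using fin pp by auto
      have Kuv: "\<exists>u v. K = {u..v} \<and> u \<le> x \<and> x \<le> v \<and> a \<le> u \<and> v \<le> b" if "(x,K) \<in> p" for x K
      proof -
        from p that have "x \<in> K" "K \<subseteq> cbox a b" "\<exists>u v. K = cbox u v" by blast+
        then show ?thesis by auto
      qed
      have "norm (sum g p2) \<le> (\<Sum>(x,K)\<in>p2. e1 * (Sup K - Inf K))"
      proof (rule sum_norm_le, safe)
        fix x K assume xK: "(x,K) \<in> p2"
        then have xp: "(x,K) \<in> p" "x \<notin> S" by (auto simp: p2_def)
        then obtain u v where uv: "K = {u..v}" "u \<le> x" "x \<le> v" "a \<le> u" "v \<le> b" using Kuv by blast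
        have "K \<subseteq> ball x (d x)" using fine xp unfolding fine_def \<gamma>_def by fastforce
        moreover have "u \<in> K" "v \<in> K" using uv by auto
        ultimately have uvd: "norm (u - x) < d x" "norm (v - x) < d x"
          by (auto simp: dist_norm norm_minus_commute)
        have xs: "x \<in> {a..b} - S" using uv xp by auto
        \<comment> \<open>Both endpoints are compared with the tag \<open>x\<close>, which lies
          between them, so the two errors add up to \<open>e1\<close> times the length.\<close>
        have "norm (g (x,K)) = norm ((y u - y x - (u - x) *\<^sub>R F x) - (y v - y x - (v - x) *\<^sub>R F x))"
          using uv xp by (simp add: g_def G_def algebra_simps)
        also have "\<dots> \<le> e1 * norm (u-x) + e1 * norm (v-x)"
          by (rule order_trans[OF norm_triangle_ineq4 add_mono[OF d(2)[OF xs uvd(1)] d(2)[OF xs uvd(2)]]])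
        also have "\<dots> = e1 * (Sup K - Inf K)" using uv by (simp add: algebra_simps)
        finally show "norm (g (x,K)) \<le> e1 * (Sup K - Inf K)" .
      qed
      also have "\<dots> \<le> (\<Sum>(x,K)\<in>p. e1 * (Sup K - Inf K))"
      proof (rule sum_mono2[OF fin], goal_cases)
        case 1 then show ?case using pp by blast
      next
        case (2 b) 
        obtain x K where "b = (x,K)" by fastforce
        moreover from this 2 obtain u v where "K = {u..v}" "u \<le> x" "x \<le> v" using Kuv by blast
        ultimately show ?case using e1 by simp
      qed
      also have "\<dots> = e1 * (b - a)" unfolding ba(1) by (simp add: sum_distrib_left case_prod_unfold)
      also have "\<dots> < e / 2" unfolding e1_def using e ab by (simp add: field_simps)
      finally have b2: "norm (sum g p2) < e / 2" .
      have "p1 tagged_partial_division_of (cbox a b)"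
        using p unfolding p1_def tagged_division_of_def
        by (auto intro: tagged_partial_division_subset)
      then have div: "(snd ` p1) division_of \<Union>(snd ` p1)"
        by (rule partial_division_of_tagged_division)
      have "K \<subseteq> T" if "(x,K) \<in> p1" for x K
        using fineD[OF fine, of x K] that by (auto simp: \<gamma>_def p1_def)
      then have "\<Union>(snd ` p1) \<subseteq> T"
        by (intro Union_least) (metis imageE prod.collapse)
      then have len: "(\<Sum>J\<in>snd ` p1. Sup J - Inf J) < \<eta>"
        using sum_length_division_le[OF div _ T(3)] T(4) by simp
      have sub: "\<Union>(snd ` p1) \<subseteq> {a..b}" 
      proof -
        have "K \<subseteq> {a..b}" if "(x,K) \<in> p1" for x K
          using Kuv[of x K] that unfolding p1_def by auto
        then show ?thesis
          by (intro Union_least) (metis imageE prod.collapse)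
      qed
      have "norm (sum g p1) \<le> (\<Sum>(x,K)\<in>p1. norm (y (Sup K) - y (Inf K)))"
        by (rule sum_norm_le) (auto simp: g_def p1_def G_def norm_minus_commute)
      \<comment> \<open>Distinct tags can share an interval only if it is degenerate, and then its
        increment is 0.\<close>
      also have "\<dots> = (\<Sum>J\<in>snd ` p1. norm (y (Sup J) - y (Inf J)))"
        unfolding case_prod_unfold
      proof (rule sum.reindex_nontrivial[OF fin12(1), of "snd" "\<lambda>J. norm (y (Sup J) - y (Inf J))", unfolded o_def, symmetric])
        fix q1 q2 assume q: "q1 \<in> p1" "q2 \<in> p1" "q1 \<noteq> q2" "snd q1 = snd q2"
        obtain x1 K x2 where xs: "q1 = (x1, K)" "q2 = (x2, K)" using q(4) by (metis prod.collapse)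
        then have pK: "(x1,K) \<in> p" "(x2,K) \<in> p" "(x1,K) \<noteq> (x2,K)" using q by (auto simp: p1_def)
        then have "interior K \<inter> interior K = {}" using tagged_division_ofD(5)[OF p] by blast
        moreover obtain u v where uv: "K = {u..v}" "u \<le> v" using Kuv[OF pK(1)] by auto
        ultimately have "u = v" by (auto simp: interior_atLeastAtMost_real)
        then show "norm (y (Sup (snd q1)) - y (Inf (snd q1))) = 0" using xs uv by simp
      qed
      also have "\<dots> < e / 2" using eta(2)[OF div sub len] .
      finally have b1: "norm (sum g p1) < e / 2" .
      have "(\<Sum>(x, k)\<in>p. measure lborel k *\<^sub>R G x) - (y b - y a) = sum g p"
        unfolding ba(2) g_def by (simp add: sum_subtractf case_prod_unfold)
      also have "\<dots> = sum g p1 + sum g p2" using pp fin12 by (simp add: sum.union_disjoint)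
      finally show ?thesis using b1 b2 norm_triangle_ineq[of "sum g p1" "sum g p2"] by simp
    qed
    ultimately show "\<exists>\<gamma>. gauge \<gamma> \<and> (\<forall>\<D>. \<D> tagged_division_of cbox a b \<and> \<gamma> fine \<D> \<longrightarrow>
       norm ((\<Sum>(x, k)\<in>\<D>. measure lborel k *\<^sub>R G x) - (y b - y a)) < e)"
      by (intro exI[of _ \<gamma>] conjI allI impI) simp_all
  qed
  then have "(G has_integral (y b - y a)) {a..b}" by simp
  then show ?thesis
    by (rule has_integral_spike[OF neg, rotated]) (simp add: G_def)
qed

lemma lipschitz_imp_abs_cont_on:
  fixes y :: "real \<Rightarrow> 'a::real_normed_vector"
  assumes "C-lipschitz_on I y"
  shows "abs_cont_on I y"
  unfolding abs_cont_on_def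
proof (intro allI impI)
  fix e :: real assume e: "e > 0"
  have C: "C \<ge> 0" using assms lipschitz_on_nonneg by blast
  have "(\<Sum>J\<in>D. norm (y (Sup J) - y (Inf J))) < e"
    if D: "D division_of T" "T \<subseteq> I" and l: "(\<Sum>J\<in>D. Sup J - Inf J) < e / (C + 1)" for D T
  proof -
    have J: "norm (y (Sup J) - y (Inf J)) \<le> (C + 1) * (Sup J - Inf J)" if JD: "J \<in> D" for J
    proof -
      from JD D(1) obtain u v where uv: "J = cbox u v" "J \<noteq> {}" by blast
      have JI: "J \<subseteq> I" using JD D by blast
      have uv': "J = {u..v}" "u \<le> v" "u \<in> I" "v \<in> I" using uv JI by auto
      have "norm (y v - y u) \<le> C * (v - u)"
        using lipschitz_onD[OF assms uv'(4,3)] uv'(2) by (simp add: dist_norm)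
      also have "\<dots> \<le> (C+1) * (v - u)" using uv'(2) by (simp add: mult_right_mono)
      finally show ?thesis using uv' by simp
    qed
    have "(\<Sum>J\<in>D. norm (y (Sup J) - y (Inf J))) \<le> (C+1) * (\<Sum>J\<in>D. Sup J - Inf J)"
      unfolding sum_distrib_left by (rule sum_mono) (rule J)
    also have "\<dots> < e" using l C by (simp add: field_simps)
    finally show ?thesis .
  qed
  then show "\<exists>\<eta>>0. \<forall>D T. D division_of T \<and> T \<subseteq> I \<and> (\<Sum>J\<in>D. Sup J - Inf J) < \<eta> \<longrightarrow>
       (\<Sum>J\<in>D. norm (y (Sup J) - y (Inf J))) < e"
    using e C by (intro exI[of _ "e / (C + 1)"]) auto
qed

lemma abs_cont_on_subset: "abs_cont_on I y \<Longrightarrow> J \<subseteq> I \<Longrightarrow> abs_cont_on J y"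
  unfolding abs_cont_on_def by (meson order_trans)

lemma abs_cont_imp_continuous_on:
  fixes y :: "real \<Rightarrow> 'a::real_normed_vector"
  assumes "abs_cont_on I y" "is_interval I"
  shows "continuous_on I y"
  unfolding continuous_on_iff
proof (intro ballI allI impI)
  fix x and e :: real assume x: "x \<in> I" and e: "e > 0"
  obtain \<eta> where eta: "\<eta> > 0" "\<And>D T. D division_of T \<Longrightarrow> T \<subseteq> I \<Longrightarrow> (\<Sum>J\<in>D. Sup J - Inf J) < \<eta> \<Longrightarrow>
        (\<Sum>J\<in>D. norm (y (Sup J) - y (Inf J))) < e"
    using assms(1) e unfolding abs_cont_on_def by metis
  have *: "norm (y v - y u) < e" if "u \<in> I" "v \<in> I" "u \<le> v" "v - u < \<eta>" for u v
  proof -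
    have "{u..v} \<subseteq> I"
      using assms(2) that by (metis atLeastAtMost_iff mem_is_interval_1_I subsetI)
    moreover have "{{u..v}} division_of {u..v}"
      using division_of_self[of u v] that by auto
    ultimately show ?thesis using eta(2)[of "{{u..v}}" "{u..v}"] that by simp
  qed
  show "\<exists>d>0. \<forall>x'\<in>I. dist x' x < d \<longrightarrow> dist (y x') (y x) < e"
  proof (intro exI[of _ \<eta>] conjI ballI impI eta)
    fix x' assume "x' \<in> I" "dist x' x < \<eta>"
    then show "dist (y x') (y x) < e"
      using *[of x x'] *[of x' x] x by (cases "x \<le> x'") (auto simp: dist_norm norm_minus_commute)
  qed
qed

section \<open>Almost-everywhere derivatives and measurability on the line\<close>

lemma ode_ae_negligible:
  assumes "ode_ae I y F" "I \<in> sets lebesgue"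
  obtains S where "negligible S" "\<And>t. t \<in> I - S \<Longrightarrow> (y has_vector_derivative F t) (at t)"
proof -
  have "AE t in lebesgue. t \<in> I \<longrightarrow> (y has_vector_derivative F t) (at t)"
    using assms unfolding ode_ae_def by (subst (asm) AE_restrict_space_iff) auto
  then obtain S where "S \<in> null_sets lebesgue" "{t. \<not> (t \<in> I \<longrightarrow> (y has_vector_derivative F t) (at t))} \<subseteq> S"
    by (auto simp: eventually_ae_filter)
  then show ?thesis using that[of S] negligible_iff_null_sets by blast
qed

lemma ode_aeI:
  assumes "negligible S" "I \<in> sets lebesgue" "\<And>t. t \<in> I - S \<Longrightarrow> (y has_vector_derivative F t) (at t)"
  shows "ode_ae I y F"
  unfolding ode_ae_def
proof (subst AE_restrict_space_iff)
  show "AE t in lebesgue. t \<in> I \<longrightarrow> (y has_vector_derivative F t) (at t)"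
    by (rule AE_I'[of S]) (use assms negligible_iff_null_sets in auto)
qed (use assms in auto)

lemma bounded_measurable_integrable:
  fixes g :: "real \<Rightarrow> 'a::euclidean_space"
  assumes "g \<in> borel_measurable lebesgue" "\<And>t. t \<in> {a..b} \<Longrightarrow> norm (g t) \<le> B"
  shows "g integrable_on {a..b}"
proof (rule measurable_bounded_by_integrable_imp_integrable[where g = "\<lambda>_. B"])
  show "g \<in> borel_measurable (lebesgue_on {a..b})"
    using assms(1) by (rule measurable_restrict_space1)
qed (use assms in auto)

lemma measurable_lebesgue_shift:
  fixes g :: "real \<Rightarrow> 'a::topological_space"
  assumes "g \<in> borel_measurable lebesgue"
  shows "(\<lambda>t. g (t + c)) \<in> borel_measurable lebesgue"
proof -
  have "(\<lambda>t::real. c + t) \<in> lebesgue \<rightarrow>\<^sub>M lebesgue"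
    using lebesgue_affine_measurable[of "\<lambda>x::real. 1" c] by simp
  from measurable_compose[OF this assms] show ?thesis by (simp add: add.commute)
qed

section \<open>Functions that are Lipschitz on bounded sets\<close>

text \<open>Boundedness is part of the notion because it makes the class closed under products, and
  because an outer function that is Lipschitz on bounded sets can then be composed with it. The set
  \<open>S\<close> itself may be unbounded, as it is for the truncated fields.\<close>

definition lipb :: "'a::metric_space set \<Rightarrow> ('a \<Rightarrow> 'b::real_normed_vector) \<Rightarrow> bool" where
  "lipb S g \<longleftrightarrow> (\<exists>C. C-lipschitz_on S g) \<and> bounded (g ` S)"

definition blip :: "('a::metric_space \<Rightarrow> 'b::real_normed_vector) \<Rightarrow> bool" where
  "blip g \<longleftrightarrow> (\<forall>S. bounded S \<longrightarrow> lipb S g)"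

lemma lipb_bound:
  assumes "lipb S g"
  shows "\<exists>C>0. (\<forall>x\<in>S. \<forall>y\<in>S. norm (g x - g y) \<le> C * dist x y) \<and> (\<forall>x\<in>S. norm (g x) \<le> C)"
proof -
  obtain C where C: "C-lipschitz_on S g" using assms lipb_def by blast
  obtain B where B: "\<And>x. x \<in> S \<Longrightarrow> norm (g x) \<le> B"
    using assms unfolding lipb_def bounded_iff by auto
  define D where "D = max C B + 1"
  have "C \<ge> 0" using C lipschitz_on_nonneg by blast
  then have D: "D > 0" "C \<le> D" "B \<le> D" by (auto simp: D_def)
  have "norm (g x - g y) \<le> D * dist x y" if "x \<in> S" "y \<in> S" for x y
    using lipschitz_onD[OF C that] D(2) mult_right_mono[OF D(2), of "dist x y"] by (simp add: dist_norm)
  moreover have "norm (g x) \<le> D" if "x \<in> S" for x using B[OF that] D(3) by simp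
  ultimately show ?thesis using D(1) by blast
qed

lemma lipbI:
  assumes "\<And>x y. x \<in> S \<Longrightarrow> y \<in> S \<Longrightarrow> norm (g x - g y) \<le> C * dist x y"
    "\<And>x. x \<in> S \<Longrightarrow> norm (g x) \<le> B"
  shows "lipb S g"
  unfolding lipb_def
proof
  have "(max 0 C)-lipschitz_on S g"
  proof (rule lipschitz_onI)
    fix x y assume "x \<in> S" "y \<in> S"
    then have "norm (g x - g y) \<le> C * dist x y" using assms by blast
    also have "\<dots> \<le> max 0 C * dist x y" by (simp add: mult_right_mono)
    finally show "dist (g x) (g y) \<le> max 0 C * dist x y" by (simp add: dist_norm)
  qed simp
  then show "\<exists>C. C-lipschitz_on S g" by blast
  show "bounded (g ` S)" using assms(2) unfolding bounded_iff by blast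
qed

lemma lipb_subset: "lipb T g \<Longrightarrow> S \<subseteq> T \<Longrightarrow> lipb S g"
  unfolding lipb_def by (meson bounded_subset image_mono lipschitz_on_subset)

lemma lipb_const: "lipb S (\<lambda>x. c)"
  by (rule lipbI[of _ _ 0 "norm c"]) auto

lemma lipb_bounded_linear:
  assumes "bounded S" "bounded_linear g" shows "lipb S g"
  unfolding lipb_def
  using bounded_linear.lipschitz_boundE[OF assms(2)] bounded_linear_image[OF assms] by metis

lemma lipb_Pair:
  assumes "lipb S f" "lipb S g" shows "lipb S (\<lambda>x. (f x, g x))"
proof -
  obtain C where C: "C > 0" "\<And>x y. x \<in> S \<Longrightarrow> y \<in> S \<Longrightarrow> norm (f x - f y) \<le> C * dist x y"
    "\<And>x. x \<in> S \<Longrightarrow> norm (f x) \<le> C" using lipb_bound[OF assms(1)] by blast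
  obtain D where D: "D > 0" "\<And>x y. x \<in> S \<Longrightarrow> y \<in> S \<Longrightarrow> norm (g x - g y) \<le> D * dist x y"
    "\<And>x. x \<in> S \<Longrightarrow> norm (g x) \<le> D" using lipb_bound[OF assms(2)] by blast
  show ?thesis
  proof (rule lipbI[of _ _ "C + D" "C + D"])
    fix x y assume "x \<in> S" "y \<in> S"
    then show "norm ((f x, g x) - (f y, g y)) \<le> (C + D) * dist x y"
      using C(2)[of x y] D(2)[of x y] norm_Pair_le[of "f x - f y" "g x - g y"] by (simp add: algebra_simps)
  next
    fix x assume "x \<in> S"
    then show "norm (f x, g x) \<le> C + D"
      using C(3)[of x] D(3)[of x] norm_Pair_le[of "f x" "g x"] by (simp add: algebra_simps)
  qed
qed

lemma lipb_bilinear: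
  assumes "bounded_bilinear bop" "lipb S f" "lipb S g"
  shows "lipb S (\<lambda>x. bop (f x) (g x))"
proof -
  interpret bounded_bilinear bop by fact
  obtain K where K: "0 < K" "\<And>a b. norm (bop a b) \<le> norm a * norm b * K" using pos_bounded by blast
  obtain C where C: "C > 0" "\<And>x y. x \<in> S \<Longrightarrow> y \<in> S \<Longrightarrow> norm (f x - f y) \<le> C * dist x y"
    "\<And>x. x \<in> S \<Longrightarrow> norm (f x) \<le> C" using lipb_bound[OF assms(2)] by blast
  obtain D where D: "D > 0" "\<And>x y. x \<in> S \<Longrightarrow> y \<in> S \<Longrightarrow> norm (g x - g y) \<le> D * dist x y"
    "\<And>x. x \<in> S \<Longrightarrow> norm (g x) \<le> D" using lipb_bound[OF assms(3)] by blast
  have bd: "norm (bop u v) \<le> p * q * K" if "norm u \<le> p" "norm v \<le> q" for u v p q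
  proof -
    have "0 \<le> p" using norm_ge_zero that(1) by (rule order_trans)
    then have "norm u * norm v \<le> p * q" using that by (intro mult_mono) auto
    then have "norm u * norm v * K \<le> p * q * K" using K(1) by (simp add: mult_right_mono)
    then show ?thesis using K(2)[of u v] by linarith
  qed
  show ?thesis
  proof (rule lipbI[of _ _ "2 * (C * D * K)" "C * D * K"])
    fix x y assume S: "x \<in> S" "y \<in> S"
    have "bop (f x) (g x) - bop (f y) (g y) = bop (f x - f y) (g x) + bop (f y) (g x - g y)"
      by (simp add: diff_left diff_right)
    then have "norm (bop (f x) (g x) - bop (f y) (g y)) \<le> norm (bop (f x - f y) (g x)) + norm (bop (f y) (g x - g y))"
      by (simp add: norm_triangle_ineq)
    also have "\<dots> \<le> (C * dist x y) * D * K + C * (D * dist x y) * K"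
      by (intro add_mono bd C D S)
    finally show "norm (bop (f x) (g x) - bop (f y) (g y)) \<le> 2 * (C * D * K) * dist x y"
      by (simp add: algebra_simps)
  next
    fix x assume S: "x \<in> S"
    show "norm (bop (f x) (g x)) \<le> C * D * K" by (intro bd C D S)
  qed
qed

lemma lipb_comp:
  assumes "lipb S f" "lipb T g" "\<And>x. x \<in> S \<Longrightarrow> f x \<in> T"
  shows "lipb S (\<lambda>x. g (f x))"
proof -
  obtain C where C: "C > 0" "\<And>x y. x \<in> S \<Longrightarrow> y \<in> S \<Longrightarrow> norm (f x - f y) \<le> C * dist x y"
    "\<And>x. x \<in> S \<Longrightarrow> norm (f x) \<le> C"
    using lipb_bound[OF assms(1)] by blast
  obtain D where D: "D > 0" "\<And>x y. x \<in> T \<Longrightarrow> y \<in> T \<Longrightarrow> norm (g x - g y) \<le> D * dist x y"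
    "\<And>x. x \<in> T \<Longrightarrow> norm (g x) \<le> D" using lipb_bound[OF assms(2)] by blast
  show ?thesis
  proof (rule lipbI[of _ _ "D * C" D])
    fix x y assume S: "x \<in> S" "y \<in> S"
    have "norm (g (f x) - g (f y)) \<le> D * norm (f x - f y)"
      using D(2)[OF assms(3)[OF S(1)] assms(3)[OF S(2)]] by (simp only: dist_norm)
    also have "\<dots> \<le> D * (C * dist x y)" using D(1) C(2)[OF S] by simp
    finally show "norm (g (f x) - g (f y)) \<le> D * C * dist x y" by simp
  qed (use assms(3) D in auto)
qed

lemma lipb_blip:
  assumes "lipb S f" "blip g"
  shows "lipb S (\<lambda>x. g (f x))"
  using lipb_comp[OF assms(1), of "f ` S" g] assms by (auto simp: blip_def lipb_def)

lemma blip_lipb: "blip g \<Longrightarrow> bounded S \<Longrightarrow> lipb S g"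
  by (simp add: blip_def)

lemma lipb_add: "lipb S f \<Longrightarrow> lipb S g \<Longrightarrow> lipb S (\<lambda>x. f x + g x)"
proof -
  assume "lipb S f" "lipb S g"
  moreover have "lipb T (\<lambda>p. fst p + snd p)" if "bounded T" for T :: "('b \<times> 'b) set"
    using that by (intro lipb_bounded_linear) (auto intro: bounded_linear_add bounded_linear_fst bounded_linear_snd)
  then have "blip (\<lambda>p::'b \<times> 'b. fst p + snd p)" by (simp add: blip_def)
  ultimately show ?thesis using lipb_blip[OF lipb_Pair] by fastforce
qed

lemma lipb_bl: "lipb S f \<Longrightarrow> bounded_linear g \<Longrightarrow> lipb S (\<lambda>x. g (f x))"
  by (rule lipb_blip) (auto simp: blip_def intro: lipb_bounded_linear)

lemma lipb_minus: "lipb S f \<Longrightarrow> lipb S (\<lambda>x. - f x)"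
  by (rule lipb_bl) (auto intro: bounded_linear_minus bounded_linear_ident)

lemma lipb_diff: "lipb S f \<Longrightarrow> lipb S g \<Longrightarrow> lipb S (\<lambda>x. f x - g x)"
  using lipb_add[of S f "\<lambda>x. - g x"] lipb_minus[of S g] by simp

lemma lipb_sum: "finite I \<Longrightarrow> (\<And>i. i \<in> I \<Longrightarrow> lipb S (f i)) \<Longrightarrow> lipb S (\<lambda>x. \<Sum>i\<in>I. f i x)"
  by (induction I rule: finite_induct) (auto intro: lipb_const lipb_add)

lemma blip_norm: "blip norm"
  unfolding blip_def
proof (intro allI impI)
  fix S :: "'a set" assume "bounded S"
  then obtain B where "\<And>x. x \<in> S \<Longrightarrow> norm x \<le> B" unfolding bounded_iff by blast
  then show "lipb S norm"
    by (intro lipbI[of _ _ 1 B]) (auto simp: dist_norm norm_triangle_ineq3)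
qed

lemma lipb_norm: "lipb S f \<Longrightarrow> lipb S (\<lambda>x. norm (f x))"
  by (rule lipb_blip[OF _ blip_norm])

lemma lipb_max0: "lipb S f \<Longrightarrow> lipb S (\<lambda>x. max 0 (f x :: real))"
proof -
  assume "lipb S f"
  then obtain C where C: "C > 0" "\<And>x y. x \<in> S \<Longrightarrow> y \<in> S \<Longrightarrow> norm (f x - f y) \<le> C * dist x y"
    "\<And>x. x \<in> S \<Longrightarrow> norm (f x) \<le> C" using lipb_bound by blast
  show ?thesis
  proof (rule lipbI[of _ _ C C])
    fix x y assume "x \<in> S" "y \<in> S"
    then show "norm (max 0 (f x) - max 0 (f y)) \<le> C * dist x y" using C(2)[of x y] by (auto simp: max_def)
  next
    fix x assume "x \<in> S" then show "norm (max 0 (f x)) \<le> C" using C(3)[of x] C(1) by auto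
  qed
qed

lemma lipb_inverse:
  fixes f :: "_ \<Rightarrow> real"
  assumes "lipb S f" "m > 0" "\<And>x. x \<in> S \<Longrightarrow> m \<le> f x"
  shows "lipb S (\<lambda>x. inverse (f x))"
proof -
  obtain C where C: "C > 0" "\<And>x y. x \<in> S \<Longrightarrow> y \<in> S \<Longrightarrow> norm (f x - f y) \<le> C * dist x y"
    "\<And>x. x \<in> S \<Longrightarrow> norm (f x) \<le> C"
    using lipb_bound[OF assms(1)] by blast
  show ?thesis
  proof (rule lipbI[of _ _ "C / (m * m)" "inverse m"])
    fix x y assume S: "x \<in> S" "y \<in> S"
    have m: "m \<le> f x" "m \<le> f y" using assms S by auto
    have "inverse (f x) - inverse (f y) = (f y - f x) / (f x * f y)"
      using m assms(2) by (simp add: field_simps)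
    then have "norm (inverse (f x) - inverse (f y)) = norm (f x - f y) / (f x * f y)"
      using m assms(2) by (simp add: abs_mult abs_minus_commute)
    also have "\<dots> \<le> (C * dist x y) / (m * m)"
      using m assms(2) C(1) C(2)[OF S] by (intro frac_le mult_mono) auto
    finally show "norm (inverse (f x) - inverse (f y)) \<le> C / (m * m) * dist x y" by simp
  next
    fix x assume "x \<in> S" then show "norm (inverse (f x)) \<le> inverse m"
      using assms(2) assms(3)[of x] by simp
  qed
qed

lemmas lipb_mult = lipb_bilinear[OF bounded_bilinear_mult]
lemmas lipb_scaleR = lipb_bilinear[OF bounded_bilinear_scaleR]
lemmas lipb_inner = lipb_bilinear[OF bounded_bilinear_inner]

lemma lipb_mv: "lipb S f \<Longrightarrow> lipb S (\<lambda>x. (A::real^'n^'m) *v f x)"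
  by (rule lipb_bl) (auto intro: matrix_vector_mul_bounded_linear)

lemma blip_continuous:
  assumes "blip g" shows "continuous_on UNIV g"
proof (rule continuous_at_imp_continuous_on, rule ballI)
  fix x
  have "lipb (ball x 1) g" using assms by (simp add: blip_def)
  then have "continuous_on (ball x 1) g" unfolding lipb_def using lipschitz_on_continuous_on by blast
  then show "isCont g x" by (simp add: continuous_on_eq_continuous_at)
qed

text \<open>Compactness of \<open>{0..M}\<close> merges the local constants into one. The general
  result concerns families that depend on time, so a one-point time set is supplied.\<close>

lemma locally_lipschitz_imp_lipb:
  fixes p :: "real \<Rightarrow> real"
  assumes "locally_lipschitz_on {0..} p"
  shows "lipb {0..M} p"
proof -
  have "local_lipschitz {0::real} {0..M} (\<lambda>_. p)"
  proof (rule local_lipschitzI)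
    fix t x :: real assume "x \<in> {0..M}"
    then have "x \<in> {0..}" by simp
    then obtain d C where dC: "d > 0" "C-lipschitz_on (cball x d \<inter> {0..}) p"
      using assms unfolding locally_lipschitz_on_def by blast
    have "C-lipschitz_on (cball x d \<inter> {0..M}) p"
      by (rule lipschitz_on_subset[OF dC(2)]) auto
    then show "\<exists>u>0. \<exists>L. \<forall>t\<in>cball t u \<inter> {0}. L-lipschitz_on (cball x u \<inter> {0..M}) p"
      using dC(1) by blast
  qed
  then obtain L where "\<And>t. t \<in> {0::real} \<Longrightarrow> L-lipschitz_on {0..M} p"
    by (rule local_lipschitz_compact_implies_lipschitz) auto
  then have L: "L-lipschitz_on {0..M} p" by blast
  then have "continuous_on {0..M} p" using lipschitz_on_continuous_on by blast
  then have "compact (p ` {0..M})" by (intro compact_continuous_image) auto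
  then show ?thesis using L unfolding lipb_def by (auto dest: compact_imp_bounded)
qed

section \<open>Continuously differentiable functions on bounded sets\<close>

lemma Ck_imp_continuous_on: "Ck k g \<Longrightarrow> continuous_on UNIV g"
proof (cases k)
  case (Suc j)
  assume "Ck k g"
  then have "\<forall>x. g differentiable (at x)" using Suc by simp
  then show ?thesis by (simp add: continuous_at_imp_continuous_on differentiable_imp_continuous_within)
qed simp

lemma Ck_Suc_has_derivative: "Ck (Suc k) g \<Longrightarrow> (g has_derivative frechet_derivative g (at x)) (at x)"
  by (simp add: frechet_derivative_works)

lemma Ck_Suc_bounded_linear: "Ck (Suc k) g \<Longrightarrow> bounded_linear (frechet_derivative g (at x))"
  by (rule has_derivative_bounded_linear[OF Ck_Suc_has_derivative])

lemma Ck_Suc_frechet: "Ck (Suc k) g \<Longrightarrow> Ck k (\<lambda>x. frechet_derivative g (at x) v)"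
  by simp

lemma continuous_bounded_on_cball:
  fixes F :: "'a::euclidean_space \<Rightarrow> 'b::real_normed_vector"
  assumes "continuous_on UNIV F"
  shows "\<exists>B. \<forall>x\<in>cball 0 r. norm (F x) \<le> B"
proof -
  have "compact (F ` cball 0 r)"
    by (rule compact_continuous_image[OF continuous_on_subset[OF assms]]) auto
  then have "bounded (F ` cball 0 r)" by (rule compact_imp_bounded)
  then show ?thesis unfolding bounded_iff by blast
qed

text \<open>\<open>Ck\<close> provides continuity of the derivative in each fixed direction
  separately. Expanding a vector in the basis bounds the operator norm by finitely many directional
  derivatives.\<close>

lemma Ck_Suc_onorm_bounded:
  fixes g :: "'a::euclidean_space \<Rightarrow> 'b::real_normed_vector"
  assumes "Ck (Suc k) g"
  shows "\<exists>B. \<forall>x\<in>cball 0 r. onorm (frechet_derivative g (at x)) \<le> B"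
proof -
  let ?D = "\<lambda>x. frechet_derivative g (at x)"
  have "\<exists>B. \<forall>x\<in>cball 0 r. norm (?D x v) \<le> B" for v
    by (rule continuous_bounded_on_cball[OF Ck_imp_continuous_on[OF Ck_Suc_frechet[OF assms]]])
  then obtain B where B: "\<And>v x. x \<in> cball 0 r \<Longrightarrow> norm (?D x v) \<le> B v" by metis
  have "onorm (?D x) \<le> (\<Sum>i\<in>Basis. B i)" if x: "x \<in> cball 0 r" for x
  proof (rule onorm_le)
    fix v :: 'a
    interpret bounded_linear "?D x" by (rule Ck_Suc_bounded_linear[OF assms])
    have "?D x v = ?D x (\<Sum>i\<in>Basis. (v \<bullet> i) *\<^sub>R i)" by (simp only: euclidean_representation)
    also have "\<dots> = (\<Sum>i\<in>Basis. (v \<bullet> i) *\<^sub>R ?D x i)" by (simp only: sum scaleR)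
    finally have "norm (?D x v) = norm (\<Sum>i\<in>Basis. (v \<bullet> i) *\<^sub>R ?D x i)" by (rule arg_cong)
    also have "\<dots> \<le> (\<Sum>i\<in>Basis. norm ((v \<bullet> i) *\<^sub>R ?D x i))" by (rule norm_sum)
    also have "\<dots> \<le> (\<Sum>i\<in>Basis. norm v * B i)"
      using B[OF x] by (intro sum_mono) (simp add: Basis_le_norm mult_mono)
    finally show "norm (?D x v) \<le> (\<Sum>i\<in>Basis. B i) * norm v" by (simp add: sum_distrib_left mult.commute)
  qed
  then show ?thesis by blast
qed

text \<open>A bounded set need not be convex, so the mean value inequality is applied on a ball that
  contains it.\<close>

lemma Ck_Suc_blip:
  fixes g :: "'a::euclidean_space \<Rightarrow> 'b::real_normed_vector"
  assumes "Ck (Suc k) g"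
  shows "blip g"
  unfolding blip_def
proof (intro allI impI)
  fix S :: "'a set" assume "bounded S"
  then obtain r where "\<forall>x\<in>S. norm x \<le> r" unfolding bounded_iff by blast
  then have r: "S \<subseteq> cball 0 r" by auto
  obtain B where B: "\<And>x. x \<in> cball 0 r \<Longrightarrow> onorm (frechet_derivative g (at x)) \<le> B"
    using Ck_Suc_onorm_bounded[OF assms] by blast
  have Lip: "norm (g x - g y) \<le> B * dist x y" if "x \<in> cball 0 r" "y \<in> cball 0 r" for x y
    unfolding dist_norm
    by (rule differentiable_bound[of "cball 0 r" g _, OF _ has_derivative_at_withinI[OF Ck_Suc_has_derivative[OF assms]] B that]) auto
  obtain M where M: "\<forall>x\<in>cball 0 r. norm (g x) \<le> M"
    using continuous_bounded_on_cball[OF Ck_imp_continuous_on[OF assms]] by blast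
  have "lipb (cball 0 r) g"
    by (rule lipbI[OF Lip, of _ M]) (use M in blast)+
  then show "lipb S g" using r lipb_subset by blast
qed

lemma smooth_blip: "smooth g \<Longrightarrow> blip (g :: 'a::euclidean_space \<Rightarrow> 'b::real_normed_vector)"
  unfolding smooth_def using Ck_Suc_blip by blast

text \<open>The basis expansion separates the point from the direction: the coefficients depend on
  \<open>v\<close> alone and the finitely many directional derivatives on \<open>x\<close>
  alone.\<close>

lemma frechet_blip:
  fixes g :: "'a::euclidean_space \<Rightarrow> 'b::real_normed_vector"
  assumes "Ck (Suc (Suc k)) g" "lipb S x" "lipb S v"
  shows "lipb S (\<lambda>s. frechet_derivative g (at (x s)) (v s))"
proof -
  have eq: "frechet_derivative g (at y) w = (\<Sum>i\<in>Basis. (w \<bullet> i) *\<^sub>R frechet_derivative g (at y) i)" for y w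
  proof -
    interpret bounded_linear "frechet_derivative g (at y)"
      by (rule Ck_Suc_bounded_linear[OF assms(1)])
    have "frechet_derivative g (at y) w = frechet_derivative g (at y) (\<Sum>i\<in>Basis. (w \<bullet> i) *\<^sub>R i)"
      by (simp only: euclidean_representation)
    also have "\<dots> = (\<Sum>i\<in>Basis. (w \<bullet> i) *\<^sub>R frechet_derivative g (at y) i)"
      by (simp only: sum scaleR)
    finally show ?thesis .
  qed
  have "blip (\<lambda>y. frechet_derivative g (at y) i)" for i
    using assms(1) by (intro Ck_Suc_blip[of k]) simp
  then have "lipb S (\<lambda>s. \<Sum>i\<in>Basis. (v s \<bullet> i) *\<^sub>R frechet_derivative g (at (x s)) i)"
    by (intro lipb_sum lipb_scaleR lipb_inner assms lipb_const lipb_blip[OF assms(2)]) auto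
  moreover have "(\<lambda>s. frechet_derivative g (at (x s)) (v s)) =
      (\<lambda>s. \<Sum>i\<in>Basis. (v s \<bullet> i) *\<^sub>R frechet_derivative g (at (x s)) i)"
    by (rule ext) (rule eq)
  ultimately show ?thesis by (simp only:)
qed

section \<open>Gradients and Jacobians\<close>

lemma grad_inner:
  assumes "(V has_derivative D) (at x)"
  shows "D v = grad V x \<bullet> v"
proof -
  have D: "frechet_derivative V (at x) = D" using assms frechet_derivative_at by metis
  interpret bounded_linear D using assms has_derivative_bounded_linear by blast
  have "D v = D (\<Sum>i\<in>UNIV. v $ i *\<^sub>R axis i 1)" by (metis basis_expansion scalar_mult_eq_scaleR)
  also have "\<dots> = (\<Sum>i\<in>UNIV. v $ i * D (axis i 1))" by (simp add: sum scaleR)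
  finally show ?thesis by (simp add: grad_def inner_vec_def D mult.commute)
qed

lemma grad_has_derivative:
  "Ck (Suc k) V \<Longrightarrow> (V has_derivative (\<lambda>v. grad V x \<bullet> v)) (at x)"
  using Ck_Suc_has_derivative[of k V x] grad_inner by (metis (no_types, lifting) ext)

lemma grad_expansion:
  "grad V x = (\<Sum>i\<in>UNIV. frechet_derivative V (at x) (axis i 1) *\<^sub>R axis i 1)"
  by (simp add: grad_def vec_eq_iff axis_def if_distrib if_distribR cong: if_cong)

lemma grad_blip: "Ck (Suc (Suc k)) V \<Longrightarrow> blip (grad V)"
  unfolding blip_def
proof (intro allI impI)
  fix S :: "(real^'a) set" assume V: "Ck (Suc (Suc k)) V" and S: "bounded S"
  have "grad V = (\<lambda>x. \<Sum>i\<in>UNIV. frechet_derivative V (at x) (axis i 1) *\<^sub>R axis i 1)"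
    by (rule ext) (rule grad_expansion)
  moreover have "lipb S (\<lambda>x. \<Sum>i\<in>UNIV. frechet_derivative V (at x) (axis i 1) *\<^sub>R (axis i 1 :: real^'a))"
    by (intro lipb_sum lipb_scaleR lipb_const frechet_blip[OF V] lipb_bounded_linear[OF S] bounded_linear_ident) auto
  ultimately show "lipb S (grad V)" by simp
qed

lemma Ck_grad: "Ck (Suc (Suc 0)) V \<Longrightarrow> Ck (Suc 0) (grad V)"
proof -
  assume V: "Ck (Suc (Suc 0)) V"
  have C1: "Ck (Suc 0) (\<lambda>x. frechet_derivative V (at x) v)" for v by (rule Ck_Suc_frechet[OF V])
  let ?D = "\<lambda>x i. frechet_derivative (\<lambda>x. frechet_derivative V (at x) (axis i 1)) (at x)"
  have d: "(grad V has_derivative (\<lambda>v. \<Sum>i\<in>UNIV. ?D x i v *\<^sub>R axis i 1)) (at x)" for x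
    unfolding grad_expansion[abs_def]
    by (intro has_derivative_sum has_derivative_scaleR_left Ck_Suc_has_derivative[OF C1])
  have fd: "frechet_derivative (grad V) (at x) = (\<lambda>v. \<Sum>i\<in>UNIV. ?D x i v *\<^sub>R axis i 1)" for x
    by (rule frechet_derivative_at[OF d, symmetric])
  have "continuous_on UNIV (\<lambda>x. ?D x i v)" for i v
    using Ck_imp_continuous_on[OF Ck_Suc_frechet[OF C1]] .
  then have "continuous_on UNIV (\<lambda>x. \<Sum>i\<in>UNIV. ?D x i v *\<^sub>R (axis i 1 :: real^'a))" for v
    by (intro continuous_on_sum continuous_on_scaleR continuous_on_const)
  then show ?thesis using d by (simp add: fd differentiableI[OF d])
qed

lemma jacobian_frechet:
  fixes h :: "real^'n \<Rightarrow> real^'k"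
  assumes "Ck (Suc k) h"
  shows "jacobian h (at x) *v v = frechet_derivative h (at x) v"
proof -
  have "h differentiable (at x)" using assms by simp
  then have "(h has_derivative (\<lambda>v. jacobian h (at x) *v v)) (at x)"
    by (rule iffD1[OF jacobian_works])
  then show ?thesis using frechet_derivative_at by metis
qed

section \<open>Differential inequalities, small gain and a weighted fixed point\<close>

lemma increment_indefinite_integral:
  fixes g :: "real \<Rightarrow> 'a::euclidean_space"
  assumes "\<And>a b. g integrable_on {a..b}" "0 \<le> s" "s \<le> t"
  shows "integral {0..t} g - integral {0..s} g = integral {s..t} g"
  using Henstock_Kurzweil_Integration.integral_combine[of 0 s t g] assms by (simp add: algebra_simps)

text \<open>The averaging theorem used here is one-sided. Applied to \<open>g\<close> it gives the
  right derivative, applied to the reflected function the left one, whose exceptional set has to be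
  reflected back.\<close>

lemma indefinite_integral_derivative_ae:
  fixes g :: "real \<Rightarrow> 'a::euclidean_space"
  assumes int: "\<And>a b. g integrable_on {a..b}"
  obtains S where "negligible S"
    "\<And>t. t > 0 \<Longrightarrow> t \<notin> S \<Longrightarrow> ((\<lambda>t. integral {0..t} g) has_vector_derivative g t) (at t)"
proof -
  obtain N1 where N1: "negligible N1" "\<And>x e. \<lbrakk>x \<notin> N1; 0 < e\<rbrakk> \<Longrightarrow> \<exists>d>0. \<forall>h. 0 < h \<and> h < d \<longrightarrow>
       norm(integral (cbox x (x + h *\<^sub>R One)) g /\<^sub>R h ^ DIM(real) - g x) < e"
    using integrable_ccontinuous_explicit[of g] int by (metis box_real(2))
  have int': "(\<lambda>x. g (- x)) integrable_on cbox a b" for a b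
    using int[of "-b" "-a"] Henstock_Kurzweil_Integration.integrable_reflect_real[where f = g and a = "-b" and b = "-a"] by simp
  obtain N2 where N2: "negligible N2" "\<And>x e. \<lbrakk>x \<notin> N2; 0 < e\<rbrakk> \<Longrightarrow> \<exists>d>0. \<forall>h. 0 < h \<and> h < d \<longrightarrow>
       norm(integral (cbox x (x + h *\<^sub>R One)) (\<lambda>x. g (- x)) /\<^sub>R h ^ DIM(real) - g (- x)) < e"
    using integrable_ccontinuous_explicit[of "\<lambda>x. g (- x)"] int' by metis
  have N2': "negligible (uminus ` N2)"
    by (rule negligible_differentiable_image_negligible[OF _ N2(1)]) (auto intro: derivative_intros)
  show ?thesis
  proof (rule that[of "N1 \<union> uminus ` N2"])
    show "negligible (N1 \<union> uminus ` N2)" using N1(1) N2' by (rule negligible_Un)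
    fix t :: real assume t: "t > 0" "t \<notin> N1 \<union> uminus ` N2"
    have t1: "t \<notin> N1" and t2: "- t \<notin> N2" using t(2) by force+
    show "((\<lambda>t. integral {0..t} g) has_vector_derivative g t) (at t)"
      unfolding has_vector_derivative_def has_derivative_at_alt
    proof (intro conjI allI impI)
      show "bounded_linear (\<lambda>x. x *\<^sub>R g t)" by (rule bounded_linear_scaleR_left)
      fix e :: real assume e: "0 < e"
      obtain d1 where d1: "d1 > 0" "\<And>h. 0 < h \<Longrightarrow> h < d1 \<Longrightarrow> norm (integral {t..t+h} g /\<^sub>R h - g t) < e"
        using N1(2)[OF t1 e] by (simp add: cbox_interval) blast
      obtain d2 where d2: "d2 > 0" "\<And>h. 0 < h \<Longrightarrow> h < d2 \<Longrightarrow>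
           norm (integral {-t..-t+h} (\<lambda>x. g (- x)) /\<^sub>R h - g t) < e"
        using N2(2)[OF t2 e] by (simp add: cbox_interval) blast
      have scale: "norm (I - h *\<^sub>R G) \<le> e * h" if "0 < h" "norm (I /\<^sub>R h - G) < e" for I G :: 'a and h
      proof -
        have "I - h *\<^sub>R G = h *\<^sub>R (I /\<^sub>R h - G)" using that(1) by (simp add: scaleR_diff_right)
        then have "norm (I - h *\<^sub>R G) = h * norm (I /\<^sub>R h - G)" using that(1) by simp
        also have "\<dots> \<le> h * e" using that by simp
        finally show ?thesis by (simp add: mult.commute)
      qed
      \<comment> \<open>The third radius \<open>t\<close> keeps \<open>y\<close> positive, so that
        \<open>integral {0..y} g\<close> is the primitive and not an integral over an empty
        interval.\<close>
      have "norm (integral {0..y} g - integral {0..t} g - (y - t) *\<^sub>R g t) \<le> e * norm (y - t)"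
        if y: "norm (y - t) < min (min d1 d2) t" for y
      proof (cases y t rule: linorder_cases)
        case less
        have "integral {0..t} g - integral {0..y} g = integral {y..t} g"
          by (rule increment_indefinite_integral[OF int]) (use y less in auto)
        moreover have "integral {-t..-t+(t-y)} (\<lambda>x. g (- x)) = integral {y..t} g"
          using Henstock_Kurzweil_Integration.integral_reflect_real[where f = g and a = y and b = t] by simp
        ultimately have "norm (integral {0..t} g - integral {0..y} g - (t - y) *\<^sub>R g t) \<le> e * (t - y)"
          using scale[of "t - y" "integral {y..t} g" "g t"] d2(2)[of "t - y"] y less by simp
        moreover have "integral {0..y} g - integral {0..t} g - (y - t) *\<^sub>R g t
            = - (integral {0..t} g - integral {0..y} g - (t - y) *\<^sub>R g t)" by (simp add: algebra_simps)
        ultimately show ?thesis using less by (simp only: norm_minus_cancel) simp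
      next
        case equal then show ?thesis by simp
      next
        case greater
        have "integral {0..y} g - integral {0..t} g = integral {t..y} g"
          by (rule increment_indefinite_integral[OF int]) (use t greater in auto)
        then show ?thesis
          using scale[of "y - t" "integral {t..y} g" "g t"] d1(2)[of "y - t"] y greater by simp
      qed
      then show "\<exists>d>0. \<forall>y. norm (y - t) < d \<longrightarrow>
          norm (integral {0..y} g - integral {0..t} g - (y - t) *\<^sub>R g t) \<le> e * norm (y - t)"
        using d1(1) d2(1) t(1) by (intro exI[of _ "min (min d1 d2) t"]) simp
    qed
  qed
qed

lemma norm_integral_le:
  fixes g :: "real \<Rightarrow> 'a::euclidean_space"
  assumes "g integrable_on {s..t}" "s \<le> t" "\<And>l. l \<in> {s..t} \<Longrightarrow> norm (g l) \<le> B"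
  shows "norm (integral {s..t} g) \<le> B * (t - s)"
proof -
  have "norm (integral {s..t} g) \<le> integral {s..t} (\<lambda>_. B)"
    by (rule integral_norm_bound_integral[OF assms(1) _ assms(3)]) auto
  then show ?thesis using assms(2) by (simp add: mult.commute)
qed

lemma indefinite_integral_lipschitz:
  fixes g :: "real \<Rightarrow> 'a::euclidean_space"
  assumes int: "\<And>a b. g integrable_on {a..b}" and B: "\<And>t. norm (g t) \<le> B"
  shows "B-lipschitz_on {0..} (\<lambda>t. integral {0..t} g)"
proof (rule lipschitz_onI)
  show "0 \<le> B" using B[of 0] norm_ge_zero order_trans by blast
  have *: "norm (integral {0..t} g - integral {0..s} g) \<le> B * (t - s)" if "0 \<le> s" "s \<le> t" for s t
    unfolding increment_indefinite_integral[OF int that] by (rule norm_integral_le[OF int that(2) B])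
  fix s t :: real assume "s \<in> {0..}" "t \<in> {0..}"
  then show "dist (integral {0..s} g) (integral {0..t} g) \<le> B * dist s t"
    using *[of s t] *[of t s] by (cases "s \<le> t") (auto simp: dist_norm norm_minus_commute)
qed

text \<open>Lipschitz continuity takes the place of absolute continuity: solutions with a bounded
  right-hand side have it, and products and compositions with functions that are Lipschitz on
  bounded sets preserve it, with the usual rules for the derivative.\<close>

definition lipode :: "real \<Rightarrow> real \<Rightarrow> (real \<Rightarrow> 'a::euclidean_space) \<Rightarrow> (real \<Rightarrow> 'a) \<Rightarrow> bool" where
  "lipode a b y F \<longleftrightarrow> (\<exists>C. C-lipschitz_on {a..b} y) \<and>
     (\<exists>S. negligible S \<and> (\<forall>t\<in>{a..b} - S. (y has_vector_derivative F t) (at t)))"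

lemma lipodeI:
  assumes "C-lipschitz_on {a..b} y" "negligible S"
    "\<And>t. t \<in> {a..b} - S \<Longrightarrow> (y has_vector_derivative F t) (at t)"
  shows "lipode a b y F"
  unfolding lipode_def using assms by blast

lemma lipodeE:
  assumes "lipode a b y F"
  obtains C S where "C-lipschitz_on {a..b} y" "negligible S"
    "\<forall>t\<in>{a..b} - S. (y has_vector_derivative F t) (at t)"
  using assms unfolding lipode_def by blast

lemma lipode_FTC:
  assumes "lipode a b y F" "a \<le> b"
  shows "(F has_integral (y b - y a)) {a..b}"
proof -
  obtain C S where *: "C-lipschitz_on {a..b} y" "negligible S"
    "\<forall>t\<in>{a..b} - S. (y has_vector_derivative F t) (at t)" by (rule lipodeE[OF assms(1)])
  show ?thesis
    by (rule abs_cont_FTC[OF lipschitz_imp_abs_cont_on[OF *(1)] assms(2) *(2)]) (use *(3) in blast)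
qed

lemma lipode_subset:
  assumes "lipode a b y F" "a \<le> c" "d \<le> b" shows "lipode c d y F"
proof -
  obtain C S where *: "C-lipschitz_on {a..b} y" "negligible S"
    "\<forall>t\<in>{a..b} - S. (y has_vector_derivative F t) (at t)" by (rule lipodeE[OF assms(1)])
  have sub: "{c..d} \<subseteq> {a..b}" using assms by auto
  show ?thesis
    by (rule lipodeI[OF lipschitz_on_subset[OF *(1) sub] *(2)]) (use *(3) sub in blast)
qed

lemma lipode_continuous: "lipode a b y F \<Longrightarrow> continuous_on {a..b} y"
  unfolding lipode_def using lipschitz_on_continuous_on by blast

lemma lipode_lipb:
  assumes "lipode a b y F" shows "lipb {a..b} y"
proof -
  have "compact (y ` {a..b})" using lipode_continuous[OF assms] by (rule compact_continuous_image) simp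
  then have "bounded (y ` {a..b})" by (rule compact_imp_bounded)
  then show ?thesis using assms unfolding lipb_def lipode_def by blast
qed

lemma lipode_diff:
  assumes "lipode a b y F" "lipode a b z G"
  shows "lipode a b (\<lambda>t. y t - z t) (\<lambda>t. F t - G t)"
proof -
  obtain C S where *: "C-lipschitz_on {a..b} y" "negligible S"
    "\<forall>t\<in>{a..b} - S. (y has_vector_derivative F t) (at t)" by (rule lipodeE[OF assms(1)])
  obtain C' S' where **: "C'-lipschitz_on {a..b} z" "negligible S'"
    "\<forall>t\<in>{a..b} - S'. (z has_vector_derivative G t) (at t)" by (rule lipodeE[OF assms(2)])
  show ?thesis
    by (rule lipodeI[OF lipschitz_on_diff[OF *(1) **(1)] negligible_Un[OF *(2) **(2)]])
       (use *(3) **(3) in \<open>auto intro: has_vector_derivative_diff\<close>)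
qed

lemma lipode_shift:
  assumes "lipode a b y F"
  shows "lipode (a + c) (b + c) (\<lambda>t. y (t - c)) (\<lambda>t. F (t - c))"
proof -
  obtain C S where *: "C-lipschitz_on {a..b} y" "negligible S"
    "\<forall>t\<in>{a..b} - S. (y has_vector_derivative F t) (at t)" by (rule lipodeE[OF assms(1)])
  have "C-lipschitz_on {a+c..b+c} (\<lambda>t. y (t - c))"
  proof (rule lipschitz_onI)
    fix s t assume "s \<in> {a+c..b+c}" "t \<in> {a+c..b+c}"
    then show "dist (y (s - c)) (y (t - c)) \<le> C * dist s t"
      using lipschitz_onD[OF *(1), of "s - c" "t - c"] by (simp add: dist_real_def)
  qed (rule lipschitz_on_nonneg[OF *(1)])
  moreover have "negligible ((+) c ` S)" using *(2) by (rule negligible_translation)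
  moreover have "((\<lambda>t. y (t - c)) has_vector_derivative F (t - c)) (at t)" if "t \<in> {a+c..b+c} - (+) c ` S" for t
  proof -
    have "t - c \<notin> S"
    proof
      assume "t - c \<in> S"
      then have "c + (t - c) \<in> (+) c ` S" by (rule imageI)
      then show False using that by simp
    qed
    then have "t - c \<in> {a..b} - S" using that by auto
    then have "(y has_vector_derivative F (t - c)) (at (t - c))" using *(3) by blast
    moreover have "((\<lambda>t. t - c) has_vector_derivative 1) (at t)"
      by (auto intro!: derivative_eq_intros)
    ultimately show ?thesis
      using vector_diff_chain_at[of "\<lambda>t. t - c" 1 t y] by (simp add: o_def)
  qed
  ultimately show ?thesis by (rule lipodeI)
qed

lemma lipode_chain:
  fixes g :: "'a::euclidean_space \<Rightarrow> 'b::euclidean_space"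
  assumes y: "lipode a b y F" and g: "blip g"
    and der: "\<And>x. (g has_derivative g' x) (at x)"
  shows "lipode a b (\<lambda>t. g (y t)) (\<lambda>t. g' (y t) (F t))"
proof -
  obtain C S where *: "C-lipschitz_on {a..b} y" "negligible S"
    "\<forall>t\<in>{a..b} - S. (y has_vector_derivative F t) (at t)" by (rule lipodeE[OF y])
  obtain D where D: "D-lipschitz_on {a..b} (\<lambda>t. g (y t))"
    using lipb_blip[OF lipode_lipb[OF y] g] unfolding lipb_def by blast
  show ?thesis
  proof (rule lipodeI[OF D *(2)])
    fix t assume "t \<in> {a..b} - S"
    then have "(y has_vector_derivative F t) (at t)" using *(3) by blast
    then have "((\<lambda>t. g (y t)) has_derivative (\<lambda>h. g' (y t) (h *\<^sub>R F t))) (at t)"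
      unfolding has_vector_derivative_def using der diff_chain_at[of y _ t g "g' (y t)"] by (simp add: o_def)
    moreover have "g' (y t) (h *\<^sub>R F t) = h *\<^sub>R g' (y t) (F t)" for h
      using has_derivative_bounded_linear[OF der] by (simp add: bounded_linear.linear linear_scale)
    ultimately show "((\<lambda>t. g (y t)) has_vector_derivative g' (y t) (F t)) (at t)"
      unfolding has_vector_derivative_def by simp
  qed
qed

lemma lipode_bilinear:
  fixes bop :: "'a::euclidean_space \<Rightarrow> 'b::euclidean_space \<Rightarrow> 'c::euclidean_space"
  assumes bb: "bounded_bilinear bop" and y: "lipode a b y F" and z: "lipode a b z G"
  shows "lipode a b (\<lambda>t. bop (y t) (z t)) (\<lambda>t. bop (y t) (G t) + bop (F t) (z t))"
proof -
  obtain C S where *: "C-lipschitz_on {a..b} y" "negligible S"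
    "\<forall>t\<in>{a..b} - S. (y has_vector_derivative F t) (at t)" by (rule lipodeE[OF y])
  obtain C' S' where **: "C'-lipschitz_on {a..b} z" "negligible S'"
    "\<forall>t\<in>{a..b} - S'. (z has_vector_derivative G t) (at t)" by (rule lipodeE[OF z])
  obtain D where D: "D-lipschitz_on {a..b} (\<lambda>t. bop (y t) (z t))"
    using lipb_bilinear[OF bb lipode_lipb[OF y] lipode_lipb[OF z]] unfolding lipb_def by blast
  show ?thesis
    by (rule lipodeI[OF D negligible_Un[OF *(2) **(2)]])
       (use *(3) **(3) bounded_bilinear.has_vector_derivative[OF bb] in auto)
qed

lemma lipode_nonincreasing:
  fixes y :: "real \<Rightarrow> real"
  assumes "lipode a b y F" "a \<le> b" "\<And>t. t \<in> {a..b} \<Longrightarrow> F t \<le> 0"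
  shows "y b \<le> y a"
proof -
  have "y b - y a \<le> 0"
    by (rule has_integral_le[OF lipode_FTC[OF assms(1,2)] has_integral_0 assms(3)])
  then show ?thesis by simp
qed

lemma lipode_real_exp:
  "lipode a b (\<lambda>t. exp (g * t)) (\<lambda>t. g * exp (g * t :: real))"
proof -
  have "Ck (Suc 0) (exp :: real \<Rightarrow> real)"
  proof -
    have "frechet_derivative exp (at x) = (\<lambda>h. exp x * h)" for x :: real
      by (rule frechet_derivative_at[symmetric]) (use DERIV_exp[of x] in \<open>simp add: has_field_derivative_def\<close>)
    moreover have "exp differentiable (at x)" for x :: real
      by (rule differentiableI[OF DERIV_exp[of x, unfolded has_field_derivative_def]])
    moreover have "continuous_on UNIV (\<lambda>x::real. exp x * v)" for v by (intro continuous_intros)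
    ultimately show ?thesis by simp
  qed
  then have "blip (exp :: real \<Rightarrow> real)" using Ck_Suc_blip by blast
  moreover have "lipb {a..b} (\<lambda>t. g * t)"
    by (intro lipb_mult lipb_const lipb_bounded_linear bounded_linear_ident) auto
  ultimately have "lipb {a..b} (\<lambda>t. exp (g * t))" by (rule lipb_blip[rotated])
  then obtain C where "C-lipschitz_on {a..b} (\<lambda>t. exp (g * t))" unfolding lipb_def by blast
  then show ?thesis
    by (rule lipodeI[OF _ negligible_empty])
       (auto intro!: derivative_eq_intros simp: has_real_derivative_iff_has_vector_derivative[symmetric])
qed

text \<open>Multiply by the integrating factor \<open>exp (g * t)\<close> and subtract a primitive
  of the forcing: with \<open>m = g - 2 * s\<close> the function
  \<open>exp (g * t) * v t - k / m * exp (m * t)\<close> does not increase. The exponent has the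
  factor 2 because \<open>v\<close> will be quadratic in an error that decays like
  \<open>exp (- s * t)\<close>.\<close>

lemma exponential_comparison:
  fixes v :: "real \<Rightarrow> real"
  assumes v: "lipode a b v F" and ab: "a \<le> b" and gs: "2 * s < g" and va: "0 \<le> v a"
    and F: "\<And>t. t \<in> {a..b} \<Longrightarrow> F t \<le> - g * v t + k * exp (- 2 * s * t)"
  shows "exp (2 * s * b) * v b \<le> exp (2 * s * a) * v a + k / (g - 2 * s) * (1 - exp (- (g - 2 * s) * (b - a)))"
proof -
  define m where "m = g - 2 * s"
  have m: "m > 0" using gs by (simp add: m_def)
  have l: "lipode a b (\<lambda>t. exp (g * t) * v t - k / m * exp (m * t))
     (\<lambda>t. (exp (g * t) * F t + g * exp (g * t) * v t) - (k / m * (m * exp (m * t)) + 0 * exp (m * t)))"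
    by (intro lipode_diff lipode_bilinear[OF bounded_bilinear_mult lipode_real_exp v]
        lipode_bilinear[OF bounded_bilinear_mult _ lipode_real_exp])
       (auto intro!: lipodeI[of 0 _ _ _ "{}"] lipschitz_on_constant)
  have "exp (g * b) * v b - k / m * exp (m * b) \<le> exp (g * a) * v a - k / m * exp (m * a)"
  proof (rule lipode_nonincreasing[OF l ab])
    fix t assume t: "t \<in> {a..b}"
    have "exp (g * t) * (F t + g * v t) \<le> exp (g * t) * (k * exp (- 2 * s * t))"
      using F[OF t] by (intro mult_left_mono) auto
    also have "\<dots> = k * exp (m * t)" by (simp add: m_def exp_add[symmetric] algebra_simps)
    finally show "(exp (g * t) * F t + g * exp (g * t) * v t) - (k / m * (m * exp (m * t)) + 0 * exp (m * t)) \<le> 0"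
      using m by (simp add: algebra_simps)
  qed
  then have "exp (- (m * b)) * (exp (g * b) * v b) \<le> exp (- (m * b)) * (exp (g * a) * v a + k / m * exp (m * b) - k / m * exp (m * a))"
    by (intro mult_left_mono) auto
  also have "\<dots> = exp (- (m * b)) * exp (g * a) * v a + k / m * (1 - exp (- m * (b - a)))"
  proof -
    have "exp (- (m * b)) * exp (m * b) = 1" "exp (- (m * b)) * exp (m * a) = exp (- m * (b - a))"
      by (simp_all add: exp_add[symmetric] algebra_simps)
    then show ?thesis by (simp only: distrib_left right_diff_distrib) (simp add: algebra_simps)
  qed
  also have "exp (- (m * b)) * exp (g * a) * v a \<le> exp (2 * s * a) * v a"
  proof -
    have "exp (- (m * b)) * exp (g * a) \<le> exp (2 * s * a)"
      using m ab by (simp add: exp_add[symmetric] m_def) (smt (verit) m_def m mult_left_mono left_diff_distrib)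
    then show ?thesis using va by (rule mult_right_mono)
  qed
  also have "exp (- (m * b)) * (exp (g * b) * v b) = exp (2 * s * b) * v b"
    by (simp add: m_def algebra_simps exp_add[symmetric])
  finally show ?thesis by (simp add: m_def)
qed

lemma exponential_comparison_limit:
  fixes v :: "real \<Rightarrow> real"
  assumes "lipode a b v F" "a \<le> b" "2 * s < g" "0 \<le> v a" "0 \<le> k"
    and "\<And>t. t \<in> {a..b} \<Longrightarrow> F t \<le> - g * v t + k * exp (- 2 * s * t)"
  shows "exp (2 * s * b) * v b \<le> exp (2 * s * a) * v a + k / (g - 2 * s)"
proof -
  have "k / (g - 2 * s) * (1 - exp (- (g - 2 * s) * (b - a))) \<le> k / (g - 2 * s) * 1"
    using assms(2,3,5) by (intro mult_left_mono) auto
  then show ?thesis using exponential_comparison[OF assms(1-4) assms(6)] by simp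
qed

text \<open>After the last time at which \<open>v\<close> is at most \<open>R\<close>, it falls at
  rate \<open>w\<close>; if there is no such time, it falls at that rate from \<open>a\<close>
  on.\<close>

lemma absorbing_level:
  fixes v :: "real \<Rightarrow> real"
  assumes v: "lipode a b v F" and ab: "a \<le> b" and w: "0 \<le> w"
    and F: "\<And>t. t \<in> {a..b} \<Longrightarrow> v t > R \<Longrightarrow> F t \<le> - w"
  shows "v b \<le> max (v a) R" "v b \<le> R \<or> v b \<le> v a - w * (b - a)"
proof -
  have cont: "continuous_on {a..b} v" using v by (rule lipode_continuous)
  have 1: "v b \<le> v c - w * (b - c)" if "a \<le> c" "c \<le> b" "\<And>t. t \<in> {c<..b} \<Longrightarrow> v t > R" for c
  proof -
    \<comment> \<open>The differential inequality is known only where \<open>v > R\<close>, which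
      may fail at \<open>c\<close> itself; so integrate from \<open>d > c\<close> and let
      \<open>d\<close> tend to \<open>c\<close>.\<close>
    have *: "v b \<le> v d - w * (b - d)" if d: "c < d" "d \<le> b" for d
    proof -
      have "(F has_integral (v b - v d)) {d..b}"
        by (rule lipode_FTC[OF lipode_subset[OF v]]) (use d \<open>a \<le> c\<close> in auto)
      moreover have "((\<lambda>_. - w) has_integral (- w * (b - d))) {d..b}"
        using has_integral_const_real[of "- w" d b] d by (simp add: mult.commute)
      ultimately have "v b - v d \<le> - w * (b - d)"
        by (rule has_integral_le) (use F d \<open>a \<le> c\<close> that(1) \<open>\<And>t. t \<in> {c<..b} \<Longrightarrow> v t > R\<close> in auto)
      then show ?thesis by simp
    qed
    show ?thesis
    proof (cases "c = b")
      case False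
      then have cb: "c < b" using that by simp
      have "continuous_on {c..b} v" using cont by (rule continuous_on_subset) (use that in auto)
      then have "continuous_on {c..b} (\<lambda>d. v d - w * (b - d))" by (intro continuous_intros)
      then have "((\<lambda>d. v d - w * (b - d)) \<longlongrightarrow> v c - w * (b - c)) (at c within {c..b})"
        using cb by (simp add: continuous_on)
      then have "((\<lambda>d. v d - w * (b - d)) \<longlongrightarrow> v c - w * (b - c)) (at_right c)"
        using cb by (simp add: at_within_Icc_at_right)
      moreover have "\<forall>\<^sub>F d in at_right c. v b \<le> v d - w * (b - d)"
        by (rule eventually_mono[OF eventually_at_right_real[OF cb]]) (use * in auto)
      ultimately show ?thesis by (rule tendsto_lowerbound) simp
    qed simp
  qed
  show 2: "v b \<le> R \<or> v b \<le> v a - w * (b - a)"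
  proof (cases "\<exists>c\<in>{a..b}. v c \<le> R")
    case False
    then have "v t > R" if "t \<in> {a<..b}" for t using that by (meson greaterThanAtMost_subseteq_atLeastAtMost_iff not_less order_refl subsetD)
    then show ?thesis using 1[of a] ab by blast
  next
    case True
    define Z where "Z = {a..b} \<inter> v -` {..R}"
    have "closed Z" unfolding Z_def using cont by (intro continuous_closed_preimage) auto
    moreover have "Z \<subseteq> {a..b}" by (auto simp: Z_def)
    ultimately have "compact Z" by (metis compact_Icc compact_Int_closed inf.absorb2)
    moreover have "Z \<noteq> {}" using True by (auto simp: Z_def)
    ultimately obtain c where c: "c \<in> Z" "\<And>d. d \<in> Z \<Longrightarrow> d \<le> c" using compact_attains_sup by metis
    have cab: "a \<le> c" "c \<le> b" "v c \<le> R" using c(1) by (auto simp: Z_def)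
    have "v t > R" if "t \<in> {c<..b}" for t
      using c(2)[of t] that cab unfolding Z_def by fastforce
    then have "v b \<le> v c - w * (b - c)" using 1 cab by blast
    then have "v b \<le> R" using cab w by (smt (verit) mult_nonneg_nonneg)
    then show ?thesis by simp
  qed
  have "w * (b - a) \<ge> 0" using w ab by simp
  then show "v b \<le> max (v a) R" using 2 by auto
qed

text \<open>The supremum \<open>m\<close> of \<phi> satisfies \<open>m \<le> A + g * m\<close>. This
  can be solved for \<open>m\<close> only because \<open>m\<close> is finite, which the crude bound
  \<open>B\<close> guarantees; the result no longer contains \<open>B\<close>.\<close>

lemma small_gain:
  fixes \<phi> :: "real \<Rightarrow> real"
  assumes bdd: "\<And>l. l \<in> {T0..t} \<Longrightarrow> \<phi> l \<le> B" and g: "0 \<le> g" "g < 1" and ne: "T0 \<le> t"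
    and pos: "\<And>l. l \<in> {T0..t} \<Longrightarrow> 0 \<le> \<phi> l"
    and init: "\<And>l. l \<in> {T0..t} \<Longrightarrow> l \<le> T1 \<Longrightarrow> \<phi> l \<le> A"
    and step: "\<And>m l. 0 \<le> m \<Longrightarrow> (\<And>l. l \<in> {T0..t} \<Longrightarrow> \<phi> l \<le> m) \<Longrightarrow> l \<in> {T0..t} \<Longrightarrow> T1 < l \<Longrightarrow> \<phi> l \<le> A + g * m"
    and l: "l \<in> {T0..t}" and A: "0 \<le> A"
  shows "\<phi> l \<le> A / (1 - g)"
proof -
  define m where "m = (SUP l\<in>{T0..t}. \<phi> l)"
  have bd: "bdd_above (\<phi> ` {T0..t})" using bdd by (intro bdd_aboveI2)
  have ub: "\<phi> l \<le> m" if "l \<in> {T0..t}" for l unfolding m_def using bd that by (rule cSUP_upper2) simp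
  have m0: "0 \<le> m" using ub[of T0] pos[of T0] ne by simp
  have "m \<le> A + g * m"
    unfolding m_def
  proof (rule cSUP_least)
    show "{T0..t} \<noteq> {}" using ne by simp
    fix l assume l: "l \<in> {T0..t}"
    show "\<phi> l \<le> A + g * (SUP l\<in>{T0..t}. \<phi> l)"
      unfolding m_def[symmetric]
    proof (cases "l \<le> T1")
      case True then show "\<phi> l \<le> A + g * m" using init[OF l] g m0 by (smt (verit) mult_nonneg_nonneg)
    next
      case False then show "\<phi> l \<le> A + g * m" using step[OF m0 ub l] by simp
    qed
  qed
  then have "m \<le> A / (1 - g)" using g by (simp add: field_simps)
  then show ?thesis using ub[OF l] by simp
qed

text \<open>Picard iteration with a pointwise weight: the iterates form a Cauchy sequence at every
  time, and measurability passes to the pointwise limit. The estimate with the weight holds for all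
  times at once, so no step-by-step continuation in time is involved.\<close>

lemma weighted_fixpoint:
  fixes \<Phi> :: "('i \<Rightarrow> real \<Rightarrow> 'e::euclidean_space) \<Rightarrow> ('i \<Rightarrow> real \<Rightarrow> 'e)"
  assumes meas: "\<And>Y. (\<And>j. Y j \<in> borel_measurable lebesgue) \<Longrightarrow> (\<And>j. \<Phi> Y j \<in> borel_measurable lebesgue)"
    and contr: "\<And>Y Y' D. (\<And>j. Y j \<in> borel_measurable lebesgue) \<Longrightarrow> (\<And>j. Y' j \<in> borel_measurable lebesgue) \<Longrightarrow>
       0 \<le> D \<Longrightarrow> (\<And>j t. norm (Y j t - Y' j t) \<le> D * exp (c * t)) \<Longrightarrow>
       (\<And>j t. norm (\<Phi> Y j t - \<Phi> Y' j t) \<le> D / 2 * exp (c * t))"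
    and start: "\<And>j t. norm (\<Phi> (\<lambda>_ _. 0) j t) \<le> D0 * exp (c * t)" and D0: "0 \<le> D0"
  shows "\<exists>Y. (\<forall>j. Y j \<in> borel_measurable lebesgue) \<and> \<Phi> Y = Y"
proof -
  define y where "y n = (\<Phi> ^^ n) (\<lambda>_ _. 0)" for n
  have ySuc: "y (Suc n) = \<Phi> (y n)" and y0: "y 0 = (\<lambda>_ _. 0)" for n by (auto simp: y_def)
  have ym: "y n j \<in> borel_measurable lebesgue" for n j
    by (induction n arbitrary: j) (auto simp: ySuc y0 intro: meas)
  have step: "norm (y (Suc n) j t - y n j t) \<le> D0 / 2 ^ n * exp (c * t)" for n j t
  proof (induction n arbitrary: j t)
    case 0 then show ?case using start by (simp add: ySuc y0)
  next
    case (Suc n)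
    have "norm (\<Phi> (y (Suc n)) j t - \<Phi> (y n) j t) \<le> D0 / 2 ^ n / 2 * exp (c * t)"
      by (rule contr[OF ym ym _ Suc]) (use D0 in auto)
    then show ?case by (simp add: ySuc[of "Suc n"] ySuc[of n] mult.commute)
  qed
  \<comment> \<open>The geometric sum is kept in the closed form \<open>2 - 2 / 2 ^ k\<close>, so
    that the induction on \<open>k\<close> closes.\<close>
  have diff: "norm (y (n + k) j t - y n j t) \<le> (2 - 2 / 2 ^ k) * (D0 / 2 ^ n) * exp (c * t)" for n k j t
  proof (induction k)
    case (Suc k)
    have "norm (y (n + Suc k) j t - y n j t) \<le> norm (y (Suc (n + k)) j t - y (n + k) j t) + norm (y (n + k) j t - y n j t)"
      using norm_triangle_ineq[of "y (Suc (n + k)) j t - y (n + k) j t" "y (n + k) j t - y n j t"] by simp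
    also have "\<dots> \<le> D0 / 2 ^ (n + k) * exp (c * t) + (2 - 2 / 2 ^ k) * (D0 / 2 ^ n) * exp (c * t)"
      using step Suc by (rule add_mono)
    also have "\<dots> = (2 - 2 / 2 ^ Suc k) * (D0 / 2 ^ n) * exp (c * t)"
      by (simp add: power_add field_simps)
    finally show ?case .
  qed simp
  have diff2: "norm (y (n + k) j t - y n j t) \<le> 2 * D0 * exp (c * t) / 2 ^ n" for n k j t
  proof -
    have "(2 - 2 / 2 ^ k) * (D0 / 2 ^ n) * exp (c * t) \<le> 2 * (D0 / 2 ^ n) * exp (c * t)"
      using D0 by (intro mult_right_mono) auto
    then show ?thesis using diff[of n k j t] by simp
  qed
  have "Cauchy (\<lambda>n. y n j t)" for j t
  proof (rule CauchyI)
    fix e :: real assume "e > 0"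
    have "(\<lambda>n. 2 * D0 * exp (c * t) * (1 / 2) ^ n) \<longlonglongrightarrow> 2 * D0 * exp (c * t) * 0"
      by (intro tendsto_mult tendsto_const LIMSEQ_power_zero) auto
    then have "\<forall>\<^sub>F n in sequentially. 2 * D0 * exp (c * t) * (1 / 2) ^ n < e / 2"
      by (rule order_tendstoD(2)) (use \<open>e > 0\<close> in simp)
    then obtain M where M: "\<And>n. n \<ge> M \<Longrightarrow> 2 * D0 * exp (c * t) * (1 / 2) ^ n < e / 2"
      unfolding eventually_sequentially by blast
    have *: "norm (y n j t - y M j t) < e / 2" if "n \<ge> M" for n
      using diff2[of M "n - M" j t] that M[of M] by (simp add: power_divide)
    have "norm (y m j t - y n j t) < e" if "m \<ge> M" "n \<ge> M" for m n
      using norm_triangle_ineq4[of "y m j t - y M j t" "y n j t - y M j t"] *[OF that(1)] *[OF that(2)] by simp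
    then show "\<exists>M. \<forall>m\<ge>M. \<forall>n\<ge>M. norm (y m j t - y n j t) < e" by blast
  qed
  then have "\<exists>l. (\<lambda>n. y n j t) \<longlonglongrightarrow> l" for j t using convergent_eq_Cauchy by blast
  then obtain Y where Y: "\<And>j t. (\<lambda>n. y n j t) \<longlonglongrightarrow> Y j t" by metis
  have Ym: "Y j \<in> borel_measurable lebesgue" for j
    by (rule borel_measurable_LIMSEQ_metric[of "\<lambda>n. y n j"]) (use ym Y in auto)
  have Yn: "norm (y n j t - Y j t) \<le> (2 * D0 / 2 ^ n) * exp (c * t)" for n j t
  proof -
    have "(\<lambda>k. y (n + k) j t - y n j t) \<longlonglongrightarrow> Y j t - y n j t"
      using LIMSEQ_ignore_initial_segment[OF Y[of j t], of n] by (intro tendsto_intros) (simp add: add.commute)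
    then have "norm (Y j t - y n j t) \<le> 2 * D0 * exp (c * t) / 2 ^ n"
      by (rule Lim_bounded[OF tendsto_norm, of _ _ 0]) (use diff2 in auto)
    then show ?thesis by (simp add: norm_minus_commute)
  qed
  have "\<Phi> Y j t = Y j t" for j t
  proof -
    have "(\<lambda>n. norm (\<Phi> (y n) j t - \<Phi> Y j t)) \<longlonglongrightarrow> 0"
    proof (rule tendsto_sandwich[OF _ _ tendsto_const])
      show "\<forall>\<^sub>F n in sequentially. norm (\<Phi> (y n) j t - \<Phi> Y j t) \<le> D0 * exp (c * t) * (1 / 2) ^ n"
      proof (rule always_eventually, rule allI)
        fix n
        have "norm (\<Phi> (y n) j t - \<Phi> Y j t) \<le> 2 * D0 / 2 ^ n / 2 * exp (c * t)"
          by (rule contr[OF ym Ym _ Yn]) (use D0 in auto)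
        then show "norm (\<Phi> (y n) j t - \<Phi> Y j t) \<le> D0 * exp (c * t) * (1 / 2) ^ n"
          by (simp add: power_divide)
      qed
      have "(\<lambda>n. D0 * exp (c * t) * (1 / 2) ^ n) \<longlonglongrightarrow> D0 * exp (c * t) * 0"
        by (intro tendsto_mult tendsto_const LIMSEQ_power_zero) auto
      then show "(\<lambda>n. D0 * exp (c * t) * (1 / 2) ^ n) \<longlonglongrightarrow> 0" by simp
    qed auto
    then have "(\<lambda>n. \<Phi> (y n) j t) \<longlonglongrightarrow> \<Phi> Y j t"
      by (rule LIM_zero_cancel[OF tendsto_norm_zero_cancel])
    moreover have "(\<lambda>n. \<Phi> (y n) j t) \<longlonglongrightarrow> Y j t"
      using LIMSEQ_Suc[OF Y[of j t]] by (simp add: ySuc)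
    ultimately show ?thesis using LIMSEQ_unique by blast
  qed
  then have "\<Phi> Y = Y" by (intro ext)
  then show ?thesis using Ym by blast
qed

section \<open>A globally Lipschitz delay system with sampling\<close>

lemma sampling_index_exists:
  assumes "time_partition ts"
  shows "\<exists>i. t < ts (Suc i)"
proof -
  have "filterlim ts at_top sequentially" using assms by (simp add: time_partition_def)
  then have "eventually (\<lambda>i. t < ts i) sequentially" by (simp add: filterlim_at_top_dense)
  then show ?thesis unfolding eventually_sequentially by (meson le_Suc_eq order_refl)
qed

text \<open>For \<open>t \<ge> 0\<close> this is the index of the sampling interval containing
  \<open>t\<close>; all negative times get index 0.\<close>

definition sampling_index :: "(nat \<Rightarrow> real) \<Rightarrow> real \<Rightarrow> nat" where
  "sampling_index ts t = (LEAST i. t < ts (Suc i))"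

lemma sampling_index_upper: "time_partition ts \<Longrightarrow> t < ts (Suc (sampling_index ts t))"
  unfolding sampling_index_def by (rule LeastI_ex[OF sampling_index_exists])

lemma sampling_index_lower:
  assumes "time_partition ts" "0 \<le> t"
  shows "ts (sampling_index ts t) \<le> t"
proof (cases "sampling_index ts t")
  case 0 then show ?thesis using assms by (simp add: time_partition_def)
next
  case (Suc j)
  then have "\<not> t < ts (Suc j)"
    using not_less_Least[of j "\<lambda>i. t < ts (Suc i)"] by (simp add: sampling_index_def)
  then show ?thesis using Suc by simp
qed

lemma sampling_index_nonneg: "time_partition ts \<Longrightarrow> 0 \<le> ts i"
  using strict_mono_less_eq[of ts 0 i] by (simp add: time_partition_def)

lemma sampling_index_eq:
  assumes "time_partition ts" "ts i \<le> t" "t < ts (Suc i)"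
  shows "sampling_index ts t = i"
proof -
  have sm: "strict_mono ts" using assms by (simp add: time_partition_def)
  have "0 \<le> t" using sampling_index_nonneg[OF assms(1), of i] assms(2) by simp
  then have "ts (sampling_index ts t) < ts (Suc i)" "ts i < ts (Suc (sampling_index ts t))"
    using sampling_index_lower[OF assms(1), of t] sampling_index_upper[OF assms(1), of t] assms(2,3) by linarith+
  then show ?thesis using strict_mono_less[OF sm] by simp
qed

lemma measurable_sampling_index:
  fixes c :: "nat \<Rightarrow> 'a::topological_space"
  assumes "time_partition ts"
  shows "(\<lambda>t. c (sampling_index ts t)) \<in> borel_measurable lebesgue"
proof -
  have sm: "strict_mono ts" using assms by (simp add: time_partition_def)
  have "sampling_index ts \<in> measurable borel (count_space UNIV)"
  proof (rule measurable_count_space_eq2_countable[THEN iffD2, rule_format]; (intro conjI ballI)?)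
    fix i
    have "sampling_index ts -` {i} \<inter> space borel = {t. t < ts (Suc i)} \<inter> (if i = 0 then UNIV else {t. ts i \<le> t})"
    proof (intro set_eqI iffI)
      fix t assume "t \<in> sampling_index ts -` {i} \<inter> space borel"
      then have i: "sampling_index ts t = i" by simp
      have "ts i \<le> t" if ne: "i \<noteq> 0"
      proof -
        obtain j where j: "i = Suc j" using ne by (cases i) simp_all
        then have "\<not> t < ts (Suc j)"
          using i not_less_Least[of j "\<lambda>i. t < ts (Suc i)"] by (simp add: sampling_index_def)
        then show ?thesis using j by simp
      qed
      then show "t \<in> {t. t < ts (Suc i)} \<inter> (if i = 0 then UNIV else {t. ts i \<le> t})"
        using sampling_index_upper[OF assms, of t] i by simp
    next
      fix t assume t: "t \<in> {t. t < ts (Suc i)} \<inter> (if i = 0 then UNIV else {t. ts i \<le> t})"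
      have "sampling_index ts t = i"
      proof (cases "i = 0")
        case True
        then show ?thesis using t Least_le[of "\<lambda>i. t < ts (Suc i)" 0] by (simp add: sampling_index_def)
      next
        case False then show ?thesis using t sampling_index_eq[OF assms] by simp
      qed
      then show "t \<in> sampling_index ts -` {i} \<inter> space borel" by simp
    qed
    then show "sampling_index ts -` {i} \<inter> space borel \<in> sets borel" by simp
  qed auto
  then have "(\<lambda>t. c (sampling_index ts t)) \<in> borel_measurable borel"
    by (rule measurable_compose) simp
  then show ?thesis by (simp add: measurable_completion)
qed

text \<open>\<open>G\<close> is controlled only for inputs in \<open>U\<close> and may be irregular
  elsewhere. It is replaced by 0 off the closed set \<open>UNIV \<times> U\<close>, on which it is
  continuous.\<close>

lemma measurable_lipschitz_comp:
  fixes G :: "'p::euclidean_space \<Rightarrow> 'm::euclidean_space \<Rightarrow> 'q::euclidean_space"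
  assumes G: "\<And>p p' u u'. u \<in> U \<Longrightarrow> u' \<in> U \<Longrightarrow> norm (G p u - G p' u') \<le> C * (norm (p - p') + norm (u - u'))"
    and U: "closed U" and p: "p \<in> borel_measurable lebesgue" and u: "u \<in> borel_measurable lebesgue" and uU: "\<And>s. u s \<in> U"
  shows "(\<lambda>s. G (p s) (u s)) \<in> borel_measurable lebesgue"
proof -
  have "(2 * max C 0)-lipschitz_on (UNIV \<times> U) (\<lambda>q. G (fst q) (snd q))"
  proof (rule lipschitz_onI)
    fix q q' :: "'p \<times> 'm" assume q: "q \<in> UNIV \<times> U" "q' \<in> UNIV \<times> U"
    have "norm (G (fst q) (snd q) - G (fst q') (snd q')) \<le> C * (norm (fst q - fst q') + norm (snd q - snd q'))"
      using q by (intro G) auto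
    also have "\<dots> \<le> max C 0 * (norm (fst q - fst q') + norm (snd q - snd q'))"
      by (intro mult_right_mono) auto
    also have "\<dots> \<le> max C 0 * (norm (q - q') + norm (q - q'))"
      using norm_fst_le[of "fst q - fst q'" "snd q - snd q'"] norm_snd_le[of "snd q - snd q'" "fst q - fst q'"]
      by (intro mult_left_mono add_mono) (auto simp: minus_prod_def)
    finally show "dist (G (fst q) (snd q)) (G (fst q') (snd q')) \<le> 2 * max C 0 * dist q q'"
      by (simp add: dist_norm)
  qed simp
  then have "continuous_on (UNIV \<times> U) (\<lambda>q. G (fst q) (snd q))" by (rule lipschitz_on_continuous_on)
  moreover have "closed (UNIV \<times> U :: ('p \<times> 'm) set)" using U by (intro closed_Times) auto
  ultimately have "(\<lambda>q. if q \<in> UNIV \<times> U then G (fst q) (snd q) else 0) \<in> borel_measurable borel"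
    by (intro borel_measurable_continuous_on_if) auto
  moreover have "(\<lambda>s. (p s, u s)) \<in> borel_measurable lebesgue" using p u by (rule borel_measurable_Pair)
  ultimately have "(\<lambda>s. (\<lambda>q. if q \<in> UNIV \<times> U then G (fst q) (snd q) else 0) (p s, u s)) \<in> borel_measurable lebesgue"
    by (rule measurable_compose[rotated])
  then show ?thesis using uU by simp
qed

lemma measurable_sign_cases:
  fixes f g :: "real \<Rightarrow> 'a::topological_space"
  assumes "f \<in> borel_measurable lebesgue" "g \<in> borel_measurable lebesgue"
  shows "(\<lambda>t. if t < 0 then f t else g t) \<in> borel_measurable lebesgue"
proof (rule measurable_If[OF assms])
  have "{..<0::real} \<in> sets lebesgue" by simp
  then show "{t \<in> space lebesgue. t < (0::real)} \<in> sets lebesgue" by (simp add: lessThan_def)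
qed

lemma measurable_nonneg_part:
  fixes g :: "real \<Rightarrow> 'a::real_normed_vector"
  assumes "continuous_on {0..} g"
  shows "(\<lambda>t. if t < 0 then 0 else g t) \<in> borel_measurable lebesgue"
proof -
  have "(\<lambda>t. if t \<in> {0..} then g t else 0) \<in> borel_measurable borel"
    using assms by (intro borel_measurable_continuous_on_if) auto
  moreover have "(\<lambda>t. if t \<in> {0..} then g t else 0) = (\<lambda>t. if t < 0 then 0 else g t)" by auto
  ultimately show ?thesis by (simp add: measurable_completion)
qed

text \<open>The source of the contraction: integrating the weight \<open>exp (c * s)\<close> gains
  the factor \<open>1 / c\<close>. The constant \<open>K\<close> collects what does not depend on
  the integration variable and has no such gain.\<close>

lemma integral_diff_exp_bound:
  fixes g g' :: "real \<Rightarrow> 'a::euclidean_space"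
  assumes g: "g integrable_on {a..b}" "g' integrable_on {a..b}" and ab: "a \<le> b" and c: "0 < c" and A: "0 \<le> A" "0 \<le> K"
    and le: "\<And>s. s \<in> {a..b} \<Longrightarrow> norm (g s - g' s) \<le> K + A * exp (c * (s + d))"
  shows "norm (integral {a..b} g - integral {a..b} g') \<le> K * (b - a) + A / c * exp (c * (b + d))"
proof -
  have "((\<lambda>s. exp (c * (s + d))) has_integral (exp (c * (b + d)) / c - exp (c * (a + d)) / c)) {a..b}"
    using c ab by (intro fundamental_theorem_of_calculus)
      (auto intro!: derivative_eq_intros simp: has_real_derivative_iff_has_vector_derivative[symmetric])
  then have "((\<lambda>s. A * exp (c * (s + d))) has_integral (A * (exp (c * (b + d)) / c - exp (c * (a + d)) / c))) {a..b}"
    by (rule has_integral_mult_right)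
  moreover have "((\<lambda>s. K) has_integral (K * (b - a))) {a..b}"
    using has_integral_const_real[of K a b] ab by (simp add: mult.commute)
  ultimately have I: "((\<lambda>s. K + A * exp (c * (s + d))) has_integral (K * (b - a) + A * (exp (c * (b + d)) / c - exp (c * (a + d)) / c))) {a..b}"
    by (rule has_integral_add[rotated])
  have "integral {a..b} g - integral {a..b} g' = integral {a..b} (\<lambda>s. g s - g' s)"
    using g by (simp add: Henstock_Kurzweil_Integration.integral_diff)
  also have "norm \<dots> \<le> integral {a..b} (\<lambda>s. K + A * exp (c * (s + d)))"
    by (rule integral_norm_bound_integral[OF integrable_diff[OF g] has_integral_integrable[OF I] le])
  also have "\<dots> = K * (b - a) + A * (exp (c * (b + d)) / c - exp (c * (a + d)) / c)"
    using I by (rule integral_unique)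
  also have "\<dots> \<le> K * (b - a) + A / c * exp (c * (b + d))"
    using A c by (simp add: right_diff_distrib)
  finally show ?thesis .
qed

text \<open>Writing both integrals through \<open>{s-d..t}\<close> treats overlapping and disjoint
  windows alike.\<close>

lemma moving_integral_lipschitz:
  fixes g :: "real \<Rightarrow> 'a::euclidean_space"
  assumes int: "\<And>a b. g integrable_on {a..b}" and B: "\<And>t. norm (g t) \<le> B" and d: "0 \<le> d"
  shows "norm (integral {t-d..t} g - integral {s-d..s} g) \<le> 2 * B * \<bar>t - s\<bar>"
proof -
  have *: "norm (integral {t-d..t} g - integral {s-d..s} g) \<le> 2 * B * (t - s)" if "s \<le> t" for s t
  proof -
    have "integral {s-d..t-d} g + integral {t-d..t} g = integral {s-d..t} g"
      by (rule Henstock_Kurzweil_Integration.integral_combine) (use that d int in auto)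
    moreover have "integral {s-d..s} g + integral {s..t} g = integral {s-d..t} g"
      by (rule Henstock_Kurzweil_Integration.integral_combine) (use that d int in auto)
    ultimately have "integral {t-d..t} g - integral {s-d..s} g = integral {s..t} g - integral {s-d..t-d} g"
      by (simp add: algebra_simps)
    moreover have "norm (integral {s..t} g) \<le> B * (t - s)" "norm (integral {s-d..t-d} g) \<le> B * (t - s)"
      using norm_integral_le[OF int that B] norm_integral_le[of g "s-d" "t-d" B] int that B by auto
    ultimately show ?thesis using norm_triangle_ineq4[of "integral {s..t} g" "integral {s-d..t-d} g"] by simp
  qed
  show ?thesis using *[of s t] *[of t s] by (cases "s \<le> t") (auto simp: norm_minus_commute)
qed

text \<open>Bound for the \<open>j\<close>-th updated predictor: the saturation passes on the errors
  of the predecessor and of \<open>z\<close>, the latter at most \<open>k\<close>, with factor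
  \<open>L\<close>, and \<open>a\<close> bounds the predictor integral.\<close>

primrec gain_seq :: "real \<Rightarrow> real \<Rightarrow> real \<Rightarrow> nat \<Rightarrow> real" where
  "gain_seq L k a 0 = k"
| "gain_seq L k a (Suc j) = L * (gain_seq L k a j + k) + a"

lemma gain_seq_nonneg: "0 \<le> L \<Longrightarrow> 0 \<le> k \<Longrightarrow> 0 \<le> a \<Longrightarrow> 0 \<le> gain_seq L k a j"
  by (induction j) auto

text \<open>\<open>k\<close> bounds the updated plant and observer states,
  \<open>(L + 2) * k\<close> the updated \<open>z\<close> and \<open>w\<close> together, and the sum
  dominates every predictor bound at once.\<close>

definition step_gain :: "real \<Rightarrow> real \<Rightarrow> nat \<Rightarrow> real" where
  "step_gain L d N = (let k = 1 + L * (3 + L) in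
     (L + 2) * k + (\<Sum>j\<le>N. gain_seq L k (L * (2 + k) * d + L * (1 + L)) j))"

text \<open>The truncated closed loop in abstract form: \<open>F1\<close> is the plant field,
  \<open>F2\<close> the observer field, \<open>F3\<close> the drift of the output, \<open>H\<close>
  the output, \<open>F4\<close> the saturation and \<open>F5\<close> the predictor integrand. All
  are bounded and globally Lipschitz in the state; their inputs are restricted to
  \<open>U\<close>.\<close>

locale lip_system =
  fixes F1 :: "'a::euclidean_space \<Rightarrow> 'm::euclidean_space \<Rightarrow> 'a"
    and F2 :: "'a \<Rightarrow> 'b::euclidean_space \<Rightarrow> 'm \<Rightarrow> 'a"
    and F3 :: "'a \<Rightarrow> 'm \<Rightarrow> 'b" and H :: "'a \<Rightarrow> 'b"
    and F4 :: "'a \<Rightarrow> 'a \<Rightarrow> 'a" and F5 :: "'a \<Rightarrow> 'a \<Rightarrow> 'm \<Rightarrow> 'a"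
    and kf :: "'a \<Rightarrow> 'm" and U :: "'m set" and L B \<tau> r :: real and N :: nat and \<delta> :: real
    and ts :: "nat \<Rightarrow> real"
  assumes L: "0 \<le> L" and \<tau>: "0 \<le> \<tau>" and r: "0 \<le> r" and N: "0 < N" and \<delta>_eq: "\<delta> = (r + \<tau>) / real N"
    and U: "closed U" "0 \<in> U" and kfU: "\<And>x. kf x \<in> U" and kfL: "\<And>x x'. norm (kf x - kf x') \<le> L * norm (x - x')"
    and F1: "\<And>x x' u u'. u \<in> U \<Longrightarrow> u' \<in> U \<Longrightarrow> norm (F1 x u - F1 x' u') \<le> L * (norm (x - x') + norm (u - u'))"
    and F2: "\<And>z z' w w' u u'. u \<in> U \<Longrightarrow> u' \<in> U \<Longrightarrow>
        norm (F2 z w u - F2 z' w' u') \<le> L * (norm (z - z') + norm (w - w') + norm (u - u'))"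
    and F3: "\<And>x x' u u'. u \<in> U \<Longrightarrow> u' \<in> U \<Longrightarrow> norm (F3 x u - F3 x' u') \<le> L * (norm (x - x') + norm (u - u'))"
    and H: "\<And>x x'. norm (H x - H x') \<le> L * norm (x - x')"
    and F4: "\<And>x x' z z'. norm (F4 x z - F4 x' z') \<le> L * (norm (x - x') + norm (z - z'))"
    and F5: "\<And>x x' z z' u u'. u \<in> U \<Longrightarrow> u' \<in> U \<Longrightarrow>
        norm (F5 x z u - F5 x' z' u') \<le> L * (norm (x - x') + norm (z - z') + norm (u - u'))"
    and bds: "\<And>x u. u \<in> U \<Longrightarrow> norm (F1 x u) \<le> B" "\<And>z w u. u \<in> U \<Longrightarrow> norm (F2 z w u) \<le> B"
        "\<And>x u. u \<in> U \<Longrightarrow> norm (F3 x u) \<le> B" "\<And>x. norm (H x) \<le> B" "\<And>x z. norm (F4 x z) \<le> B"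
        "\<And>x z u. u \<in> U \<Longrightarrow> norm (F5 x z u) \<le> B"
    and ts: "time_partition ts"
begin

abbreviation "idx \<equiv> sampling_index ts"

lemma \<delta>_nonneg: "0 \<le> \<delta>" using \<tau> r by (simp add: \<delta>_eq)

lemma N_\<delta>: "real N * \<delta> = r + \<tau>" using N by (simp add: \<delta>_eq)

lemma j_\<delta>: "j \<le> N \<Longrightarrow> real j * \<delta> \<le> r + \<tau>"
  using mult_right_mono[of "real j" "real N" \<delta>] \<delta>_nonneg N_\<delta> by simp

lemma B_nonneg: "0 \<le> B" using bds(4)[of undefined] norm_ge_zero order_trans by blast

text \<open>The value 0, an element of \<open>U\<close>, before the recorded history makes the input
  a measurable \<open>U\<close>-valued function on the whole line.\<close>

definition uhist :: "(real \<Rightarrow> 'm) \<Rightarrow> (real \<Rightarrow> 'a) \<Rightarrow> real \<Rightarrow> 'm" where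
  "uhist u0 \<xi> t = (if t \<in> {-r-\<tau>..<0} then u0 t else if t < 0 then 0 else kf (\<xi> t))"

definition xhist :: "(real \<Rightarrow> 'a) \<Rightarrow> (real \<Rightarrow> 'a) \<Rightarrow> real \<Rightarrow> 'a" where
  "xhist x0 x t = (if t \<le> 0 then x0 t else x t)"

definition xihist :: "(real \<Rightarrow> 'a) \<Rightarrow> (real \<Rightarrow> 'a) \<Rightarrow> real \<Rightarrow> 'a" where
  "xihist \<xi>0 \<xi> t = (if t \<in> {-\<delta>..<0} then \<xi>0 t else if t < 0 then 0 else \<xi> t)"

definition Xs :: "(real \<Rightarrow> 'a) \<Rightarrow> (real \<Rightarrow> 'a) \<Rightarrow> (real \<Rightarrow> 'm) \<Rightarrow> real \<Rightarrow> 'a" where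
  "Xs x0 x u t = x0 0 + integral {0..t} (\<lambda>s. F1 (x s) (u (s - \<tau>)))"

definition Zs :: "'a \<Rightarrow> (real \<Rightarrow> 'a) \<Rightarrow> (real \<Rightarrow> 'b) \<Rightarrow> (real \<Rightarrow> 'm) \<Rightarrow> real \<Rightarrow> 'a" where
  "Zs z0 z w u t = z0 + integral {0..t} (\<lambda>s. F2 (z s) (w s) (u (s - r - \<tau>)))"

text \<open>No measurement is used at the first sampling time, where \<open>w\<close> starts from
  \<open>w0\<close>.\<close>

definition sample :: "(real \<Rightarrow> 'a) \<Rightarrow> 'b \<Rightarrow> (real \<Rightarrow> 'b) \<Rightarrow> (real \<Rightarrow> 'a) \<Rightarrow> nat \<Rightarrow> 'b" where
  "sample x0 w0 e x i = (if i = 0 then w0 else H (xhist x0 x (ts i - r)) + e (ts i))"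

definition Ws :: "(real \<Rightarrow> 'a) \<Rightarrow> 'b \<Rightarrow> (real \<Rightarrow> 'b) \<Rightarrow> (real \<Rightarrow> 'a) \<Rightarrow> (real \<Rightarrow> 'a) \<Rightarrow> (real \<Rightarrow> 'm) \<Rightarrow> real \<Rightarrow> 'b" where
  "Ws x0 w0 e x z u t = sample x0 w0 e x (idx t) + integral {ts (idx t)..t} (\<lambda>s. F3 (z s) (u (s - r - \<tau>)))"

definition Ps :: "nat \<Rightarrow> (real \<Rightarrow> 'a) \<Rightarrow> (real \<Rightarrow> 'a) \<Rightarrow> (real \<Rightarrow> 'm) \<Rightarrow> real \<Rightarrow> 'a" where
  "Ps j \<xi> z u t = integral {0..\<delta>} (\<lambda>s. F5 (\<xi> (t + s - \<delta>)) (z t) (u (t + (real j - 1) * \<delta> - \<tau> - r + s)))"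

lemma uhist_U: "(\<And>t. t \<in> {-r-\<tau>..<0} \<Longrightarrow> u0 t \<in> U) \<Longrightarrow> uhist u0 \<xi> t \<in> U"
  using kfU U(2) by (simp add: uhist_def)

lemma uhist_meas:
  assumes "u0 \<in> borel_measurable (lebesgue_on {-r-\<tau>..<0})" "\<xi> \<in> borel_measurable lebesgue"
  shows "uhist u0 \<xi> \<in> borel_measurable lebesgue"
proof -
  have "(\<lambda>t. if t \<in> {-r-\<tau>..<0} then u0 t else 0) \<in> borel_measurable lebesgue"
    using assms(1) by (rule borel_measurable_if_I) simp
  moreover have "L-lipschitz_on UNIV kf" using kfL L by (intro lipschitz_onI) (auto simp: dist_norm)
  then have "continuous_on UNIV kf" by (rule lipschitz_on_continuous_on)
  then have "(\<lambda>t. kf (\<xi> t)) \<in> borel_measurable lebesgue" using assms(2) by (rule borel_measurable_continuous_on)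
  ultimately have "(\<lambda>t. if t < 0 then (if t \<in> {-r-\<tau>..<0} then u0 t else 0) else kf (\<xi> t)) \<in> borel_measurable lebesgue"
    by (rule measurable_sign_cases)
  moreover have "uhist u0 \<xi> = (\<lambda>t. if t < 0 then (if t \<in> {-r-\<tau>..<0} then u0 t else 0) else kf (\<xi> t))"
    by (rule ext) (simp add: uhist_def)
  ultimately show ?thesis by simp
qed

lemma xihist_meas:
  assumes "\<xi>0 \<in> borel_measurable (lebesgue_on {-\<delta>..<0})" "\<xi> \<in> borel_measurable lebesgue"
  shows "xihist \<xi>0 \<xi> \<in> borel_measurable lebesgue"
proof -
  have "(\<lambda>t. if t \<in> {-\<delta>..<0} then \<xi>0 t else 0) \<in> borel_measurable lebesgue"
    using assms(1) by (rule borel_measurable_if_I) simp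
  then have "(\<lambda>t. if t < 0 then (if t \<in> {-\<delta>..<0} then \<xi>0 t else 0) else \<xi> t) \<in> borel_measurable lebesgue"
    using assms(2) by (rule measurable_sign_cases)
  moreover have "xihist \<xi>0 \<xi> = (\<lambda>t. if t < 0 then (if t \<in> {-\<delta>..<0} then \<xi>0 t else 0) else \<xi> t)"
    by (rule ext) (simp add: xihist_def)
  ultimately show ?thesis by simp
qed

lemma integrand_meas:
  fixes x :: "real \<Rightarrow> 'a" and u :: "real \<Rightarrow> 'm" and w :: "real \<Rightarrow> 'b"
  assumes "x \<in> borel_measurable lebesgue" "u \<in> borel_measurable lebesgue" "\<And>s. u s \<in> U"
  shows "(\<lambda>s. F1 (x s) (u (s - d))) \<in> borel_measurable lebesgue"
    "(\<lambda>s. F3 (x s) (u (s - d))) \<in> borel_measurable lebesgue"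
    "(\<lambda>s. F5 (x (s + d')) \<zeta> (u (s + d))) \<in> borel_measurable lebesgue"
    "w \<in> borel_measurable lebesgue \<Longrightarrow> (\<lambda>s. F2 (x s) (w s) (u (s - d))) \<in> borel_measurable lebesgue"
proof -
  have u': "(\<lambda>s. u (s - d)) \<in> borel_measurable lebesgue" "(\<lambda>s. u (s + d)) \<in> borel_measurable lebesgue"
    "(\<lambda>s. x (s + d')) \<in> borel_measurable lebesgue"
    using measurable_lebesgue_shift[OF assms(2), of "- d"] measurable_lebesgue_shift[OF assms(2), of d]
      measurable_lebesgue_shift[OF assms(1), of d'] by simp_all
  show "(\<lambda>s. F1 (x s) (u (s - d))) \<in> borel_measurable lebesgue"
    by (rule measurable_lipschitz_comp[OF F1 U(1) assms(1) u'(1) assms(3)])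
  show "(\<lambda>s. F3 (x s) (u (s - d))) \<in> borel_measurable lebesgue"
    by (rule measurable_lipschitz_comp[OF F3 U(1) assms(1) u'(1) assms(3)])
  show "(\<lambda>s. F5 (x (s + d')) \<zeta> (u (s + d))) \<in> borel_measurable lebesgue"
  proof (rule measurable_lipschitz_comp[OF _ U(1) u'(3) u'(2) assms(3)])
    show "norm (F5 p \<zeta> v - F5 p' \<zeta> v') \<le> L * (norm (p - p') + norm (v - v'))" if "v \<in> U" "v' \<in> U" for p p' v v'
      using F5[OF that, of p \<zeta> p' \<zeta>] by simp
  qed
  show "(\<lambda>s. F2 (x s) (w s) (u (s - d))) \<in> borel_measurable lebesgue" if w: "w \<in> borel_measurable lebesgue"
  proof -
    have "(\<lambda>s. (\<lambda>p. F2 (fst p) (snd p)) (x s, w s) (u (s - d))) \<in> borel_measurable lebesgue"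
    proof (rule measurable_lipschitz_comp[OF _ U(1) borel_measurable_Pair[OF assms(1) w] u'(1) assms(3)])
      fix p p' v v' assume v: "v \<in> U" "v' \<in> U"
      have "norm (F2 (fst p) (snd p) v - F2 (fst p') (snd p') v') \<le> L * (norm (fst p - fst p') + norm (snd p - snd p') + norm (v - v'))"
        by (rule F2[OF v])
      also have "\<dots> \<le> L * (norm (p - p') + norm (p - p') + 2 * norm (v - v'))"
        using L norm_fst_le[of "fst (p - p')" "snd (p - p')"] norm_snd_le[of "snd (p - p')" "fst (p - p')"]
        by (intro mult_left_mono add_mono) (auto simp: minus_prod_def)
      finally show "norm (F2 (fst p) (snd p) v - F2 (fst p') (snd p') v') \<le> (2 * L) * (norm (p - p') + norm (v - v'))"
        by (simp add: algebra_simps)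
    qed
    then show ?thesis by simp
  qed
qed

lemma integrand_integrable:
  fixes x :: "real \<Rightarrow> 'a" and u :: "real \<Rightarrow> 'm" and w :: "real \<Rightarrow> 'b"
  assumes "x \<in> borel_measurable lebesgue" "u \<in> borel_measurable lebesgue" "\<And>s. u s \<in> U"
  shows "(\<lambda>s. F1 (x s) (u (s - d))) integrable_on {a..b}"
    "(\<lambda>s. F3 (x s) (u (s - d))) integrable_on {a..b}"
    "(\<lambda>s. F5 (x (s + d')) \<zeta> (u (s + d))) integrable_on {a..b}"
    "w \<in> borel_measurable lebesgue \<Longrightarrow> (\<lambda>s. F2 (x s) (w s) (u (s - d))) integrable_on {a..b}"
  by (rule bounded_measurable_integrable[OF integrand_meas(1)[OF assms] bds(1)[OF assms(3)]]
      bounded_measurable_integrable[OF integrand_meas(2)[OF assms] bds(3)[OF assms(3)]]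
      bounded_measurable_integrable[OF integrand_meas(3)[OF assms] bds(6)[OF assms(3)]]
      bounded_measurable_integrable[OF integrand_meas(4)[OF assms] bds(2)[OF assms(3)]], assumption?)+

lemma Xs_lipschitz:
  assumes "x \<in> borel_measurable lebesgue" "u \<in> borel_measurable lebesgue" "\<And>s. u s \<in> U"
  shows "B-lipschitz_on {0..} (Xs x0 x u)"
proof -
  have "B-lipschitz_on {0..} (\<lambda>t. integral {0..t} (\<lambda>s. F1 (x s) (u (s - \<tau>))))"
    by (rule indefinite_integral_lipschitz[OF integrand_integrable(1)[OF assms] bds(1)[OF assms(3)]])
  from lipschitz_on_add[OF lipschitz_on_constant this, of "x0 0"] show ?thesis by (simp add: Xs_def)
qed

lemma Zs_lipschitz:
  assumes "z \<in> borel_measurable lebesgue" "u \<in> borel_measurable lebesgue" "\<And>s. u s \<in> U" "w \<in> borel_measurable lebesgue"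
  shows "B-lipschitz_on {0..} (Zs z0 z w u)"
proof -
  have "B-lipschitz_on {0..} (\<lambda>t. integral {0..t} (\<lambda>s. F2 (z s) (w s) (u (s - (r + \<tau>)))))"
    by (rule indefinite_integral_lipschitz[OF integrand_integrable(4)[OF assms] bds(2)[OF assms(3)]])
  from lipschitz_on_add[OF lipschitz_on_constant this, of "z0"] show ?thesis by (simp add: Zs_def diff_diff_eq)
qed

text \<open>Splitting the integral at the last sampling time writes \<open>Ws\<close> as a function
  of the sampling index plus a continuous primitive.\<close>

lemma Ws_meas:
  assumes "z \<in> borel_measurable lebesgue" "u \<in> borel_measurable lebesgue" "\<And>s. u s \<in> U"
  shows "(\<lambda>t. if t < 0 then 0 else Ws x0 w0 e x z u t) \<in> borel_measurable lebesgue"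
proof -
  define g where "g = (\<lambda>s. F3 (z s) (u (s - r - \<tau>)))"
  have int: "g integrable_on {a..b}" for a b
    using integrand_integrable(2)[OF assms, of "r + \<tau>"] by (simp add: g_def diff_diff_eq)
  have gB: "norm (g s) \<le> B" for s using bds(3)[OF assms(3)] by (simp add: g_def)
  have "continuous_on {0..} (\<lambda>t. integral {0..t} g)"
    by (rule lipschitz_on_continuous_on[OF indefinite_integral_lipschitz[OF int gB]])
  then have "(\<lambda>t. if t < 0 then 0 else integral {0..t} g) \<in> borel_measurable lebesgue" by (rule measurable_nonneg_part)
  moreover have "(\<lambda>t. (\<lambda>i. sample x0 w0 e x i - integral {0..ts i} g) (idx t)) \<in> borel_measurable lebesgue"
    by (rule measurable_sampling_index[OF ts])
  ultimately have "(\<lambda>t. if t < 0 then 0 else (\<lambda>i. sample x0 w0 e x i - integral {0..ts i} g) (idx t)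
       + (if t < 0 then 0 else integral {0..t} g)) \<in> borel_measurable lebesgue"
    by (intro measurable_sign_cases[OF _ borel_measurable_add]) simp_all
  moreover have "(\<lambda>t. if t < 0 then 0 else Ws x0 w0 e x z u t) = (\<lambda>t. if t < 0 then 0 else (\<lambda>i. sample x0 w0 e x i - integral {0..ts i} g) (idx t)
       + (if t < 0 then 0 else integral {0..t} g))"
  proof (rule ext)
    fix t
    have "integral {0..t} g - integral {0..ts (idx t)} g = integral {ts (idx t)..t} g" if "0 \<le> t"
      by (rule increment_indefinite_integral[OF int sampling_index_nonneg[OF ts] sampling_index_lower[OF ts that]])
    then show "(if t < 0 then 0 else Ws x0 w0 e x z u t) = (if t < 0 then 0 else (\<lambda>i. sample x0 w0 e x i - integral {0..ts i} g) (idx t)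
       + (if t < 0 then 0 else integral {0..t} g))"
      by (simp add: Ws_def g_def algebra_simps)
  qed
  ultimately show ?thesis by (simp only:)
qed

text \<open>In this form the window ends at \<open>t\<close> and the lag of the input is constant,
  which exposes the dependence on \<open>t\<close>.\<close>

lemma Ps_shift:
  "Ps j \<xi> z u t = integral {t-\<delta>..t} (\<lambda>v. F5 (\<xi> v) (z t) (u (v + (real j * \<delta> - \<tau> - r))))"
proof -
  have "Ps j \<xi> z u t = integral {0..\<delta>} (\<lambda>s. (\<lambda>v. F5 (\<xi> v) (z t) (u (v + (real j * \<delta> - \<tau> - r)))) (s + (t - \<delta>)))"
    unfolding Ps_def by (intro integral_cong) (simp add: algebra_simps)
  also have "\<dots> = integral {t-\<delta>..t} (\<lambda>v. F5 (\<xi> v) (z t) (u (v + (real j * \<delta> - \<tau> - r))))"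
    using integral_shift_real_ivl[where a = "t - \<delta>" and b = t and c = "t - \<delta>" and f = "\<lambda>v. F5 (\<xi> v) (z t) (u (v + (real j * \<delta> - \<tau> - r)))"] by simp
  finally show ?thesis .
qed

text \<open>Time enters twice, through \<open>z t\<close> in the integrand and through the moving
  window; freezing \<open>z\<close> at \<open>t0\<close> separates the two effects. Nothing beyond
  measurability is asked of the predictor history.\<close>

lemma Ps_continuous:
  assumes "\<xi> \<in> borel_measurable lebesgue" "u \<in> borel_measurable lebesgue" "\<And>s. u s \<in> U" and z: "continuous_on {0..} z"
  shows "continuous_on {0..} (Ps j \<xi> z u)"
  unfolding continuous_on_def
proof
  fix t0 :: real assume t0: "t0 \<in> {0..}"
  let ?g = "\<lambda>\<zeta> v. F5 (\<xi> v) \<zeta> (u (v + (real j * \<delta> - \<tau> - r)))"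
  have int: "?g \<zeta> integrable_on {a..b}" for \<zeta> a b
    using integrand_integrable(3)[OF assms(1-3), of 0 \<zeta>] by simp
  have bnd: "norm (Ps j \<xi> z u t - Ps j \<xi> z u t0) \<le> L * norm (z t - z t0) * \<delta> + 2 * B * \<bar>t - t0\<bar>" for t
  proof -
    have "norm (integral {t-\<delta>..t} (?g (z t)) - integral {t-\<delta>..t} (?g (z t0))) =
          norm (integral {t-\<delta>..t} (\<lambda>v. ?g (z t) v - ?g (z t0) v))"
      using int by (simp add: Henstock_Kurzweil_Integration.integral_diff)
    also have "\<dots> \<le> L * norm (z t - z t0) * (t - (t - \<delta>))"
    proof (rule norm_integral_le)
      show "norm (?g (z t) v - ?g (z t0) v) \<le> L * norm (z t - z t0)" for v
        using F5[OF assms(3)[of "v + (real j * \<delta> - \<tau> - r)"] assms(3)[of "v + (real j * \<delta> - \<tau> - r)"], of "\<xi> v" "z t" "\<xi> v" "z t0"] by simp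
    qed (use int \<delta>_nonneg in \<open>auto intro: integrable_diff\<close>)
    finally have 1: "norm (integral {t-\<delta>..t} (?g (z t)) - integral {t-\<delta>..t} (?g (z t0))) \<le> L * norm (z t - z t0) * \<delta>"
      by simp
    have 2: "norm (integral {t-\<delta>..t} (?g (z t0)) - integral {t0-\<delta>..t0} (?g (z t0))) \<le> 2 * B * \<bar>t - t0\<bar>"
      by (rule moving_integral_lipschitz[OF int _ \<delta>_nonneg]) (use bds(6)[OF assms(3)] in simp)
    show ?thesis unfolding Ps_shift using 1 2
      norm_triangle_ineq[of "integral {t-\<delta>..t} (?g (z t)) - integral {t-\<delta>..t} (?g (z t0))"
        "integral {t-\<delta>..t} (?g (z t0)) - integral {t0-\<delta>..t0} (?g (z t0))"] by simp
  qed
  have "((\<lambda>t. L * norm (z t - z t0) * \<delta> + 2 * B * \<bar>t - t0\<bar>) \<longlongrightarrow> L * norm (z t0 - z t0) * \<delta> + 2 * B * \<bar>t0 - t0\<bar>) (at t0 within {0..})"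
    using z t0 unfolding continuous_on_def by (intro tendsto_intros) auto
  then have lim: "((\<lambda>t. L * norm (z t - z t0) * \<delta> + 2 * B * \<bar>t - t0\<bar>) \<longlongrightarrow> 0) (at t0 within {0..})" by simp
  have "((\<lambda>t. Ps j \<xi> z u t - Ps j \<xi> z u t0) \<longlongrightarrow> 0) (at t0 within {0..})"
    by (rule Lim_null_comparison[OF always_eventually[OF allI[OF bnd]] lim])
  then show "(Ps j \<xi> z u \<longlongrightarrow> Ps j \<xi> z u t0) (at t0 within {0..})" by (rule LIM_zero_cancel)
qed

end

lemma norm_fst_diff_le: "norm (fst p - fst q) \<le> norm (p - q)"
  using norm_fst_le[of "fst p - fst q" "snd p - snd q"] by (simp add: minus_prod_def)

lemma norm_snd_diff_le: "norm (snd p - snd q) \<le> norm (p - q)"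
  using norm_snd_le[of "snd p - snd q" "fst p - fst q"] by (simp add: minus_prod_def)

context lip_system
begin

section \<open>The Gauss-Seidel step as a contraction\<close>

definition admissible :: "(nat \<Rightarrow> real \<Rightarrow> 'a) \<Rightarrow> (real \<Rightarrow> 'm) \<Rightarrow> bool" where
  "admissible \<xi>0 u0 \<longleftrightarrow> u0 \<in> borel_measurable (lebesgue_on {-r-\<tau>..<0}) \<and> (\<forall>v\<in>{-r-\<tau>..<0}. u0 v \<in> U) \<and>
     (\<forall>j\<in>{1..N}. \<xi>0 j \<in> borel_measurable (lebesgue_on {-\<delta>..<0}))"

definition meas_state :: "(real \<Rightarrow> 'a) \<Rightarrow> (real \<Rightarrow> 'a) \<Rightarrow> (real \<Rightarrow> 'b) \<Rightarrow> (nat \<Rightarrow> real \<Rightarrow> 'a) \<Rightarrow> bool" where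
  "meas_state x z w \<xi> \<longleftrightarrow> x \<in> borel_measurable lebesgue \<and> z \<in> borel_measurable lebesgue \<and>
     w \<in> borel_measurable lebesgue \<and> (\<forall>j\<in>{1..N}. \<xi> j \<in> borel_measurable lebesgue)"

definition close_state where
  "close_state c D T x z w \<xi> x' z' w' \<xi>' \<longleftrightarrow> (\<forall>t\<in>{0..T::real}.
     norm (x t - x' t :: 'a) \<le> D * exp (c * t) \<and> norm (z t - z' t :: 'a) \<le> D * exp (c * t) \<and>
     norm (w t - w' t :: 'b) \<le> D * exp (c * t) \<and>
     (\<forall>j\<in>{1..N}. norm (\<xi> j t - \<xi>' j t :: 'a) \<le> D * exp (c * t)))"

definition close_data where
  "close_data S T x0 z0 w0 \<xi>0 u0 e x0' z0' w0' \<xi>0' u0' e' \<longleftrightarrow>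
     (\<forall>v\<in>{-r..0}. norm (x0 v - x0' v :: 'a) \<le> S) \<and> norm (z0 - z0' :: 'a) \<le> S \<and> norm (w0 - w0' :: 'b) \<le> S \<and>
     (\<forall>j\<in>{1..N}. \<forall>v\<in>{-\<delta>..<0}. norm (\<xi>0 j v - \<xi>0' j v :: 'a) \<le> S) \<and>
     (\<forall>v\<in>{-r-\<tau>..<0}. norm (u0 v - u0' v :: 'm) \<le> S) \<and> (\<forall>v\<in>{0..T::real}. norm (e v - e' v :: 'b) \<le> S)"

text \<open>One step of the Picard iteration in Gauss-Seidel order: the new \<open>w\<close> samples the new \<open>x\<close>, and every
  new predictor state uses its new predecessor and the new \<open>z\<close>. Only time integrals contain old
  components, hence the map contracts in an exponentially weighted norm.\<close>
definition gs_step where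
  "gs_step T x0 z0 w0 \<xi>0 u0 e x z w \<xi> xn zn wn \<xi>n \<longleftrightarrow> (\<forall>t\<in>{0..T::real}.
     xn t = Xs x0 x (uhist u0 (\<xi> N)) t \<and> zn t = Zs z0 z w (uhist u0 (\<xi> N)) t \<and>
     wn t = Ws x0 w0 e xn z (uhist u0 (\<xi> N)) t \<and> \<xi>n 0 t = zn t \<and>
     (\<forall>j<N. \<xi>n (Suc j) t = F4 (\<xi>n j t) (zn t) + Ps (Suc j) (xihist (\<xi>0 (Suc j)) (\<xi> (Suc j))) zn (uhist u0 (\<xi> N)) t))"

text \<open>Every old component stands under a time integral and enters with \<open>D / c\<close>;
  differences of the data enter with \<open>S\<close>. The new components are estimated in their
  order of dependence: \<open>xn\<close>, \<open>zn\<close>, \<open>wn\<close>, then the predictors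
  by induction.\<close>

lemma gs_step_compare:
  assumes c: "1 \<le> c" and S: "0 \<le> S" and D: "0 \<le> D"
    and ad: "admissible \<xi>0 u0" "admissible \<xi>0' u0'"
    and dc: "close_data S T x0 z0 w0 \<xi>0 u0 e x0' z0' w0' \<xi>0' u0' e'"
    and me: "meas_state x z w \<xi>" "meas_state x' z' w' \<xi>'"
    and cl: "close_state c D T x z w \<xi> x' z' w' \<xi>'"
    and st: "gs_step T x0 z0 w0 \<xi>0 u0 e x z w \<xi> xn zn wn \<xi>n" "gs_step T x0' z0' w0' \<xi>0' u0' e' x' z' w' \<xi>' xn' zn' wn' \<xi>n'"
    and t: "t \<in> {0..T}"
  shows "norm (xn t - xn' t) \<le> step_gain L \<delta> N * (S + D / c) * exp (c * t)"
    "norm (zn t - zn' t) + norm (wn t - wn' t) \<le> step_gain L \<delta> N * (S + D / c) * exp (c * t)"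
    "j \<le> N \<Longrightarrow> norm (\<xi>n j t - \<xi>n' j t) \<le> step_gain L \<delta> N * (S + D / c) * exp (c * t)"
proof -
  define u where "u = uhist u0 (\<xi> N)"
  define u' where "u' = uhist u0' (\<xi>' N)"
  define k where "k = 1 + L * (3 + L)"
  define \<epsilon> where "\<epsilon> = S + D / c"
  have N1: "N \<in> {1..N}" using N by simp
  have um: "u \<in> borel_measurable lebesgue" "u' \<in> borel_measurable lebesgue"
    unfolding u_def u'_def using ad me N1 by (auto simp: admissible_def meas_state_def intro!: uhist_meas)
  have uU: "\<And>s. u s \<in> U" "\<And>s. u' s \<in> U"
    unfolding u_def u'_def using ad by (auto simp: admissible_def intro!: uhist_U)
  have xm: "x \<in> borel_measurable lebesgue" "z \<in> borel_measurable lebesgue" "w \<in> borel_measurable lebesgue"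
    "x' \<in> borel_measurable lebesgue" "z' \<in> borel_measurable lebesgue" "w' \<in> borel_measurable lebesgue"
    using me by (auto simp: meas_state_def)
  have c0: "0 < c" using c by simp
  have \<epsilon>: "S \<le> \<epsilon>" "D / c \<le> \<epsilon>" "S / c \<le> \<epsilon>" "0 \<le> \<epsilon>"
  proof -
    have "S / c \<le> S" using S c by (simp add: divide_le_eq mult_left_le_one_le mult.commute mult_le_cancel_left1)
    moreover have "0 \<le> D / c" using D c0 by simp
    ultimately show "S \<le> \<epsilon>" "D / c \<le> \<epsilon>" "S / c \<le> \<epsilon>" "0 \<le> \<epsilon>" using S by (auto simp: \<epsilon>_def)
  qed
  have k1: "1 \<le> k" using L by (simp add: k_def)
  have E1: "1 \<le> exp (c * s)" if "0 \<le> s" for s using that c0 by simp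
  have \<epsilon>E: "a \<le> \<epsilon> * exp (c * s)" if "0 \<le> s" "a \<le> \<epsilon>" for a s
    using mult_left_mono[OF E1[OF that(1)] \<epsilon>(4)] that(2) by simp
  \<comment> \<open>Negative times contribute the difference of the histories, and nothing before
    these begin; from time 0 on the feedback is Lipschitz in the old last predictor.\<close>
  have uc: "norm (u v - u' v) \<le> S + L * D * exp (c * v)" if "v \<le> T" for v
  proof -
    have nn: "0 \<le> L * D * exp (c * v)" using L D by simp
    consider "v \<in> {-r-\<tau>..<0}" | "v < 0" "v \<notin> {-r-\<tau>..<0}" | "0 \<le> v" by fastforce
    then show ?thesis
    proof cases
      case 1
      then have "norm (u0 v - u0' v) \<le> S" using dc by (simp add: close_data_def)
      then show ?thesis using 1 nn by (simp add: u_def u'_def uhist_def)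
    next
      case 2 then have "u v = 0" "u' v = 0" by (auto simp: u_def u'_def uhist_def)
      then show ?thesis using nn S by simp
    next
      case 3
      have "norm (\<xi> N v - \<xi>' N v) \<le> D * exp (c * v)"
        using cl 3 that N1 unfolding close_state_def by (metis atLeastAtMost_iff)
      then have "L * norm (\<xi> N v - \<xi>' N v) \<le> L * (D * exp (c * v))" using L by (rule mult_left_mono)
      then show ?thesis using 3 kfL[of "\<xi> N v" "\<xi>' N v"] S by (simp add: u_def u'_def uhist_def)
    qed
  qed
  \<comment> \<open>A delay can only decrease the exponential weight.\<close>
  have uc': "norm (u (s - d) - u' (s - d)) \<le> (S + L * D) * exp (c * s)" if "0 \<le> d" "0 \<le> s" "s \<le> T" for s d
  proof -
    have "norm (u (s - d) - u' (s - d)) \<le> S + L * D * exp (c * (s - d))" using that by (intro uc) simp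
    also have "\<dots> \<le> S * exp (c * s) + L * D * exp (c * s)"
      using mult_left_mono[OF E1[OF that(2)] S] that c0 L D by (intro add_mono mult_left_mono) auto
    finally show ?thesis by (simp add: algebra_simps)
  qed
  have X: "norm (xn t - xn' t) \<le> k * \<epsilon> * exp (c * t)" if t: "t \<in> {0..T}" for t
  proof -
    have t0: "0 \<le> t" "t \<le> T" using t by auto
    have "norm (integral {0..t} (\<lambda>s. F1 (x s) (u (s - \<tau>))) - integral {0..t} (\<lambda>s. F1 (x' s) (u' (s - \<tau>))))
       \<le> 0 * (t - 0) + L * (S + D + L * D) / c * exp (c * (t + 0))"
    proof (rule integral_diff_exp_bound[OF integrand_integrable(1)[OF xm(1) um(1) uU(1)] integrand_integrable(1)[OF xm(4) um(2) uU(2)] t0(1) c0])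
      fix s assume s: "s \<in> {0..t}"
      have "norm (F1 (x s) (u (s - \<tau>)) - F1 (x' s) (u' (s - \<tau>))) \<le> L * (norm (x s - x' s) + norm (u (s - \<tau>) - u' (s - \<tau>)))"
        by (rule F1[OF uU])
      also have "\<dots> \<le> L * (D * exp (c * s) + (S + L * D) * exp (c * s))"
        using cl s t0 \<tau> unfolding close_state_def by (intro mult_left_mono add_mono uc' L) auto
      finally show "norm (F1 (x s) (u (s - \<tau>)) - F1 (x' s) (u' (s - \<tau>))) \<le> 0 + L * (S + D + L * D) * exp (c * (s + 0))"
        by (simp add: algebra_simps)
    qed (use L D S in auto)
    also have "\<dots> = L * (S / c + D / c + L * (D / c)) * exp (c * t)" by (simp add: add_divide_distrib algebra_simps)
    also have "\<dots> \<le> L * (\<epsilon> + \<epsilon> + L * \<epsilon>) * exp (c * t)"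
      using \<epsilon> L by (intro mult_right_mono mult_left_mono add_mono) auto
    finally have I: "norm (integral {0..t} (\<lambda>s. F1 (x s) (u (s - \<tau>))) - integral {0..t} (\<lambda>s. F1 (x' s) (u' (s - \<tau>))))
       \<le> L * (2 + L) * (\<epsilon> * exp (c * t))" by (simp add: algebra_simps)
    have "norm (x0 0 - x0' 0) \<le> S" using dc r by (simp add: close_data_def)
    then have "norm (x0 0 - x0' 0) \<le> \<epsilon> * exp (c * t)" using \<epsilon>(1) by (intro \<epsilon>E t0) simp
    moreover have "xn t = x0 0 + integral {0..t} (\<lambda>s. F1 (x s) (u (s - \<tau>)))" "xn' t = x0' 0 + integral {0..t} (\<lambda>s. F1 (x' s) (u' (s - \<tau>)))"
      using st t by (auto simp: gs_step_def Xs_def u_def u'_def)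
    then have "norm (xn t - xn' t) \<le> norm (x0 0 - x0' 0) + norm (integral {0..t} (\<lambda>s. F1 (x s) (u (s - \<tau>))) - integral {0..t} (\<lambda>s. F1 (x' s) (u' (s - \<tau>))))"
      by (simp only: norm_diff_triangle_ineq)
    ultimately have "norm (xn t - xn' t) \<le> \<epsilon> * exp (c * t) + L * (2 + L) * (\<epsilon> * exp (c * t))" using I by linarith
    also have "\<dots> = (1 + L * (2 + L)) * (\<epsilon> * exp (c * t))" by (simp add: algebra_simps)
    also have "\<dots> \<le> k * (\<epsilon> * exp (c * t))"
      unfolding k_def using L \<epsilon>(4) by (intro mult_right_mono add_mono mult_left_mono) auto
    finally show ?thesis by (simp add: mult.assoc)
  qed
  have Z: "norm (zn t - zn' t) \<le> k * \<epsilon> * exp (c * t)" if t: "t \<in> {0..T}" for t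
  proof -
    have t0: "0 \<le> t" "t \<le> T" using t by auto
    let ?I = "integral {0..t} (\<lambda>s. F2 (z s) (w s) (u (s - (r + \<tau>))))"
    let ?I' = "integral {0..t} (\<lambda>s. F2 (z' s) (w' s) (u' (s - (r + \<tau>))))"
    have "norm (?I - ?I') \<le> 0 * (t - 0) + L * (S + 2 * D + L * D) / c * exp (c * (t + 0))"
    proof (rule integral_diff_exp_bound[OF integrand_integrable(4)[OF xm(2) um(1) uU(1) xm(3)] integrand_integrable(4)[OF xm(5) um(2) uU(2) xm(6)] t0(1) c0])
      fix s assume s: "s \<in> {0..t}"
      have "norm (F2 (z s) (w s) (u (s - (r + \<tau>))) - F2 (z' s) (w' s) (u' (s - (r + \<tau>)))) \<le> L * (norm (z s - z' s) + norm (w s - w' s) + norm (u (s - (r + \<tau>)) - u' (s - (r + \<tau>))))"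
        by (rule F2[OF uU])
      also have "\<dots> \<le> L * (D * exp (c * s) + D * exp (c * s) + (S + L * D) * exp (c * s))"
        using cl s t0 \<tau> r unfolding close_state_def by (intro mult_left_mono add_mono uc' L) auto
      finally show "norm (F2 (z s) (w s) (u (s - (r + \<tau>))) - F2 (z' s) (w' s) (u' (s - (r + \<tau>)))) \<le> 0 + L * (S + 2 * D + L * D) * exp (c * (s + 0))"
        by (simp add: algebra_simps)
    qed (use L D S in auto)
    also have "\<dots> = L * (S / c + 2 * (D / c) + L * (D / c)) * exp (c * t)" by (simp add: add_divide_distrib algebra_simps)
    also have "\<dots> \<le> L * (\<epsilon> + 2 * \<epsilon> + L * \<epsilon>) * exp (c * t)"
      using \<epsilon> L by (intro mult_right_mono mult_left_mono add_mono) auto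
    finally have I: "norm (?I - ?I') \<le> L * (3 + L) * (\<epsilon> * exp (c * t))" by (simp add: algebra_simps)
    have "norm (z0 - z0') \<le> S" using dc by (simp add: close_data_def)
    then have "norm (z0 - z0') \<le> \<epsilon> * exp (c * t)" using \<epsilon>(1) by (intro \<epsilon>E t0) simp
    moreover have "zn t = z0 + ?I" "zn' t = z0' + ?I'"
      using st t by (auto simp: gs_step_def Zs_def u_def u'_def diff_diff_eq)
    then have "norm (zn t - zn' t) \<le> norm (z0 - z0') + norm (?I - ?I')"
      by (simp only: norm_diff_triangle_ineq)
    ultimately have "norm (zn t - zn' t) \<le> \<epsilon> * exp (c * t) + L * (3 + L) * (\<epsilon> * exp (c * t))" using I by linarith
    then show ?thesis by (simp add: k_def algebra_simps)
  qed
  have Wn: "norm (wn t - wn' t) \<le> (L + 1) * k * \<epsilon> * exp (c * t)" if t: "t \<in> {0..T}" for t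
  proof -
    have t0: "0 \<le> t" "t \<le> T" using t by auto
    define i where "i = idx t"
    have i: "0 \<le> ts i" "ts i \<le> t" unfolding i_def using sampling_index_nonneg[OF ts] sampling_index_lower[OF ts t0(1)] by auto
    let ?I = "integral {ts i..t} (\<lambda>s. F3 (z s) (u (s - (r + \<tau>))))"
    let ?I' = "integral {ts i..t} (\<lambda>s. F3 (z' s) (u' (s - (r + \<tau>))))"
    have "norm (?I - ?I') \<le> 0 * (t - ts i) + L * (S + D + L * D) / c * exp (c * (t + 0))"
    proof (rule integral_diff_exp_bound[OF integrand_integrable(2)[OF xm(2) um(1) uU(1)] integrand_integrable(2)[OF xm(5) um(2) uU(2)] i(2) c0])
      fix s assume s: "s \<in> {ts i..t}"
      have "norm (F3 (z s) (u (s - (r + \<tau>))) - F3 (z' s) (u' (s - (r + \<tau>)))) \<le> L * (norm (z s - z' s) + norm (u (s - (r + \<tau>)) - u' (s - (r + \<tau>))))"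
        by (rule F3[OF uU])
      also have "\<dots> \<le> L * (D * exp (c * s) + (S + L * D) * exp (c * s))"
        using cl s t0 \<tau> r i unfolding close_state_def by (intro mult_left_mono add_mono uc' L) auto
      finally show "norm (F3 (z s) (u (s - (r + \<tau>))) - F3 (z' s) (u' (s - (r + \<tau>)))) \<le> 0 + L * (S + D + L * D) * exp (c * (s + 0))"
        by (simp add: algebra_simps)
    qed (use L D S in auto)
    also have "\<dots> = L * (S / c + D / c + L * (D / c)) * exp (c * t)" by (simp add: add_divide_distrib algebra_simps)
    also have "\<dots> \<le> L * (\<epsilon> + \<epsilon> + L * \<epsilon>) * exp (c * t)"
      using \<epsilon> L by (intro mult_right_mono mult_left_mono add_mono) auto
    finally have I: "norm (?I - ?I') \<le> L * (2 + L) * (\<epsilon> * exp (c * t))" by (simp add: algebra_simps)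
    let ?s = "sample x0 w0 e xn i" and ?s' = "sample x0' w0' e' xn' i"
    have Sle: "S \<le> \<epsilon> * exp (c * t)" using \<epsilon>(1) by (intro \<epsilon>E t0)
    \<comment> \<open>A sample has no time integral to discount it. It relies on the bound
      \<open>X\<close> for the new \<open>xn\<close> at an earlier time, or on the initial function
      if \<open>ts i \<le> r\<close>.\<close>
    have samp: "norm (?s - ?s') \<le> L * (k * (\<epsilon> * exp (c * t))) + \<epsilon> * exp (c * t)"
    proof (cases "i = 0")
      case True
      have "norm (w0 - w0') \<le> S" using dc by (simp add: close_data_def)
      moreover have "0 \<le> L * (k * (\<epsilon> * exp (c * t)))" using L k1 \<epsilon>(4) by simp
      ultimately show ?thesis using True Sle by (simp add: sample_def)
    next
      case False
      have "norm (xhist x0 xn (ts i - r) - xhist x0' xn' (ts i - r)) \<le> k * (\<epsilon> * exp (c * t))"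
      proof (cases "ts i - r \<le> 0")
        case True
        then have "norm (x0 (ts i - r) - x0' (ts i - r)) \<le> S" using dc i unfolding close_data_def by simp
        also have "S \<le> \<epsilon> * exp (c * t)" by (rule Sle)
        also have "\<dots> \<le> k * (\<epsilon> * exp (c * t))" using mult_right_mono[OF k1, of "\<epsilon> * exp (c * t)"] \<epsilon>(4) by simp
        finally show ?thesis using True by (simp add: xhist_def)
      next
        case False
        then have "norm (xn (ts i - r) - xn' (ts i - r)) \<le> k * \<epsilon> * exp (c * (ts i - r))" using i t0 r by (intro X) simp
        also have "\<dots> \<le> k * \<epsilon> * exp (c * t)" using i r k1 \<epsilon>(4) c0 by (intro mult_left_mono) auto
        finally show ?thesis using False by (simp add: xhist_def mult.assoc)
      qed
      then have "L * norm (xhist x0 xn (ts i - r) - xhist x0' xn' (ts i - r)) \<le> L * (k * (\<epsilon> * exp (c * t)))" using L by (rule mult_left_mono)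
      then have "norm (H (xhist x0 xn (ts i - r)) - H (xhist x0' xn' (ts i - r))) \<le> L * (k * (\<epsilon> * exp (c * t)))"
        by (rule order_trans[OF H])
      moreover have "norm (e (ts i) - e' (ts i)) \<le> S" using dc i t0 by (simp add: close_data_def)
      moreover have "norm (?s - ?s') \<le> norm (H (xhist x0 xn (ts i - r)) - H (xhist x0' xn' (ts i - r))) + norm (e (ts i) - e' (ts i))"
        using False norm_diff_triangle_ineq[of "H (xhist x0 xn (ts i - r))" "e (ts i)" "H (xhist x0' xn' (ts i - r))" "e' (ts i)"] by (simp add: sample_def)
      ultimately show ?thesis using Sle by linarith
    qed
    have "wn t = ?s + ?I" "wn' t = ?s' + ?I'"
      using st t by (auto simp: gs_step_def Ws_def u_def u'_def diff_diff_eq i_def)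
    then have "norm (wn t - wn' t) \<le> norm (?s - ?s') + norm (?I - ?I')"
      by (simp only: norm_diff_triangle_ineq)
    also have "\<dots> \<le> (L * k + 1 + L * (2 + L)) * (\<epsilon> * exp (c * t))" using samp I by (simp add: algebra_simps)
    also have "\<dots> \<le> ((L + 1) * k) * (\<epsilon> * exp (c * t))"
      using L \<epsilon>(4) by (intro mult_right_mono) (auto simp: k_def algebra_simps)
    finally show ?thesis by (simp add: mult.assoc)
  qed
  define aa where "aa = L * (2 + k) * \<delta> + L * (1 + L)"
  have Xi: "norm (\<xi>n j t - \<xi>n' j t) \<le> gain_seq L k aa j * \<epsilon> * exp (c * t)" if "j \<le> N" for j
    using that
  proof (induction j)
    case 0 then show ?case using Z[OF t] st t by (simp add: gs_step_def)
  next
    case (Suc j)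
    have t0: "0 \<le> t" "t \<le> T" using t by auto
    let ?d = "real j * \<delta> - \<tau> - r"
    let ?x = "xihist (\<xi>0 (Suc j)) (\<xi> (Suc j))" and ?x' = "xihist (\<xi>0' (Suc j)) (\<xi>' (Suc j))"
    have j1: "Suc j \<in> {1..N}" using Suc.prems by simp
    have ximeas: "?x \<in> borel_measurable lebesgue" "?x' \<in> borel_measurable lebesgue"
      using ad me j1 by (auto simp: admissible_def meas_state_def intro!: xihist_meas)
    have xc: "norm (?x v - ?x' v) \<le> S + D * exp (c * v)" if "v \<le> T" for v
    proof -
      have nn: "0 \<le> D * exp (c * v)" using D by simp
      consider "v \<in> {-\<delta>..<0}" | "v < 0" "v \<notin> {-\<delta>..<0}" | "0 \<le> v" by fastforce
      then show ?thesis
      proof cases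
        case 1
        then have "norm (\<xi>0 (Suc j) v - \<xi>0' (Suc j) v) \<le> S" using dc j1 unfolding close_data_def by blast
        then show ?thesis using 1 nn by (simp add: xihist_def)
      next
        case 2 then have "?x v = 0" "?x' v = 0" by (auto simp: xihist_def)
        then show ?thesis using nn S by simp
      next
        case 3
        have "norm (\<xi> (Suc j) v - \<xi>' (Suc j) v) \<le> D * exp (c * v)"
          using cl 3 that j1 unfolding close_state_def by (metis atLeastAtMost_iff)
        then show ?thesis using 3 S by (simp add: xihist_def)
      qed
    qed
    let ?I = "integral {0..\<delta>} (\<lambda>s. F5 (?x (s + (t - \<delta>))) (zn t) (u (s + (t + ?d))))"
    let ?I' = "integral {0..\<delta>} (\<lambda>s. F5 (?x' (s + (t - \<delta>))) (zn' t) (u' (s + (t + ?d))))"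
    \<comment> \<open>\<open>zn t\<close> and the histories do not vary with the weight under the
      integral, so they go into the constant part and get the factor \<open>\<delta>\<close>; the
      old predictor and the old input are discounted.\<close>
    have "norm (?I - ?I') \<le> L * (2 * S + k * \<epsilon> * exp (c * t)) * (\<delta> - 0) + L * (1 + L) * D / c * exp (c * (\<delta> + (t - \<delta>)))"
    proof (rule integral_diff_exp_bound[OF integrand_integrable(3)[OF ximeas(1) um(1) uU(1)] integrand_integrable(3)[OF ximeas(2) um(2) uU(2)] \<delta>_nonneg c0])
      fix s assume s: "s \<in> {0..\<delta>}"
      \<comment> \<open>Since \<open>real (Suc j) * \<delta> \<le> r + \<tau>\<close>, this
        predictor reads the input no later than time \<open>t\<close>, with a weight no larger than
        that of its own history.\<close>
      have dd: "?d \<le> - \<delta>" using j_\<delta>[of "Suc j"] Suc.prems by (simp add: algebra_simps)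
      have "norm (u (s + (t + ?d)) - u' (s + (t + ?d))) \<le> S + L * D * exp (c * (s + (t + ?d)))"
        using s t0 dd by (intro uc) auto
      also have "\<dots> \<le> S + L * D * exp (c * (s + (t - \<delta>)))" using dd L D c0 by (intro add_mono mult_left_mono) auto
      finally have uu: "norm (u (s + (t + ?d)) - u' (s + (t + ?d))) \<le> S + L * D * exp (c * (s + (t - \<delta>)))" .
      have "norm (F5 (?x (s + (t - \<delta>))) (zn t) (u (s + (t + ?d))) - F5 (?x' (s + (t - \<delta>))) (zn' t) (u' (s + (t + ?d))))
        \<le> L * (norm (?x (s + (t - \<delta>)) - ?x' (s + (t - \<delta>))) + norm (zn t - zn' t) + norm (u (s + (t + ?d)) - u' (s + (t + ?d))))"
        by (rule F5[OF uU])
      also have "\<dots> \<le> L * ((S + D * exp (c * (s + (t - \<delta>)))) + k * \<epsilon> * exp (c * t) + (S + L * D * exp (c * (s + (t - \<delta>)))))"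
        using s t0 by (intro mult_left_mono add_mono uu Z[OF t] xc L) auto
      finally show "norm (F5 (?x (s + (t - \<delta>))) (zn t) (u (s + (t + ?d))) - F5 (?x' (s + (t - \<delta>))) (zn' t) (u' (s + (t + ?d))))
        \<le> L * (2 * S + k * \<epsilon> * exp (c * t)) + L * (1 + L) * D * exp (c * (s + (t - \<delta>)))"
        by (simp add: algebra_simps)
    qed (use L D S k1 \<epsilon>(4) in auto)
    also have "\<dots> = L * (2 * S + k * \<epsilon> * exp (c * t)) * \<delta> + L * (1 + L) * (D / c) * exp (c * t)" by simp
    also have "\<dots> \<le> L * (2 * (\<epsilon> * exp (c * t)) + k * \<epsilon> * exp (c * t)) * \<delta> + L * (1 + L) * \<epsilon> * exp (c * t)"
      using L \<delta>_nonneg \<epsilon> \<epsilon>E[OF t0(1) \<epsilon>(1)] by (intro add_mono mult_right_mono mult_left_mono) auto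
    finally have I: "norm (?I - ?I') \<le> aa * (\<epsilon> * exp (c * t))" by (simp add: aa_def algebra_simps)
    have Pseq: "Ps (Suc j) ?x zn u t = ?I" "Ps (Suc j) ?x' zn' u' t = ?I'"
      unfolding Ps_def by (simp_all add: algebra_simps)
    have jN: "j < N" using Suc.prems by simp
    have e1: "\<xi>n (Suc j) t = F4 (\<xi>n j t) (zn t) + ?I" "\<xi>n' (Suc j) t = F4 (\<xi>n' j t) (zn' t) + ?I'"
      using st t jN unfolding gs_step_def u_def[symmetric] u'_def[symmetric] Pseq[symmetric] by auto
    have "norm (\<xi>n (Suc j) t - \<xi>n' (Suc j) t) \<le> norm (F4 (\<xi>n j t) (zn t) - F4 (\<xi>n' j t) (zn' t)) + norm (?I - ?I')"
      unfolding e1 by (rule norm_diff_triangle_ineq)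
    also have "norm (F4 (\<xi>n j t) (zn t) - F4 (\<xi>n' j t) (zn' t)) \<le> L * (norm (\<xi>n j t - \<xi>n' j t) + norm (zn t - zn' t))"
      by (rule F4)
    also have "\<dots> \<le> L * (gain_seq L k aa j * \<epsilon> * exp (c * t) + k * \<epsilon> * exp (c * t))"
      using Suc by (intro mult_left_mono add_mono Z[OF t] L) simp_all
    finally show ?case using I by (simp add: algebra_simps)
  qed
  have aa0: "0 \<le> aa" using L k1 \<delta>_nonneg by (simp add: aa_def)
  have g0: "0 \<le> gain_seq L k aa j" for j using L k1 aa0 by (intro gain_seq_nonneg) auto
  have sg: "step_gain L \<delta> N = (L + 2) * k + (\<Sum>j\<le>N. gain_seq L k aa j)"
    unfolding step_gain_def Let_def k_def aa_def by simp
  have sg1: "(L + 2) * k \<le> step_gain L \<delta> N" unfolding sg using g0 by (simp add: sum_nonneg)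
  have \<epsilon>E0: "0 \<le> \<epsilon> * exp (c * t)" using \<epsilon>(4) by simp
  have Lk: "k \<le> (L + 2) * k" using L k1 by (simp add: algebra_simps)
  show "norm (xn t - xn' t) \<le> step_gain L \<delta> N * (S + D / c) * exp (c * t)"
    using X[OF t] mult_right_mono[OF order_trans[OF Lk sg1] \<epsilon>E0] by (simp add: \<epsilon>_def mult.assoc)
  show "norm (zn t - zn' t) + norm (wn t - wn' t) \<le> step_gain L \<delta> N * (S + D / c) * exp (c * t)"
  proof -
    have "k * \<epsilon> * exp (c * t) + (L + 1) * k * \<epsilon> * exp (c * t) = (L + 2) * k * (\<epsilon> * exp (c * t))"
      by (simp add: algebra_simps)
    then have "norm (zn t - zn' t) + norm (wn t - wn' t) \<le> step_gain L \<delta> N * (\<epsilon> * exp (c * t))"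
      using Z[OF t] Wn[OF t] mult_right_mono[OF sg1 \<epsilon>E0] by linarith
    then show ?thesis by (simp add: \<epsilon>_def mult.assoc)
  qed
  show "norm (\<xi>n j t - \<xi>n' j t) \<le> step_gain L \<delta> N * (S + D / c) * exp (c * t)" if j: "j \<le> N"
  proof -
    have "gain_seq L k aa j \<le> (\<Sum>j\<le>N. gain_seq L k aa j)" using j g0 by (intro member_le_sum) auto
    moreover have "0 \<le> (L + 2) * k" using L k1 by simp
    ultimately have "gain_seq L k aa j \<le> step_gain L \<delta> N" unfolding sg by simp
    then show ?thesis using Xi[OF j] mult_right_mono[OF _ \<epsilon>E0, of "gain_seq L k aa j" "step_gain L \<delta> N"] by (simp add: \<epsilon>_def mult.assoc)
  qed
qed

lemma step_gain_ge_1: "1 \<le> step_gain L \<delta> N"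
proof -
  have "0 \<le> gain_seq L (1 + L * (3 + L)) (L * (2 + (1 + L * (3 + L))) * \<delta> + L * (1 + L)) j" for j
    using L \<delta>_nonneg by (intro gain_seq_nonneg) auto
  then have "0 \<le> (\<Sum>j\<le>N. gain_seq L (1 + L * (3 + L)) (L * (2 + (1 + L * (3 + L))) * \<delta> + L * (1 + L)) j)"
    by (intro sum_nonneg) simp
  moreover have "1 * 1 \<le> (L + 2) * (1 + L * (3 + L))" using L by (intro mult_mono) auto
  ultimately show ?thesis by (simp add: step_gain_def Let_def)
qed

text \<open>With this rate the old error enters a step as
  \<open>step_gain L \<delta> N * (D / rate) = D / 2\<close>.\<close>

definition rate :: real where "rate = 2 * step_gain L \<delta> N"

lemma rate_ge_1: "1 \<le> rate" using step_gain_ge_1 by (simp add: rate_def)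

text \<open>Zero solves the system for zero data, and a solution is its own update. Each comparison
  of the two halves the crude bound \<open>M\<close>; in the limit only the part proportional to
  \<open>S\<close> remains.\<close>

lemma linear_bound:
  assumes zero: "F1 0 0 = 0" "F2 0 0 0 = 0" "F3 0 0 = 0" "H 0 = 0" "F4 0 0 = 0" "F5 0 0 0 = 0" "kf 0 = 0"
    and S: "0 \<le> S" and ad: "admissible \<xi>0 u0" and me: "meas_state x z w \<xi>"
    and dc: "close_data S T x0 z0 w0 \<xi>0 u0 e (\<lambda>_. 0) 0 0 (\<lambda>_ _. 0) (\<lambda>_. 0) (\<lambda>_. 0)"
    and st: "gs_step T x0 z0 w0 \<xi>0 u0 e x z w \<xi> x z w \<xi>"
    and bd: "close_state rate M T x z w \<xi> (\<lambda>_. 0) (\<lambda>_. 0) (\<lambda>_. 0) (\<lambda>_ _. 0)" and M: "0 \<le> M"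
  shows "close_state rate (2 * step_gain L \<delta> N * S) T x z w \<xi> (\<lambda>_. 0) (\<lambda>_. 0) (\<lambda>_. 0) (\<lambda>_ _. 0)"
proof -
  let ?\<kappa> = "step_gain L \<delta> N"
  have kp: "0 < ?\<kappa>" using step_gain_ge_1 by simp
  have uz: "uhist (\<lambda>_. 0) (\<lambda>_. 0) = (\<lambda>_. 0)" and xiz: "xihist (\<lambda>_. 0) (\<lambda>_. 0) = (\<lambda>_. 0)"
    using zero by (auto simp: uhist_def xihist_def fun_eq_iff)
  have sample0: "sample (\<lambda>_. 0) 0 (\<lambda>_. 0) (\<lambda>_. 0) i = 0" for i
    using zero by (simp add: sample_def xhist_def)
  have st0: "gs_step T (\<lambda>_. 0) 0 0 (\<lambda>_ _. 0) (\<lambda>_. 0) (\<lambda>_. 0) (\<lambda>_. 0) (\<lambda>_. 0) (\<lambda>_. 0) (\<lambda>_ _. 0) (\<lambda>_. 0) (\<lambda>_. 0) (\<lambda>_. 0) (\<lambda>_ _. 0)"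
    unfolding gs_step_def uz xiz Xs_def Zs_def Ws_def Ps_def sample0 zero by simp
  have ad0: "admissible (\<lambda>_ _. 0) (\<lambda>_. 0)" using U(2) by (simp add: admissible_def)
  have me0: "meas_state (\<lambda>_. 0) (\<lambda>_. 0) (\<lambda>_. 0) (\<lambda>_ _. 0)" by (simp add: meas_state_def)
  have iter: "close_state rate (2 * ?\<kappa> * S + M / 2 ^ n) T x z w \<xi> (\<lambda>_. 0) (\<lambda>_. 0) (\<lambda>_. 0) (\<lambda>_ _. 0)" for n
  proof (induction n)
    case 0
    show ?case unfolding close_state_def
    proof
      fix t assume t: "t \<in> {0..T}"
      have "M * exp (rate * t) \<le> (2 * ?\<kappa> * S + M / 2 ^ 0) * exp (rate * t)" using kp S by (intro mult_right_mono) auto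
      then show "norm (x t - 0) \<le> (2 * ?\<kappa> * S + M / 2 ^ 0) * exp (rate * t) \<and> norm (z t - 0) \<le> (2 * ?\<kappa> * S + M / 2 ^ 0) * exp (rate * t) \<and>
        norm (w t - 0) \<le> (2 * ?\<kappa> * S + M / 2 ^ 0) * exp (rate * t) \<and> (\<forall>j\<in>{1..N}. norm (\<xi> j t - 0) \<le> (2 * ?\<kappa> * S + M / 2 ^ 0) * exp (rate * t))"
        using bd t unfolding close_state_def by (meson order_trans)
    qed
  next
    case (Suc n)
    let ?D = "2 * ?\<kappa> * S + M / 2 ^ n"
    have D: "0 \<le> ?D" using kp S M by simp
    have eq: "?\<kappa> * (S + ?D / rate) = 2 * ?\<kappa> * S + M / 2 ^ Suc n"
      using kp by (simp add: rate_def field_simps)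
    note cmp = gs_step_compare[OF rate_ge_1 S D ad ad0 dc me me0 Suc st st0, unfolded eq]
    show ?case unfolding close_state_def
    proof (intro ballI conjI)
      fix t assume t: "t \<in> {0..T}"
      show "norm (x t - 0) \<le> (2 * ?\<kappa> * S + M / 2 ^ Suc n) * exp (rate * t)" using cmp(1)[OF t] .
      show "norm (z t - 0) \<le> (2 * ?\<kappa> * S + M / 2 ^ Suc n) * exp (rate * t)" using cmp(2)[OF t] norm_ge_zero[of "w t - 0"] by linarith
      show "norm (w t - 0) \<le> (2 * ?\<kappa> * S + M / 2 ^ Suc n) * exp (rate * t)" using cmp(2)[OF t] norm_ge_zero[of "z t - 0"] by linarith
      show "norm (\<xi> j t - 0) \<le> (2 * ?\<kappa> * S + M / 2 ^ Suc n) * exp (rate * t)" if "j \<in> {1..N}" for j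
        using cmp(3)[OF t, of j] that by simp
    qed
  qed
  have lim: "y \<le> (2 * ?\<kappa> * S) * exp (rate * t)" if "\<And>n. y \<le> (2 * ?\<kappa> * S + M / 2 ^ n) * exp (rate * t)" for y t
  proof (rule LIMSEQ_le_const)
    have "(\<lambda>n. (2 * ?\<kappa> * S + M * (1 / 2) ^ n) * exp (rate * t)) \<longlonglongrightarrow> (2 * ?\<kappa> * S + M * 0) * exp (rate * t)"
      by (intro tendsto_intros LIMSEQ_power_zero) auto
    then show "(\<lambda>n. (2 * ?\<kappa> * S + M / 2 ^ n) * exp (rate * t)) \<longlonglongrightarrow> (2 * ?\<kappa> * S) * exp (rate * t)"
      by (simp add: power_divide)
  qed (use that in auto)
  show ?thesis unfolding close_state_def
  proof (intro ballI conjI)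
    fix t assume t: "t \<in> {0..T}"
    show "norm (x t - 0) \<le> (2 * ?\<kappa> * S) * exp (rate * t)" by (rule lim) (use iter t in \<open>simp add: close_state_def\<close>)
    show "norm (z t - 0) \<le> (2 * ?\<kappa> * S) * exp (rate * t)" by (rule lim) (use iter t in \<open>simp add: close_state_def\<close>)
    show "norm (w t - 0) \<le> (2 * ?\<kappa> * S) * exp (rate * t)" by (rule lim) (use iter t in \<open>simp add: close_state_def\<close>)
    show "norm (\<xi> j t - 0) \<le> (2 * ?\<kappa> * S) * exp (rate * t)" if "j \<in> {1..N}" for j
      by (rule lim) (use iter t that in \<open>simp add: close_state_def\<close>)
  qed
qed

section \<open>Existence of mild solutions\<close>

primrec pred_chain :: "(nat \<Rightarrow> real \<Rightarrow> 'a) \<Rightarrow> (real \<Rightarrow> 'a) \<Rightarrow> nat \<Rightarrow> real \<Rightarrow> 'a" where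
  "pred_chain J z 0 = z"
| "pred_chain J z (Suc j) = (\<lambda>t. F4 (pred_chain J z j t) (z t) + J (Suc j) t)"

lemma pred_chain_continuous:
  assumes "continuous_on {0..} z" "\<And>j. j < N \<Longrightarrow> continuous_on {0..} (J (Suc j))" "j \<le> N"
  shows "continuous_on {0..} (pred_chain J z j)"
  using assms(3)
proof (induction j)
  case (Suc j)
  then have cj: "continuous_on {0..} (pred_chain J z j)" by simp
  have "(2 * L)-lipschitz_on UNIV (\<lambda>p. F4 (fst p) (snd p))"
  proof (rule lipschitz_onI)
    fix p q :: "'a \<times> 'a"
    have "norm (F4 (fst p) (snd p) - F4 (fst q) (snd q)) \<le> L * (norm (fst p - fst q) + norm (snd p - snd q))" by (rule F4)
    also have "\<dots> \<le> L * (norm (p - q) + norm (p - q))"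
      using norm_fst_le[of "fst p - fst q" "snd p - snd q"] norm_snd_le[of "snd p - snd q" "fst p - fst q"] L
      by (intro mult_left_mono add_mono) (auto simp: minus_prod_def)
    finally show "dist (F4 (fst p) (snd p)) (F4 (fst q) (snd q)) \<le> 2 * L * dist p q" by (simp add: dist_norm)
  qed (use L in simp)
  then have "continuous_on UNIV (\<lambda>p. F4 (fst p) (snd p))" by (rule lipschitz_on_continuous_on)
  then have "continuous_on {0..} (\<lambda>t. (\<lambda>p. F4 (fst p) (snd p)) (pred_chain J z j t, z t))"
    by (rule continuous_on_compose2) (intro continuous_on_Pair cj assms(1), simp)
  then have "continuous_on {0..} (\<lambda>t. F4 (pred_chain J z j t) (z t))" by simp
  then show ?case using assms(2)[of j] Suc.prems by (auto intro: continuous_on_add)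
qed (use assms in simp)

text \<open>The state is packed into one family with values in a product: \<open>(z, w)\<close> at
  index 0, the predictors at \<open>1..N\<close>, \<open>x\<close> at \<open>N + 1\<close>, and 0 in
  the spare slots. The update of this family is then an instance of
  \<open>weighted_fixpoint\<close>.\<close>

theorem mild_solution_exists:
  assumes ad: "admissible \<xi>0 u0" and eb: "\<And>t. 0 \<le> t \<Longrightarrow> norm (e t) \<le> Be"
  shows "\<exists>x z w \<xi>. meas_state x z w \<xi> \<and> (\<forall>T. gs_step T x0 z0 w0 \<xi>0 u0 e x z w \<xi> x z w \<xi>) \<and>
    continuous_on {0..} x \<and> continuous_on {0..} z \<and> (\<forall>j\<le>N. continuous_on {0..} (\<xi> j))"
proof -
  define u where "u Y = uhist u0 (\<lambda>t. fst (Y N t :: 'a \<times> 'b))" for Y :: "nat \<Rightarrow> real \<Rightarrow> 'a \<times> 'b"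
  define xn where "xn Y = Xs x0 (\<lambda>t. fst (Y (Suc N) t)) (u Y)" for Y
  define zn where "zn Y = Zs z0 (\<lambda>t. fst (Y 0 t)) (\<lambda>t. snd (Y 0 t)) (u Y)" for Y
  define wn where "wn Y = Ws x0 w0 e (xn Y) (\<lambda>t. fst (Y 0 t)) (u Y)" for Y
  define J where "J Y j = Ps j (xihist (\<xi>0 j) (\<lambda>t. fst (Y j t))) (zn Y) (u Y)" for Y j
  define xin where "xin Y = pred_chain (J Y) (zn Y)" for Y
  define \<Phi> where "\<Phi> Y = (\<lambda>j t. if t < 0 then 0 else if j = 0 then (zn Y t, wn Y t)
     else if j \<le> N then (xin Y j t, 0) else if j = Suc N then (xn Y t, 0) else (0::'a \<times> 'b))" for Y
  define ms where "ms Y \<longleftrightarrow> (\<forall>j. Y j \<in> borel_measurable lebesgue)" for Y :: "nat \<Rightarrow> real \<Rightarrow> 'a \<times> 'b"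
  have mf: "(\<lambda>t. fst (Y j t)) \<in> borel_measurable lebesgue" and msn: "(\<lambda>t. snd (Y j t)) \<in> borel_measurable lebesgue" if "ms Y" for Y j
  proof -
    have "Y j \<in> borel_measurable lebesgue" using that by (simp add: ms_def)
    then show "(\<lambda>t. fst (Y j t)) \<in> borel_measurable lebesgue" "(\<lambda>t. snd (Y j t)) \<in> borel_measurable lebesgue"
      by (rule borel_measurable_continuous_on[OF continuous_on_fst[OF continuous_on_id]],
          rule borel_measurable_continuous_on[OF continuous_on_snd[OF continuous_on_id]])
  qed
  have mst: "meas_state (\<lambda>t. fst (Y (Suc N) t)) (\<lambda>t. fst (Y 0 t)) (\<lambda>t. snd (Y 0 t)) (\<lambda>j t. fst (Y j t))" if "ms Y" for Y
    using mf[OF that] msn[OF that] by (simp add: meas_state_def)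
  have um: "u Y \<in> borel_measurable lebesgue" if "ms Y" for Y
    unfolding u_def using ad mf[OF that] by (intro uhist_meas) (auto simp: admissible_def)
  have uU: "u Y s \<in> U" for Y s
    unfolding u_def using ad by (intro uhist_U) (auto simp: admissible_def)
  have xnc: "continuous_on {0..} (xn Y)" if "ms Y" for Y
    unfolding xn_def by (rule lipschitz_on_continuous_on[OF Xs_lipschitz[OF mf[OF that] um[OF that] uU]])
  have znc: "continuous_on {0..} (zn Y)" if "ms Y" for Y
    unfolding zn_def by (rule lipschitz_on_continuous_on[OF Zs_lipschitz[OF mf[OF that] um[OF that] uU msn[OF that]]])
  have Jc: "continuous_on {0..} (J Y (Suc j))" if "ms Y" "j < N" for Y j
    unfolding J_def
  proof (rule Ps_continuous[OF _ um[OF that(1)] uU znc[OF that(1)]])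
    show "xihist (\<xi>0 (Suc j)) (\<lambda>t. fst (Y (Suc j) t)) \<in> borel_measurable lebesgue"
      using ad that(2) by (intro xihist_meas mf that(1)) (auto simp: admissible_def)
  qed
  have xinc: "continuous_on {0..} (xin Y j)" if "ms Y" "j \<le> N" for Y j
    unfolding xin_def by (rule pred_chain_continuous) (use znc[OF that(1)] Jc[OF that(1)] that(2) in blast)+
  have step: "gs_step T x0 z0 w0 \<xi>0 u0 e (\<lambda>t. fst (Y (Suc N) t)) (\<lambda>t. fst (Y 0 t)) (\<lambda>t. snd (Y 0 t)) (\<lambda>j t. fst (Y j t))
     (xn Y) (zn Y) (wn Y) (xin Y)" for T Y
    unfolding gs_step_def xin_def J_def wn_def zn_def xn_def u_def by simp
  have pairm: "(\<lambda>t. if t < 0 then 0 else (f t, g t)) \<in> borel_measurable lebesgue"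
    if "(\<lambda>t. if t < 0 then 0 else f t :: 'a) \<in> borel_measurable lebesgue" "(\<lambda>t. if t < 0 then 0 else g t :: 'b) \<in> borel_measurable lebesgue"
    for f :: "real \<Rightarrow> 'a" and g :: "real \<Rightarrow> 'b"
  proof -
    have "(\<lambda>t. if t < 0 then 0 else (f t, g t)) = (\<lambda>t. (if t < 0 then 0 else f t, if t < 0 then 0 else g t))"
      by (auto simp: zero_prod_def)
    then show ?thesis using borel_measurable_Pair[OF that] by (simp only:)
  qed
  have z00: "(\<lambda>t::real. if t < 0 then 0 else 0 :: 'b) \<in> borel_measurable lebesgue" by simp
  have \<Phi>m: "\<Phi> Y j \<in> borel_measurable lebesgue" if "\<And>j. Y j \<in> borel_measurable lebesgue" for Y j
  proof -
    have Y: "ms Y" using that by (simp add: ms_def)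
    consider "j = 0" | "0 < j" "j \<le> N" | "j = Suc N" | "j > Suc N" by linarith
    then show ?thesis
    proof cases
      case 1
      have "(\<lambda>t. if t < 0 then 0 else (zn Y t, wn Y t)) \<in> borel_measurable lebesgue"
        unfolding wn_def by (rule pairm[OF measurable_nonneg_part[OF znc[OF Y]] Ws_meas[OF mf[OF Y] um[OF Y] uU]])
      moreover have "\<Phi> Y j = (\<lambda>t. if t < 0 then 0 else (zn Y t, wn Y t))" using 1 by (intro ext) (simp add: \<Phi>_def)
      ultimately show ?thesis by (simp only:)
    next
      case 2
      have "(\<lambda>t. if t < 0 then 0 else (xin Y j t, 0::'b)) \<in> borel_measurable lebesgue"
        by (rule pairm[OF measurable_nonneg_part[OF xinc[OF Y 2(2)]] z00])
      moreover have "\<Phi> Y j = (\<lambda>t. if t < 0 then 0 else (xin Y j t, 0))" using 2 by (intro ext) (simp add: \<Phi>_def)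
      ultimately show ?thesis by (simp only:)
    next
      case 3
      have "(\<lambda>t. if t < 0 then 0 else (xn Y t, 0::'b)) \<in> borel_measurable lebesgue"
        by (rule pairm[OF measurable_nonneg_part[OF xnc[OF Y]] z00])
      moreover have "\<Phi> Y j = (\<lambda>t. if t < 0 then 0 else (xn Y t, 0))" using 3 by (intro ext) (simp add: \<Phi>_def)
      ultimately show ?thesis by (simp only:)
    next
      case 4
      then have "\<Phi> Y j = (\<lambda>t. 0)" by (intro ext) (simp add: \<Phi>_def)
      then show ?thesis by simp
    qed
  qed
  have npair: "norm (a, 0::'b) = norm a" for a :: 'a by (simp add: norm_Pair)
  have contr: "norm (\<Phi> Y j t - \<Phi> Y' j t) \<le> D / 2 * exp (rate * t)"
    if Y: "\<And>j. Y j \<in> borel_measurable lebesgue" "\<And>j. Y' j \<in> borel_measurable lebesgue" and D: "0 \<le> D"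
      and cl: "\<And>j t. norm (Y j t - Y' j t) \<le> D * exp (rate * t)" for Y Y' D j t
  proof (cases "t < 0")
    case True then show ?thesis using D by (simp add: \<Phi>_def)
  next
    case False
    have ms: "ms Y" "ms Y'" using Y by (auto simp: ms_def)
    have f: "norm (fst (Y j t) - fst (Y' j t)) \<le> D * exp (rate * t)" for j t
      by (rule order_trans[OF norm_fst_diff_le cl])
    have sn: "norm (snd (Y j t) - snd (Y' j t)) \<le> D * exp (rate * t)" for j t
      by (rule order_trans[OF norm_snd_diff_le cl])
    have cs: "close_state rate D t (\<lambda>t. fst (Y (Suc N) t)) (\<lambda>t. fst (Y 0 t)) (\<lambda>t. snd (Y 0 t)) (\<lambda>j t. fst (Y j t))
       (\<lambda>t. fst (Y' (Suc N) t)) (\<lambda>t. fst (Y' 0 t)) (\<lambda>t. snd (Y' 0 t)) (\<lambda>j t. fst (Y' j t))"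
      using f sn by (simp add: close_state_def)
    \<comment> \<open>Both updates belong to the same data, hence \<open>S = 0\<close>.\<close>
    have cd: "close_data 0 t x0 z0 w0 \<xi>0 u0 e x0 z0 w0 \<xi>0 u0 e" by (simp add: close_data_def)
    have tt: "t \<in> {0..t}" using False by simp
    have eq: "step_gain L \<delta> N * (0 + D / rate) = D / 2" using step_gain_ge_1 by (simp add: rate_def)
    note cmp = gs_step_compare[OF rate_ge_1 order_refl D ad ad cd mst[OF ms(1)] mst[OF ms(2)] cs step step tt, unfolded eq]
    consider "j = 0" | "0 < j" "j \<le> N" | "j = Suc N" | "j > Suc N" by linarith
    then show ?thesis
    proof cases
      case 1
      have "norm (\<Phi> Y j t - \<Phi> Y' j t) \<le> norm (zn Y t - zn Y' t) + norm (wn Y t - wn Y' t)"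
        using 1 False norm_Pair_le[of "zn Y t - zn Y' t" "wn Y t - wn Y' t"] by (simp add: \<Phi>_def)
      then show ?thesis using cmp(2) by linarith
    next
      case 2 then show ?thesis using cmp(3)[OF 2(2)] False by (simp add: \<Phi>_def npair)
    next
      case 3 then show ?thesis using cmp(1) False by (simp add: \<Phi>_def npair)
    next
      case 4 then show ?thesis using D by (simp add: \<Phi>_def)
    qed
  qed
  \<comment> \<open>Size of the update of zero: the fields are bounded by \<open>B\<close>, and the
    linear growth of their integrals is absorbed by \<open>t \<le> exp (rate * t)\<close>.\<close>
  define D0 where "D0 = norm z0 + norm w0 + norm (x0 0) + \<bar>Be\<bar> + 3 * B + B * \<delta>"
  have start: "norm (\<Phi> (\<lambda>_ _. 0) j t) \<le> D0 * exp (rate * t)" for j t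
  proof (cases "t < 0")
    case True
    have "0 \<le> D0" using B_nonneg \<delta>_nonneg by (simp add: D0_def)
    then show ?thesis using True by (simp add: \<Phi>_def)
  next
    case False
    let ?Y = "\<lambda>_ _. 0 :: 'a \<times> 'b"
    have Y: "ms ?Y" by (simp add: ms_def)
    have t0: "0 \<le> t" using False by simp
    have e1: "1 \<le> exp (rate * t)" "t \<le> exp (rate * t)"
    proof -
      have "t \<le> rate * t" using rate_ge_1 t0 by (simp add: mult_le_cancel_right1)
      then show "1 \<le> exp (rate * t)" "t \<le> exp (rate * t)" using exp_ge_add_one_self[of "rate * t"] t0 by linarith+
    qed
    have le: "a + B * s \<le> D0 * exp (rate * t)" if "a + B \<le> D0" "s \<le> t" "0 \<le> a" for a s
    proof -
      have "a + B * s \<le> a * exp (rate * t) + B * exp (rate * t)"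
        using e1 that B_nonneg mult_left_mono[OF e1(1) that(3)] by (intro add_mono mult_left_mono) auto
      also have "\<dots> \<le> D0 * exp (rate * t)" using that by (simp add: distrib_right[symmetric])
      finally show ?thesis .
    qed
    have xb: "norm (xn ?Y t) \<le> norm (x0 0) + B * t"
    proof -
      have "norm (integral {0..t} (\<lambda>s. F1 (fst (?Y (Suc N) s)) (u ?Y (s - \<tau>)))) \<le> B * (t - 0)"
        by (rule norm_integral_le[OF integrand_integrable(1)[OF mf[OF Y] um[OF Y] uU] t0 bds(1)[OF uU]])
      then show ?thesis unfolding xn_def Xs_def by (intro norm_triangle_le) simp
    qed
    have zb: "norm (zn ?Y t) \<le> norm z0 + B * t"
    proof -
      have "norm (integral {0..t} (\<lambda>s. F2 (fst (?Y 0 s)) (snd (?Y 0 s)) (u ?Y (s - (r + \<tau>))))) \<le> B * (t - 0)"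
        by (rule norm_integral_le[OF integrand_integrable(4)[OF mf[OF Y] um[OF Y] uU msn[OF Y]] t0 bds(2)[OF uU]])
      then show ?thesis unfolding zn_def Zs_def diff_diff_eq by (intro norm_triangle_le) simp
    qed
    have wb: "norm (wn ?Y t) \<le> norm w0 + B + \<bar>Be\<bar> + B * t"
    proof -
      have i: "0 \<le> ts (idx t)" "ts (idx t) \<le> t" using sampling_index_nonneg[OF ts] sampling_index_lower[OF ts t0] by auto
      have "norm (integral {ts (idx t)..t} (\<lambda>s. F3 (fst (?Y 0 s)) (u ?Y (s - (r + \<tau>))))) \<le> B * (t - ts (idx t))"
        by (rule norm_integral_le[OF integrand_integrable(2)[OF mf[OF Y] um[OF Y] uU] i(2) bds(3)[OF uU]])
      also have "\<dots> \<le> B * t" using i(1) B_nonneg by (intro mult_left_mono) auto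
      finally have 1: "norm (integral {ts (idx t)..t} (\<lambda>s. F3 (fst (?Y 0 s)) (u ?Y (s - (r + \<tau>))))) \<le> B * t" .
      have "norm (sample x0 w0 e (xn ?Y) (idx t)) \<le> norm w0 + B + \<bar>Be\<bar>"
      proof (cases "idx t = 0")
        case True then show ?thesis using B_nonneg by (simp add: sample_def)
      next
        case False
        have "norm (H (xhist x0 (xn ?Y) (ts (idx t) - r)) + e (ts (idx t))) \<le> B + \<bar>Be\<bar>"
          using bds(4)[of "xhist x0 (xn ?Y) (ts (idx t) - r)"] eb[OF i(1)] by (intro norm_triangle_le) linarith
        then have "norm (H (xhist x0 (xn ?Y) (ts (idx t) - r)) + e (ts (idx t))) \<le> norm w0 + B + \<bar>Be\<bar>"
          using norm_ge_zero[of w0] by linarith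
        then show ?thesis using False by (simp add: sample_def)
      qed
      then show ?thesis unfolding wn_def Ws_def diff_diff_eq using 1 by (intro norm_triangle_le) linarith
    qed
    have xib: "norm (xin ?Y j t) \<le> (B + B * \<delta>) + B * 0" if j: "0 < j" "j \<le> N" for j
    proof -
      obtain i where i: "j = Suc i" using j by (cases j) auto
      have "norm (J ?Y j t) \<le> B * (\<delta> - 0)"
      proof -
        let ?x = "xihist (\<xi>0 j) (\<lambda>t. fst (?Y j t))"
        have xm: "?x \<in> borel_measurable lebesgue"
          using ad j by (intro xihist_meas mf Y) (auto simp: admissible_def)
        have "norm (integral {t-\<delta>..t} (\<lambda>v. F5 (?x (v + 0)) (zn ?Y t) (u ?Y (v + (real j * \<delta> - \<tau> - r))))) \<le> B * (t - (t - \<delta>))"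
          by (rule norm_integral_le[OF integrand_integrable(3)[OF xm um[OF Y] uU] _ bds(6)[OF uU]]) (use \<delta>_nonneg in simp)
        then show ?thesis unfolding J_def Ps_shift by simp
      qed
      then have "norm (F4 (xin ?Y i t) (zn ?Y t) + J ?Y j t) \<le> B + B * \<delta>"
        using bds(5)[of "xin ?Y i t" "zn ?Y t"] by (intro norm_triangle_le) simp
      then show ?thesis using i by (simp add: xin_def)
    qed
    have nn: "0 \<le> norm z0" "0 \<le> norm w0" "0 \<le> norm (x0 0)" "0 \<le> \<bar>Be\<bar>" "0 \<le> B * \<delta>"
      using B_nonneg \<delta>_nonneg by auto
    consider "j = 0" | "0 < j" "j \<le> N" | "j = Suc N" | "j > Suc N" by linarith
    then show ?thesis
    proof cases
      case 1
      have "norm (\<Phi> ?Y j t) \<le> norm (zn ?Y t) + norm (wn ?Y t)"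
        using 1 False norm_Pair_le[of "zn ?Y t" "wn ?Y t"] by (simp add: \<Phi>_def)
      also have "\<dots> \<le> (norm z0 + norm w0 + B + \<bar>Be\<bar>) + 2 * B * t" using zb wb by simp
      also have "\<dots> \<le> (norm z0 + norm w0 + B + \<bar>Be\<bar>) * exp (rate * t) + 2 * B * exp (rate * t)"
        using e1 B_nonneg nn mult_left_mono[OF e1(1), of "norm z0 + norm w0 + B + \<bar>Be\<bar>"]
        by (intro add_mono mult_left_mono) auto
      also have "\<dots> \<le> D0 * exp (rate * t)"
        unfolding D0_def using nn by (simp add: distrib_right[symmetric])
      finally show ?thesis .
    next
      case 2
      have "norm (\<Phi> ?Y j t) \<le> (B + B * \<delta>) + B * 0" using 2 False xib[OF 2] by (simp add: \<Phi>_def npair)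
      also have "\<dots> \<le> D0 * exp (rate * t)" by (rule le) (use nn B_nonneg t0 in \<open>auto simp: D0_def\<close>)
      finally show ?thesis .
    next
      case 3
      have "norm (\<Phi> ?Y j t) \<le> norm (x0 0) + B * t" using 3 False xb by (simp add: \<Phi>_def npair)
      also have "\<dots> \<le> D0 * exp (rate * t)" by (rule le) (use nn B_nonneg t0 in \<open>auto simp: D0_def\<close>)
      finally show ?thesis .
    next
      case 4
      have "0 \<le> D0" using nn B_nonneg by (simp add: D0_def)
      then show ?thesis using 4 by (simp add: \<Phi>_def)
    qed
  qed
  have D0: "0 \<le> D0" using B_nonneg \<delta>_nonneg by (simp add: D0_def)
  obtain Y where Ym: "\<And>j. Y j \<in> borel_measurable lebesgue" and fp: "\<Phi> Y = Y"
    using weighted_fixpoint[of \<Phi> rate D0, OF \<Phi>m contr start D0] by blast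
  have msY: "ms Y" using Ym by (simp add: ms_def)
  define x where "x = (\<lambda>t. fst (Y (Suc N) t))"
  define z where "z = (\<lambda>t. fst (Y 0 t))"
  define w where "w = (\<lambda>t. snd (Y 0 t))"
  define \<xi> where "\<xi> = (\<lambda>j t. fst (Y j t))"
  have Yeq: "Y j t = \<Phi> Y j t" for j t using fp by simp
  have xe: "x t = xn Y t" and ze: "z t = zn Y t" and we: "w t = wn Y t" if "0 \<le> t" for t
    using that Yeq[of "Suc N" t] Yeq[of 0 t] by (auto simp: x_def z_def w_def \<Phi>_def)
  have xie: "\<xi> j t = xin Y j t" if "0 \<le> t" "j \<le> N" for j t
    using that Yeq[of j t] by (cases "j = 0") (auto simp: \<xi>_def \<Phi>_def xin_def)
  have st: "gs_step T x0 z0 w0 \<xi>0 u0 e x z w \<xi> x z w \<xi>" for T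
    unfolding gs_step_def
  proof (intro ballI conjI allI impI)
    fix t assume t: "t \<in> {0..T}"
    then have t0: "0 \<le> t" by simp
    note s = step[of T Y, folded x_def z_def w_def \<xi>_def, unfolded gs_step_def, rule_format, OF t]
    show "x t = Xs x0 x (uhist u0 (\<xi> N)) t" using s xe[OF t0] by simp
    show "z t = Zs z0 z w (uhist u0 (\<xi> N)) t" using s ze[OF t0] by simp
    \<comment> \<open>\<open>wn Y\<close> samples the updated \<open>xn Y\<close>. At the fixed
      point this agrees with \<open>x\<close> at positive times, and \<open>xhist\<close> reads
      \<open>x0\<close> at the others.\<close>
    have "xhist x0 (xn Y) v = xhist x0 x v" for v using xe[of v] by (simp add: xhist_def)
    then have "sample x0 w0 e (xn Y) = sample x0 w0 e x" by (simp add: sample_def fun_eq_iff)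
    then have "Ws x0 w0 e (xn Y) z (uhist u0 (\<xi> N)) t = Ws x0 w0 e x z (uhist u0 (\<xi> N)) t" by (simp add: Ws_def)
    then show "w t = Ws x0 w0 e x z (uhist u0 (\<xi> N)) t" using s we[OF t0] by simp
    show "\<xi> 0 t = z t" by (simp add: \<xi>_def z_def)
    show "\<xi> (Suc j) t = F4 (\<xi> j t) (z t) + Ps (Suc j) (xihist (\<xi>0 (Suc j)) (\<xi> (Suc j))) z (uhist u0 (\<xi> N)) t" if "j < N" for j
    proof -
      have "Ps (Suc j) (xihist (\<xi>0 (Suc j)) (\<xi> (Suc j))) (zn Y) (uhist u0 (\<xi> N)) t = Ps (Suc j) (xihist (\<xi>0 (Suc j)) (\<xi> (Suc j))) z (uhist u0 (\<xi> N)) t"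
        using ze[OF t0] by (simp add: Ps_def)
      then show ?thesis using s that xie[OF t0, of j] xie[OF t0, of "Suc j"] ze[OF t0] by simp
    qed
  qed
  have "meas_state x z w \<xi>" using mst[OF msY] by (simp add: x_def z_def w_def \<xi>_def)
  moreover have "continuous_on {0..} x" using xnc[OF msY] by (rule continuous_on_eq) (simp add: xe)
  moreover have "continuous_on {0..} z" using znc[OF msY] by (rule continuous_on_eq) (simp add: ze)
  moreover have "continuous_on {0..} (\<xi> j)" if "j \<le> N" for j
    using xinc[OF msY that] by (rule continuous_on_eq) (simp add: xie that)
  ultimately show ?thesis using st by blast
qed

end

section \<open>Lyapunov levels and the observer correction\<close>

locale closed_loop_setup =
  fixes U :: "(real^'m) set" and \<tau> r :: real
    and f :: "real^'n \<Rightarrow> real^'m \<Rightarrow> real^'n" and h :: "real^'n \<Rightarrow> real^'k"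
    and V W P :: "real^'n \<Rightarrow> real" and R \<mu> K1 :: real and kf :: "real^'n \<Rightarrow> real^'m"
    and Q :: "real^'n^'n" and L :: "real^'k^'n" and \<omega> a b c :: real
    and p q :: "real \<Rightarrow> real" and K :: real and \<psi> :: "real^'n \<Rightarrow> real"
    and N :: nat and \<delta> :: real and \<rho> :: "real \<Rightarrow> real"
    and S1 S2 S3 S4 :: "(real^'n) set"
    and M1q M1f G1 G2 Pt K2 Ts \<sigma> :: real
  assumes U: "U \<noteq> {}" "compact U" "0 \<in> U"
    and delays: "\<tau> \<ge> 0" "r \<ge> 0"
    and f: "smooth (\<lambda>(x, u). f x u)" "f 0 0 = 0"
    and h: "smooth h" "h 0 = 0"
    and V: "Ck 2 V" "\<forall>x. V x \<ge> 0" "radially_unbounded V"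
    and W: "Ck 1 W" "\<forall>x. W x \<ge> 0" "positive_definite_fun W"
    and R: "R > 0" "\<forall>x. \<forall>u\<in>U. V x \<ge> R \<longrightarrow> grad V x \<bullet> f x u \<le> - W x"
    and nbhd: "0 \<in> interior {x. V x \<le> R}"
    and P: "Ck 2 P" "\<forall>x. P x \<ge> 0" "positive_definite_fun P"
    and consts2: "\<mu> > 0" "K1 > 0"
    and PK1: "\<forall>x. V x \<le> R \<longrightarrow> K1 * (norm x)\<^sup>2 \<le> P x"
    and kf: "\<exists>M. M-lipschitz_on UNIV kf" "\<forall>x. kf x \<in> U" "kf 0 = 0"
    and Pdecay: "\<forall>x. V x \<le> R \<longrightarrow> grad P x \<bullet> f x (kf x) \<le> - 2 * \<mu> * (norm x)\<^sup>2"
    and Q: "transpose Q = Q" "\<forall>x. x \<noteq> 0 \<longrightarrow> x \<bullet> (Q *v x) > 0"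
    and consts3: "\<omega> > 0" "b > R"
    and observer: "\<forall>u\<in>U. \<forall>z x. V z \<le> b \<and> V x \<le> R \<longrightarrow>
        (z - x) \<bullet> (Q *v (f z u + L *v (h z - h x) - f x u)) \<le> - \<omega> * (norm (z - x))\<^sup>2"
    and consts4: "0 < c" "c < 1" "R \<le> a" "a < b"
    and correction: "\<forall>u\<in>U. \<forall>z x.
        a < V z \<and> V z \<le> b \<and> grad V z \<bullet> (Q *v (z - x)) < 0 \<and> V x \<le> R \<longrightarrow>
        grad V z \<bullet> (f z u + L *v (h z - h x))
          \<le> - W z + (1 - c) * (norm (grad V z))\<^sup>2 *
              (((z - x) \<bullet> (Q *v (f z u + L *v (h z - h x) - f x u)))
                / (grad V z \<bullet> (Q *v (z - x))))"
    and p: "locally_lipschitz_on {0..} p" "\<forall>s\<ge>0. 0 \<le> p s \<and> p s \<le> 1"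
           "\<forall>s\<ge>b. p s = 1" "\<forall>s. 0 \<le> s \<and> s \<le> a \<longrightarrow> p s = 0"
    and q: "Ck 1 q" "\<forall>s. q s \<ge> 0" "\<forall>s\<le>1. q s = 1" "K \<ge> 1" "\<forall>s\<ge>1. s * q s \<le> K"
    and \<psi>: "smooth \<psi>" "\<forall>z. \<psi> z \<ge> 1" "\<forall>x z. V x \<le> max (V z) b \<longrightarrow> norm x \<le> \<psi> z"
    and N: "N > 0"
    and \<delta>_def: "\<delta> = (r + \<tau>) / real N"
    and \<rho>_def: "\<rho> = (\<lambda>s. Sup {norm (f z u) | z u. u \<in> U \<and> norm z \<le> s})"
    and S1_def: "S1 = {x. V x \<le> R}"
    and S2_def: "S2 = {x. V x \<le> b}"
    and S3_def: "S3 = {x. \<exists>z\<in>S2. norm x \<le> K * \<psi> z + \<delta> * \<rho> (K * \<psi> z)}"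
    and S4_def: "S4 = {x. \<exists>z\<in>S2. norm x \<le> K * \<psi> z}"
    and M1q_def: "M1q = Sup {norm (q (norm \<xi> / \<psi> z) *\<^sub>R \<xi> - q (norm x / \<psi> z) *\<^sub>R x) / norm (x - \<xi>) | x \<xi> z.
                     x \<in> S1 \<and> \<xi> \<in> S3 \<and> z \<in> S2 \<and> x \<noteq> \<xi>}"
    and M1f_def: "M1f = Sup {norm (f x u - f \<xi> u) / norm (x - \<xi>) | x \<xi> u.
                     x \<in> S1 \<and> \<xi> \<in> S4 \<and> u \<in> U \<and> x \<noteq> \<xi>}"
    and G1_def: "G1 = Sup {norm (jacobian h (at x) *v f x u - jacobian h (at z) *v f z u)
                     / norm (x - z) | x z u. x \<in> S1 \<and> z \<in> S2 \<and> u \<in> U \<and> x \<noteq> z}"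
    and G2_def: "G2 = Sup {norm (khat f h V W p L R z y u - khat f h V W p L R z w u)
                     / norm (y - w) | y w z u. z \<in> S2 \<and> u \<in> U \<and> y \<noteq> w}"
    and Pt_def: "Pt = Sup {matnorm (hessian P x) | x. x \<in> convex hull S1}"
    and K2: "0 < K2" "K2 \<le> matnorm Q" "\<forall>x. K2 * (norm x)\<^sup>2 \<le> x \<bullet> (Q *v x)"
    and Ts_\<sigma>: "Ts > 0" "\<sigma> > 0"
    and \<sigma>_le: "\<sigma> \<le> min (\<mu> / (sqrt (real CARD('n)) * Pt)) (c * \<omega> / (4 * matnorm Q))"
    and predictor_gain: "\<delta> * M1q * M1f * exp (\<sigma> * \<delta>) < 1"
    and sampling_gain: "Ts * G1 * exp (\<sigma> * Ts) * sqrt (2 * matnorm Q / K2)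
                          * (G2 * matnorm Q / (c * \<omega>)) < 1"
begin

section \<open>Regularity of the given functions and compactness of the level sets\<close>

lemma V1: "Ck (Suc (Suc 0)) V" and W1: "Ck (Suc 0) W" and P1: "Ck (Suc (Suc 0)) P" and q1: "Ck (Suc 0) q"
  using V(1) W(1) P(1) q(1) by (simp_all add: numeral_2_eq_2)

lemma h2: "Ck (Suc (Suc 0)) h" using h(1) unfolding smooth_def by blast

lemma V_blip: "blip V" and W_blip: "blip W" and P_blip: "blip P" and q_blip: "blip q"
  and gradV_blip: "blip (grad V)" and gradP_blip: "blip (grad P)" and h_blip: "blip h" and \<psi>_blip: "blip \<psi>"
  using Ck_Suc_blip[OF V1] Ck_Suc_blip[OF W1] Ck_Suc_blip[OF P1] Ck_Suc_blip[OF q1] grad_blip[OF V1] grad_blip[OF P1]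
    smooth_blip[OF h(1)] smooth_blip[OF \<psi>(1)] by auto

lemma kf_blip: "blip kf"
proof -
  obtain M where M: "M-lipschitz_on UNIV kf" using kf(1) by blast
  show ?thesis unfolding blip_def
  proof (intro allI impI)
    fix S :: "(real^'n) set" assume "bounded S"
    have "bounded (kf ` S)" using kf(2) compact_imp_bounded[OF U(2)] by (metis bounded_subset image_subsetI)
    then show "lipb S kf" unfolding lipb_def using lipschitz_on_subset[OF M] by blast
  qed
qed

lemma f_lipb: "lipb S x \<Longrightarrow> lipb S u \<Longrightarrow> lipb S (\<lambda>s. f (x s) (u s))"
  using lipb_blip[OF lipb_Pair smooth_blip[OF f(1)]] by fastforce

lemma Dhf_lipb: "lipb S x \<Longrightarrow> lipb S u \<Longrightarrow> lipb S (\<lambda>s. jacobian h (at (x s)) *v f (x s) (u s))"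
  unfolding jacobian_frechet[OF h2] by (intro frechet_blip[OF h2] f_lipb)

lemma bounded_U: "bounded U" using U(2) by (rule compact_imp_bounded)

lemma V_cont: "continuous_on UNIV V" by (rule blip_continuous[OF V_blip])

lemma level_bounded: "bounded {x. V x \<le> M}"
proof (cases "0 \<le> M")
  case True then show ?thesis using V(3) unfolding radially_unbounded_def by (metis bounded_empty)
next
  case False
  then have "{x. V x \<le> M} = {}" using V(2) by (auto intro: less_le_trans simp: not_le)
  then show ?thesis by simp
qed

lemma level_compact: "compact {x. V x \<le> M}"
proof -
  have "closed {x. V x \<le> M}" using V_cont by (intro closed_Collect_le) auto
  then show ?thesis using level_bounded compact_eq_bounded_closed by blast
qed

lemma S12: "S1 \<subseteq> S2" "bounded S1" "bounded S2" "compact S1" "compact S2" "0 \<in> S1" "x \<in> S1 \<longleftrightarrow> V x \<le> R" "x \<in> S2 \<longleftrightarrow> V x \<le> b"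
proof -
  have "0 \<in> {x. V x \<le> R}" using nbhd interior_subset by blast
  then show "0 \<in> S1" by (simp add: S1_def)
qed (use level_bounded level_compact consts3 in \<open>auto simp: S1_def S2_def\<close>)

lemma inner_nbhd: "\<exists>\<epsilon>>0. ball 0 \<epsilon> \<subseteq> S1"
  using nbhd unfolding S1_def mem_interior by blast

text \<open>\<open>W\<close> is positive only away from 0. The neighbourhood hypothesis keeps the
  region \<open>V > R\<close> out of a ball around 0, so its part with \<open>V \<le> M\<close> lies
  in a compact set on which \<open>W\<close> has a positive minimum.\<close>

lemma W_lower: "\<exists>w>0. \<forall>z. R < V z \<and> V z \<le> M \<longrightarrow> w \<le> W z"
proof -
  obtain \<epsilon> where e: "\<epsilon> > 0" "ball 0 \<epsilon> \<subseteq> S1" using inner_nbhd by blast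
  define A where "A = {x. V x \<le> M} - ball 0 \<epsilon>"
  have cA: "compact A" unfolding A_def by (intro compact_diff level_compact) auto
  have A: "z \<in> A" if "R < V z" "V z \<le> M" for z using that e(2) by (auto simp: A_def S1_def)
  show ?thesis
  proof (cases "A = {}")
    case True then show ?thesis using A by (intro exI[of _ 1]) auto
  next
    case False
    obtain z0 where z0: "z0 \<in> A" "\<And>z. z \<in> A \<Longrightarrow> W z0 \<le> W z"
      using continuous_attains_inf[OF cA False continuous_on_subset[OF blip_continuous[OF W_blip]]] by auto
    have "z0 \<noteq> 0" using z0(1) e(1) by (auto simp: A_def)
    then have "W z0 > 0" using W(3) by (simp add: positive_definite_fun_def)
    then show ?thesis using z0(2) A by blast
  qed
qed

lemma W_pos: "R < V z \<Longrightarrow> 0 < W z"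
  using W_lower[of "V z"] by (metis less_le_trans order_refl)

lemma gradV_nz: "R < V z \<Longrightarrow> grad V z \<noteq> 0"
proof
  assume "R < V z" "grad V z = 0"
  then show False using R(2) U(3) W_pos[of z] by (smt (verit) inner_zero_left)
qed

lemma gradV_f: "R \<le> V z \<Longrightarrow> u \<in> U \<Longrightarrow> grad V z \<bullet> f z u \<le> - W z"
  using R(2) by blast

lemma Q_sym: "x \<bullet> (Q *v y) = y \<bullet> (Q *v x)"
  by (metis Q(1) dot_lmul_matrix inner_commute transpose_matrix_vector)

lemma Q_le: "norm (Q *v x) \<le> matnorm Q * norm x"
  unfolding matnorm_def by (rule onorm) (rule matrix_vector_mul_bounded_linear)

lemma Qn_pos: "0 < matnorm Q" using K2 by simp

lemma L_bound: "norm (L *v y) \<le> matnorm L * norm y"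
  unfolding matnorm_def by (rule onorm) (rule matrix_vector_mul_bounded_linear)

lemma Ln_nonneg: "0 \<le> matnorm L" unfolding matnorm_def by (rule onorm_pos_le) (rule matrix_vector_mul_bounded_linear)

abbreviation "ph \<equiv> phi f h V W p L"
abbreviation "kh \<equiv> khat f h V W p L R"

section \<open>The correction term of the observer\<close>

lemma p01: "0 \<le> p (V z)" "p (V z) \<le> 1" using p(2) V(2) by auto

lemma ph_nonneg: "0 \<le> ph z y u" by (simp add: phi_def)

lemma ph_le:
  assumes "R \<le> V z" "u \<in> U"
  shows "ph z y u \<le> p (V z) * (norm (grad V z) * norm (L *v (h z - y)))"
proof -
  have "grad V z \<bullet> f z u + W z + p (V z) * (grad V z \<bullet> (L *v (h z - y))) \<le> p (V z) * (grad V z \<bullet> (L *v (h z - y)))"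
    using gradV_f[OF assms] by simp
  also have "\<dots> \<le> p (V z) * (norm (grad V z) * norm (L *v (h z - y)))"
    using p01 by (intro mult_left_mono norm_cauchy_schwarz) auto
  finally show ?thesis unfolding phi_def using p01(1)[of z] by simp
qed

text \<open>By hypothesis 1 the terms of \<open>ph\<close> without the factor \<open>p\<close> sum
  to at most 0. What remains is linear in the gradient, so the division by its squared norm does not
  make the correction large where the gradient is small.\<close>

lemma corr_norm:
  assumes "R < V z" "u \<in> U"
  shows "norm ((ph z y u / (norm (grad V z))\<^sup>2) *\<^sub>R grad V z) \<le> p (V z) * norm (L *v (h z - y))"
proof -
  have g: "0 < norm (grad V z)" using gradV_nz[OF assms(1)] by simp
  have "norm ((ph z y u / (norm (grad V z))\<^sup>2) *\<^sub>R grad V z) = ph z y u / norm (grad V z)"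
    using g ph_nonneg[of z y u] by (simp add: power2_eq_square)
  also have "\<dots> \<le> p (V z) * norm (L *v (h z - y))"
    using ph_le[of z u y] assms g by (simp add: divide_le_eq mult.commute mult.left_commute)
  finally show ?thesis .
qed

lemma kh_norm:
  assumes "u \<in> U"
  shows "norm (kh z y u) \<le> 2 * matnorm L * norm (h z - y)"
proof (cases "V z \<le> R")
  case True
  then have "norm (kh z y u) \<le> matnorm L * norm (h z - y)" using L_bound by (simp add: khat_def)
  then show ?thesis using mult_nonneg_nonneg[OF Ln_nonneg norm_ge_zero[of "h z - y"]] by linarith
next
  case False
  then have "kh z y u = L *v (h z - y) - (ph z y u / (norm (grad V z))\<^sup>2) *\<^sub>R grad V z"
    by (simp add: khat_def)
  then have "norm (kh z y u) \<le> norm (L *v (h z - y)) + norm ((ph z y u / (norm (grad V z))\<^sup>2) *\<^sub>R grad V z)"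
    by (metis norm_triangle_ineq4)
  also have "\<dots> \<le> norm (L *v (h z - y)) + p (V z) * norm (L *v (h z - y))"
    using corr_norm[of z u y] False assms by simp
  also have "\<dots> \<le> norm (L *v (h z - y)) + 1 * norm (L *v (h z - y))"
    using p01 by (intro add_left_mono mult_right_mono) auto
  also have "\<dots> \<le> 2 * matnorm L * norm (h z - y)" using L_bound[of "h z - y"] by simp
  finally show ?thesis .
qed

text \<open>At these levels \<open>p = 1\<close>, and subtracting \<open>ph\<close> removes any
  excess of the uncorrected derivative over \<open>- W z\<close>.\<close>

lemma gradV_kh:
  assumes "b \<le> V z" "u \<in> U"
  shows "grad V z \<bullet> (f z u + kh z y u) \<le> - W z"
proof -
  have VR: "R < V z" using assms consts3 by simp
  then have g: "norm (grad V z) \<noteq> 0" using gradV_nz by simp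
  have "grad V z \<bullet> kh z y u = grad V z \<bullet> (L *v (h z - y)) - ph z y u"
    using VR g by (simp add: khat_def inner_diff_right dot_square_norm)
  moreover have "ph z y u \<ge> grad V z \<bullet> f z u + W z + grad V z \<bullet> (L *v (h z - y))"
    unfolding phi_def using p(3) assms by simp
  ultimately show ?thesis by (simp add: inner_add_right)
qed

text \<open>Taking the positive part is 1-Lipschitz, so the correction varies no more than the
  linear term. The bound is uniform in all arguments; this makes the supremum \<open>G2\<close>
  finite although \<open>y\<close> and \<open>w\<close> range over the whole space.\<close>

lemma kh_diff:
  assumes "u \<in> U"
  shows "norm (kh z y u - kh z w u) \<le> 2 * matnorm L * norm (y - w)"
proof (cases "V z \<le> R")
  case True
  have "kh z y u - kh z w u = L *v (w - y)" using True by (simp add: khat_def matrix_vector_mult_diff_distrib)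
  then have "norm (kh z y u - kh z w u) \<le> matnorm L * norm (y - w)" using L_bound[of "w - y"] by (simp add: norm_minus_commute)
  then show ?thesis using mult_nonneg_nonneg[OF Ln_nonneg norm_ge_zero[of "y - w"]] by linarith
next
  case False
  have g: "0 < norm (grad V z)" using gradV_nz[of z] False by simp
  have "kh z y u - kh z w u = L *v (w - y) - ((ph z y u - ph z w u) / (norm (grad V z))\<^sup>2) *\<^sub>R grad V z"
    using False by (simp add: khat_def matrix_vector_mult_diff_distrib diff_divide_distrib scaleR_diff_left)
  moreover have "norm (((ph z y u - ph z w u) / (norm (grad V z))\<^sup>2) *\<^sub>R grad V z) \<le> norm (L *v (w - y))"
  proof -
    have "\<bar>ph z y u - ph z w u\<bar> \<le> \<bar>p (V z) * (grad V z \<bullet> (L *v (h z - y))) - p (V z) * (grad V z \<bullet> (L *v (h z - w)))\<bar>"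
      unfolding phi_def by (auto simp: max_def)
    also have "\<dots> = \<bar>p (V z) * (grad V z \<bullet> (L *v (w - y)))\<bar>"
      by (simp add: matrix_vector_mult_diff_distrib inner_diff_right algebra_simps)
    also have "\<dots> = p (V z) * \<bar>grad V z \<bullet> (L *v (w - y))\<bar>" using p01 by (simp add: abs_mult)
    also have "\<dots> \<le> 1 * (norm (grad V z) * norm (L *v (w - y)))"
      using p01 by (intro mult_mono Cauchy_Schwarz_ineq2) auto
    finally have "\<bar>ph z y u - ph z w u\<bar> \<le> norm (grad V z) * norm (L *v (w - y))" by simp
    then have "\<bar>ph z y u - ph z w u\<bar> / norm (grad V z) \<le> norm (L *v (w - y))" using g by (simp add: divide_le_eq mult.commute)
    then show ?thesis using g by (simp add: power2_eq_square)
  qed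
  ultimately have "norm (kh z y u - kh z w u) \<le> norm (L *v (w - y)) + norm (L *v (w - y))"
    using norm_triangle_ineq4[of "L *v (w - y)" "((ph z y u - ph z w u) / (norm (grad V z))\<^sup>2) *\<^sub>R grad V z"] by simp
  also have "\<dots> \<le> 2 * matnorm L * norm (y - w)" using L_bound[of "w - y"] by (simp add: norm_minus_commute)
  finally show ?thesis .
qed

text \<open>The correction contributes minus a nonnegative multiple of \<open>Dd\<close>. If
  \<open>Dd \<ge> 0\<close> it only helps. If \<open>Dd < 0\<close>, hypothesis 4 is exactly the
  bound on \<open>ph\<close> that limits the damage to the fraction \<open>1 - c\<close> of the
  decay \<open>A\<close>, so that \<open>c * A\<close> survives.\<close>

lemma kh_observer:
  assumes z: "z \<in> S2" and x: "x \<in> S1" and u: "u \<in> U"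
  shows "(z - x) \<bullet> (Q *v (f z u + kh z (h x) u - f x u)) \<le> - (c * \<omega>) * (norm (z - x))\<^sup>2"
proof -
  define A where "A = (z - x) \<bullet> (Q *v (f z u + L *v (h z - h x) - f x u))"
  have A: "A \<le> - \<omega> * (norm (z - x))\<^sup>2" unfolding A_def using observer z x u by (simp add: S1_def S2_def)
  have "c * (\<omega> * (norm (z - x))\<^sup>2) \<le> 1 * (\<omega> * (norm (z - x))\<^sup>2)" using consts4 consts3 by (intro mult_right_mono) auto
  then have le: "- \<omega> * (norm (z - x))\<^sup>2 \<le> - (c * \<omega>) * (norm (z - x))\<^sup>2" by (simp add: mult.assoc)
  have cA: "c * A \<le> - (c * \<omega>) * (norm (z - x))\<^sup>2" using mult_left_mono[OF A, of c] consts4 by (simp add: mult.assoc)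
  show ?thesis
  proof (cases "V z \<le> R \<or> ph z (h x) u = 0")
    case True
    then have "kh z (h x) u = L *v (h z - h x)" by (auto simp: khat_def)
    then show ?thesis using A le by (simp add: A_def)
  next
    case False
    then have VR: "R < V z" and ph0: "0 < ph z (h x) u" using ph_nonneg[of z "h x" u] by auto
    have g: "0 < (norm (grad V z))\<^sup>2" using gradV_nz[OF VR] by simp
    define Dd where "Dd = grad V z \<bullet> (Q *v (z - x))"
    have "(z - x) \<bullet> (Q *v (f z u + kh z (h x) u - f x u)) = A - ph z (h x) u / (norm (grad V z))\<^sup>2 * Dd"
    proof -
      have "f z u + kh z (h x) u - f x u = (f z u + L *v (h z - h x) - f x u) - (ph z (h x) u / (norm (grad V z))\<^sup>2) *\<^sub>R grad V z"
        using VR by (simp add: khat_def)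
      then have "Q *v (f z u + kh z (h x) u - f x u) = Q *v (f z u + L *v (h z - h x) - f x u) - (ph z (h x) u / (norm (grad V z))\<^sup>2) *\<^sub>R (Q *v grad V z)"
        by (simp only: matrix_vector_mult_diff_distrib matrix_vector_mult_scaleR)
      then show ?thesis by (simp only: A_def Dd_def inner_diff_right inner_scaleR_right Q_sym[of "grad V z" "z - x"])
    qed
    moreover have "A - ph z (h x) u / (norm (grad V z))\<^sup>2 * Dd \<le> - (c * \<omega>) * (norm (z - x))\<^sup>2"
    proof (cases "0 \<le> Dd")
      case True
      then have "0 \<le> ph z (h x) u / (norm (grad V z))\<^sup>2 * Dd" using ph0 g by simp
      then show ?thesis using A le by linarith
    next
      case False
      \<comment> \<open>Up to level \<open>a\<close> the factor \<open>p\<close> vanishes, and then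
        hypothesis 1 makes \<open>ph\<close> zero.\<close>
      have aV: "a < V z"
      proof (rule ccontr)
        assume "\<not> a < V z"
        then have "p (V z) = 0" using p(4) V(2) by auto
        then have "ph z (h x) u = 0" using gradV_f[of z u] VR u by (simp add: phi_def)
        then show False using ph0 by simp
      qed
      have phe: "ph z (h x) u = grad V z \<bullet> f z u + W z + p (V z) * (grad V z \<bullet> (L *v (h z - h x)))"
        using ph0 by (auto simp: phi_def max_def split: if_splits)
      \<comment> \<open>A positive \<open>ph\<close> can only come from the term with
        \<open>p\<close>. That term is positive, so replacing \<open>p\<close> by 1 enlarges it and
        produces the left-hand side of hypothesis 4.\<close>
      have "0 < p (V z) * (grad V z \<bullet> (L *v (h z - h x)))" using phe ph0 gradV_f[of z u] VR u by simp
      then have "0 < grad V z \<bullet> (L *v (h z - h x))" using p01(1)[of z] by (simp add: zero_less_mult_iff)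
      then have "p (V z) * (grad V z \<bullet> (L *v (h z - h x))) \<le> 1 * (grad V z \<bullet> (L *v (h z - h x)))"
        using p01 by (intro mult_right_mono) auto
      then have "ph z (h x) u \<le> grad V z \<bullet> (f z u + L *v (h z - h x)) + W z" using phe by (simp add: inner_add_right)
      also have "\<dots> \<le> (1 - c) * (norm (grad V z))\<^sup>2 * (A / Dd)"
        using correction u aV z x False unfolding A_def Dd_def S1_def S2_def by (smt (verit) mem_Collect_eq)
      finally have "ph z (h x) u / (norm (grad V z))\<^sup>2 \<le> (1 - c) * (A / Dd)"
        unfolding pos_divide_le_eq[OF g] by (simp only: mult_ac)
      then have "ph z (h x) u / (norm (grad V z))\<^sup>2 * (- Dd) \<le> (1 - c) * (A / Dd) * (- Dd)"
        using False by (intro mult_right_mono) auto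
      also have "\<dots> = - ((1 - c) * A)" using False by (simp add: field_simps)
      finally have "A - ph z (h x) u / (norm (grad V z))\<^sup>2 * Dd \<le> c * A" by (simp add: algebra_simps)
      then show ?thesis using cA by linarith
    qed
    ultimately show ?thesis by simp
  qed
qed

text \<open>The formula switches at \<open>V z = R\<close>, where the quotient could produce a jump.
  But the correction is at most a bounded multiple of \<open>p (V z)\<close>, and
  \<open>p R = 0\<close> because \<open>R \<le> a\<close>; since \<open>p\<close> and
  \<open>V\<close> are Lipschitz on bounded sets, it vanishes at a Lipschitz rate towards the
  switch.\<close>

lemma kh_lipb:
  assumes "bounded S" "\<And>z y u. (z, y, u) \<in> S \<Longrightarrow> u \<in> U"
  shows "lipb S (\<lambda>(z, y, u). kh z y u)"
proof -
  have fst': "lipb S fst" "lipb S (\<lambda>s. fst (snd s))" "lipb S (\<lambda>s. snd (snd s))"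
    by (intro lipb_bounded_linear assms bounded_linear_fst bounded_linear_compose[OF bounded_linear_fst bounded_linear_snd]
        bounded_linear_compose[OF bounded_linear_snd bounded_linear_snd])+
  have sub: "lipb A g" if "lipb S g" "A \<subseteq> S" for g :: "(real^'n) \<times> (real^'k) \<times> (real^'m) \<Rightarrow> 'z::real_normed_vector" and A
    using lipb_subset that by blast
  have bfst: "bounded (fst ` S)" using fst'(1) by (simp add: lipb_def)
  obtain M where M: "\<And>s. s \<in> S \<Longrightarrow> norm (fst s) \<le> M" using bfst unfolding bounded_iff by auto
  have hy: "lipb S (\<lambda>s. L *v (h (fst s) - fst (snd s)))"
    by (intro lipb_mv lipb_diff lipb_blip[OF fst'(1) h_blip] fst'(2))
  obtain BL where BL: "BL > 0" "\<forall>s\<in>S. norm (L *v (h (fst s) - fst (snd s))) \<le> BL" using lipb_bound[OF hy] by blast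
  have Vf: "lipb S (\<lambda>s. V (fst s))" by (rule lipb_blip[OF fst'(1) V_blip])
  obtain CV where CV: "CV > 0" "\<forall>s\<in>S. \<forall>s'\<in>S. norm (V (fst s) - V (fst s')) \<le> CV * dist s s'" "\<forall>s\<in>S. norm (V (fst s)) \<le> CV"
    using lipb_bound[OF Vf] by blast
  have pl: "lipb {0..CV} p" by (rule locally_lipschitz_imp_lipb[OF p(1)])
  obtain Cp where Cp: "Cp > 0" "\<forall>s\<in>{0..CV}. \<forall>s'\<in>{0..CV}. norm (p s - p s') \<le> Cp * dist s s'" using lipb_bound[OF pl] by blast
  have pV: "lipb S (\<lambda>s. p (V (fst s)))"
    by (rule lipb_comp[OF Vf pl]) (use CV(3) V(2) in auto)
  define A where "A = {s\<in>S. R < V (fst s)}"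
  have AS: "A \<subseteq> S" by (auto simp: A_def)
  obtain \<epsilon> where e: "\<epsilon> > 0" "ball 0 \<epsilon> \<subseteq> S1" using inner_nbhd by blast
  \<comment> \<open>The closed condition \<open>R \<le> V z\<close> is used to have compactness.
    Hypothesis 1 includes equality, so the gradient is nonzero on this boundary too, given that
    \<open>W\<close> is positive away from 0.\<close>
  obtain m where m: "m > 0" "\<And>s. s \<in> A \<Longrightarrow> m \<le> norm (grad V (fst s))"
  proof -
    define B where "B = {z \<in> cball 0 M - ball 0 \<epsilon>. R \<le> V z}"
    have "compact B"
    proof -
      have "B = (cball 0 M - ball 0 \<epsilon>) \<inter> {z. R \<le> V z}" by (auto simp: B_def)
      moreover have "closed {z. R \<le> V z}" using V_cont by (intro closed_Collect_le) auto
      ultimately show ?thesis by (simp add: compact_Int_closed compact_diff)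
    qed
    have AB: "fst s \<in> B" if "s \<in> A" for s
      using that M[of s] e(2) by (auto simp: A_def B_def S1_def)
    show thesis
    proof (cases "B = {}")
      case True then show thesis using AB by (intro that[of 1]) auto
    next
      case False
      obtain z0 where z0: "z0 \<in> B" "\<And>z. z \<in> B \<Longrightarrow> norm (grad V z0) \<le> norm (grad V z)"
        using continuous_attains_inf[OF \<open>compact B\<close> False continuous_on_norm[OF continuous_on_subset[OF blip_continuous[OF gradV_blip]]]] by auto
      have "z0 \<noteq> 0" using z0(1) e(1) by (auto simp: B_def)
      then have "W z0 > 0" using W(3) by (simp add: positive_definite_fun_def)
      then have "grad V z0 \<noteq> 0" using gradV_f[of z0 0] U(3) z0(1) by (auto simp: B_def)
      then show thesis using z0(2) AB by (intro that[of "norm (grad V z0)"]) auto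
    qed
  qed
  define g where "g = (\<lambda>s. (ph (fst s) (fst (snd s)) (snd (snd s)) / (norm (grad V (fst s)))\<^sup>2) *\<^sub>R grad V (fst s))"
  have gV: "lipb A (\<lambda>s. grad V (fst s))" by (rule sub[OF lipb_blip[OF fst'(1) gradV_blip] AS])
  have phl: "lipb A (\<lambda>s. ph (fst s) (fst (snd s)) (snd (snd s)))"
    unfolding phi_def
    by (intro lipb_max0 lipb_add lipb_inner lipb_mult gV sub[OF f_lipb[OF fst'(1) fst'(3)] AS] sub[OF lipb_blip[OF fst'(1) W_blip] AS] sub[OF pV AS] sub[OF hy AS])
  have gl: "lipb A g"
  proof -
    have "lipb A (\<lambda>s. inverse (norm (grad V (fst s))))"
      by (rule lipb_inverse[OF lipb_norm[OF gV] m])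
    then have "lipb A (\<lambda>s. (ph (fst s) (fst (snd s)) (snd (snd s)) * (inverse (norm (grad V (fst s))) * inverse (norm (grad V (fst s))))) *\<^sub>R grad V (fst s))"
      by (intro lipb_scaleR lipb_mult phl gV)
    then show ?thesis by (simp add: g_def power2_eq_square divide_inverse)
  qed
  obtain Cg where Cg: "Cg > 0" "\<forall>s\<in>A. \<forall>s'\<in>A. norm (g s - g s') \<le> Cg * dist s s'" "\<forall>s\<in>A. norm (g s) \<le> Cg"
    using lipb_bound[OF gl] by blast
  have mixed: "norm (g s) \<le> Cp * CV * BL * dist s s'" if "s \<in> A" "s' \<in> S" "V (fst s') \<le> R" for s s'
  proof -
    have sS: "s \<in> S" "R < V (fst s)" using that by (auto simp: A_def)
    have uU: "snd (snd s) \<in> U" using assms(2)[of "fst s" "fst (snd s)" "snd (snd s)"] sS by simp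
    have pR: "p R = 0" using p(4) R(1) consts4 by simp
    have "p (V (fst s)) \<le> Cp * (V (fst s) - R)"
    proof -
      have "norm (p (V (fst s)) - p R) \<le> Cp * dist (V (fst s)) R"
        using Cp(2) CV(3) sS R(1) by (auto simp: V(2))
      then show ?thesis using pR sS by (simp add: dist_real_def)
    qed
    also have "\<dots> \<le> Cp * (CV * dist s s')"
    proof (rule mult_left_mono)
      have "norm (V (fst s) - V (fst s')) \<le> CV * dist s s'" using CV(2) sS that by blast
      then show "V (fst s) - R \<le> CV * dist s s'" using that by simp
    qed (use Cp in simp)
    finally have pp: "p (V (fst s)) \<le> Cp * (CV * dist s s')" .
    have "norm (g s) \<le> p (V (fst s)) * norm (L *v (h (fst s) - fst (snd s)))"
      unfolding g_def by (rule corr_norm[OF sS(2) uU])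
    also have "\<dots> \<le> Cp * (CV * dist s s') * BL" using pp BL sS Cp CV p01 by (intro mult_mono) auto
    finally show ?thesis by (simp add: algebra_simps)
  qed
  define G where "G s = (if V (fst s) \<le> R then 0 else g s)" for s
  have GA: "G s = g s" if "s \<in> A" for s using that by (simp add: G_def A_def)
  have G0: "G s = 0" if "V (fst s) \<le> R" for s using that by (simp add: G_def)
  have "lipb S G"
  proof (rule lipbI[of _ _ "Cg + Cp * CV * BL" Cg])
    fix s s' assume s: "s \<in> S" "s' \<in> S"
    have nn: "0 \<le> Cp * CV * BL * dist s s'" "0 \<le> Cg * dist s s'" using Cp CV BL Cg by auto
    consider "s \<in> A" "s' \<in> A" | "s \<in> A" "V (fst s') \<le> R" | "V (fst s) \<le> R" "s' \<in> A" | "V (fst s) \<le> R" "V (fst s') \<le> R"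
      using s by (auto simp: A_def not_le[symmetric])
    then show "norm (G s - G s') \<le> (Cg + Cp * CV * BL) * dist s s'"
    proof cases
      case 1
      then have "norm (G s - G s') \<le> Cg * dist s s'" using Cg(2) by (simp add: GA)
      then show ?thesis using nn by (simp add: distrib_right)
    next
      case 2
      then have "norm (G s - G s') \<le> Cp * CV * BL * dist s s'" using mixed[OF 2(1) s(2) 2(2)] by (simp add: GA[OF 2(1)] G0[OF 2(2)])
      then show ?thesis using nn by (simp add: distrib_right)
    next
      case 3
      then have "norm (G s - G s') \<le> Cp * CV * BL * dist s s'" using mixed[OF 3(2) s(1) 3(1)] by (simp add: GA[OF 3(2)] G0[OF 3(1)] dist_commute)
      then show ?thesis using nn by (simp add: distrib_right)
    next
      case 4 then show ?thesis using nn by (simp add: G0 distrib_right)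
    qed
  next
    fix s assume "s \<in> S"
    then consider "s \<in> A" | "V (fst s) \<le> R" by (auto simp: A_def not_le[symmetric])
    then show "norm (G s) \<le> Cg" using Cg(1,3) by cases (auto simp: GA G0)
  qed
  then have "lipb S (\<lambda>s. L *v (h (fst s) - fst (snd s)) - G s)" by (rule lipb_diff[OF hy])
  moreover have "(\<lambda>(z, y, u). kh z y u) = (\<lambda>s. L *v (h (fst s) - fst (snd s)) - G s)"
    by (rule ext) (auto simp: khat_def G_def g_def)
  ultimately show ?thesis by simp
qed

end

section \<open>Saturation and the gain constants\<close>

lemma le_Sup_ratio:
  fixes F :: "'i \<Rightarrow> real"
  assumes "\<And>i. i \<in> I \<Longrightarrow> F i \<le> C" "i \<in> I"
  shows "F i \<le> Sup (F ` I)"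
  using assms by (intro cSUP_upper bdd_aboveI2[where M = C]) auto

context closed_loop_setup
begin

definition sat :: "real^'n \<Rightarrow> real^'n \<Rightarrow> real^'n" where
  "sat \<xi> z = q (norm \<xi> / \<psi> z) *\<^sub>R \<xi>"

lemma \<psi>_pos: "0 < \<psi> z" "1 \<le> \<psi> z"
proof -
  show "1 \<le> \<psi> z" using \<psi>(2) by blast
  then show "0 < \<psi> z" by linarith
qed

lemma sat_id: "norm \<xi> \<le> \<psi> z \<Longrightarrow> sat \<xi> z = \<xi>"
  using q(3) \<psi>_pos[of z] by (simp add: sat_def)

lemma sat_id': "V x \<le> max (V z) b \<Longrightarrow> sat x z = x"
  using sat_id \<psi>(3) by blast

lemma sat_le_\<psi>: "norm (sat \<xi> z) \<le> K * \<psi> z"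
proof (cases "norm \<xi> / \<psi> z \<le> 1")
  case True
  then have "norm (sat \<xi> z) = norm \<xi>" using q(3) by (simp add: sat_def)
  also have "\<dots> \<le> \<psi> z" using True \<psi>_pos[of z] by (simp add: divide_le_eq)
  also have "\<dots> \<le> K * \<psi> z" using q(4) \<psi>_pos(1)[of z] by simp
  finally show ?thesis .
next
  case False
  let ?s = "norm \<xi> / \<psi> z"
  have "?s * q ?s \<le> K" by (rule q(5)[rule_format]) (use False in linarith)
  then have "\<psi> z * (?s * q ?s) \<le> \<psi> z * K" using \<psi>_pos[of z] by (intro mult_left_mono) auto
  moreover have "norm (sat \<xi> z) = \<psi> z * (?s * q ?s)" using \<psi>_pos[of z] q(2) by (simp add: sat_def)
  ultimately show ?thesis by (simp add: mult.commute)
qed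

lemma sat_lipb:
  assumes "lipb S x" "lipb S z"
  shows "lipb S (\<lambda>s. sat (x s) (z s))"
proof -
  have "lipb S (\<lambda>s. inverse (\<psi> (z s)))"
    by (rule lipb_inverse[OF lipb_blip[OF assms(2) \<psi>_blip], of 1]) (use \<psi>_pos in auto)
  then have "lipb S (\<lambda>s. norm (x s) * inverse (\<psi> (z s)))" by (intro lipb_mult lipb_norm assms)
  then have "lipb S (\<lambda>s. q (norm (x s) * inverse (\<psi> (z s))))" using q_blip by (rule lipb_blip)
  then have "lipb S (\<lambda>s. q (norm (x s) * inverse (\<psi> (z s))) *\<^sub>R x s)" by (intro lipb_scaleR assms)
  then show ?thesis by (simp add: sat_def divide_inverse)
qed

lemma f_bounded: "\<exists>C. \<forall>z u. norm z \<le> s \<and> u \<in> U \<longrightarrow> norm (f z u) \<le> C"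
proof -
  have "lipb (cball 0 s \<times> U) (\<lambda>p. f (fst p) (snd p))"
    by (intro f_lipb lipb_bounded_linear bounded_linear_fst bounded_linear_snd bounded_Times bounded_cball bounded_U)
  then obtain C where C: "\<forall>p\<in>cball 0 s \<times> U. norm (f (fst p) (snd p)) \<le> C" using lipb_bound by blast
  have "norm (f z u) \<le> C" if "norm z \<le> s" "u \<in> U" for z u
    using C[rule_format, of "(z, u)"] that by simp
  then show ?thesis by blast
qed

lemma \<rho>_set: "\<rho> s = Sup {norm (f z u) | z u. u \<in> U \<and> norm z \<le> s}" by (simp add: \<rho>_def)

lemma Dhf_bounded: "\<exists>C\<ge>0. \<forall>z u. norm z \<le> M \<and> u \<in> U \<longrightarrow> norm (jacobian h (at z) *v f z u) \<le> C"
proof -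
  have "lipb (cball 0 M \<times> U) (\<lambda>p. jacobian h (at (fst p)) *v f (fst p) (snd p))"
    by (intro Dhf_lipb lipb_bounded_linear bounded_linear_fst bounded_linear_snd bounded_Times bounded_cball bounded_U)
  then obtain C where C: "C > 0" "\<forall>p\<in>cball 0 M \<times> U. norm (jacobian h (at (fst p)) *v f (fst p) (snd p)) \<le> C" using lipb_bound by blast
  have "norm (jacobian h (at z) *v f z u) \<le> C" if "norm z \<le> M" "u \<in> U" for z u
    using C(2)[rule_format, of "(z, u)"] that by simp
  then show ?thesis using C(1) less_imp_le by blast
qed

lemma \<rho>_upper:
  assumes "norm z \<le> s" "u \<in> U" shows "norm (f z u) \<le> \<rho> s"
proof -
  obtain C where C: "\<forall>z u. norm z \<le> s \<and> u \<in> U \<longrightarrow> norm (f z u) \<le> C" using f_bounded by blast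
  show ?thesis unfolding \<rho>_set by (rule cSup_upper) (use C assms in \<open>auto intro!: bdd_aboveI[of _ C]\<close>)
qed

lemma \<rho>_least:
  assumes "0 \<le> s" "\<And>z u. norm z \<le> s \<Longrightarrow> u \<in> U \<Longrightarrow> norm (f z u) \<le> C" shows "\<rho> s \<le> C"
  unfolding \<rho>_set
proof (rule cSup_least)
  have "norm (f 0 0) \<in> {norm (f z u) | z u. u \<in> U \<and> norm z \<le> s}" using U(3) assms(1) by force
  then show "{norm (f z u) | z u. u \<in> U \<and> norm z \<le> s} \<noteq> {}" by blast
qed (use assms(2) in blast)

lemma \<delta>_nonneg: "0 \<le> \<delta>" using delays by (simp add: \<delta>_def)

lemma \<psi>_bounded: "\<exists>C. \<forall>z\<in>S2. \<psi> z \<le> C"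
proof -
  obtain C where "\<forall>z\<in>S2. norm (\<psi> z) \<le> C" using lipb_bound[OF blip_lipb[OF \<psi>_blip S12(3)]] by blast
  then show ?thesis by (intro exI[of _ C]) (auto dest!: bspec)
qed

lemma S4_bounded: "bounded S4" and S3_bounded: "bounded S3"
proof -
  obtain C where C: "\<And>z. z \<in> S2 \<Longrightarrow> \<psi> z \<le> C" using \<psi>_bounded by blast
  obtain B where B: "\<And>z u. norm z \<le> K * C \<Longrightarrow> u \<in> U \<Longrightarrow> norm (f z u) \<le> B" using f_bounded by blast
  have K: "K * \<psi> z \<le> K * C" "0 \<le> K * \<psi> z" if "z \<in> S2" for z using C[OF that] q(4) \<psi>_pos(1)[of z] by auto
  have "norm x \<le> K * C" if "x \<in> S4" for x
    using that K unfolding S4_def by force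
  then show "bounded S4" unfolding bounded_iff by blast
  have "norm x \<le> K * C + \<delta> * B" if xS3: "x \<in> S3" for x
  proof -
    obtain z where z: "z \<in> S2" "norm x \<le> K * \<psi> z + \<delta> * \<rho> (K * \<psi> z)" using xS3 unfolding S3_def by blast
    have "\<rho> (K * \<psi> z) \<le> B" by (rule \<rho>_least[OF K(2)[OF z(1)] B]) (use K(1)[OF z(1)] in linarith)
    then have "\<delta> * \<rho> (K * \<psi> z) \<le> \<delta> * B" using \<delta>_nonneg by (rule mult_left_mono)
    then show ?thesis using z K(1)[OF z(1)] by linarith
  qed
  then show "bounded S3" unfolding bounded_iff by blast
qed

text \<open>A real supremum bounds its set only if the set is bounded; here the quotients are,
  because \<open>sat\<close> is Lipschitz on the bounded sets \<open>S1\<close>, \<open>S3\<close>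
  and \<open>S2\<close>. Equal points do not occur in the supremum and are treated apart.\<close>

lemma M1q_bound:
  assumes "x \<in> S1" "\<xi> \<in> S3" "z \<in> S2"
  shows "norm (sat \<xi> z - sat x z) \<le> M1q * norm (\<xi> - x)"
proof (cases "x = \<xi>")
  case False
  let ?I = "{(x, \<xi>, z). x \<in> S1 \<and> \<xi> \<in> S3 \<and> z \<in> S2 \<and> x \<noteq> \<xi>}"
  let ?F = "\<lambda>(x, \<xi>, z). norm (sat \<xi> z - sat x z) / norm (x - \<xi>)"
  have eq: "M1q = Sup (?F ` ?I)"
    unfolding M1q_def sat_def by (rule arg_cong[where f = Sup]) (auto simp: image_def)
  have "lipb ((S1 \<union> S3) \<times> S2) (\<lambda>p. sat (fst p) (snd p))"
    by (intro sat_lipb lipb_bounded_linear bounded_linear_fst bounded_linear_snd bounded_Times S12 S3_bounded iffD2[OF bounded_Un] conjI)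
  then obtain C where C: "\<forall>p\<in>(S1 \<union> S3) \<times> S2. \<forall>p'\<in>(S1 \<union> S3) \<times> S2. norm (sat (fst p) (snd p) - sat (fst p') (snd p')) \<le> C * dist p p'"
    using lipb_bound by blast
  have "?F i \<le> C" if iI: "i \<in> ?I" for i
  proof -
    obtain x \<xi> z where i: "i = (x, \<xi>, z)" "x \<in> S1" "\<xi> \<in> S3" "z \<in> S2" "x \<noteq> \<xi>" using iI by auto
    have "norm (sat \<xi> z - sat x z) \<le> C * dist (\<xi>, z) (x, z)" using C[rule_format, of "(\<xi>, z)" "(x, z)"] i by simp
    also have "dist (\<xi>, z) (x, z) = norm (x - \<xi>)" by (simp add: dist_Pair_Pair dist_norm norm_minus_commute)
    finally show ?thesis using i by (simp add: divide_le_eq)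
  qed
  then have "?F (x, \<xi>, z) \<le> M1q" unfolding eq by (rule le_Sup_ratio) (use assms False in auto)
  then show ?thesis using False by (simp add: divide_le_eq norm_minus_commute)
qed simp

lemma M1f_bound:
  assumes "x \<in> S1" "\<xi> \<in> S4" "u \<in> U"
  shows "norm (f \<xi> u - f x u) \<le> M1f * norm (\<xi> - x)"
proof (cases "x = \<xi>")
  case False
  let ?I = "{(x, \<xi>, u). x \<in> S1 \<and> \<xi> \<in> S4 \<and> u \<in> U \<and> x \<noteq> \<xi>}"
  let ?F = "\<lambda>(x, \<xi>, u). norm (f x u - f \<xi> u) / norm (x - \<xi>)"
  have eq: "M1f = Sup (?F ` ?I)"
    unfolding M1f_def by (rule arg_cong[where f = Sup]) (auto simp: image_def)
  have "lipb ((S1 \<union> S4) \<times> U) (\<lambda>p. f (fst p) (snd p))"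
    by (intro f_lipb lipb_bounded_linear bounded_linear_fst bounded_linear_snd bounded_Times bounded_U S12 S4_bounded iffD2[OF bounded_Un] conjI)
  then obtain C where C: "\<forall>p\<in>(S1 \<union> S4) \<times> U. \<forall>p'\<in>(S1 \<union> S4) \<times> U. norm (f (fst p) (snd p) - f (fst p') (snd p')) \<le> C * dist p p'"
    using lipb_bound by blast
  have "?F i \<le> C" if iI: "i \<in> ?I" for i
  proof -
    obtain x \<xi> u where i: "i = (x, \<xi>, u)" "x \<in> S1" "\<xi> \<in> S4" "u \<in> U" "x \<noteq> \<xi>" using iI by auto
    have "norm (f x u - f \<xi> u) \<le> C * dist (x, u) (\<xi>, u)" using C[rule_format, of "(x, u)" "(\<xi>, u)"] i by simp
    also have "dist (x, u) (\<xi>, u) = norm (x - \<xi>)" by (simp add: dist_Pair_Pair dist_norm)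
    finally show ?thesis using i by (simp add: divide_le_eq)
  qed
  then have "?F (x, \<xi>, u) \<le> M1f" unfolding eq by (rule le_Sup_ratio) (use assms False in auto)
  then show ?thesis using False by (simp add: divide_le_eq norm_minus_commute)
qed simp

lemma G1_bound:
  assumes "x \<in> S1" "z \<in> S2" "u \<in> U"
  shows "norm (jacobian h (at z) *v f z u - jacobian h (at x) *v f x u) \<le> G1 * norm (z - x)"
proof (cases "x = z")
  case False
  let ?g = "\<lambda>x u. jacobian h (at x) *v f x u"
  let ?I = "{(x, z, u). x \<in> S1 \<and> z \<in> S2 \<and> u \<in> U \<and> x \<noteq> z}"
  let ?F = "\<lambda>(x, z, u). norm (?g x u - ?g z u) / norm (x - z)"
  have eq: "G1 = Sup (?F ` ?I)"
    unfolding G1_def by (rule arg_cong[where f = Sup]) (auto simp: image_def)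
  have "lipb (S2 \<times> U) (\<lambda>p. ?g (fst p) (snd p))"
    by (intro Dhf_lipb lipb_bounded_linear bounded_linear_fst bounded_linear_snd bounded_Times bounded_U S12)
  then obtain C where C: "\<forall>p\<in>S2 \<times> U. \<forall>p'\<in>S2 \<times> U. norm (?g (fst p) (snd p) - ?g (fst p') (snd p')) \<le> C * dist p p'"
    using lipb_bound by blast
  have "?F i \<le> C" if iI: "i \<in> ?I" for i
  proof -
    obtain x z u where i: "i = (x, z, u)" "x \<in> S1" "z \<in> S2" "u \<in> U" "x \<noteq> z" using iI by auto
    have xS: "x \<in> S2" using i S12(1) by blast
    have "norm (?g x u - ?g z u) \<le> C * dist (x, u) (z, u)" using C[rule_format, of "(x, u)" "(z, u)"] i xS by simp
    also have "dist (x, u) (z, u) = norm (x - z)" by (simp add: dist_Pair_Pair dist_norm)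
    finally show ?thesis using i by (simp add: divide_le_eq)
  qed
  then have "?F (x, z, u) \<le> G1" unfolding eq by (rule le_Sup_ratio) (use assms False in auto)
  then show ?thesis using False by (simp add: divide_le_eq norm_minus_commute)
qed simp

lemma G2_bound:
  assumes "z \<in> S2" "u \<in> U"
  shows "norm (kh z y u - kh z w u) \<le> G2 * norm (y - w)"
proof (cases "y = w")
  case False
  let ?I = "{(y, w, z, u). z \<in> S2 \<and> u \<in> U \<and> y \<noteq> w}"
  let ?F = "\<lambda>(y, w, z, u). norm (kh z y u - kh z w u) / norm (y - w)"
  have eq: "G2 = Sup (?F ` ?I)"
    unfolding G2_def by (rule arg_cong[where f = Sup]) (auto simp: image_def)
  have "?F i \<le> 2 * matnorm L" if iI: "i \<in> ?I" for i
  proof -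
    obtain y w z u where i: "i = (y, w, z, u)" "z \<in> S2" "u \<in> U" "y \<noteq> w" using iI by auto
    show ?thesis using kh_diff[OF i(3), of z y w] i by (simp add: divide_le_eq)
  qed
  then have "?F (y, w, z, u) \<le> G2" unfolding eq by (rule le_Sup_ratio) (use assms False in auto)
  then show ?thesis using False by (simp add: divide_le_eq)
qed simp

lemma S1_nonzero: "\<exists>x\<in>S1. x \<noteq> 0"
proof -
  obtain \<epsilon> where e: "\<epsilon> > 0" "ball 0 \<epsilon> \<subseteq> S1" using inner_nbhd by blast
  define x :: "real^'n" where "x = (\<epsilon> / 2) *\<^sub>R axis undefined 1"
  have "norm x = \<epsilon> / 2" using e by (simp add: x_def)
  then have "x \<in> ball 0 \<epsilon>" "x \<noteq> 0" using e by auto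
  then show ?thesis using e by blast
qed

text \<open>The supremum of an empty set of quotients would tell nothing about the sign. The
  neighbourhood hypothesis supplies a nonzero point of \<open>S1\<close>, and applying the bounds to
  this point and 0 forces the constants to be nonnegative; for \<open>G2\<close> two distinct
  outputs do the same.\<close>

lemma gains_nonneg: "0 \<le> M1q" "0 \<le> M1f" "0 \<le> G1" "0 \<le> G2"
proof -
  obtain x where x: "x \<in> S1" "x \<noteq> 0" using S1_nonzero by blast
  have n: "0 < norm (0 - x)" using x by simp
  have pos: "0 \<le> G" if "norm a \<le> G * norm (0 - x)" for G and a :: "'z::real_normed_vector"
    using order_trans[OF norm_ge_zero that] n by (simp add: zero_le_mult_iff)
  have 0: "0 \<in> S3" "0 \<in> S4"
  proof -
    have "0 \<le> \<rho> (K * \<psi> 0)" using \<rho>_upper[of 0 "K * \<psi> 0" 0] U(3) q(4) \<psi>_pos(1)[of 0] by (auto intro: order_trans[OF norm_ge_zero])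
    then have "norm (0::real^'n) \<le> K * \<psi> 0 + \<delta> * \<rho> (K * \<psi> 0)" using \<delta>_nonneg q(4) \<psi>_pos(1)[of 0] by simp
    then show "0 \<in> S3" using S12(1,6) unfolding S3_def by blast
    have "norm (0::real^'n) \<le> K * \<psi> 0" using q(4) \<psi>_pos(1)[of 0] by simp
    then show "0 \<in> S4" using S12(1,6) unfolding S4_def by blast
  qed
  have 02: "0 \<in> S2" using S12(1,6) by blast
  show "0 \<le> M1q" by (rule pos[OF M1q_bound[OF x(1) 0(1) 02]])
  show "0 \<le> M1f" by (rule pos[OF M1f_bound[OF x(1) 0(2) U(3)]])
  show "0 \<le> G1" by (rule pos[OF G1_bound[OF x(1) 02 U(3)]])
  have "0 < norm (1 - 0 :: real^'k)" by simp
  then show "0 \<le> G2" using order_trans[OF norm_ge_zero G2_bound[OF 02 U(3), of 1 0]] by (simp add: zero_le_mult_iff)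
qed

section \<open>Quadratic bounds for \<open>P\<close> and the decay rates\<close>

lemma gradP_zero: "grad P 0 = 0"
proof -
  have d: "(P has_derivative (\<lambda>v. grad P 0 \<bullet> v)) (at 0)" by (rule grad_has_derivative[OF P1])
  have "P 0 \<le> P y" for y using P(2,3) by (simp add: positive_definite_fun_def)
  then have "(\<lambda>v. grad P 0 \<bullet> v) = (\<lambda>v. 0)"
    using differential_zero_maxmin[of 0 UNIV P "\<lambda>v. grad P 0 \<bullet> v"] d by auto
  then have "grad P 0 \<bullet> grad P 0 = 0" by metis
  then show ?thesis by simp
qed

lemma hessian_le_Pt:
  assumes "x \<in> convex hull S1" shows "onorm (\<lambda>v. hessian P x *v v) \<le> Pt"
proof -
  have "bounded (convex hull S1)" by (rule bounded_convex_hull[OF S12(2)])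
  then obtain r where r: "\<forall>x\<in>convex hull S1. norm x \<le> r" unfolding bounded_iff by blast
  obtain B where B: "\<forall>x\<in>cball 0 r. onorm (frechet_derivative (grad P) (at x)) \<le> B"
    using Ck_Suc_onorm_bounded[OF Ck_grad[OF P1]] by blast
  have h: "(\<lambda>v. hessian P x *v v) = frechet_derivative (grad P) (at x)" for x
    unfolding hessian_def by (rule ext) (rule jacobian_frechet[OF Ck_grad[OF P1]])
  have eq: "Pt = Sup ((\<lambda>x. matnorm (hessian P x)) ` (convex hull S1))"
    unfolding Pt_def by (rule arg_cong[where f = Sup]) (auto simp: image_def)
  have "matnorm (hessian P x) \<le> Pt"
    unfolding eq by (rule le_Sup_ratio[OF _ assms, of _ B]) (use r B in \<open>auto simp: matnorm_def h\<close>)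
  then show ?thesis by (simp add: matnorm_def)
qed

text \<open>\<open>S1\<close> need not be convex; \<open>Pt\<close> is taken over its convex hull,
  which contains the segment from 0 to \<open>x\<close>.\<close>

lemma gradP_le:
  assumes "x \<in> S1" "0 \<le> s" "s \<le> 1"
  shows "norm (grad P (s *\<^sub>R x)) \<le> Pt * (s * norm x)"
proof -
  have hd: "(grad P has_derivative (\<lambda>v. hessian P y *v v)) (at y)" for y
    using Ck_Suc_has_derivative[OF Ck_grad[OF P1], of y] jacobian_frechet[OF Ck_grad[OF P1], of y]
    unfolding hessian_def by (simp add: has_derivative_eq_rhs[OF _ ext])
  have in': "0 \<in> convex hull S1" "x \<in> convex hull S1" using assms S12(6) hull_subset by fast+
  have "s *\<^sub>R x \<in> convex hull S1"
    using convexD[OF convex_convex_hull in', of "1 - s" s] assms by simp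
  then have "norm (grad P (s *\<^sub>R x) - grad P 0) \<le> Pt * norm (s *\<^sub>R x - 0)"
    using differentiable_bound[OF convex_convex_hull has_derivative_at_withinI[OF hd] hessian_le_Pt, of S1] in' by blast
  then show ?thesis using gradP_zero assms by simp
qed

text \<open>Second-order Taylor bound at the minimum 0, taken along the ray through \<open>x\<close>
  by subtracting the expected quadratic.\<close>

lemma P_le:
  assumes "x \<in> S1" shows "P x \<le> Pt / 2 * (norm x)\<^sup>2"
proof -
  let ?g = "\<lambda>s. P (s *\<^sub>R x) - Pt * (norm x)\<^sup>2 * s\<^sup>2 / 2"
  have d: "(?g has_real_derivative (grad P (s *\<^sub>R x) \<bullet> x - Pt * (norm x)\<^sup>2 * s)) (at s)" for s
  proof -
    have "((\<lambda>s. s *\<^sub>R x) has_derivative (\<lambda>h. h *\<^sub>R x)) (at s)" by (auto intro!: derivative_eq_intros)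
    then have "((\<lambda>s. P (s *\<^sub>R x)) has_derivative (\<lambda>h. grad P (s *\<^sub>R x) \<bullet> (h *\<^sub>R x))) (at s)"
      by (rule has_derivative_compose[OF _ grad_has_derivative[OF P1]])
    then have "((\<lambda>s. P (s *\<^sub>R x)) has_real_derivative grad P (s *\<^sub>R x) \<bullet> x) (at s)"
      by (simp add: has_field_derivative_def mult_commute_abs)
    then show ?thesis by (auto intro!: derivative_eq_intros)
  qed
  have "?g 1 \<le> ?g 0"
  proof (rule DERIV_nonpos_imp_nonincreasing[of 0 1 ?g])
    fix s :: real assume s: "0 \<le> s" "s \<le> 1"
    have "grad P (s *\<^sub>R x) \<bullet> x \<le> norm (grad P (s *\<^sub>R x)) * norm x" by (rule norm_cauchy_schwarz)
    also have "\<dots> \<le> (Pt * (s * norm x)) * norm x" by (intro mult_right_mono gradP_le assms s) simp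
    finally have "grad P (s *\<^sub>R x) \<bullet> x - Pt * (norm x)\<^sup>2 * s \<le> 0" by (simp add: power2_eq_square algebra_simps)
    then show "\<exists>y. (?g has_real_derivative y) (at s) \<and> y \<le> 0" using d by blast
  qed simp
  then show ?thesis using P(3) by (simp add: positive_definite_fun_def)
qed

lemma Pt_pos: "0 < Pt"
proof -
  obtain x where x: "x \<in> S1" "x \<noteq> 0" using S1_nonzero by blast
  have "K1 * (norm x)\<^sup>2 \<le> Pt / 2 * (norm x)\<^sup>2" using P_le[OF x(1)] PK1 x(1) S12(7) by fastforce
  then have "K1 \<le> Pt / 2" using x by (simp add: mult_le_cancel_right)
  then show ?thesis using consts2 by linarith
qed

text \<open>\<open>3 * \<mu> / Pt\<close> is the rate of \<open>P\<close> in
  \<open>plant_decay\<close>: a quarter of the decay \<open>2 * \<mu>\<close> is spent on the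
  predictor error, and \<open>P x \<le> Pt / 2 * (norm x)\<^sup>2\<close>. Strictness leaves a
  margin for the forcing term.\<close>

lemma \<sigma>_P: "2 * \<sigma> < 3 * \<mu> / Pt"
proof -
  have "\<sigma> \<le> \<mu> / (sqrt (real CARD('n)) * Pt)" using \<sigma>_le by simp
  also have "\<dots> \<le> \<mu> / (1 * Pt)"
  proof (rule divide_left_mono)
    have "1 \<le> CARD('n)" by (simp add: Suc_leI)
    then have "1 \<le> real CARD('n)" by linarith
    then have "1 \<le> sqrt (real CARD('n))" by simp
    then show "1 * Pt \<le> sqrt (real CARD('n)) * Pt" using Pt_pos by (intro mult_right_mono) auto
    then show "0 < sqrt (real CARD('n)) * Pt * (1 * Pt)" using Pt_pos by simp
  qed (use consts2 in simp)
  finally have "\<sigma> \<le> \<mu> / Pt" by simp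
  moreover have "0 < \<mu> / Pt" using consts2 Pt_pos by simp
  ultimately show ?thesis by (simp add: add_divide_distrib)
qed

text \<open>At least half of the observer rate \<open>c * \<omega> / matnorm Q\<close> is left after
  weighting with the exponent \<open>2 * \<sigma>\<close>; this is the origin of the factor 2 under
  the square root in \<open>noise_gain\<close>.\<close>

lemma \<sigma>_Q: "2 * \<sigma> \<le> c * \<omega> / matnorm Q / 2"
proof -
  have "\<sigma> \<le> c * \<omega> / (4 * matnorm Q)" using \<sigma>_le by simp
  then show ?thesis by simp
qed

end

section \<open>Solutions of the closed loop\<close>

lemma has_integral_norm_le:
  fixes g :: "real \<Rightarrow> 'a::euclidean_space"
  assumes "(g has_integral I) {s..t}" "s \<le> t" "\<And>l. l \<in> {s..t} \<Longrightarrow> norm (g l) \<le> B"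
  shows "norm I \<le> B * (t - s)"
  using norm_integral_le[OF has_integral_integrable[OF assms(1)] assms(2,3)] integral_unique[OF assms(1)] by simp

text \<open>The bound on the right-hand side becomes a Lipschitz constant through the integral
  formula, which absolute continuity justifies.\<close>

lemma abs_cont_ode_lipode:
  fixes y :: "real \<Rightarrow> 'a::euclidean_space"
  assumes ac: "abs_cont_on {a..b} y" and ode: "ode_ae I y F" and I: "I \<in> sets lebesgue" "{a..b} \<subseteq> I"
    and B: "\<And>t. t \<in> {a..b} \<Longrightarrow> norm (F t) \<le> B" and B0: "0 \<le> B"
  shows "lipode a b y F"
proof -
  obtain S where S: "negligible S" "\<And>t. t \<in> I - S \<Longrightarrow> (y has_vector_derivative F t) (at t)"
    using ode_ae_negligible[OF ode I(1)] by metis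
  have le: "norm (y t - y s) \<le> B * (t - s)" if st: "a \<le> s" "s \<le> t" "t \<le> b" for s t
  proof -
    have "(F has_integral (y t - y s)) {s..t}"
    proof (rule abs_cont_FTC[OF abs_cont_on_subset[OF ac] st(2) S(1)])
      show "{s..t} \<subseteq> {a..b}" using st by auto
      fix l assume "l \<in> {s..t} - S"
      then have "l \<in> I - S" using st I(2) by auto
      then show "(y has_vector_derivative F l) (at l)" by (rule S(2))
    qed
    then show ?thesis by (rule has_integral_norm_le[OF _ st(2)]) (use B st in auto)
  qed
  have "B-lipschitz_on {a..b} y"
  proof (rule lipschitz_onI)
    fix s t assume "s \<in> {a..b}" "t \<in> {a..b}"
    then show "dist (y s) (y t) \<le> B * dist s t"
      using le[of s t] le[of t s] by (cases "s \<le> t") (auto simp: dist_norm norm_minus_commute)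
  qed (rule B0)
  then show ?thesis by (rule lipodeI[OF _ S(1)]) (use S(2) I(2) in auto)
qed

locale closed_loop_solution_locale = closed_loop_setup +
  fixes ts e x0 z0 w0 \<xi>0 u0 x z w \<xi> u
  assumes ts: "time_partition ts" and gaps: "\<And>i. ts (Suc i) - ts i \<le> Ts"
    and e: "Linf_fun {0..} UNIV e" and \<xi>0: "\<And>j. j \<in> {1..N} \<Longrightarrow> Linf_fun {-\<delta>..<0} UNIV (\<xi>0 j)"
    and x0: "continuous_on {-r..0} x0" and u0: "Linf_fun {-r-\<tau>..<0} U u0"
    and sol: "closed_loop_solution f h (khat f h V W p L R) kf q \<psi> \<tau> r N ts e x0 z0 w0 \<xi>0 u0 x z w \<xi> u"
begin

lemmas sol' = sol[unfolded closed_loop_solution_def Let_def, folded \<delta>_def]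

lemma x_ac: "0 \<le> T \<Longrightarrow> abs_cont_on {0..T} x" and x_ode: "ode_ae {0..} x (\<lambda>t. f (x t) (u (t - \<tau>)))"
  and z_ac: "0 \<le> T \<Longrightarrow> abs_cont_on {0..T} z"
  and z_ode: "ode_ae {0..} z (\<lambda>t. f (z t) (u (t - r - \<tau>)) + kh (z t) (w t) (u (t - r - \<tau>)))"
  and w_ac: "abs_cont_on {ts i..<ts (Suc i)} w"
  and w_ode: "ode_ae {ts i..<ts (Suc i)} w (\<lambda>t. jacobian h (at (z t)) *v f (z t) (u (t - r - \<tau>)))"
  and w_sample: "1 \<le> i \<Longrightarrow> w (ts i) = h (x (ts i - r)) + e (ts i)"
  and xi0: "0 \<le> t \<Longrightarrow> \<xi> 0 t = z t"
  and xi_Linf: "j \<in> {1..N} \<Longrightarrow> 0 \<le> T \<Longrightarrow> Linf_fun {-\<delta>..T} UNIV (\<xi> j)"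
  and xi_eq': "j \<in> {1..N} \<Longrightarrow> 0 \<le> t \<Longrightarrow> \<xi> j t = q (norm (\<xi> (j - 1) t) / \<psi> (z t)) *\<^sub>R \<xi> (j - 1) t
           + integral {0..\<delta>} (\<lambda>s. f (q (norm (\<xi> j (t + s - \<delta>)) / \<psi> (z t)) *\<^sub>R \<xi> j (t + s - \<delta>))
                 (u (t + (real j - 1) * \<delta> - \<tau> - r + s)))"
  and u_eq: "0 \<le> t \<Longrightarrow> u t = kf (\<xi> N t)"
  and x_init: "\<theta> \<in> {-r..0} \<Longrightarrow> x \<theta> = x0 \<theta>" and z_init: "z 0 = z0" and w_init: "w 0 = w0"
  and xi_init: "j \<in> {1..N} \<Longrightarrow> \<theta> \<in> {-\<delta>..<0} \<Longrightarrow> \<xi> j \<theta> = \<xi>0 j \<theta>"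
  and u_init: "\<theta> \<in> {-r-\<tau>..<0} \<Longrightarrow> u \<theta> = u0 \<theta>"
  using sol' by blast+

lemma xi_eq: "j \<in> {1..N} \<Longrightarrow> 0 \<le> t \<Longrightarrow> \<xi> j t = sat (\<xi> (j - 1) t) (z t)
           + integral {0..\<delta>} (\<lambda>s. f (sat (\<xi> j (t + s - \<delta>)) (z t)) (u (t + (real j - 1) * \<delta> - \<tau> - r + s)))"
  unfolding sat_def by (rule xi_eq')

section \<open>Boundedness and regularity along a solution\<close>

lemma u_U: "-r-\<tau> \<le> v \<Longrightarrow> u v \<in> U"
proof (cases "v < 0")
  case True
  assume "-r-\<tau> \<le> v"
  then have "v \<in> {-r-\<tau>..<0}" using True by simp
  then show ?thesis using u_init[of v] u0 unfolding Linf_fun_def by auto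
next
  case False then show ?thesis using u_eq[of v] kf(2) by simp
qed

lemma N\<delta>: "real N * \<delta> = r + \<tau>" using N by (simp add: \<delta>_def)

lemma j\<delta>: "j \<le> N \<Longrightarrow> real j * \<delta> \<le> r + \<tau>"
  using mult_right_mono[of "real j" "real N" \<delta>] \<delta>_nonneg N\<delta> by simp

lemma x_cont: "0 \<le> T \<Longrightarrow> continuous_on {0..T} x" and z_cont: "0 \<le> T \<Longrightarrow> continuous_on {0..T} z"
  using abs_cont_imp_continuous_on[OF x_ac] abs_cont_imp_continuous_on[OF z_ac] is_interval_cc by auto

lemma x_bounded: "\<exists>M. \<forall>t\<in>{-r..T}. norm (x t) \<le> M"
proof -
  have "compact (x0 ` {-r..0})" using x0 by (rule compact_continuous_image) simp
  then have "bounded (x0 ` {-r..0})" by (rule compact_imp_bounded)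
  then obtain M1 where M1: "\<forall>t\<in>{-r..0}. norm (x0 t) \<le> M1" unfolding bounded_iff by blast
  have "compact (x ` {0..max 0 T})" using x_cont[of "max 0 T"] by (intro compact_continuous_image) auto
  then have "bounded (x ` {0..max 0 T})" by (rule compact_imp_bounded)
  then obtain M2 where M2: "\<forall>t\<in>{0..max 0 T}. norm (x t) \<le> M2" unfolding bounded_iff by blast
  have "norm (x t) \<le> max M1 M2" if t: "t \<in> {-r..T}" for t
  proof (cases "t \<le> 0")
    case True
    then have "norm (x t) \<le> M1" using M1 x_init[of t] t by simp
    then show ?thesis by simp
  next
    case False
    then have "norm (x t) \<le> M2" using M2 t by simp
    then show ?thesis by simp
  qed
  then show ?thesis by blast
qed

lemma z_bounded: "\<exists>M. \<forall>t\<in>{0..T}. norm (z t) \<le> M"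
proof -
  have "compact (z ` {0..max 0 T})" using z_cont[of "max 0 T"] by (intro compact_continuous_image) auto
  then have "bounded (z ` {0..max 0 T})" by (rule compact_imp_bounded)
  then obtain M2 where "\<forall>t\<in>{0..max 0 T}. norm (z t) \<le> M2" unfolding bounded_iff by blast
  then show ?thesis by (intro exI[of _ M2]) auto
qed

lemma w_integral:
  assumes "ts i \<le> t" "t < ts (Suc i)"
  shows "((\<lambda>s. jacobian h (at (z s)) *v f (z s) (u (s - r - \<tau>))) has_integral (w t - w (ts i))) {ts i..t}"
proof -
  obtain S where S: "negligible S" "\<And>t. t \<in> {ts i..<ts (Suc i)} - S \<Longrightarrow> (w has_vector_derivative jacobian h (at (z t)) *v f (z t) (u (t - r - \<tau>))) (at t)"
    using ode_ae_negligible[OF w_ode] by (metis (no_types, lifting) lborelD_Collect sets_completionI_sets atLeastLessThan_borel sets_lborel)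
  show ?thesis
    by (rule abs_cont_FTC[OF abs_cont_on_subset[OF w_ac[of i]] assms(1) S(1) S(2)]) (use assms in auto)
qed

text \<open>\<open>w\<close> is reset at the sampling times, so compactness does not bound it. It
  restarts from a measurement, or from \<open>w0\<close>, and then drifts for at most
  \<open>Ts\<close>; the bound is therefore independent of the number of samples.\<close>

lemma w_bound:
  assumes Mz: "\<And>l. l \<in> {0..T} \<Longrightarrow> norm (z l) \<le> Mz" and Bf: "\<And>z u. norm z \<le> Mz \<Longrightarrow> u \<in> U \<Longrightarrow> norm (jacobian h (at z) *v f z u) \<le> Bf" "0 \<le> Bf"
    and Mh: "\<And>l. l \<in> {-r..T} \<Longrightarrow> norm (h (x l)) \<le> Mh" "0 \<le> Mh" and ee: "\<And>l. l \<in> {0..T} \<Longrightarrow> norm (e l) \<le> \<epsilon>" "0 \<le> \<epsilon>"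
    and t: "t \<in> {0..T}"
  shows "norm (w t) \<le> norm w0 + Mh + \<epsilon> + Bf * Ts"
proof -
  define i where "i = sampling_index ts t"
  have i: "0 \<le> ts i" "ts i \<le> t" "t < ts (Suc i)"
    unfolding i_def using sampling_index_nonneg[OF ts] sampling_index_lower[OF ts] sampling_index_upper[OF ts] t by auto
  have "norm (w t - w (ts i)) \<le> Bf * (t - ts i)"
  proof (rule has_integral_norm_le[OF w_integral[OF i(2,3)] i(2)])
    show "norm (jacobian h (at (z s)) *v f (z s) (u (s - r - \<tau>))) \<le> Bf" if "s \<in> {ts i..t}" for s
      using that i t by (intro Bf(1) Mz u_U) auto
  qed
  also have "\<dots> \<le> Bf * Ts" using i gaps[of i] Bf(2) by (intro mult_left_mono) auto
  finally have 1: "norm (w t - w (ts i)) \<le> Bf * Ts" .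
  have "norm (w (ts i)) \<le> norm w0 + Mh + \<epsilon>"
  proof (cases "i = 0")
    case True
    then have "w (ts i) = w0" using w_init ts by (simp add: time_partition_def)
    then show ?thesis using Mh ee by simp
  next
    case False
    then have "norm (w (ts i)) \<le> norm (h (x (ts i - r))) + norm (e (ts i))" using w_sample[of i] norm_triangle_ineq by simp
    also have "\<dots> \<le> Mh + \<epsilon>" using i t delays by (intro add_mono Mh(1) ee(1)) auto
    finally show ?thesis using norm_ge_zero[of w0] by linarith
  qed
  then show ?thesis using 1 norm_triangle_ineq[of "w t - w (ts i)" "w (ts i)"] by simp
qed

lemma e_bounded: "\<exists>\<epsilon>\<ge>0. \<forall>l\<ge>0. norm (e l) \<le> \<epsilon>"
proof -
  have "bounded (e ` {0..})" using e unfolding Linf_fun_def by blast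
  then obtain B where "\<forall>l\<in>{0..}. norm (e l) \<le> B" unfolding bounded_iff by blast
  then show ?thesis by (intro exI[of _ "max 0 B"]) (auto simp: le_max_iff_disj)
qed

lemma w_bounded: "\<exists>M. \<forall>t\<in>{0..T}. norm (w t) \<le> M"
proof -
  obtain Mz where Mz: "\<forall>t\<in>{0..T}. norm (z t) \<le> Mz" using z_bounded by blast
  obtain C where C: "0 \<le> C" "\<forall>z u. norm z \<le> Mz \<and> u \<in> U \<longrightarrow> norm (jacobian h (at z) *v f z u) \<le> C" using Dhf_bounded by blast
  obtain Mx where Mx: "\<forall>t\<in>{-r..T}. norm (x t) \<le> Mx" using x_bounded by blast
  obtain Mh where Mh: "Mh > 0" "\<forall>x\<in>cball 0 Mx. norm (h x) \<le> Mh" using lipb_bound[OF blip_lipb[OF h_blip bounded_cball, of 0 Mx]] by blast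
  obtain \<epsilon> where eps: "0 \<le> \<epsilon>" "\<forall>l\<ge>0. norm (e l) \<le> \<epsilon>" using e_bounded by blast
  have "norm (w t) \<le> norm w0 + Mh + \<epsilon> + C * Ts" if "t \<in> {0..T}" for t
    by (rule w_bound[of T Mz C Mh \<epsilon> t]) (use Mz C Mx Mh eps that in auto)
  then show ?thesis by blast
qed

lemma x_lipode: "lipode 0 T x (\<lambda>t. f (x t) (u (t - \<tau>)))"
proof (cases "0 \<le> T")
  case True
  obtain Mx where Mx: "\<forall>t\<in>{-r..T}. norm (x t) \<le> Mx" using x_bounded by blast
  obtain C where C: "\<forall>z u. norm z \<le> Mx \<and> u \<in> U \<longrightarrow> norm (f z u) \<le> C" using f_bounded by blast
  have B: "norm (f (x t) (u (t - \<tau>))) \<le> max 0 C" if "t \<in> {0..T}" for t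
  proof -
    have "norm (x t) \<le> Mx" "u (t - \<tau>) \<in> U" using Mx that delays u_U[of "t - \<tau>"] by auto
    then show ?thesis using C by (simp add: le_max_iff_disj)
  qed
  show ?thesis by (rule abs_cont_ode_lipode[OF x_ac[OF True] x_ode _ _ B]) auto
qed (auto intro!: lipodeI[of 0 _ _ _ "{}"])

lemma z_lipode: "lipode 0 T z (\<lambda>t. f (z t) (u (t - r - \<tau>)) + kh (z t) (w t) (u (t - r - \<tau>)))"
proof (cases "0 \<le> T")
  case True
  obtain Mz where Mz: "\<forall>t\<in>{0..T}. norm (z t) \<le> Mz" using z_bounded by blast
  obtain Mw where Mw: "\<forall>t\<in>{0..T}. norm (w t) \<le> Mw" using w_bounded by blast
  obtain C where C: "\<forall>z u. norm z \<le> Mz \<and> u \<in> U \<longrightarrow> norm (f z u) \<le> C" using f_bounded by blast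
  obtain Mh where Mh: "Mh > 0" "\<forall>x\<in>cball 0 Mz. norm (h x) \<le> Mh" using lipb_bound[OF blip_lipb[OF h_blip bounded_cball, of 0 Mz]] by blast
  have B: "norm (f (z t) (u (t - r - \<tau>)) + kh (z t) (w t) (u (t - r - \<tau>))) \<le> max 0 (C + 2 * matnorm L * (Mh + Mw))" if t: "t \<in> {0..T}" for t
  proof -
    have a: "norm (z t) \<le> Mz" "u (t - r - \<tau>) \<in> U" "norm (w t) \<le> Mw" using Mz Mw t delays u_U[of "t - r - \<tau>"] by auto
    have "norm (h (z t) - w t) \<le> Mh + Mw" using Mh(2)[rule_format, of "z t"] a norm_triangle_ineq4[of "h (z t)" "w t"] by simp
    then have "2 * matnorm L * norm (h (z t) - w t) \<le> 2 * matnorm L * (Mh + Mw)" using Ln_nonneg by (intro mult_left_mono) auto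
    then have "norm (kh (z t) (w t) (u (t - r - \<tau>))) \<le> 2 * matnorm L * (Mh + Mw)" using kh_norm[OF a(2), of "z t" "w t"] by linarith
    moreover have "norm (f (z t) (u (t - r - \<tau>))) \<le> C" using C a by blast
    ultimately have "norm (f (z t) (u (t - r - \<tau>)) + kh (z t) (w t) (u (t - r - \<tau>))) \<le> C + 2 * matnorm L * (Mh + Mw)"
      by (rule norm_triangle_mono[rotated])
    then show ?thesis by simp
  qed
  show ?thesis by (rule abs_cont_ode_lipode[OF z_ac[OF True] z_ode _ _ B]) auto
qed (auto intro!: lipodeI[of 0 _ _ _ "{}"])

section \<open>Entry into the level sets\<close>

lemma Vx_lipode: "lipode 0 T (\<lambda>t. V (x t)) (\<lambda>t. grad V (x t) \<bullet> f (x t) (u (t - \<tau>)))"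
  by (rule lipode_chain[OF x_lipode V_blip grad_has_derivative[OF V1]])

lemma Vz_lipode: "lipode 0 T (\<lambda>t. V (z t)) (\<lambda>t. grad V (z t) \<bullet> (f (z t) (u (t - r - \<tau>)) + kh (z t) (w t) (u (t - r - \<tau>))))"
  by (rule lipode_chain[OF z_lipode V_blip grad_has_derivative[OF V1]])

lemma W_nonneg: "0 \<le> W v" using W(2) by blast

lemma Vx_le: "0 \<le> t \<Longrightarrow> V (x t) \<le> max (V (x 0)) R"
proof (rule absorbing_level(1)[OF Vx_lipode, of t 0])
  fix l assume "l \<in> {0..t}" "R < V (x l)"
  then show "grad V (x l) \<bullet> f (x l) (u (l - \<tau>)) \<le> - 0"
    using gradV_f[of "x l" "u (l - \<tau>)"] W_nonneg[of "x l"] u_U[of "l - \<tau>"] delays by simp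
qed auto

lemma Vz_le: "0 \<le> t \<Longrightarrow> V (z t) \<le> max (V (z 0)) b"
proof (rule absorbing_level(1)[OF Vz_lipode, of t 0])
  fix l assume "l \<in> {0..t}" "b < V (z l)"
  then show "grad V (z l) \<bullet> (f (z l) (u (l - r - \<tau>)) + kh (z l) (w l) (u (l - r - \<tau>))) \<le> - 0"
    using gradV_kh[of "z l" "u (l - r - \<tau>)" "w l"] W_nonneg[of "z l"] u_U[of "l - r - \<tau>"] delays by simp
qed auto

text \<open>Outside the level sets \<open>V\<close> falls at rate at least \<open>w'\<close>; a fall
  lasting for the whole time \<open>t\<close> would make it negative.\<close>

lemma entry:
  assumes w: "w' > 0" "\<And>v. R < V v \<Longrightarrow> V v \<le> M \<Longrightarrow> w' \<le> W v" and M: "V (x 0) \<le> M" "V (z 0) \<le> M" "b \<le> M"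
    and t: "M < w' * t" "0 \<le> t"
  shows "V (x t) \<le> R" "V (z t) \<le> b"
proof -
  have "V (x t) \<le> R \<or> V (x t) \<le> V (x 0) - w' * (t - 0)"
  proof (rule absorbing_level(2)[OF Vx_lipode])
    fix l assume l: "l \<in> {0..t}" "R < V (x l)"
    have "V (x l) \<le> M" using Vx_le[of l] l M consts3 by auto
    then show "grad V (x l) \<bullet> f (x l) (u (l - \<tau>)) \<le> - w'"
      using gradV_f[of "x l" "u (l - \<tau>)"] w(2)[of "x l"] u_U[of "l - \<tau>"] delays l by simp
  qed (use t w in auto)
  moreover have "0 \<le> V (x t)" "0 \<le> V (z t)" using V(2) by auto
  ultimately show "V (x t) \<le> R" using M t by auto
  have "V (z t) \<le> b \<or> V (z t) \<le> V (z 0) - w' * (t - 0)"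
  proof (rule absorbing_level(2)[OF Vz_lipode])
    fix l assume l: "l \<in> {0..t}" "b < V (z l)"
    have "V (z l) \<le> M" using Vz_le[of l] l M by auto
    then show "grad V (z l) \<bullet> (f (z l) (u (l - r - \<tau>)) + kh (z l) (w l) (u (l - r - \<tau>))) \<le> - w'"
      using gradV_kh[of "z l" "u (l - r - \<tau>)" "w l"] w(2)[of "z l"] u_U[of "l - r - \<tau>"] delays l consts3 by simp
  qed (use t w in auto)
  then show "V (z t) \<le> b" using \<open>0 \<le> V (z t)\<close> M t by auto
qed

section \<open>Measurability and size of the input and the predictors\<close>

lemma u_meas: "0 \<le> T \<Longrightarrow> (\<lambda>s. if s \<in> {-r-\<tau>..T} then u s else 0) \<in> borel_measurable lebesgue"
proof -
  assume T: "0 \<le> T"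
  have N1: "N \<in> {1..N}" using N by simp
  have "\<xi> N \<in> borel_measurable (lebesgue_on {-\<delta>..T})" using xi_Linf[OF N1 T] by (simp add: Linf_fun_def)
  then have "(\<lambda>s. if s \<in> {-\<delta>..T} then \<xi> N s else 0) \<in> borel_measurable lebesgue" by (rule borel_measurable_if_I) simp
  then have k: "(\<lambda>s. kf (if s \<in> {-\<delta>..T} then \<xi> N s else 0)) \<in> borel_measurable lebesgue"
    using blip_continuous[OF kf_blip] by (rule borel_measurable_continuous_on[rotated])
  have "u0 \<in> borel_measurable (lebesgue_on {-r-\<tau>..<0})" using u0 by (simp add: Linf_fun_def)
  then have "(\<lambda>s. if s \<in> {-r-\<tau>..<0} then u0 s else 0) \<in> borel_measurable lebesgue" by (rule borel_measurable_if_I) simp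
  from measurable_sign_cases[OF this k]
  have m: "(\<lambda>t. if t < 0 then if t \<in> {-r-\<tau>..<0} then u0 t else 0 else kf (if t \<in> {-\<delta>..T} then \<xi> N t else 0)) \<in> borel_measurable lebesgue" .
  \<comment> \<open>Beyond \<open>T\<close> the right-hand side is \<open>kf 0\<close>, which equals
    0.\<close>
  have "(\<lambda>s. if s \<in> {-r-\<tau>..T} then u s else 0) = (\<lambda>t. if t < 0 then if t \<in> {-r-\<tau>..<0} then u0 t else 0 else kf (if t \<in> {-\<delta>..T} then \<xi> N t else 0))"
    using T delays \<delta>_nonneg u_init u_eq kf(3) by (intro ext) auto
  then show ?thesis using m by (simp only:)
qed

lemma xi_meas: "j \<in> {1..N} \<Longrightarrow> 0 \<le> T \<Longrightarrow> (\<lambda>s. if s \<in> {-\<delta>..T} then \<xi> j s else 0) \<in> borel_measurable lebesgue"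
  using xi_Linf[of j T] by (intro borel_measurable_if_I) (auto simp: Linf_fun_def)

lemma predictor_integrable:
  assumes j: "j \<in> {1..N}" and t: "0 \<le> t"
  shows "(\<lambda>s. f (sat (\<xi> j (t + s - \<delta>)) \<zeta>) (u (t + (real j - 1) * \<delta> - \<tau> - r + s))) integrable_on {0..\<delta>}"
proof -
  define xx where "xx = (\<lambda>s. if s \<in> {-\<delta>..t} then \<xi> j s else 0)"
  define uu where "uu = (\<lambda>s. if s \<in> {-r-\<tau>..t} then u s else 0)"
  let ?d = "(real j - 1) * \<delta> - \<tau> - r"
  have m: "xx \<in> borel_measurable lebesgue" "uu \<in> borel_measurable lebesgue" unfolding xx_def uu_def using xi_meas[OF j t] u_meas[OF t] by auto
  have uU: "uu s \<in> U" for s using u_U U(3) by (simp add: uu_def)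
  have "(\<lambda>s. (xx (s + (t - \<delta>)), uu (s + (t + ?d)))) \<in> borel_measurable lebesgue"
    by (intro borel_measurable_Pair measurable_lebesgue_shift m)
  moreover have "blip (\<lambda>p. f (sat (fst p) \<zeta>) (snd p))"
    unfolding blip_def by (intro allI impI f_lipb sat_lipb lipb_const lipb_bounded_linear bounded_linear_fst bounded_linear_snd)
  ultimately have "(\<lambda>s. f (sat (xx (s + (t - \<delta>))) \<zeta>) (uu (s + (t + ?d)))) \<in> borel_measurable lebesgue"
    using borel_measurable_continuous_on[OF blip_continuous] by fastforce
  then have "(\<lambda>s. f (sat (xx (s + (t - \<delta>))) \<zeta>) (uu (s + (t + ?d)))) integrable_on {0..\<delta>}"
    by (rule bounded_measurable_integrable) (rule \<rho>_upper[OF sat_le_\<psi> uU])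
  moreover have "f (sat (xx (s + (t - \<delta>))) \<zeta>) (uu (s + (t + ?d))) = f (sat (\<xi> j (t + s - \<delta>)) \<zeta>) (u (t + (real j - 1) * \<delta> - \<tau> - r + s))"
    if s: "s \<in> {0..\<delta>}" for s
  proof -
    have a: "s + (t - \<delta>) \<in> {-\<delta>..t}" "s + (t - \<delta>) = t + s - \<delta>" using s t by auto
    have "real j * \<delta> \<le> r + \<tau>" using j by (intro j\<delta>) simp
    then have "?d \<le> - \<delta>" by (simp add: algebra_simps)
    moreover have "- r - \<tau> \<le> ?d" using j \<delta>_nonneg by (simp add: mult_nonneg_nonneg)
    ultimately have b: "s + (t + ?d) \<in> {-r-\<tau>..t}" "s + (t + ?d) = t + (real j - 1) * \<delta> - \<tau> - r + s" using s t by auto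
    have "xx v = \<xi> j v" if "v \<in> {-\<delta>..t}" for v using that by (simp add: xx_def)
    moreover have "uu v = u v" if "v \<in> {-r-\<tau>..t}" for v using that by (simp add: uu_def)
    ultimately show ?thesis using a b by metis
  qed
  ultimately show ?thesis by (rule integrable_eq)
qed

lemma u_arg: "j \<in> {1..N} \<Longrightarrow> 0 \<le> t \<Longrightarrow> 0 \<le> s \<Longrightarrow> u (t + (real j - 1) * \<delta> - \<tau> - r + s) \<in> U"
  using \<delta>_nonneg by (intro u_U) (simp add: mult_nonneg_nonneg)

text \<open>The saturation bounds both terms by quantities that depend on \<open>z t\<close> alone.
  Hence the predictors stay bounded as long as \<open>z\<close> does, whatever their own history
  is.\<close>

lemma xi_le_\<rho>:
  assumes j: "j \<in> {1..N}" and t: "0 \<le> t"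
  shows "norm (\<xi> j t) \<le> K * \<psi> (z t) + \<delta> * \<rho> (K * \<psi> (z t))"
proof -
  have "norm (integral {0..\<delta>} (\<lambda>s. f (sat (\<xi> j (t + s - \<delta>)) (z t)) (u (t + (real j - 1) * \<delta> - \<tau> - r + s)))) \<le> \<rho> (K * \<psi> (z t)) * (\<delta> - 0)"
    by (rule norm_integral_le[OF predictor_integrable[OF j t] \<delta>_nonneg]) (rule \<rho>_upper[OF sat_le_\<psi>], use u_arg[OF j t] in auto)
  then show ?thesis unfolding xi_eq[OF j t] using sat_le_\<psi>[of "\<xi> (j - 1) t" "z t"]
    by (intro norm_triangle_mono) (auto simp: mult.commute)
qed

end

section \<open>Decay inside the level sets\<close>

lemma sup_norm_le: "0 \<le> B \<Longrightarrow> (\<And>s. s \<in> A \<Longrightarrow> norm (g s) \<le> B) \<Longrightarrow> sup_norm A g \<le> B"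
  unfolding sup_norm_def by (auto intro: cSUP_least)

lemma le_add_of_squares:
  fixes a b c :: real
  assumes "a\<^sup>2 \<le> b\<^sup>2 + c\<^sup>2" "0 \<le> b" "0 \<le> c"
  shows "a \<le> b + c"
proof (rule power2_le_imp_le)
  have "0 \<le> 2 * b * c" using assms by simp
  then show "a\<^sup>2 \<le> (b + c)\<^sup>2" using assms(1) unfolding power2_sum by linarith
qed (use assms in simp)

lemma young: "0 < (m::real) \<Longrightarrow> a * b \<le> m / 2 * a\<^sup>2 + b\<^sup>2 / (2 * m)"
proof -
  assume m: "0 < m"
  have "0 \<le> (m * a - b)\<^sup>2" by simp
  then have "2 * m * (a * b) \<le> m\<^sup>2 * a\<^sup>2 + b\<^sup>2" by (simp add: power2_diff power_mult_distrib algebra_simps)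
  then have "a * b \<le> (m\<^sup>2 * a\<^sup>2 + b\<^sup>2) / (2 * m)" using m by (simp add: pos_le_divide_eq mult.commute mult.left_commute)
  also have "\<dots> = m / 2 * a\<^sup>2 + b\<^sup>2 / (2 * m)" using m by (simp add: add_divide_distrib power2_eq_square)
  finally show ?thesis .
qed

context closed_loop_setup
begin

text \<open>Gain from the weighted output error to the weighted observer error, as found in
  \<open>observer_error_step\<close>. Its product with \<open>Ts * G1 * exp (\<sigma> * Ts)\<close>,
  the gain back through the sampling, is the left-hand side of the sampling condition.\<close>

definition noise_gain :: real where "noise_gain = sqrt (2 * matnorm Q / K2) * (G2 * matnorm Q / (c * \<omega>))"
definition sampling_loop_gain :: real where "sampling_loop_gain = Ts * G1 * exp (\<sigma> * Ts) * noise_gain"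
text \<open>The terms \<open>1 + sqrt (matnorm Q / K2)\<close> belong to the start-up bound and
  \<open>noise_gain\<close> to the measurement error; one constant dominates both.\<close>

definition observer_error_gain :: real where "observer_error_gain = (1 + sqrt (matnorm Q / K2) + noise_gain) / (1 - sampling_loop_gain)"
definition predictor_loop_gain :: real where "predictor_loop_gain = \<delta> * M1q * M1f * exp (\<sigma> * \<delta>)"

primrec predictor_error_gain :: "nat \<Rightarrow> real" where
  "predictor_error_gain 0 = observer_error_gain"
| "predictor_error_gain (Suc j) = (1 + M1q * predictor_error_gain j) / (1 - predictor_loop_gain)"

lemma c_\<omega>_pos: "0 < c * \<omega>" using consts3 consts4 by simp

lemma noise_gain_nonneg: "0 \<le> noise_gain"
proof -
  have "0 \<le> G2 * matnorm Q / (c * \<omega>)" using gains_nonneg(4) Qn_pos c_\<omega>_pos by (intro divide_nonneg_pos) auto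
  moreover have "0 \<le> sqrt (2 * matnorm Q / K2)" using Qn_pos K2(1) by simp
  ultimately show ?thesis unfolding noise_gain_def by (rule mult_nonneg_nonneg[rotated])
qed

lemma sampling_loop_gain: "0 \<le> sampling_loop_gain" "sampling_loop_gain < 1"
proof -
  show "0 \<le> sampling_loop_gain" unfolding sampling_loop_gain_def using gains_nonneg(3) noise_gain_nonneg Ts_\<sigma> by (intro mult_nonneg_nonneg) auto
  show "sampling_loop_gain < 1" using sampling_gain unfolding sampling_loop_gain_def noise_gain_def by (simp only: mult.assoc)
qed

lemma predictor_loop_gain: "0 \<le> predictor_loop_gain" "predictor_loop_gain < 1"
  using predictor_gain gains_nonneg(1,2) \<delta>_nonneg unfolding predictor_loop_gain_def by auto

lemma observer_error_gain_nonneg: "0 \<le> observer_error_gain" and observer_error_gain_ge: "(1 + sqrt (matnorm Q / K2)) / (1 - sampling_loop_gain) \<le> observer_error_gain" "noise_gain / (1 - sampling_loop_gain) \<le> observer_error_gain"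
proof -
  have "0 \<le> sqrt (matnorm Q / K2)" using Qn_pos K2(1) by simp
  then show "0 \<le> observer_error_gain" "(1 + sqrt (matnorm Q / K2)) / (1 - sampling_loop_gain) \<le> observer_error_gain" "noise_gain / (1 - sampling_loop_gain) \<le> observer_error_gain"
    unfolding observer_error_gain_def using noise_gain_nonneg sampling_loop_gain by (auto intro!: divide_right_mono)
qed

lemma predictor_error_gain_nonneg: "0 \<le> predictor_error_gain j"
  by (induction j) (use observer_error_gain_nonneg gains_nonneg(1) predictor_loop_gain in auto)

lemma input_lipschitz_ex: "\<exists>C\<ge>0. \<forall>x \<xi>. x \<in> S1 \<longrightarrow> norm (f x (kf \<xi>) - f x (kf x)) \<le> C * norm (\<xi> - x)"
proof -
  have "lipb (S1 \<times> U) (\<lambda>p. f (fst p) (snd p))"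
    by (intro f_lipb lipb_bounded_linear bounded_linear_fst bounded_linear_snd bounded_Times bounded_U S12)
  then obtain C where C: "C > 0" "\<forall>p\<in>S1 \<times> U. \<forall>p'\<in>S1 \<times> U. norm (f (fst p) (snd p) - f (fst p') (snd p')) \<le> C * dist p p'"
    using lipb_bound by blast
  obtain M where M: "M-lipschitz_on UNIV kf" using kf(1) by blast
  have "norm (f x (kf \<xi>) - f x (kf x)) \<le> C * M * norm (\<xi> - x)" if "x \<in> S1" for x \<xi>
  proof -
    have "norm (f x (kf \<xi>) - f x (kf x)) \<le> C * dist (x, kf \<xi>) (x, kf x)"
      using C(2)[rule_format, of "(x, kf \<xi>)" "(x, kf x)"] that kf(2) by simp
    also have "dist (x, kf \<xi>) (x, kf x) = dist (kf \<xi>) (kf x)" by (simp add: dist_Pair_Pair)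
    also have "C * \<dots> \<le> C * (M * dist \<xi> x)" using C(1) lipschitz_onD[OF M] by (intro mult_left_mono) auto
    finally show ?thesis by (simp add: dist_norm mult.assoc)
  qed
  moreover have "0 \<le> C * M" using C lipschitz_on_nonneg[OF M] by simp
  ultimately show ?thesis by blast
qed

definition input_lipschitz :: real where "input_lipschitz = (SOME C. C \<ge> 0 \<and> (\<forall>x \<xi>. x \<in> S1 \<longrightarrow> norm (f x (kf \<xi>) - f x (kf x)) \<le> C * norm (\<xi> - x)))"

lemma input_lipschitz: "0 \<le> input_lipschitz" "x \<in> S1 \<Longrightarrow> norm (f x (kf \<xi>) - f x (kf x)) \<le> input_lipschitz * norm (\<xi> - x)"
  using someI_ex[OF input_lipschitz_ex] unfolding input_lipschitz_def[symmetric] by auto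

lemma feedback_lipschitz_ex: "\<exists>C\<ge>0. \<forall>\<xi>. norm (kf \<xi>) \<le> C * norm \<xi>"
proof -
  obtain M where M: "M-lipschitz_on UNIV kf" using kf(1) by blast
  have "norm (kf \<xi>) \<le> M * norm \<xi>" for \<xi> using lipschitz_onD[OF M, of \<xi> 0] kf(3) by (simp add: dist_norm)
  then show ?thesis using lipschitz_on_nonneg[OF M] by blast
qed

definition feedback_lipschitz :: real where "feedback_lipschitz = (SOME C. C \<ge> 0 \<and> (\<forall>\<xi>. norm (kf \<xi>) \<le> C * norm \<xi>))"

lemma feedback_lipschitz: "0 \<le> feedback_lipschitz" "norm (kf \<xi>) \<le> feedback_lipschitz * norm \<xi>"
  using someI_ex[OF feedback_lipschitz_ex] unfolding feedback_lipschitz_def[symmetric] by auto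

lemma output_lipschitz_ex: "\<exists>C\<ge>0. \<forall>x\<in>S1. norm (h x) \<le> C * norm x"
proof -
  obtain C where C: "C > 0" "\<forall>x\<in>S1. \<forall>x'\<in>S1. norm (h x - h x') \<le> C * dist x x'"
    using lipb_bound[OF blip_lipb[OF h_blip S12(2)]] by blast
  have "norm (h x) \<le> C * norm x" if "x \<in> S1" for x
    using C(2)[rule_format, OF that S12(6)] h(2) by (simp add: dist_norm)
  then show ?thesis using C(1) less_imp_le by blast
qed

definition output_lipschitz :: real where "output_lipschitz = (SOME C. C \<ge> 0 \<and> (\<forall>x\<in>S1. norm (h x) \<le> C * norm x))"

lemma output_lipschitz: "0 \<le> output_lipschitz" "x \<in> S1 \<Longrightarrow> norm (h x) \<le> output_lipschitz * norm x"
  using someI_ex[OF output_lipschitz_ex] unfolding output_lipschitz_def[symmetric] by auto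

text \<open>Gain from the last predictor error to the plant. Young's inequality turns the input
  error into a forcing with coefficient \<open>(Pt * input_lipschitz)\<^sup>2 / (2 * \<mu>)\<close>,
  the comparison lemma divides by the margin of the rate, and \<open>K1\<close> leads from
  \<open>P\<close> back to the norm.\<close>

definition forcing_gain :: real where "forcing_gain = sqrt ((Pt * input_lipschitz)\<^sup>2 / (2 * \<mu>) / (3 * \<mu> / Pt - 2 * \<sigma>) / K1)"
definition plant_gain :: real where "plant_gain = sqrt (Pt / (2 * K1)) + forcing_gain * predictor_error_gain N"

lemma forcing_gain_nonneg: "0 \<le> forcing_gain"
  unfolding forcing_gain_def using consts2 \<sigma>_P by simp

lemma plant_gain_nonneg: "0 \<le> plant_gain"
  unfolding plant_gain_def using forcing_gain_nonneg predictor_error_gain_nonneg Pt_pos consts2 by simp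

text \<open>The factor \<open>D\<close> pays for looking back over the delays: the claim concerns
  time \<open>t\<close>, but it rests on weighted estimates at times down to
  \<open>t - 2 * (r + \<tau>)\<close>. The summands belong to \<open>x\<close>, \<open>z\<close>,
  \<open>w\<close>, the predictors and the input, in this order.\<close>

definition ultimate_gain :: real where
  "ultimate_gain = (let D = exp (2 * \<sigma> * (r + \<tau>)) in plant_gain * D + (observer_error_gain + plant_gain * D) + (1 + Ts * G1 * exp (\<sigma> * Ts) * observer_error_gain + output_lipschitz * (plant_gain * D))
     + (\<Sum>j=1..N. D * (predictor_error_gain j + plant_gain)) + feedback_lipschitz * (D * (predictor_error_gain N + plant_gain)))"

end

text \<open>The data enter only through \<open>A\<close>, a bound for the weighted errors on the
  start-up windows, whose lengths are one sampling period and one predictor step. The plant is in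
  \<open>S1\<close> already from \<open>T0 - r\<close> on, since the observer follows
  \<open>x (l - r)\<close>. The lower bound on \<open>t\<close> puts all times needed for the
  estimate at \<open>t\<close> behind \<open>T0\<close>.\<close>

locale final_phase = closed_loop_solution_locale +
  fixes T0 A \<epsilon> t :: real
  assumes T0: "r \<le> T0" "0 < T0"
    and xS: "\<And>l. T0 - r \<le> l \<Longrightarrow> V (x l) \<le> R" and zS: "\<And>l. T0 \<le> l \<Longrightarrow> V (z l) \<le> b"
    and winE: "\<And>l. l \<in> {T0..T0 + Ts} \<Longrightarrow> l \<le> t \<Longrightarrow> exp (\<sigma> * l) * norm (z l - x (l - r)) \<le> A"
    and wineta: "\<And>j l. j \<in> {1..N} \<Longrightarrow> l \<in> {T0..T0 + \<delta>} \<Longrightarrow> l \<le> t \<Longrightarrow> exp (\<sigma> * l) * norm (\<xi> j l - x (l - r + real j * \<delta>)) \<le> A"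
    and winx: "exp (\<sigma> * T0) * norm (x (T0 + \<tau>)) \<le> A" and A: "0 \<le> A"
    and \<epsilon>: "\<And>l. l \<in> {0..t} \<Longrightarrow> norm (e l) \<le> \<epsilon>" "0 \<le> \<epsilon>"
    and tT: "T0 + Ts + 3 * (r + \<tau>) \<le> t"
begin

definition M :: "real \<Rightarrow> real" where "M l = A + exp (\<sigma> * l) * \<epsilon>"

lemma M_mono: "s \<le> l \<Longrightarrow> M s \<le> M l"
  unfolding M_def using Ts_\<sigma> \<epsilon>(2) by (intro add_left_mono mult_right_mono) auto

lemma M_nonneg: "0 \<le> M l" unfolding M_def using A \<epsilon>(2) by simp

lemma A_le_M: "A \<le> M l" unfolding M_def using \<epsilon>(2) by simp

lemma Tt: "T0 \<le> t"
proof -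
  have "0 \<le> 3 * (r + \<tau>)" using delays by simp
  then show ?thesis using tT Ts_\<sigma>(1) by linarith
qed

lemma X_lipode: "T0 \<le> a' \<Longrightarrow> lipode a' b' (\<lambda>l. x (l - r)) (\<lambda>l. f (x (l - r)) (u (l - r - \<tau>)))"
  using lipode_subset[OF lipode_shift[OF x_lipode[of "b' - r"], of r], of a' b'] T0 by simp

lemma E_cont: "continuous_on {T0..t'} (\<lambda>l. z l - x (l - r))"
  using lipode_continuous[OF lipode_diff[OF lipode_subset[OF z_lipode[of t'], of T0 t'] X_lipode[of T0 t']]] T0 by simp

text \<open>Between two samples the observer output drifts from the true output by the integral of
  the mismatch of the vector fields, at most \<open>Ts G\<^sub>1\<close> times the largest recent observer error.\<close>

lemma output_error:
  assumes m: "\<And>l. l \<in> {T0..s} \<Longrightarrow> exp (\<sigma> * l) * norm (z l - x (l - r)) \<le> m" and s: "T0 + Ts \<le> s" "s \<le> t" and m0: "0 \<le> m"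
  shows "exp (\<sigma> * s) * norm (w s - h (x (s - r))) \<le> exp (\<sigma> * s) * \<epsilon> + Ts * G1 * exp (\<sigma> * Ts) * m"
proof -
  have s0: "0 \<le> s" using s T0 Ts_\<sigma> by linarith
  define i where "i = sampling_index ts s"
  have i: "0 \<le> ts i" "ts i \<le> s" "s < ts (Suc i)"
    unfolding i_def using sampling_index_nonneg[OF ts] sampling_index_lower[OF ts s0] sampling_index_upper[OF ts] by auto
  \<comment> \<open>The last sample is at most \<open>Ts\<close> old and so not taken before
    \<open>T0 > 0\<close>; in particular it is a measurement and not the initial value
    \<open>w0\<close>.\<close>
  have iT: "T0 \<le> ts i" "s - Ts \<le> ts i" using i s gaps[of i] by linarith+
  have i1: "1 \<le> i"
  proof (rule ccontr)
    assume "\<not> 1 \<le> i"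
    then have "ts i = 0" using ts by (simp add: time_partition_def not_le)
    then show False using iT T0 by simp
  qed
  have hX: "((\<lambda>l. frechet_derivative h (at (x (l - r))) (f (x (l - r)) (u (l - r - \<tau>)))) has_integral (h (x (s - r)) - h (x (ts i - r)))) {ts i..s}"
    by (rule lipode_FTC[OF lipode_chain[OF X_lipode[OF iT(1)] h_blip Ck_Suc_has_derivative[OF h2]] i(2)])
  have "((\<lambda>l. jacobian h (at (z l)) *v f (z l) (u (l - r - \<tau>)) - jacobian h (at (x (l - r))) *v f (x (l - r)) (u (l - r - \<tau>)))
      has_integral ((w s - w (ts i)) - (h (x (s - r)) - h (x (ts i - r))))) {ts i..s}"
    using has_integral_diff[OF w_integral[OF i(2,3)] hX] by (simp add: jacobian_frechet[OF h2])
  then have "norm ((w s - w (ts i)) - (h (x (s - r)) - h (x (ts i - r)))) \<le> G1 * (m * exp (- \<sigma> * (s - Ts))) * (s - ts i)"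
  proof (rule has_integral_norm_le[OF _ i(2)])
    fix l assume l: "l \<in> {ts i..s}"
    then have lT: "l \<in> {T0..s}" using iT by auto
    have "norm (jacobian h (at (z l)) *v f (z l) (u (l - r - \<tau>)) - jacobian h (at (x (l - r))) *v f (x (l - r)) (u (l - r - \<tau>))) \<le> G1 * norm (z l - x (l - r))"
      using xS[of "l - r"] zS[of l] lT T0 by (intro G1_bound u_U) (auto simp: S1_def S2_def)
    also have "\<dots> \<le> G1 * (m * exp (- \<sigma> * (s - Ts)))"
    proof (rule mult_left_mono[OF _ gains_nonneg(3)])
      have "norm (z l - x (l - r)) = exp (- \<sigma> * l) * (exp (\<sigma> * l) * norm (z l - x (l - r)))" by (simp add: exp_minus)
      also have "\<dots> \<le> exp (- \<sigma> * (s - Ts)) * m"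
        using m[OF lT] l iT Ts_\<sigma> m0 by (intro mult_mono) auto
      finally show "norm (z l - x (l - r)) \<le> m * exp (- \<sigma> * (s - Ts))" by (simp only: mult.commute)
    qed
    finally show "norm (jacobian h (at (z l)) *v f (z l) (u (l - r - \<tau>)) - jacobian h (at (x (l - r))) *v f (x (l - r)) (u (l - r - \<tau>))) \<le> G1 * (m * exp (- \<sigma> * (s - Ts)))" .
  qed
  also have "\<dots> \<le> G1 * (m * exp (- \<sigma> * (s - Ts))) * Ts"
    using iT gains_nonneg(3) m0 by (intro mult_left_mono) auto
  finally have 1: "norm ((w s - w (ts i)) - (h (x (s - r)) - h (x (ts i - r)))) \<le> G1 * (m * exp (- \<sigma> * (s - Ts))) * Ts" .
  have "w s - h (x (s - r)) = e (ts i) + ((w s - w (ts i)) - (h (x (s - r)) - h (x (ts i - r))))"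
    using w_sample[OF i1] by simp
  then have "norm (w s - h (x (s - r))) \<le> norm (e (ts i)) + norm ((w s - w (ts i)) - (h (x (s - r)) - h (x (ts i - r))))"
    by (metis norm_triangle_ineq)
  also have "\<dots> \<le> \<epsilon> + G1 * (m * exp (- \<sigma> * (s - Ts))) * Ts" using 1 \<epsilon>(1)[of "ts i"] i s by (intro add_mono) auto
  finally have "exp (\<sigma> * s) * norm (w s - h (x (s - r))) \<le> exp (\<sigma> * s) * (\<epsilon> + G1 * (m * exp (- \<sigma> * (s - Ts))) * Ts)"
    by (intro mult_left_mono) auto
  also have "\<dots> = exp (\<sigma> * s) * \<epsilon> + Ts * G1 * (exp (\<sigma> * s) * exp (- \<sigma> * (s - Ts))) * m" by (simp add: algebra_simps)
  also have "exp (\<sigma> * s) * exp (- \<sigma> * (s - Ts)) = exp (\<sigma> * Ts)" by (simp add: exp_add[symmetric] algebra_simps)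
  finally show ?thesis .
qed

text \<open>Along \<open>y \<bullet> (Q *v y)\<close> the decay is \<open>2 * c * \<omega>\<close>
  times the squared error, and Young's inequality spends half of it on the output error. Exponential
  comparison and the bounds \<open>K2\<close> and \<open>matnorm Q\<close> of the quadratic form
  lead back to the norm.\<close>

lemma observer_error_step:
  assumes D: "\<And>s. s \<in> {T1..l} \<Longrightarrow> exp (\<sigma> * s) * norm (w s - h (x (s - r))) \<le> D" and l: "T0 \<le> T1" "T1 \<le> l" and D0: "0 \<le> D"
  shows "exp (\<sigma> * l) * norm (z l - x (l - r)) \<le> sqrt (matnorm Q / K2) * (exp (\<sigma> * T1) * norm (z T1 - x (T1 - r))) + noise_gain * D"
proof -
  define E where "E = (\<lambda>s. z s - x (s - r))"
  define E' where "E' = (\<lambda>s. (f (z s) (u (s - r - \<tau>)) + kh (z s) (w s) (u (s - r - \<tau>))) - f (x (s - r)) (u (s - r - \<tau>)))"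
  define q where "q = (\<lambda>y::real^'b. y \<bullet> (Q *v y))"
  \<comment> \<open>The remaining decay \<open>c * \<omega>\<close>, expressed as a rate of the
    quadratic form, which is at most \<open>matnorm Q\<close> times the squared norm.\<close>
  define \<gamma> where "\<gamma> = c * \<omega> / matnorm Q"
  define k where "k = (matnorm Q * G2)\<^sup>2 / (c * \<omega>)"
  have Elip: "lipode T1 l E E'"
    unfolding E_def E'_def by (rule lipode_diff[OF lipode_subset[OF z_lipode[of l]] X_lipode[OF l(1)]]) (use l T0 in auto)
  have qb: "blip q"
    unfolding blip_def q_def by (intro allI impI lipb_inner lipb_mv lipb_bounded_linear bounded_linear_ident)
  have qd: "(q has_derivative (\<lambda>v. y \<bullet> (Q *v v) + v \<bullet> (Q *v y))) (at y)" for y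
    unfolding q_def by (auto intro!: derivative_eq_intros bounded_linear_imp_has_derivative matrix_vector_mul_bounded_linear)
  have vl: "lipode T1 l (\<lambda>s. q (E s)) (\<lambda>s. E s \<bullet> (Q *v E' s) + E' s \<bullet> (Q *v E s))"
    by (rule lipode_chain[OF Elip qb qd])
  have q0: "0 \<le> q y" for y unfolding q_def using Q(2) by (cases "y = 0") (auto simp: less_imp_le)
  have qle: "q y \<le> matnorm Q * (norm y)\<^sup>2" for y
  proof -
    have "q y \<le> norm y * norm (Q *v y)" unfolding q_def by (rule norm_cauchy_schwarz)
    also have "\<dots> \<le> norm y * (matnorm Q * norm y)" using Q_le by (intro mult_left_mono) auto
    finally show ?thesis by (simp add: power2_eq_square algebra_simps)
  qed
  have \<gamma>: "2 * \<sigma> \<le> \<gamma> / 2" "0 < \<gamma>" using \<sigma>_Q c_\<omega>_pos Qn_pos by (auto simp: \<gamma>_def)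
  have k0: "0 \<le> k" using c_\<omega>_pos by (simp add: k_def)
  have "exp (2 * \<sigma> * l) * q (E l) \<le> exp (2 * \<sigma> * T1) * q (E T1) + k * D\<^sup>2 / (\<gamma> - 2 * \<sigma>)"
  proof (rule exponential_comparison_limit[OF vl l(2)])
    fix s assume s: "s \<in> {T1..l}"
    define v where "v = u (s - r - \<tau>)"
    have sT: "T0 \<le> s" "0 \<le> s - r" using s l T0 by auto
    have vU: "v \<in> U" unfolding v_def using sT delays by (intro u_U) simp
    have S: "z s \<in> S2" "x (s - r) \<in> S1" using zS[of s] xS[of "s - r"] sT by (auto simp: S1_def S2_def)
    define ew where "ew = norm (w s - h (x (s - r)))"
    have Eq: "E' s = (f (z s) v + kh (z s) (h (x (s - r))) v - f (x (s - r)) v) + (kh (z s) (w s) v - kh (z s) (h (x (s - r))) v)"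
      by (simp add: E'_def v_def)
    have "E s \<bullet> (Q *v E' s) = E s \<bullet> (Q *v (f (z s) v + kh (z s) (h (x (s - r))) v - f (x (s - r)) v)) + E s \<bullet> (Q *v (kh (z s) (w s) v - kh (z s) (h (x (s - r))) v))"
      unfolding Eq by (simp only: matrix_vector_right_distrib inner_add_right)
    also have "\<dots> \<le> - (c * \<omega>) * (norm (E s))\<^sup>2 + norm (E s) * (matnorm Q * (G2 * ew))"
    proof (rule add_mono)
      show "E s \<bullet> (Q *v (f (z s) v + kh (z s) (h (x (s - r))) v - f (x (s - r)) v)) \<le> - (c * \<omega>) * (norm (E s))\<^sup>2"
        unfolding E_def by (rule kh_observer[OF S vU])
      have "E s \<bullet> (Q *v (kh (z s) (w s) v - kh (z s) (h (x (s - r))) v)) \<le> norm (E s) * norm (Q *v (kh (z s) (w s) v - kh (z s) (h (x (s - r))) v))"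
        by (rule norm_cauchy_schwarz)
      also have "\<dots> \<le> norm (E s) * (matnorm Q * norm (kh (z s) (w s) v - kh (z s) (h (x (s - r))) v))"
        by (intro mult_left_mono Q_le) simp
      also have "\<dots> \<le> norm (E s) * (matnorm Q * (G2 * ew))"
        unfolding ew_def using Qn_pos by (intro mult_left_mono G2_bound S vU) auto
      finally show "E s \<bullet> (Q *v (kh (z s) (w s) v - kh (z s) (h (x (s - r))) v)) \<le> norm (E s) * (matnorm Q * (G2 * ew))" .
    qed
    also have "norm (E s) * (matnorm Q * (G2 * ew)) \<le> c * \<omega> / 2 * (norm (E s))\<^sup>2 + (matnorm Q * (G2 * ew))\<^sup>2 / (2 * (c * \<omega>))"
      by (rule young[OF c_\<omega>_pos])
    finally have 1: "2 * (E s \<bullet> (Q *v E' s)) \<le> - (c * \<omega>) * (norm (E s))\<^sup>2 + k * ew\<^sup>2"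
      by (simp add: k_def power_mult_distrib field_simps)
    have "\<gamma> * q (E s) \<le> \<gamma> * (matnorm Q * (norm (E s))\<^sup>2)" using \<gamma>(2) qle by (intro mult_left_mono) auto
    also have "\<dots> = (c * \<omega>) * (norm (E s))\<^sup>2" using Qn_pos by (simp add: \<gamma>_def)
    finally have 2: "- (c * \<omega>) * (norm (E s))\<^sup>2 \<le> - \<gamma> * q (E s)" by simp
    have "ew = exp (- \<sigma> * s) * (exp (\<sigma> * s) * ew)" by (simp add: exp_minus)
    also have "\<dots> \<le> exp (- \<sigma> * s) * D" unfolding ew_def by (intro mult_left_mono D[OF s]) simp
    finally have "ew\<^sup>2 \<le> (exp (- \<sigma> * s) * D)\<^sup>2" by (intro power_mono) (auto simp: ew_def)
    also have "\<dots> = D\<^sup>2 * exp (- 2 * \<sigma> * s)" by (simp add: power_mult_distrib power2_eq_square exp_add[symmetric])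
    finally have 3: "k * ew\<^sup>2 \<le> k * D\<^sup>2 * exp (- 2 * \<sigma> * s)" using k0 by (simp add: mult_left_mono mult.assoc)
    have "E s \<bullet> (Q *v E' s) + E' s \<bullet> (Q *v E s) = 2 * (E s \<bullet> (Q *v E' s))" using Q_sym[of "E' s" "E s"] by simp
    then show "E s \<bullet> (Q *v E' s) + E' s \<bullet> (Q *v E s) \<le> - \<gamma> * q (E s) + k * D\<^sup>2 * exp (- 2 * \<sigma> * s)" using 1 2 3 by linarith
  qed (use \<gamma> Ts_\<sigma> k0 q0 in auto)
  also have "k * D\<^sup>2 / (\<gamma> - 2 * \<sigma>) \<le> k * D\<^sup>2 / (\<gamma> / 2)" using \<gamma> k0 by (intro divide_left_mono) auto
  also have "k * D\<^sup>2 / (\<gamma> / 2) = 2 * matnorm Q * (G2 * matnorm Q / (c * \<omega>))\<^sup>2 * D\<^sup>2"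
    using Qn_pos c_\<omega>_pos by (simp add: k_def \<gamma>_def power2_eq_square field_simps)
  also have "exp (2 * \<sigma> * T1) * q (E T1) \<le> exp (2 * \<sigma> * T1) * (matnorm Q * (norm (E T1))\<^sup>2)"
    using qle by (intro mult_left_mono) auto
  finally have 4: "exp (2 * \<sigma> * l) * q (E l) \<le> matnorm Q * (exp (\<sigma> * T1) * norm (E T1))\<^sup>2 + 2 * matnorm Q * (G2 * matnorm Q / (c * \<omega>))\<^sup>2 * D\<^sup>2"
    by (simp add: power_mult_distrib power2_eq_square exp_add[symmetric] algebra_simps)
  have "K2 * (exp (\<sigma> * l) * norm (E l))\<^sup>2 = exp (2 * \<sigma> * l) * (K2 * (norm (E l))\<^sup>2)"
    by (simp add: power_mult_distrib power2_eq_square exp_add[symmetric] algebra_simps)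
  also have "\<dots> \<le> exp (2 * \<sigma> * l) * q (E l)" unfolding q_def using K2(3) by (intro mult_left_mono) auto
  finally have 5: "K2 * (exp (\<sigma> * l) * norm (E l))\<^sup>2 \<le> matnorm Q * (exp (\<sigma> * T1) * norm (E T1))\<^sup>2 + 2 * matnorm Q * (G2 * matnorm Q / (c * \<omega>))\<^sup>2 * D\<^sup>2"
    using 4 by linarith
  have "(exp (\<sigma> * l) * norm (E l))\<^sup>2 \<le> (matnorm Q * (exp (\<sigma> * T1) * norm (E T1))\<^sup>2 + 2 * matnorm Q * (G2 * matnorm Q / (c * \<omega>))\<^sup>2 * D\<^sup>2) / K2"
    using 5 K2(1) by (simp add: pos_le_divide_eq mult.commute)
  also have "\<dots> = matnorm Q / K2 * (exp (\<sigma> * T1) * norm (E T1))\<^sup>2 + 2 * matnorm Q / K2 * (G2 * matnorm Q / (c * \<omega>))\<^sup>2 * D\<^sup>2"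
    by (simp only: add_divide_distrib times_divide_eq_left)
  also have "\<dots> = (sqrt (matnorm Q / K2) * (exp (\<sigma> * T1) * norm (E T1)))\<^sup>2 + (noise_gain * D)\<^sup>2"
    unfolding noise_gain_def power_mult_distrib using Qn_pos K2(1) by simp
  finally show ?thesis
    unfolding E_def by (rule le_add_of_squares) (use noise_gain_nonneg D0 Qn_pos K2(1) in auto)
qed

text \<open>The loop consists of the observer error, which causes drift between samples, and the
  output error, which drives the observer. A first window of length \<open>Ts\<close> serves as
  start-up, because earlier the last sample may precede \<open>T0\<close>.\<close>

lemma observer_error:
  assumes l: "T0 \<le> l" "l \<le> t"
  shows "exp (\<sigma> * l) * norm (z l - x (l - r)) \<le> observer_error_gain * M l"
proof -
  define A' where "A' = (1 + sqrt (matnorm Q / K2)) * A + noise_gain * (exp (\<sigma> * l) * \<epsilon>)"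
  have sq: "0 \<le> sqrt (matnorm Q / K2)" using Qn_pos K2(1) by simp
  have A'0: "0 \<le> A'" unfolding A'_def using sq A noise_gain_nonneg \<epsilon>(2) by simp
  have AA': "A \<le> A'"
    unfolding A'_def using sq A mult_nonneg_nonneg[OF noise_gain_nonneg, of "exp (\<sigma> * l) * \<epsilon>"] \<epsilon>(2) by (simp add: distrib_right add_increasing2)
  have "continuous_on {T0..l} (\<lambda>s. exp (\<sigma> * s) * norm (z s - x (s - r)))"
    by (intro continuous_intros E_cont)
  then have "compact ((\<lambda>s. exp (\<sigma> * s) * norm (z s - x (s - r))) ` {T0..l})" by (rule compact_continuous_image) simp
  then have "bounded ((\<lambda>s. exp (\<sigma> * s) * norm (z s - x (s - r))) ` {T0..l})" by (rule compact_imp_bounded)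
  then obtain B where B: "\<forall>s\<in>{T0..l}. norm (exp (\<sigma> * s) * norm (z s - x (s - r))) \<le> B" unfolding bounded_iff by blast
  have "exp (\<sigma> * l) * norm (z l - x (l - r)) \<le> A' / (1 - sampling_loop_gain)"
  proof (rule small_gain[of T0 l "\<lambda>s. exp (\<sigma> * s) * norm (z s - x (s - r))" B sampling_loop_gain "T0 + Ts" A' l, OF _ sampling_loop_gain l(1)])
    show "exp (\<sigma> * s) * norm (z s - x (s - r)) \<le> A'" if "s \<in> {T0..l}" "s \<le> T0 + Ts" for s
      by (rule order_trans[OF winE AA']) (use that l in auto)
    fix m s assume m: "0 \<le> m" "\<And>s. s \<in> {T0..l} \<Longrightarrow> exp (\<sigma> * s) * norm (z s - x (s - r)) \<le> m" and s: "s \<in> {T0..l}" "T0 + Ts < s"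
    \<comment> \<open>Worst weighted output error up to \<open>l\<close> if \<open>m\<close> bounds
      the observer error; the coefficient of \<open>m\<close>, multiplied by
      \<open>noise_gain\<close>, is \<open>sampling_loop_gain\<close>.\<close>
    define D where "D = exp (\<sigma> * l) * \<epsilon> + Ts * G1 * exp (\<sigma> * Ts) * m"
    have "exp (\<sigma> * s) * norm (z s - x (s - r)) \<le> sqrt (matnorm Q / K2) * (exp (\<sigma> * (T0 + Ts)) * norm (z (T0 + Ts) - x (T0 + Ts - r))) + noise_gain * D"
    proof (rule observer_error_step)
      fix s' assume s': "s' \<in> {T0 + Ts..s}"
      have "exp (\<sigma> * s') * norm (w s' - h (x (s' - r))) \<le> exp (\<sigma> * s') * \<epsilon> + Ts * G1 * exp (\<sigma> * Ts) * m"
        by (rule output_error[OF m(2)]) (use s s' l m in auto)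
      also have "\<dots> \<le> D" unfolding D_def using s s' \<epsilon>(2) Ts_\<sigma> by (intro add_right_mono mult_right_mono) auto
      finally show "exp (\<sigma> * s') * norm (w s' - h (x (s' - r))) \<le> D" .
    next
      show "0 \<le> D" unfolding D_def using \<epsilon>(2) Ts_\<sigma> gains_nonneg(3) m by simp
    qed (use s Ts_\<sigma> in auto)
    also have "\<dots> \<le> sqrt (matnorm Q / K2) * A + noise_gain * D"
      by (intro add_right_mono mult_left_mono winE sq) (use Ts_\<sigma> s l in auto)
    also have "\<dots> \<le> A' + sampling_loop_gain * m"
      unfolding A'_def D_def sampling_loop_gain_def using A by (simp add: algebra_simps)
    finally show "exp (\<sigma> * s) * norm (z s - x (s - r)) \<le> A' + sampling_loop_gain * m" .
  qed (use B A'0 l in auto)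
  also have "A' / (1 - sampling_loop_gain) = (1 + sqrt (matnorm Q / K2)) / (1 - sampling_loop_gain) * A + noise_gain / (1 - sampling_loop_gain) * (exp (\<sigma> * l) * \<epsilon>)"
    unfolding A'_def by (simp only: times_divide_eq_left add_divide_distrib[symmetric])
  also have "\<dots> \<le> observer_error_gain * A + observer_error_gain * (exp (\<sigma> * l) * \<epsilon>)"
    using observer_error_gain_ge A \<epsilon>(2) by (intro add_mono mult_right_mono) auto
  finally show ?thesis by (simp add: M_def distrib_left)
qed

text \<open>The true plant satisfies the predictor equation exactly over a step of length
  \<open>\<delta>\<close>, because the saturation is the identity on \<open>S1\<close>. After
  subtraction the error consists of the predecessor's error, known by induction, and an integral of
  the predictor's own error over the last \<open>\<delta>\<close>, which the predictor condition
  absorbs.\<close>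

lemma predictor_error:
  assumes "j \<le> N" "T0 \<le> l" "l \<le> t"
  shows "exp (\<sigma> * l) * norm (\<xi> j l - x (l - r + real j * \<delta>)) \<le> predictor_error_gain j * M l"
  using assms
proof (induction j arbitrary: l)
  case 0
  then show ?case using observer_error[of l] xi0[of l] T0 by simp
next
  case (Suc j)
  let ?\<eta> = "\<lambda>s. \<xi> (Suc j) s - x (s - r + real (Suc j) * \<delta>)"
  have j1: "Suc j \<in> {1..N}" using Suc.prems by simp
  have l0: "0 \<le> l" using Suc.prems T0 by simp
  define A' where "A' = A + M1q * (predictor_error_gain j * M l)"
  have A'0: "0 \<le> A'" unfolding A'_def using A gains_nonneg(1) predictor_error_gain_nonneg M_nonneg by simp
  have "bounded (\<xi> (Suc j) ` {-\<delta>..l})" using xi_Linf[OF j1 l0] unfolding Linf_fun_def by blast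
  then obtain B1 where B1: "\<forall>s\<in>{-\<delta>..l}. norm (\<xi> (Suc j) s) \<le> B1" unfolding bounded_iff by blast
  obtain B2 where B2: "\<forall>s\<in>{-r..l + real (Suc j) * \<delta>}. norm (x s) \<le> B2" using x_bounded by blast
  have jd: "0 \<le> real (Suc j) * \<delta>" using \<delta>_nonneg by simp
  have "exp (\<sigma> * l) * norm (?\<eta> l) \<le> A' / (1 - predictor_loop_gain)"
  proof (rule small_gain[of T0 l "\<lambda>s. exp (\<sigma> * s) * norm (?\<eta> s)" "exp (\<sigma> * l) * (B1 + B2)" predictor_loop_gain "T0 + \<delta>" A' l, OF _ predictor_loop_gain Suc.prems(2)])
    fix s assume s: "s \<in> {T0..l}"
    have "norm (\<xi> (Suc j) s) \<le> B1" "norm (x (s - r + real (Suc j) * \<delta>)) \<le> B2" using B1 B2 s T0 \<delta>_nonneg jd delays by auto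
    then have "norm (?\<eta> s) \<le> B1 + B2" using norm_triangle_ineq4[of "\<xi> (Suc j) s" "x (s - r + real (Suc j) * \<delta>)"] by linarith
    then show "exp (\<sigma> * s) * norm (?\<eta> s) \<le> exp (\<sigma> * l) * (B1 + B2)"
      using s Ts_\<sigma> by (intro mult_mono) auto
  next
    fix s assume "s \<in> {T0..l}" "s \<le> T0 + \<delta>"
    then have "exp (\<sigma> * s) * norm (?\<eta> s) \<le> A" using Suc.prems by (intro wineta j1) auto
    also have "A \<le> A'" unfolding A'_def using gains_nonneg(1) predictor_error_gain_nonneg M_nonneg by simp
    finally show "exp (\<sigma> * s) * norm (?\<eta> s) \<le> A'" .
  next
    fix m s assume m: "0 \<le> m" "\<And>s. s \<in> {T0..l} \<Longrightarrow> exp (\<sigma> * s) * norm (?\<eta> s) \<le> m" and s: "s \<in> {T0..l}" "T0 + \<delta> < s"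
    have s0: "0 \<le> s" "0 \<le> s - r" using s T0 by auto
    let ?X = "x (s - r + real j * \<delta>)"
    have jd': "0 \<le> real j * \<delta>" using \<delta>_nonneg by simp
    have zs: "z s \<in> S2" using zS[of s] s by (simp add: S2_def)
    have XS: "x v \<in> S1" if "s - r - \<delta> \<le> v" for v using xS[of v] that s by (simp add: S1_def)
    have satX: "sat (x v) (z s) = x v" if "s - r - \<delta> \<le> v" for v
      using XS[OF that] consts3 by (intro sat_id') (simp add: S1_def le_max_iff_disj)
    \<comment> \<open>The definition of \<open>S3\<close> copies the bound of
      \<open>xi_le_\<rho>\<close>. Index 0 is \<open>z\<close> itself, for which
      \<open>norm (z l') \<le> \<psi> (z l')\<close> suffices.\<close>
    have S3: "\<xi> i l' \<in> S3" if "i \<le> N" "T0 \<le> l'" for i l'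
    proof -
      have l': "0 \<le> l'" "z l' \<in> S2" using that T0 zS[of l'] by (auto simp: S2_def)
      have "norm (\<xi> i l') \<le> K * \<psi> (z l') + \<delta> * \<rho> (K * \<psi> (z l'))"
      proof (cases "i = 0")
        case True
        have "norm (z l') \<le> \<psi> (z l')" using \<psi>(3) by simp
        also have "\<dots> \<le> K * \<psi> (z l')" using q(4) \<psi>_pos(1)[of "z l'"] by simp
        finally have "norm (z l') \<le> K * \<psi> (z l')" .
        moreover have "0 \<le> \<rho> (K * \<psi> (z l'))"
          using \<rho>_upper[of 0 "K * \<psi> (z l')" 0] U(3) q(4) \<psi>_pos(1)[of "z l'"] by (auto intro: order_trans[OF norm_ge_zero])
        then have "0 \<le> \<delta> * \<rho> (K * \<psi> (z l'))" using \<delta>_nonneg by simp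
        ultimately show ?thesis using True xi0[OF l'(1)] by simp
      next
        case False then show ?thesis using xi_le_\<rho>[of i l'] that l' by simp
      qed
      then show ?thesis using l' unfolding S3_def by blast
    qed
    have jN: "j \<le> N" using Suc.prems by simp
    let ?F = "\<lambda>v. f (sat (\<xi> (Suc j) (s + v - \<delta>)) (z s)) (u (s + (real (Suc j) - 1) * \<delta> - \<tau> - r + v))"
    let ?G = "\<lambda>v. f (x (v + (s - r + real j * \<delta>))) (u (v + (s - r + real j * \<delta>) - \<tau>))"
    \<comment> \<open>The plant equation over one step from
      \<open>s - r + real j * \<delta>\<close>; its input is the one that the predictor reads at
      time \<open>s\<close>, so the two integrands differ in the state only.\<close>
    have G: "(?G has_integral (x (s - r + real (Suc j) * \<delta>) - ?X)) {0..\<delta>}"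
    proof -
      have "((\<lambda>l. f (x l) (u (l - \<tau>))) has_integral (x (s - r + real j * \<delta> + \<delta>) - ?X)) {s - r + real j * \<delta>..s - r + real j * \<delta> + \<delta>}"
        by (rule lipode_FTC[OF lipode_subset[OF x_lipode[of "s - r + real j * \<delta> + \<delta>"]]]) (use s0 jd' \<delta>_nonneg in auto)
      from has_integral_shift_real_ivl[OF this, of "s - r + real j * \<delta>"] show ?thesis by (simp add: algebra_simps)
    qed
    have "norm (integral {0..\<delta>} ?F - (x (s - r + real (Suc j) * \<delta>) - ?X)) \<le> M1f * (M1q * (m * exp (- \<sigma> * (s - \<delta>)))) * (\<delta> - 0)"
    proof (rule has_integral_norm_le[OF has_integral_diff[OF integrable_integral[OF predictor_integrable[OF j1 s0(1)]] G] \<delta>_nonneg])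
      fix v assume v: "v \<in> {0..\<delta>}"
      let ?l = "s + v - \<delta>"
      have vT: "?l \<in> {T0..l}" using v s by auto
      let ?Y = "x (?l - r + real (Suc j) * \<delta>)"
      have Yeq: "v + (s - r + real j * \<delta>) = ?l - r + real (Suc j) * \<delta>" by (simp add: algebra_simps)
      have Yge: "s - r - \<delta> \<le> ?l - r + real (Suc j) * \<delta>" using v jd by simp
      have uU: "u (v + (s - r + real j * \<delta>) - \<tau>) \<in> U" using v s0 jd' delays by (intro u_U) auto
      have ueq: "u (s + (real (Suc j) - 1) * \<delta> - \<tau> - r + v) = u (v + (s - r + real j * \<delta>) - \<tau>)" by (simp add: algebra_simps)
      have "norm (?F v - ?G v) = norm (f (sat (\<xi> (Suc j) ?l) (z s)) (u (v + (s - r + real j * \<delta>) - \<tau>)) - f ?Y (u (v + (s - r + real j * \<delta>) - \<tau>)))"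
        unfolding ueq by (simp only: Yeq)
      also have "\<dots> \<le> M1f * norm (sat (\<xi> (Suc j) ?l) (z s) - ?Y)"
      proof (rule M1f_bound[OF XS[OF Yge] _ uU])
        show "sat (\<xi> (Suc j) ?l) (z s) \<in> S4" using sat_le_\<psi> zs unfolding S4_def by blast
      qed
      also have "\<dots> \<le> M1f * (M1q * (m * exp (- \<sigma> * (s - \<delta>))))"
      proof (rule mult_left_mono[OF _ gains_nonneg(2)])
        have "norm (\<xi> (Suc j) ?l - ?Y) = exp (- \<sigma> * ?l) * (exp (\<sigma> * ?l) * norm (?\<eta> ?l))" by (simp add: exp_minus)
        also have "\<dots> \<le> exp (- \<sigma> * (s - \<delta>)) * m"
          using m(2)[OF vT] m(1) v Ts_\<sigma> by (intro mult_mono) auto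
        finally have "norm (\<xi> (Suc j) ?l - ?Y) \<le> m * exp (- \<sigma> * (s - \<delta>))" by (simp only: mult.commute)
        then have "M1q * norm (\<xi> (Suc j) ?l - ?Y) \<le> M1q * (m * exp (- \<sigma> * (s - \<delta>)))"
          using gains_nonneg(1) by (rule mult_left_mono)
        moreover have "norm (sat (\<xi> (Suc j) ?l) (z s) - sat ?Y (z s)) \<le> M1q * norm (\<xi> (Suc j) ?l - ?Y)"
          by (rule M1q_bound[OF XS[OF Yge] S3[of "Suc j" ?l] zs]) (use vT Suc.prems in auto)
        ultimately show "norm (sat (\<xi> (Suc j) ?l) (z s) - ?Y) \<le> M1q * (m * exp (- \<sigma> * (s - \<delta>)))"
          unfolding satX[OF Yge] by linarith
      qed
      finally show "norm (?F v - ?G v) \<le> M1f * (M1q * (m * exp (- \<sigma> * (s - \<delta>))))" .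
    qed
    then have I: "norm (integral {0..\<delta>} ?F - (x (s - r + real (Suc j) * \<delta>) - ?X)) \<le> M1f * (M1q * (m * exp (- \<sigma> * (s - \<delta>)))) * \<delta>" by simp
    have "?\<eta> s = (sat (\<xi> j s) (z s) - sat ?X (z s)) + (integral {0..\<delta>} ?F - (x (s - r + real (Suc j) * \<delta>) - ?X))"
      using xi_eq[OF j1 s0(1)] satX[of "s - r + real j * \<delta>"] jd' \<delta>_nonneg by simp
    then have "norm (?\<eta> s) = norm ((sat (\<xi> j s) (z s) - sat ?X (z s)) + (integral {0..\<delta>} ?F - (x (s - r + real (Suc j) * \<delta>) - ?X)))"
      by (rule arg_cong)
    also have "\<dots> \<le> norm (sat (\<xi> j s) (z s) - sat ?X (z s)) + norm (integral {0..\<delta>} ?F - (x (s - r + real (Suc j) * \<delta>) - ?X))"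
      by (rule norm_triangle_ineq)
    also have "norm (sat (\<xi> j s) (z s) - sat ?X (z s)) \<le> M1q * norm (\<xi> j s - ?X)"
    proof (rule M1q_bound[OF XS S3[OF jN] zs])
      show "s - r - \<delta> \<le> s - r + real j * \<delta>" using \<delta>_nonneg jd' by linarith
    qed (use s in simp)
    finally have "norm (?\<eta> s) \<le> M1q * norm (\<xi> j s - ?X) + M1f * (M1q * (m * exp (- \<sigma> * (s - \<delta>)))) * \<delta>" using I by linarith
    then have "exp (\<sigma> * s) * norm (?\<eta> s) \<le> exp (\<sigma> * s) * (M1q * norm (\<xi> j s - ?X) + M1f * (M1q * (m * exp (- \<sigma> * (s - \<delta>)))) * \<delta>)"
      by (intro mult_left_mono) auto
    also have "\<dots> = M1q * (exp (\<sigma> * s) * norm (\<xi> j s - ?X)) + \<delta> * M1q * M1f * (exp (\<sigma> * s) * exp (- \<sigma> * (s - \<delta>))) * m"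
      by (simp add: algebra_simps)
    also have "exp (\<sigma> * s) * exp (- \<sigma> * (s - \<delta>)) = exp (\<sigma> * \<delta>)" by (simp add: exp_add[symmetric] algebra_simps)
    also have "M1q * (exp (\<sigma> * s) * norm (\<xi> j s - ?X)) \<le> M1q * (predictor_error_gain j * M l)"
    proof (rule mult_left_mono[OF _ gains_nonneg(1)])
      have "exp (\<sigma> * s) * norm (\<xi> j s - ?X) \<le> predictor_error_gain j * M s" using Suc.prems s by (intro Suc.IH) auto
      also have "\<dots> \<le> predictor_error_gain j * M l" using s by (intro mult_left_mono M_mono predictor_error_gain_nonneg) simp
      finally show "exp (\<sigma> * s) * norm (\<xi> j s - ?X) \<le> predictor_error_gain j * M l" .
    qed
    finally have "exp (\<sigma> * s) * norm (?\<eta> s) \<le> M1q * (predictor_error_gain j * M l) + predictor_loop_gain * m" by (simp add: predictor_loop_gain_def)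
    then show "exp (\<sigma> * s) * norm (?\<eta> s) \<le> A' + predictor_loop_gain * m" unfolding A'_def using A by simp
  qed (use Suc.prems A'0 in auto)
  also have "\<dots> \<le> (1 + M1q * predictor_error_gain j) * M l / (1 - predictor_loop_gain)"
    using A_le_M[of l] predictor_loop_gain by (intro divide_right_mono) (auto simp: A'_def algebra_simps)
  finally show ?case by simp
qed

text \<open>At time \<open>s + \<tau>\<close> the plant is driven by
  \<open>u s = kf (\<xi> N s)\<close>, and \<open>\<xi> N s\<close> predicts
  \<open>x (s - r + real N * \<delta>) = x (s + \<tau>)\<close>. So the loop is the nominal feedback
  with an input error proportional to the last predictor error.\<close>

lemma plant_decay:
  assumes l: "T0 \<le> l" "l \<le> t"
  shows "exp (\<sigma> * l) * norm (x (l + \<tau>)) \<le> plant_gain * M l"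
proof -
  define D where "D = predictor_error_gain N * M l"
  have D0: "0 \<le> D" unfolding D_def using predictor_error_gain_nonneg M_nonneg by simp
  define k where "k = (Pt * input_lipschitz)\<^sup>2 / (2 * \<mu>)"
  have k0: "0 \<le> k" using consts2 by (simp add: k_def)
  have Xl: "lipode T0 l (\<lambda>s. x (s + \<tau>)) (\<lambda>s. f (x (s + \<tau>)) (u s))"
    using lipode_subset[OF lipode_shift[OF x_lipode[of "l + \<tau>"], of "- \<tau>"], of T0 l] T0 delays by simp
  have Pl: "lipode T0 l (\<lambda>s. P (x (s + \<tau>))) (\<lambda>s. grad P (x (s + \<tau>)) \<bullet> f (x (s + \<tau>)) (u s))"
    by (rule lipode_chain[OF Xl P_blip grad_has_derivative[OF P1]])
  have "exp (2 * \<sigma> * l) * P (x (l + \<tau>)) \<le> exp (2 * \<sigma> * T0) * P (x (T0 + \<tau>)) + k * D\<^sup>2 / (3 * \<mu> / Pt - 2 * \<sigma>)"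
  proof (rule exponential_comparison_limit[OF Pl l(1) \<sigma>_P])
    fix s assume s: "s \<in> {T0..l}"
    let ?y = "x (s + \<tau>)"
    have yS: "?y \<in> S1" using xS[of "s + \<tau>"] s delays by (simp add: S1_def)
    have us: "u s = kf (\<xi> N s)" using s T0 by (intro u_eq) simp
    define \<eta> where "\<eta> = norm (\<xi> N s - ?y)"
    have eq: "s - r + real N * \<delta> = s + \<tau>" by (simp add: N\<delta>)
    have "exp (\<sigma> * s) * \<eta> \<le> predictor_error_gain N * M s"
      unfolding \<eta>_def by (rule predictor_error[of N s, unfolded eq]) (use s l in auto)
    also have "\<dots> \<le> D" unfolding D_def using s by (intro mult_left_mono M_mono predictor_error_gain_nonneg) simp
    finally have "exp (- \<sigma> * s) * (exp (\<sigma> * s) * \<eta>) \<le> exp (- \<sigma> * s) * D" by (intro mult_left_mono) auto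
    moreover have "exp (- \<sigma> * s) * (exp (\<sigma> * s) * \<eta>) = \<eta>" by (simp add: exp_minus)
    ultimately have "\<eta> \<le> exp (- \<sigma> * s) * D" by (simp only:)
    then have "\<eta>\<^sup>2 \<le> (exp (- \<sigma> * s) * D)\<^sup>2" by (intro power_mono) (auto simp: \<eta>_def)
    also have "\<dots> = D\<^sup>2 * exp (- 2 * \<sigma> * s)" by (simp add: power_mult_distrib power2_eq_square exp_add[symmetric])
    finally have 3: "k * \<eta>\<^sup>2 \<le> k * D\<^sup>2 * exp (- 2 * \<sigma> * s)" using k0 by (simp add: mult_left_mono mult.assoc)
    have "grad P ?y \<bullet> f ?y (u s) = grad P ?y \<bullet> f ?y (kf ?y) + grad P ?y \<bullet> (f ?y (kf (\<xi> N s)) - f ?y (kf ?y))"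
      by (simp add: us inner_diff_right)
    also have "\<dots> \<le> - 2 * \<mu> * (norm ?y)\<^sup>2 + norm ?y * (Pt * input_lipschitz * \<eta>)"
    proof (rule add_mono)
      show "grad P ?y \<bullet> f ?y (kf ?y) \<le> - 2 * \<mu> * (norm ?y)\<^sup>2" using Pdecay yS by (simp add: S1_def)
      have "grad P ?y \<bullet> (f ?y (kf (\<xi> N s)) - f ?y (kf ?y)) \<le> norm (grad P ?y) * norm (f ?y (kf (\<xi> N s)) - f ?y (kf ?y))"
        by (rule norm_cauchy_schwarz)
      also have "\<dots> \<le> (Pt * norm ?y) * (input_lipschitz * \<eta>)"
        using gradP_le[OF yS, of 1] input_lipschitz(2)[OF yS] Pt_pos unfolding \<eta>_def by (intro mult_mono) auto
      finally show "grad P ?y \<bullet> (f ?y (kf (\<xi> N s)) - f ?y (kf ?y)) \<le> norm ?y * (Pt * input_lipschitz * \<eta>)" by (simp add: algebra_simps)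
    qed
    also have "norm ?y * (Pt * input_lipschitz * \<eta>) \<le> \<mu> / 2 * (norm ?y)\<^sup>2 + (Pt * input_lipschitz * \<eta>)\<^sup>2 / (2 * \<mu>)" by (rule young[OF consts2(1)])
    finally have 1: "grad P ?y \<bullet> f ?y (u s) \<le> - (3 / 2 * \<mu>) * (norm ?y)\<^sup>2 + k * \<eta>\<^sup>2"
      by (simp add: k_def power_mult_distrib)
    have "3 * \<mu> / Pt * P ?y \<le> 3 * \<mu> / Pt * (Pt / 2 * (norm ?y)\<^sup>2)"
      using P_le[OF yS] consts2 Pt_pos by (intro mult_left_mono) auto
    also have "\<dots> = 3 / 2 * \<mu> * (norm ?y)\<^sup>2" using Pt_pos by simp
    finally show "grad P ?y \<bullet> f ?y (u s) \<le> - (3 * \<mu> / Pt) * P ?y + k * D\<^sup>2 * exp (- 2 * \<sigma> * s)" using 1 3 by linarith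
  qed (use P(2) k0 in auto)
  also have "exp (2 * \<sigma> * T0) * P (x (T0 + \<tau>)) \<le> exp (2 * \<sigma> * T0) * (Pt / 2 * (norm (x (T0 + \<tau>)))\<^sup>2)"
    using xS[of "T0 + \<tau>"] delays by (intro mult_left_mono P_le) (auto simp: S1_def)
  also have "\<dots> = Pt / 2 * (exp (\<sigma> * T0) * norm (x (T0 + \<tau>)))\<^sup>2"
    by (simp add: power_mult_distrib power2_eq_square exp_add[symmetric])
  also have "\<dots> \<le> Pt / 2 * A\<^sup>2" using winx Pt_pos by (intro mult_left_mono power_mono) auto
  finally have 4: "exp (2 * \<sigma> * l) * P (x (l + \<tau>)) \<le> Pt / 2 * A\<^sup>2 + k * D\<^sup>2 / (3 * \<mu> / Pt - 2 * \<sigma>)" by simp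
  have "K1 * (exp (\<sigma> * l) * norm (x (l + \<tau>)))\<^sup>2 = exp (2 * \<sigma> * l) * (K1 * (norm (x (l + \<tau>)))\<^sup>2)"
    by (simp add: power_mult_distrib power2_eq_square exp_add[symmetric])
  also have "\<dots> \<le> exp (2 * \<sigma> * l) * P (x (l + \<tau>))"
    using PK1 xS[of "l + \<tau>"] l delays by (intro mult_left_mono) auto
  finally have "K1 * (exp (\<sigma> * l) * norm (x (l + \<tau>)))\<^sup>2 \<le> Pt / 2 * A\<^sup>2 + k * D\<^sup>2 / (3 * \<mu> / Pt - 2 * \<sigma>)" using 4 by linarith
  then have "(exp (\<sigma> * l) * norm (x (l + \<tau>)))\<^sup>2 \<le> (Pt / 2 * A\<^sup>2 + k * D\<^sup>2 / (3 * \<mu> / Pt - 2 * \<sigma>)) / K1"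
    using consts2 by (simp add: pos_le_divide_eq mult.commute)
  also have "\<dots> = Pt / (2 * K1) * A\<^sup>2 + k / (3 * \<mu> / Pt - 2 * \<sigma>) / K1 * D\<^sup>2" by (simp add: add_divide_distrib)
  also have "\<dots> = (sqrt (Pt / (2 * K1)) * A)\<^sup>2 + (forcing_gain * D)\<^sup>2"
    unfolding forcing_gain_def k_def power_mult_distrib using Pt_pos consts2 \<sigma>_P by simp
  finally have "exp (\<sigma> * l) * norm (x (l + \<tau>)) \<le> sqrt (Pt / (2 * K1)) * A + forcing_gain * D"
    by (rule le_add_of_squares) (use A D0 forcing_gain_nonneg Pt_pos consts2 in auto)
  also have "\<dots> \<le> sqrt (Pt / (2 * K1)) * M l + forcing_gain * (predictor_error_gain N * M l)"
    unfolding D_def using A_le_M Pt_pos consts2 by (intro add_right_mono mult_left_mono) auto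
  finally show ?thesis by (simp add: plant_gain_def algebra_simps)
qed

theorem final_bound:
  "sup_norm {-r..0} (\<lambda>s. x (t + s)) + norm (w t) + norm (z t)
     + (\<Sum>j=1..N. sup_norm {-\<delta>..<0} (\<lambda>s. \<xi> j (t + s))) + sup_norm {-r-\<tau>..<0} (\<lambda>s. u (t + s))
   \<le> ultimate_gain * (exp (- \<sigma> * t) * A + \<epsilon>)"
proof -
  define D where "D = exp (2 * \<sigma> * (r + \<tau>))"
  define m where "m = exp (- \<sigma> * t) * A + \<epsilon>"
  have D1: "1 \<le> D" using Ts_\<sigma> delays by (simp add: D_def)
  have m: "m = exp (- \<sigma> * t) * M t" unfolding m_def M_def by (simp add: distrib_left exp_minus)
  have m0: "0 \<le> m" unfolding m using M_nonneg by simp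
  have rt: "0 \<le> r + \<tau>" using delays by simp
  have \<delta>le: "\<delta> \<le> r + \<tau>" using j\<delta>[of 1] N by simp
  have tT': "T0 + 3 * (r + \<tau>) \<le> t" using tT Ts_\<sigma>(1) by linarith
  \<comment> \<open>Removes the weight from an estimate at a time at most
    \<open>2 * (r + \<tau>)\<close> before \<open>t\<close>, at the cost of the factor
    \<open>D\<close>.\<close>
  have sc: "n \<le> D * (k * m)" if "exp (\<sigma> * l) * n \<le> k * M l" "t - 2 * (r + \<tau>) \<le> l" "l \<le> t" "0 \<le> k" for n k l
  proof -
    have "n = exp (- \<sigma> * l) * (exp (\<sigma> * l) * n)" by (simp add: exp_minus)
    also have "\<dots> \<le> exp (- \<sigma> * l) * (k * M l)" using that by (intro mult_left_mono) auto
    also have "\<dots> \<le> exp (- \<sigma> * (t - 2 * (r + \<tau>))) * (k * M t)"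
      using that Ts_\<sigma> M_nonneg M_mono[OF that(3)] by (intro mult_mono mult_left_mono) auto
    also have "exp (- \<sigma> * (t - 2 * (r + \<tau>))) = D * exp (- \<sigma> * t)" unfolding D_def by (simp add: exp_add[symmetric] algebra_simps)
    finally show ?thesis unfolding m by (simp add: algebra_simps)
  qed
  \<comment> \<open>Times up to \<open>t + \<tau>\<close> are included because the predictors are
    compared with future plant states.\<close>
  have xb: "norm (x v) \<le> plant_gain * D * m" if "t - 2 * (r + \<tau>) + \<tau> \<le> v" "v \<le> t + \<tau>" for v
  proof -
    have "exp (\<sigma> * (v - \<tau>)) * norm (x (v - \<tau> + \<tau>)) \<le> plant_gain * M (v - \<tau>)"
      by (rule plant_decay) (use that tT' rt in linarith)+
    then have "exp (\<sigma> * (v - \<tau>)) * norm (x v) \<le> plant_gain * M (v - \<tau>)" by simp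
    from sc[OF this] have "norm (x v) \<le> D * (plant_gain * m)" using that plant_gain_nonneg by simp
    then show ?thesis by (simp add: algebra_simps)
  qed
  have et: "exp (- \<sigma> * t) * (exp (\<sigma> * t) * n) = n" for n by (simp add: exp_minus)
  have tr: "norm (x (t - r)) \<le> plant_gain * D * m" using delays by (intro xb) auto
  have X: "sup_norm {-r..0} (\<lambda>s. x (t + s)) \<le> plant_gain * D * m"
  proof (rule sup_norm_le)
    show "norm (x (t + s)) \<le> plant_gain * D * m" if "s \<in> {-r..0}" for s using that delays by (intro xb) auto
  qed (use plant_gain_nonneg D1 m0 in simp)
  have E: "norm (z t - x (t - r)) \<le> observer_error_gain * m"
  proof -
    have "exp (- \<sigma> * t) * (exp (\<sigma> * t) * norm (z t - x (t - r))) \<le> exp (- \<sigma> * t) * (observer_error_gain * M t)"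
      using observer_error[OF Tt] by (intro mult_left_mono) auto
    then show ?thesis unfolding et m by (simp add: algebra_simps)
  qed
  have Z: "norm (z t) \<le> observer_error_gain * m + plant_gain * D * m"
    using E tr norm_triangle_ineq[of "z t - x (t - r)" "x (t - r)"] by simp
  have Wt: "norm (w t) \<le> (1 + Ts * G1 * exp (\<sigma> * Ts) * observer_error_gain) * m + output_lipschitz * (plant_gain * D * m)"
  proof -
    have "exp (\<sigma> * t) * norm (w t - h (x (t - r))) \<le> exp (\<sigma> * t) * \<epsilon> + Ts * G1 * exp (\<sigma> * Ts) * (observer_error_gain * M t)"
    proof (rule output_error)
      fix l assume l: "l \<in> {T0..t}"
      then have "exp (\<sigma> * l) * norm (z l - x (l - r)) \<le> observer_error_gain * M l" by (intro observer_error) auto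
      also have "\<dots> \<le> observer_error_gain * M t" using l by (intro mult_left_mono M_mono observer_error_gain_nonneg) simp
      finally show "exp (\<sigma> * l) * norm (z l - x (l - r)) \<le> observer_error_gain * M t" .
    qed (use tT rt observer_error_gain_nonneg M_nonneg in auto)
    also have "\<dots> \<le> M t + Ts * G1 * exp (\<sigma> * Ts) * (observer_error_gain * M t)" unfolding M_def using A by simp
    finally have "exp (- \<sigma> * t) * (exp (\<sigma> * t) * norm (w t - h (x (t - r)))) \<le> exp (- \<sigma> * t) * (M t + Ts * G1 * exp (\<sigma> * Ts) * (observer_error_gain * M t))"
      by (intro mult_left_mono) auto
    then have 1: "norm (w t - h (x (t - r))) \<le> (1 + Ts * G1 * exp (\<sigma> * Ts) * observer_error_gain) * m"
      unfolding et m by (simp add: algebra_simps)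
    have "norm (h (x (t - r))) \<le> output_lipschitz * norm (x (t - r))"
      using xS[of "t - r"] Tt by (intro output_lipschitz) (simp add: S1_def)
    also have "\<dots> \<le> output_lipschitz * (plant_gain * D * m)" using tr output_lipschitz(1) by (rule mult_left_mono)
    finally show ?thesis using 1 norm_triangle_ineq[of "w t - h (x (t - r))" "h (x (t - r))"] by simp
  qed
  have xib: "norm (\<xi> j v) \<le> D * (predictor_error_gain j + plant_gain) * m" if j: "j \<le> N" and v: "t - (r + \<tau>) \<le> v" "v \<le> t" for j v
  proof -
    have "norm (\<xi> j v - x (v - r + real j * \<delta>)) \<le> D * (predictor_error_gain j * m)"
    proof (rule sc[OF predictor_error[OF j]])
      show "T0 \<le> v" using v(1) tT' rt by simp
      show "t - 2 * (r + \<tau>) \<le> v" using v(1) rt by simp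
    qed (use v(2) predictor_error_gain_nonneg in auto)
    moreover have "norm (x (v - r + real j * \<delta>)) \<le> plant_gain * D * m"
    proof (rule xb)
      have "0 \<le> real j * \<delta>" using \<delta>_nonneg by simp
      then show "t - 2 * (r + \<tau>) + \<tau> \<le> v - r + real j * \<delta>" using v by (simp add: algebra_simps)
      show "v - r + real j * \<delta> \<le> t + \<tau>" using j\<delta>[OF j] v by linarith
    qed
    ultimately have "norm (\<xi> j v) \<le> D * (predictor_error_gain j * m) + plant_gain * D * m"
      using norm_triangle_ineq[of "\<xi> j v - x (v - r + real j * \<delta>)" "x (v - r + real j * \<delta>)"] by simp
    then show ?thesis by (simp add: algebra_simps)
  qed
  have Xi: "(\<Sum>j=1..N. sup_norm {-\<delta>..<0} (\<lambda>s. \<xi> j (t + s))) \<le> (\<Sum>j=1..N. D * (predictor_error_gain j + plant_gain) * m)"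
  proof (intro sum_mono sup_norm_le)
    fix j s assume "j \<in> {1..N}" "s \<in> {-\<delta>..<0}"
    then show "norm (\<xi> j (t + s)) \<le> D * (predictor_error_gain j + plant_gain) * m" using \<delta>le by (intro xib) auto
  qed (use D1 predictor_error_gain_nonneg plant_gain_nonneg m0 in simp)
  have Uu: "sup_norm {-r-\<tau>..<0} (\<lambda>s. u (t + s)) \<le> feedback_lipschitz * (D * (predictor_error_gain N + plant_gain) * m)"
  proof (rule sup_norm_le)
    fix s assume s: "s \<in> {-r-\<tau>..<0}"
    have ts0: "0 \<le> t + s" using s tT' T0 rt by auto
    have "norm (u (t + s)) \<le> feedback_lipschitz * norm (\<xi> N (t + s))" unfolding u_eq[OF ts0] by (rule feedback_lipschitz(2))
    also have "\<dots> \<le> feedback_lipschitz * (D * (predictor_error_gain N + plant_gain) * m)" using s by (intro mult_left_mono xib feedback_lipschitz(1)) auto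
    finally show "norm (u (t + s)) \<le> feedback_lipschitz * (D * (predictor_error_gain N + plant_gain) * m)" .
  qed (use D1 predictor_error_gain_nonneg plant_gain_nonneg m0 feedback_lipschitz(1) in simp)
  have "ultimate_gain * m = plant_gain * D * m + (observer_error_gain * m + plant_gain * D * m) + ((1 + Ts * G1 * exp (\<sigma> * Ts) * observer_error_gain) * m + output_lipschitz * (plant_gain * D * m))
     + (\<Sum>j=1..N. D * (predictor_error_gain j + plant_gain) * m) + feedback_lipschitz * (D * (predictor_error_gain N + plant_gain) * m)"
    unfolding ultimate_gain_def Let_def D_def[symmetric] by (simp add: distrib_right sum_distrib_right mult.assoc)
  then show ?thesis unfolding m_def[symmetric] using X Z Wt Xi Uu by linarith
qed

end

lemma (in closed_loop_setup) ultimate_gain_nonneg: "0 \<le> ultimate_gain"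
  unfolding ultimate_gain_def Let_def using plant_gain_nonneg observer_error_gain_nonneg predictor_error_gain_nonneg output_lipschitz(1) feedback_lipschitz(1) gains_nonneg(3) Ts_\<sigma>
  by (intro add_nonneg_nonneg mult_nonneg_nonneg sum_nonneg) auto

section \<open>Truncation of the closed loop\<close>

text \<open>Projection onto a convex set is nonexpansive, so clipping the arguments makes a field
  that is Lipschitz on bounded sets globally Lipschitz.\<close>

definition clip :: "real \<Rightarrow> 'a::euclidean_space \<Rightarrow> 'a" where
  "clip m v = closest_point (cball 0 m) v"

lemma clip_id: "norm v \<le> m \<Longrightarrow> clip m v = v"
  unfolding clip_def by (rule closest_point_self) simp

lemma clip_norm: "0 \<le> m \<Longrightarrow> norm (clip m v) \<le> m"
  unfolding clip_def using closest_point_in_set[of "cball 0 m" v] by simp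

lemma clip_lipb: "0 \<le> m \<Longrightarrow> lipb S (clip m :: 'a::euclidean_space \<Rightarrow> 'a)"
proof (rule lipbI[of _ _ 1 m])
  fix x y :: 'a assume "0 \<le> m"
  then have "dist (clip m x) (clip m y) \<le> dist x y"
    unfolding clip_def by (intro closest_point_lipschitz) auto
  then show "norm (clip m x - clip m y) \<le> 1 * dist x y" by (simp add: dist_norm)
qed (rule clip_norm)

text \<open>\<open>lipb_comp\<close> asks for a bounded inner function, and coordinate projections
  on the whole space are unbounded; a bounded, globally Lipschitz outer function makes up for
  this.\<close>

lemma lipb_lipschitz_comp:
  assumes f: "\<And>x y. x \<in> S \<Longrightarrow> y \<in> S \<Longrightarrow> dist (f x) (f y) \<le> dist x y" and g: "lipb UNIV g"
  shows "lipb S (\<lambda>x. g (f x))"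
proof -
  obtain C where C: "C > 0" "\<forall>x\<in>UNIV. \<forall>y\<in>UNIV. norm (g x - g y) \<le> C * dist x y" "\<forall>x\<in>UNIV. norm (g x) \<le> C"
    using lipb_bound[OF g] by blast
  show ?thesis
  proof (rule lipbI[of _ _ C C])
    fix x y assume "x \<in> S" "y \<in> S"
    then have "C * dist (f x) (f y) \<le> C * dist x y" using f C(1) by (intro mult_left_mono) auto
    then show "norm (g (f x) - g (f y)) \<le> C * dist x y" using C(2) by (meson UNIV_I order_trans)
  qed (use C in blast)
qed

definition cutoff :: "real \<Rightarrow> 'a::real_normed_vector \<Rightarrow> real" where
  "cutoff m v = max 0 (min 1 (m + 1 - norm v))"

lemma cutoff_lipb: "lipb S (cutoff m :: 'a::real_normed_vector \<Rightarrow> real)"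
proof (rule lipbI[of _ _ 1 1])
  fix x y :: 'a
  have "\<bar>norm x - norm y\<bar> \<le> dist x y" by (simp add: dist_norm norm_triangle_ineq3)
  then show "norm (cutoff m x - cutoff m y) \<le> 1 * dist x y"
    unfolding cutoff_def by (auto simp: max_def min_def)
qed (auto simp: cutoff_def)

lemma cutoff_simps: "0 \<le> cutoff m v" "norm v \<le> m \<Longrightarrow> cutoff m v = 1" "m + 1 \<le> norm v \<Longrightarrow> cutoff m v = 0"
  by (auto simp: cutoff_def)

lemma lipb_two_args:
  fixes G :: "'p::real_normed_vector \<Rightarrow> 'm::real_normed_vector \<Rightarrow> 'q::real_normed_vector"
  assumes "lipb (UNIV \<times> U) (\<lambda>s. G (fst s) (snd s))"
  shows "\<exists>C>0. (\<forall>p p' u u'. u \<in> U \<longrightarrow> u' \<in> U \<longrightarrow> norm (G p u - G p' u') \<le> C * (norm (p - p') + norm (u - u'))) \<and>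
    (\<forall>p u. u \<in> U \<longrightarrow> norm (G p u) \<le> C)"
proof -
  obtain C where C: "C > 0" "\<forall>s\<in>UNIV \<times> U. \<forall>s'\<in>UNIV \<times> U. norm (G (fst s) (snd s) - G (fst s') (snd s')) \<le> C * dist s s'"
    "\<forall>s\<in>UNIV \<times> U. norm (G (fst s) (snd s)) \<le> C" using lipb_bound[OF assms] by blast
  have 1: "norm (G p u - G p' u') \<le> C * (norm (p - p') + norm (u - u'))" if "u \<in> U" "u' \<in> U" for p p' u u'
  proof -
    have "norm (G p u - G p' u') \<le> C * dist (p, u) (p', u')" using C(2)[rule_format, of "(p, u)" "(p', u')"] that by simp
    also have "dist (p, u) (p', u') \<le> norm (p - p') + norm (u - u')" using norm_Pair_le[of "p - p'" "u - u'"] by (simp add: dist_norm)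
    finally show ?thesis using C(1) by simp
  qed
  have 2: "norm (G p u) \<le> C" if "u \<in> U" for p u using C(3)[rule_format, of "(p, u)"] that by simp
  show ?thesis using C(1) 1 2 by blast
qed

text \<open>\<open>y\<close> is given by the formula only on \<open>I\<close>; openness of
  \<open>I - {a}\<close> transfers the two-sided derivative of the primitive, and the endpoint
  \<open>a\<close> joins the exceptional set.\<close>

lemma indefinite_integral_ode:
  fixes y :: "real \<Rightarrow> 'a::euclidean_space"
  assumes g: "g \<in> borel_measurable lebesgue" "\<And>s. norm (g s) \<le> B" and y: "\<And>t. t \<in> I \<Longrightarrow> y t = c + integral {a..t} g"
    and a: "0 \<le> a" and I: "I \<subseteq> {a..}" "open (I - {a})"
  shows "B-lipschitz_on I y" "\<exists>S. negligible S \<and> (\<forall>t\<in>I - S. (y has_vector_derivative g t) (at t))"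
proof -
  have int: "g integrable_on {s..t}" for s t by (rule bounded_measurable_integrable[OF g])
  have yI: "y t = (c - integral {0..a} g) + integral {0..t} g" if "t \<in> I" for t
  proof -
    have "a \<le> t" using that I by auto
    then show ?thesis using increment_indefinite_integral[OF int a, of t] y[OF that] by (simp add: algebra_simps)
  qed
  have "B-lipschitz_on {0..} (\<lambda>t. integral {0..t} g)" by (rule indefinite_integral_lipschitz[OF int g(2)])
  then have "B-lipschitz_on I (\<lambda>t. integral {0..t} g)" by (rule lipschitz_on_subset) (use a I in auto)
  from lipschitz_on_add[OF lipschitz_on_constant this, of "c - integral {0..a} g"]
  have "B-lipschitz_on I (\<lambda>t. (c - integral {0..a} g) + integral {0..t} g)" by simp
  then show "B-lipschitz_on I y"
    by (rule lipschitz_on_transform) (use yI in simp)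
  obtain S where S: "negligible S" "\<And>t. t > 0 \<Longrightarrow> t \<notin> S \<Longrightarrow> ((\<lambda>t. integral {0..t} g) has_vector_derivative g t) (at t)"
    using indefinite_integral_derivative_ae[OF int] by metis
  have "(y has_vector_derivative g t) (at t)" if t: "t \<in> I - (S \<union> {a})" for t
  proof -
    have "a \<le> t" "t \<noteq> a" using t I by auto
    then have "((\<lambda>t. integral {0..t} g) has_vector_derivative g t) (at t)" using t a by (intro S(2)) auto
    then have "((\<lambda>t. (c - integral {0..a} g) + integral {0..t} g) has_vector_derivative 0 + g t) (at t)"
      by (intro derivative_intros)
    then have "((\<lambda>t. (c - integral {0..a} g) + integral {0..t} g) has_vector_derivative g t) (at t)" by simp
    then show ?thesis
      by (rule has_vector_derivative_transform_within_open[OF _ I(2)]) (use t yI in auto)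
  qed
  moreover have "negligible (S \<union> {a})" using S(1) by (intro negligible_Un) auto
  ultimately show "\<exists>S. negligible S \<and> (\<forall>t\<in>I - S. (y has_vector_derivative g t) (at t))" by blast
qed

context closed_loop_setup
begin

text \<open>The cutoff multiplies the complete vector field, so that \<open>V\<close> still does not increase along truncated
  solutions outside the level sets; this keeps them in the region where the truncation is inactive.\<close>
definition plant_trunc where "plant_trunc m x u = cutoff m x *\<^sub>R f (clip (m + 1) x) u"
definition observer_trunc where "observer_trunc m z w u = cutoff m z *\<^sub>R (f (clip (m + 1) z) u + kh (clip (m + 1) z) (clip m w) u)"
definition drift_trunc where "drift_trunc m z u = jacobian h (at (clip m z)) *v f (clip m z) u"
definition output_trunc where "output_trunc m x = h (clip m x)"
definition sat_trunc where "sat_trunc m \<xi> z = sat (clip m \<xi>) (clip m z)"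
definition predictor_trunc where "predictor_trunc m \<xi> z u = f (sat_trunc m \<xi> z) u"

text \<open>Both constants are chosen before \<open>ts\<close>: the transient gains must be uniform
  over all sampling schedules.\<close>

lemma trunc_system:
  assumes m: "0 \<le> m"
  shows "\<exists>L0 B. \<forall>ts. time_partition ts \<longrightarrow>
    lip_system (plant_trunc m) (observer_trunc m) (drift_trunc m) (output_trunc m) (sat_trunc m) (predictor_trunc m) kf U L0 B \<tau> r N \<delta> ts"
proof -
  have m1: "0 \<le> m + 1" using m by simp
  have Usnd: "lipb (UNIV \<times> U) (snd :: 'z::real_normed_vector \<times> (real^'m) \<Rightarrow> real^'m)"
  proof -
    obtain B where B: "\<forall>u\<in>U. norm u \<le> B" using bounded_U unfolding bounded_iff by blast
    show ?thesis
    proof (rule lipbI[of _ _ 1 B])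
      show "norm (snd x - snd y) \<le> 1 * dist x y" for x y :: "'z \<times> (real^'m)"
        using dist_snd_le[of x y] by (simp only: dist_norm mult_1)
    qed (use B in auto)
  qed
  have c1: "lipb S (\<lambda>s. clip k (fst s :: 'e))" if "0 \<le> k" for k and S :: "('e::euclidean_space \<times> 'z::real_normed_vector) set"
    by (rule lipb_lipschitz_comp[OF dist_fst_le clip_lipb[OF that]])
  have c2: "lipb S (\<lambda>s. clip k (snd s :: 'e))" if "0 \<le> k" for k and S :: "('z::real_normed_vector \<times> 'e::euclidean_space) set"
    by (rule lipb_lipschitz_comp[OF dist_snd_le clip_lipb[OF that]])
  have cff: "lipb S (\<lambda>s. clip k (fst (fst s) :: 'e))" if "0 \<le> k" for k and S :: "(('e::euclidean_space \<times> 'y::real_normed_vector) \<times> 'z::real_normed_vector) set"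
    by (rule lipb_lipschitz_comp[OF _ clip_lipb[OF that]]) (rule order_trans[OF dist_fst_le dist_fst_le])
  have cfs: "lipb S (\<lambda>s. clip k (snd (fst s) :: 'e))" if "0 \<le> k" for k and S :: "(('y::real_normed_vector \<times> 'e::euclidean_space) \<times> 'z::real_normed_vector) set"
    by (rule lipb_lipschitz_comp[OF _ clip_lipb[OF that]]) (rule order_trans[OF dist_snd_le dist_fst_le])
  have "lipb (UNIV \<times> U) (\<lambda>s. plant_trunc m (fst s) (snd s))"
    unfolding plant_trunc_def by (intro lipb_scaleR f_lipb c1 m1 Usnd lipb_lipschitz_comp[OF _ cutoff_lipb] dist_fst_le)
  from lipb_two_args[OF this] obtain C1 where C1: "C1 > 0"
    "\<And>x x' u u'. u \<in> U \<Longrightarrow> u' \<in> U \<Longrightarrow> norm (plant_trunc m x u - plant_trunc m x' u') \<le> C1 * (norm (x - x') + norm (u - u'))" "\<And>x u. u \<in> U \<Longrightarrow> norm (plant_trunc m x u) \<le> C1"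
    by metis
  have kl: "lipb (UNIV \<times> U) (\<lambda>s. kh (clip (m + 1) (fst (fst s))) (clip m (snd (fst s))) (snd s))"
  proof -
    have "lipb (UNIV \<times> U) (\<lambda>s. case (clip (m + 1) (fst (fst s)), clip m (snd (fst s)), snd s) of (z, y, u) \<Rightarrow> kh z y u)"
    proof (rule lipb_comp[where T = "cball 0 (m + 1) \<times> cball 0 m \<times> U"])
      show "lipb (UNIV \<times> U) (\<lambda>s. (clip (m + 1) (fst (fst s)) :: real^'n, clip m (snd (fst s)) :: real^'k, snd s))"
        by (intro lipb_Pair cff cfs m m1 Usnd)
      show "lipb (cball 0 (m + 1) \<times> cball 0 m \<times> U) (\<lambda>(z, y, u). kh z y u)"
        by (intro kh_lipb bounded_Times bounded_cball bounded_U) auto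
    qed (auto intro: clip_norm[OF m] clip_norm[OF m1])
    then show ?thesis by simp
  qed
  have "lipb (UNIV \<times> U) (\<lambda>s. observer_trunc m (fst (fst s)) (snd (fst s)) (snd s))"
    unfolding observer_trunc_def by (intro lipb_scaleR lipb_add kl f_lipb cff m1 Usnd lipb_lipschitz_comp[OF _ cutoff_lipb] order_trans[OF dist_fst_le dist_fst_le])
  from lipb_two_args[where G = "\<lambda>p. observer_trunc m (fst p) (snd p)", OF this] obtain C2 where C2: "C2 > 0"
    "\<And>p p' u u'. u \<in> U \<Longrightarrow> u' \<in> U \<Longrightarrow> norm (observer_trunc m (fst p) (snd p) u - observer_trunc m (fst p') (snd p') u') \<le> C2 * (norm (p - p') + norm (u - u'))"
    "\<And>p u. u \<in> U \<Longrightarrow> norm (observer_trunc m (fst p) (snd p) u) \<le> C2"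
    by metis
  have "lipb (UNIV \<times> U) (\<lambda>s. drift_trunc m (fst s) (snd s))"
    unfolding drift_trunc_def by (intro Dhf_lipb c1 m Usnd)
  from lipb_two_args[OF this] obtain C3 where C3: "C3 > 0"
    "\<And>x x' u u'. u \<in> U \<Longrightarrow> u' \<in> U \<Longrightarrow> norm (drift_trunc m x u - drift_trunc m x' u') \<le> C3 * (norm (x - x') + norm (u - u'))" "\<And>x u. u \<in> U \<Longrightarrow> norm (drift_trunc m x u) \<le> C3"
    by metis
  have "lipb UNIV (output_trunc m)" unfolding output_trunc_def by (intro lipb_blip[OF clip_lipb[OF m] h_blip])
  from lipb_bound[OF this] obtain CH where CH: "CH > 0" "\<And>x x'. norm (output_trunc m x - output_trunc m x') \<le> CH * norm (x - x')" "\<And>x. norm (output_trunc m x) \<le> CH"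
    unfolding dist_norm by (metis UNIV_I)
  have "lipb (UNIV \<times> UNIV) (\<lambda>s. sat_trunc m (fst s) (snd s))"
    unfolding sat_trunc_def by (intro sat_lipb c1 c2 m)
  from lipb_two_args[OF this] obtain C4 where C4: "C4 > 0"
    "\<And>x x' u u'. norm (sat_trunc m x u - sat_trunc m x' u') \<le> C4 * (norm (x - x') + norm (u - u'))" "\<And>x u. norm (sat_trunc m x u) \<le> C4"
    by (metis UNIV_I)
  have "lipb (UNIV \<times> U) (\<lambda>s. predictor_trunc m (fst (fst s)) (snd (fst s)) (snd s))"
    unfolding predictor_trunc_def sat_trunc_def by (intro f_lipb sat_lipb cff cfs m Usnd)
  from lipb_two_args[where G = "\<lambda>p. predictor_trunc m (fst p) (snd p)", OF this] obtain C5 where C5: "C5 > 0"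
    "\<And>p p' u u'. u \<in> U \<Longrightarrow> u' \<in> U \<Longrightarrow> norm (predictor_trunc m (fst p) (snd p) u - predictor_trunc m (fst p') (snd p') u') \<le> C5 * (norm (p - p') + norm (u - u'))"
    "\<And>p u. u \<in> U \<Longrightarrow> norm (predictor_trunc m (fst p) (snd p) u) \<le> C5"
    by metis
  obtain Mk where Mk: "Mk-lipschitz_on UNIV kf" using kf(1) by blast
  define C where "C = C1 + C2 + C3 + CH + C4 + C5 + Mk"
  have Mk0: "0 \<le> Mk" using Mk lipschitz_on_nonneg by blast
  have CC: "0 \<le> C" "C1 \<le> C" "C2 \<le> C" "C3 \<le> C" "CH \<le> C" "C4 \<le> C" "C5 \<le> C" "Mk \<le> C"
    unfolding C_def using C1(1) C2(1) C3(1) CH(1) C4(1) C5(1) Mk0 by auto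
  have up: "v \<le> C * s" if "v \<le> D * s'" "D \<le> C" "0 \<le> D" "s' \<le> s" "0 \<le> s'" for v D s s'
    using mult_mono[OF that(2,4) CC(1) that(5)] that(1) by linarith
  show ?thesis
  proof (rule exI[of _ C], rule exI[of _ C], intro allI impI)
    fix ts assume ts: "time_partition ts"
    show "lip_system (plant_trunc m) (observer_trunc m) (drift_trunc m) (output_trunc m) (sat_trunc m) (predictor_trunc m) kf U C C \<tau> r N \<delta> ts"
    proof
      show "norm (kf x - kf x') \<le> C * norm (x - x')" for x x'
        by (rule up[of _ Mk "norm (x - x')"]) (use lipschitz_onD[OF Mk, of x x'] CC Mk0 in \<open>auto simp: dist_norm\<close>)
      show "norm (plant_trunc m x u - plant_trunc m x' u') \<le> C * (norm (x - x') + norm (u - u'))" if "u \<in> U" "u' \<in> U" for x x' u u'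
        by (rule up[OF C1(2)[OF that]]) (use CC C1(1) in auto)
      show "norm (drift_trunc m x u - drift_trunc m x' u') \<le> C * (norm (x - x') + norm (u - u'))" if "u \<in> U" "u' \<in> U" for x x' u u'
        by (rule up[OF C3(2)[OF that]]) (use CC C3(1) in auto)
      show "norm (sat_trunc m x z - sat_trunc m x' z') \<le> C * (norm (x - x') + norm (z - z'))" for x x' z z'
        by (rule up[OF C4(2)]) (use CC C4(1) in auto)
      show "norm (output_trunc m x - output_trunc m x') \<le> C * norm (x - x')" for x x'
        by (rule up[OF CH(2)]) (use CC CH(1) in auto)
      show "norm (observer_trunc m z w u - observer_trunc m z' w' u') \<le> C * (norm (z - z') + norm (w - w') + norm (u - u'))" if "u \<in> U" "u' \<in> U" for z z' w w' u u'
        by (rule up[OF C2(2)[OF that, of "(z, w)" "(z', w')", simplified]]) (use CC C2(1) norm_Pair_le[of "z - z'" "w - w'"] in auto)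
      show "norm (predictor_trunc m z w u - predictor_trunc m z' w' u') \<le> C * (norm (z - z') + norm (w - w') + norm (u - u'))" if "u \<in> U" "u' \<in> U" for z z' w w' u u'
        by (rule up[OF C5(2)[OF that, of "(z, w)" "(z', w')", simplified]]) (use CC C5(1) norm_Pair_le[of "z - z'" "w - w'"] in auto)
      show "norm (plant_trunc m x u) \<le> C" if "u \<in> U" for x u using C1(3)[OF that] CC(2) by (rule order_trans)
      show "norm (drift_trunc m x u) \<le> C" if "u \<in> U" for x u using C3(3)[OF that] CC(4) by (rule order_trans)
      show "norm (observer_trunc m x z u) \<le> C" if "u \<in> U" for x z u using order_trans[OF C2(3)[OF that, of "(x, z)"] CC(3)] by simp
      show "norm (predictor_trunc m x z u) \<le> C" if "u \<in> U" for x z u using order_trans[OF C5(3)[OF that, of "(x, z)"] CC(7)] by simp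
      show "norm (output_trunc m x) \<le> C" for x using CH(3) CC(5) by (rule order_trans)
      show "norm (sat_trunc m x z) \<le> C" for x z using C4(3) CC(6) by (rule order_trans)
    qed (use CC delays N \<delta>_def U kf ts compact_imp_closed in auto)
  qed
qed

lemma trunc_zero: "0 \<le> m \<Longrightarrow> plant_trunc m 0 0 = 0" "0 \<le> m \<Longrightarrow> observer_trunc m 0 0 0 = 0" "0 \<le> m \<Longrightarrow> drift_trunc m 0 0 = 0" "0 \<le> m \<Longrightarrow> output_trunc m 0 = 0"
  "0 \<le> m \<Longrightarrow> sat_trunc m 0 0 = 0" "0 \<le> m \<Longrightarrow> predictor_trunc m 0 0 0 = 0"
proof -
  assume m: "0 \<le> m"
  have c: "clip m 0 = 0" "clip (m + 1) 0 = 0" "clip m (0::real^'k) = 0" using m by (auto intro: clip_id)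
  have s: "sat 0 0 = 0" by (simp add: sat_def)
  have k: "kh 0 0 0 = 0" using kh_norm[OF U(3), of 0 0] h(2) by simp
  show "plant_trunc m 0 0 = 0" "observer_trunc m 0 0 0 = 0" "drift_trunc m 0 0 = 0" "output_trunc m 0 = 0" "sat_trunc m 0 0 = 0" "predictor_trunc m 0 0 0 = 0"
    unfolding plant_trunc_def observer_trunc_def drift_trunc_def output_trunc_def sat_trunc_def predictor_trunc_def c s f(2) h(2) k by simp_all
qed

lemma trunc_eq:
  "norm v \<le> m \<Longrightarrow> plant_trunc m v u' = f v u'" "norm v \<le> m \<Longrightarrow> norm y \<le> m \<Longrightarrow> observer_trunc m v y u' = f v u' + kh v y u'"
  "norm v \<le> m \<Longrightarrow> drift_trunc m v u' = jacobian h (at v) *v f v u'" "norm v \<le> m \<Longrightarrow> output_trunc m v = h v"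
  "norm v \<le> m \<Longrightarrow> norm v' \<le> m \<Longrightarrow> sat_trunc m v' v = sat v' v" "norm v \<le> m \<Longrightarrow> norm v' \<le> m \<Longrightarrow> predictor_trunc m v' v u' = f (sat v' v) u'"
  by (auto simp: plant_trunc_def observer_trunc_def drift_trunc_def output_trunc_def sat_trunc_def predictor_trunc_def clip_id cutoff_simps)

end

section \<open>Linear bounds on bounded time intervals\<close>

text \<open>A solution is a total function with arbitrary values outside its domain, and its bounds
  are used only up to \<open>T\<close>; extension by 0 turns it into a measurable state of the
  truncated system.\<close>

definition window :: "real \<Rightarrow> (real \<Rightarrow> 'z) \<Rightarrow> real \<Rightarrow> 'z::euclidean_space" where
  "window T g = (\<lambda>t. if t \<in> {0..T} then g t else 0)"

lemma window_eq: "t \<in> {0..T} \<Longrightarrow> window T g t = g t" by (simp add: window_def)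

lemma window_meas:
  assumes "continuous_on {0..T} g" shows "window T g \<in> borel_measurable lebesgue"
proof -
  have "(\<lambda>t. if t \<in> {0..T} then g t else 0) \<in> borel_measurable borel"
    using assms by (intro borel_measurable_continuous_on_if) auto
  then show ?thesis unfolding window_def by (simp add: measurable_completion)
qed

context closed_loop_setup
begin

text \<open>\<open>n\<close> bounds the data, \<open>m0\<close> the plant and the observer through
  levels of \<open>V\<close>, and \<open>m\<close> everything else. The sum with \<open>Mh\<close>
  is the initial value, a measurement with its error and the drift over \<open>Ts\<close>; the last
  line is the predictor bound of \<open>xi_le_\<rho>\<close>.\<close>

definition apriori :: "real \<Rightarrow> real \<Rightarrow> real \<Rightarrow> bool" where
  "apriori n m0 m \<longleftrightarrow> n \<le> m0 \<and> m0 \<le> m \<and> (\<forall>v v0. norm v0 \<le> n \<longrightarrow> V v \<le> max (V v0) b \<longrightarrow> norm v \<le> m0) \<and>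
     (\<exists>Mh Bf. 0 \<le> Mh \<and> 0 \<le> Bf \<and> (\<forall>v. norm v \<le> m0 \<longrightarrow> norm (h v) \<le> Mh) \<and>
        (\<forall>v u. norm v \<le> m0 \<and> u \<in> U \<longrightarrow> norm (jacobian h (at v) *v f v u) \<le> Bf) \<and> n + Mh + n + Bf * Ts \<le> m) \<and>
     (\<forall>v. norm v \<le> m0 \<longrightarrow> K * \<psi> v + \<delta> * \<rho> (K * \<psi> v) \<le> m)"

lemma V_level: "\<exists>C. \<forall>v. norm v \<le> n \<longrightarrow> V v \<le> C"
proof -
  obtain C where "\<forall>v\<in>cball 0 n. norm (V v) \<le> C" using lipb_bound[OF blip_lipb[OF V_blip bounded_cball, of 0 n]] by blast
  then show ?thesis by (intro exI[of _ C]) (auto simp: abs_le_iff)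
qed

lemma apriori_ex: "0 \<le> n \<Longrightarrow> \<exists>m0 m. apriori n m0 m"
proof -
  assume n: "0 \<le> n"
  obtain Vn where Vn: "\<forall>v. norm v \<le> n \<longrightarrow> V v \<le> Vn" using V_level by blast
  obtain m1 where m1: "\<forall>v\<in>{v. V v \<le> max Vn b}. norm v \<le> m1" using level_bounded unfolding bounded_iff by blast
  define m0 where "m0 = max n m1"
  have a: "norm v \<le> m0" if "norm v0 \<le> n" "V v \<le> max (V v0) b" for v v0
  proof -
    have "V v \<le> max Vn b" using Vn[rule_format, OF that(1)] that(2) by auto
    then show ?thesis using m1 by (auto simp: m0_def)
  qed
  obtain Mh where Mh: "Mh > 0" "\<forall>x\<in>cball 0 m0. norm (h x) \<le> Mh" using lipb_bound[OF blip_lipb[OF h_blip bounded_cball, of 0 m0]] by blast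
  obtain Bf where Bf: "0 \<le> Bf" "\<forall>z u. norm z \<le> m0 \<and> u \<in> U \<longrightarrow> norm (jacobian h (at z) *v f z u) \<le> Bf" using Dhf_bounded by blast
  obtain C where C: "C > 0" "\<forall>z\<in>cball 0 m0. norm (\<psi> z) \<le> C" using lipb_bound[OF blip_lipb[OF \<psi>_blip bounded_cball, of 0 m0]] by blast
  obtain D where D: "\<forall>z u. norm z \<le> K * C \<and> u \<in> U \<longrightarrow> norm (f z u) \<le> D" using f_bounded by blast
  have K0: "0 \<le> K" using q(4) by simp
  have r: "K * \<psi> v + \<delta> * \<rho> (K * \<psi> v) \<le> K * C + \<delta> * D" if v: "norm v \<le> m0" for v
  proof -
    have "norm (\<psi> v) \<le> C" using C(2) v by simp
    then have pC: "\<psi> v \<le> C" by simp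
    have KC: "K * \<psi> v \<le> K * C" using pC K0 by (rule mult_left_mono)
    have "0 \<le> K * \<psi> v" using K0 \<psi>_pos(1)[of v] by simp
    then have "\<rho> (K * \<psi> v) \<le> D" by (rule \<rho>_least) (use D KC in \<open>meson order_trans\<close>)
    then show ?thesis using KC mult_left_mono[OF _ \<delta>_nonneg, of "\<rho> (K * \<psi> v)" D] by linarith
  qed
  define m where "m = max m0 (max (n + Mh + n + Bf * Ts) (K * C + \<delta> * D))"
  have "apriori n m0 m" unfolding apriori_def
  proof (intro conjI)
    show "\<forall>v. norm v \<le> m0 \<longrightarrow> K * \<psi> v + \<delta> * \<rho> (K * \<psi> v) \<le> m" using r by (auto simp: m_def le_max_iff_disj)
    show "\<exists>Mh Bf. 0 \<le> Mh \<and> 0 \<le> Bf \<and> (\<forall>v. norm v \<le> m0 \<longrightarrow> norm (h v) \<le> Mh) \<and>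
        (\<forall>v u. norm v \<le> m0 \<and> u \<in> U \<longrightarrow> norm (jacobian h (at v) *v f v u) \<le> Bf) \<and> n + Mh + n + Bf * Ts \<le> m"
      by (rule exI[of _ Mh], rule exI[of _ Bf]) (use Mh Bf in \<open>auto simp: m_def\<close>)
    show "\<forall>v v0. norm v0 \<le> n \<longrightarrow> V v \<le> max (V v0) b \<longrightarrow> norm v \<le> m0" using a by blast
  qed (simp_all add: m_def m0_def)
  then show ?thesis by blast
qed

text \<open>A truncation radius that depends on the data only through \<open>n\<close>, so that all
  gains derived from it are functions of \<open>n\<close>.\<close>

definition radius :: "real \<Rightarrow> real" where "radius n = (SOME m. \<exists>m0. apriori n m0 m)"

lemma radius: "0 \<le> n \<Longrightarrow> \<exists>m0. apriori n m0 (radius n)"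
  unfolding radius_def by (rule someI_ex) (use apriori_ex in blast)

lemma radius_nonneg: "0 \<le> n \<Longrightarrow> 0 \<le> radius n"
  using radius[of n] unfolding apriori_def by auto

definition trunc_lipschitz :: "real \<Rightarrow> real" where
  "trunc_lipschitz n = (SOME L0. \<exists>B. \<forall>ts. time_partition ts \<longrightarrow> lip_system (plant_trunc (radius n)) (observer_trunc (radius n)) (drift_trunc (radius n))
     (output_trunc (radius n)) (sat_trunc (radius n)) (predictor_trunc (radius n)) kf U L0 B \<tau> r N \<delta> ts)"

lemma trunc_lipschitz: "0 \<le> n \<Longrightarrow> \<exists>B. \<forall>ts. time_partition ts \<longrightarrow> lip_system (plant_trunc (radius n)) (observer_trunc (radius n)) (drift_trunc (radius n))
     (output_trunc (radius n)) (sat_trunc (radius n)) (predictor_trunc (radius n)) kf U (trunc_lipschitz n) B \<tau> r N \<delta> ts"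
  unfolding trunc_lipschitz_def by (rule someI_ex) (rule trunc_system[OF radius_nonneg])

definition transient_rate :: "real \<Rightarrow> real" where "transient_rate n = 2 * step_gain (trunc_lipschitz n) \<delta> N"

definition data_bound where
  "data_bound S T x0 z0 w0 \<xi>0 u0 e \<longleftrightarrow>
     (\<forall>v\<in>{-r..0}. norm (x0 v :: real^'n) \<le> S) \<and> norm (z0 :: real^'n) \<le> S \<and> norm (w0 :: real^'k) \<le> S \<and>
     (\<forall>j\<in>{1..N}. \<forall>v\<in>{-\<delta>..<0}. norm (\<xi>0 j v :: real^'n) \<le> S) \<and>
     (\<forall>v\<in>{-r-\<tau>..<0}. norm (u0 v :: real^'m) \<le> S) \<and> (\<forall>v\<in>{0..T::real}. norm (e v :: real^'k) \<le> S)"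

end

section \<open>The linear transient bound\<close>

context closed_loop_solution_locale
begin

lemma state_bounded:
  assumes ap: "apriori n m0 m" and d: "data_bound n T x0 z0 w0 \<xi>0 u0 e" and n: "0 \<le> n"
  shows "l \<in> {0..T} \<Longrightarrow> norm (x l) \<le> m0" "l \<in> {0..T} \<Longrightarrow> norm (z l) \<le> m0"
    "l \<in> {0..T} \<Longrightarrow> norm (w l) \<le> m" "j \<in> {1..N} \<Longrightarrow> l \<in> {0..T} \<Longrightarrow> norm (\<xi> j l) \<le> m"
    "l \<in> {-r..T} \<Longrightarrow> norm (x l) \<le> m0"
proof -
  obtain Mh Bf where ap': "n \<le> m0" "m0 \<le> m" "\<And>v v0. norm v0 \<le> n \<Longrightarrow> V v \<le> max (V v0) b \<Longrightarrow> norm v \<le> m0"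
     "0 \<le> Mh" "0 \<le> Bf" "\<And>v. norm v \<le> m0 \<Longrightarrow> norm (h v) \<le> Mh"
     "\<And>v u. norm v \<le> m0 \<Longrightarrow> u \<in> U \<Longrightarrow> norm (jacobian h (at v) *v f v u) \<le> Bf" "n + Mh + n + Bf * Ts \<le> m"
     "\<And>v. norm v \<le> m0 \<Longrightarrow> K * \<psi> v + \<delta> * \<rho> (K * \<psi> v) \<le> m" using ap unfolding apriori_def by blast
  have d': "\<And>v. v \<in> {-r..0} \<Longrightarrow> norm (x0 v) \<le> n" "norm z0 \<le> n" "norm w0 \<le> n" "\<And>v. v \<in> {0..T} \<Longrightarrow> norm (e v) \<le> n"
    using d unfolding data_bound_def by auto
  have x0n: "norm (x 0) \<le> n" using x_init[of 0] d'(1)[of 0] delays by simp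
  have X: "norm (x l) \<le> m0" if "l \<in> {0..T}" for l
    by (rule ap'(3)[OF x0n]) (use Vx_le[of l] that consts3 in auto)
  have Z: "norm (z l) \<le> m0" if "l \<in> {0..T}" for l
    by (rule ap'(3)[OF d'(2)]) (use Vz_le[of l] that z_init in auto)
  have X': "norm (x l) \<le> m0" if "l \<in> {-r..T}" for l
  proof (cases "0 \<le> l")
    case True then show ?thesis using X that by simp
  next
    case False then show ?thesis using x_init[of l] d'(1)[of l] that ap'(1) by simp
  qed
  show "l \<in> {0..T} \<Longrightarrow> norm (x l) \<le> m0" "l \<in> {0..T} \<Longrightarrow> norm (z l) \<le> m0" by (fact X, fact Z)
  show "l \<in> {-r..T} \<Longrightarrow> norm (x l) \<le> m0" by (fact X')
  show "norm (w l) \<le> m" if l: "l \<in> {0..T}"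
  proof -
    have "norm (w l) \<le> norm w0 + Mh + n + Bf * Ts"
      by (rule w_bound[OF Z ap'(7,5) ap'(6)[OF X'] ap'(4) d'(4) n l])
    then show ?thesis using d'(3) ap'(8) by linarith
  qed
  show "norm (\<xi> j l) \<le> m" if "j \<in> {1..N}" "l \<in> {0..T}"
    using xi_le_\<rho>[OF that(1), of l] ap'(9)[OF Z[OF that(2)]] that by simp
qed

text \<open>\<open>n\<close> fixes the truncation and hence the rate, whereas the bound is linear in
  the possibly much smaller \<open>S\<close>. By the a priori bounds the truncation is inactive
  along the solution, whose restriction to \<open>{0..T}\<close> is therefore a fixed point of the
  truncated Gauss-Seidel step.\<close>

lemma transient:
  assumes n: "0 \<le> n" and d: "data_bound S T x0 z0 w0 \<xi>0 u0 e" and S: "0 \<le> S" "S \<le> n" and l: "l \<in> {0..T}"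
  shows "norm (x l) \<le> transient_rate n * S * exp (transient_rate n * l)" "norm (z l) \<le> transient_rate n * S * exp (transient_rate n * l)"
    "norm (w l) \<le> transient_rate n * S * exp (transient_rate n * l)" "j \<in> {1..N} \<Longrightarrow> norm (\<xi> j l) \<le> transient_rate n * S * exp (transient_rate n * l)"
proof -
  define m where "m = radius n"
  obtain m0 where ap: "apriori n m0 m" using radius[OF n] unfolding m_def by blast
  have m0m: "n \<le> m0" "m0 \<le> m" and m: "0 \<le> m" using ap n unfolding apriori_def by auto
  have T: "0 \<le> T" using l by simp
  have dn: "data_bound n T x0 z0 w0 \<xi>0 u0 e" using d S(2) unfolding data_bound_def by (meson order_trans)
  note sb = state_bounded[OF ap dn n]
  have bx: "norm (x v) \<le> m" if "v \<in> {-r..T}" for v using sb(5)[OF that] m0m(2) by (rule order_trans)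
  have bz: "norm (z v) \<le> m" if "v \<in> {0..T}" for v using sb(2)[OF that] m0m(2) by (rule order_trans)
  note bw = sb(3)
  have bxi: "norm (\<xi> j v) \<le> m" if "j \<le> N" "v \<in> {0..T}" for j v
  proof (cases "j = 0")
    case True then show ?thesis using bz[OF that(2)] xi0[of v] that by simp
  next
    case False then show ?thesis using sb(4)[of j v] that by simp
  qed
  have bxi': "norm (\<xi> j v) \<le> m" if "j \<in> {1..N}" "v \<in> {-\<delta>..T}" for j v
  proof (cases "v < 0")
    case True
    then have v: "v \<in> {-\<delta>..<0}" using that by simp
    have "norm (\<xi>0 j v) \<le> n" using dn v that(1) unfolding data_bound_def by blast
    then show ?thesis using xi_init[OF that(1) v] m0m by simp
  next
    case False then show ?thesis using bxi[of j v] that by simp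
  qed
  obtain B where "lip_system (plant_trunc m) (observer_trunc m) (drift_trunc m) (output_trunc m) (sat_trunc m) (predictor_trunc m) kf U (trunc_lipschitz n) B \<tau> r N \<delta> ts"
    using trunc_lipschitz[OF n] ts unfolding m_def by blast
  then interpret T: lip_system "plant_trunc m" "observer_trunc m" "drift_trunc m" "output_trunc m" "sat_trunc m" "predictor_trunc m" kf U "trunc_lipschitz n" B \<tau> r N \<delta> ts .
  define xT where "xT = window T x"
  define zT where "zT = window T z"
  define wT where "wT = window T w"
  define xiT where "xiT = (\<lambda>j. window T (\<xi> j))"
  define uT where "uT = T.uhist u0 (xiT N)"
  have xm: "xT \<in> borel_measurable lebesgue" and zm: "zT \<in> borel_measurable lebesgue"
    unfolding xT_def zT_def by (rule window_meas[OF x_cont[OF T]], rule window_meas[OF z_cont[OF T]])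
  have xim: "xiT j \<in> borel_measurable lebesgue" if j: "j \<in> {1..N}" for j
  proof -
    have "\<xi> j \<in> borel_measurable (lebesgue_on {-\<delta>..T})" using xi_Linf[OF j T] by (simp add: Linf_fun_def)
    then have "\<xi> j \<in> borel_measurable (lebesgue_on {0..T})"
      by (rule measurable_restrict_mono) (use \<delta>_nonneg in auto)
    then show ?thesis unfolding xiT_def window_def by (rule borel_measurable_if_I) simp
  qed
  have ad: "T.admissible \<xi>0 u0"
    using u0 \<xi>0 unfolding T.admissible_def Linf_fun_def by auto
  have N1: "N \<in> {1..N}" using N by simp
  have um: "uT \<in> borel_measurable lebesgue"
    unfolding uT_def using ad xim[OF N1] by (intro T.uhist_meas) (auto simp: T.admissible_def)
  have uU: "uT v \<in> U" for v
    unfolding uT_def using ad by (intro T.uhist_U) (auto simp: T.admissible_def)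
  have ueq: "uT v = u v" if "v \<in> {-r-\<tau>..T}" for v
  proof (cases "v < 0")
    case True then show ?thesis using that u_init[of v] by (simp add: uT_def T.uhist_def)
  next
    case False
    then show ?thesis using that u_eq[of v] by (simp add: uT_def T.uhist_def xiT_def window_eq)
  qed
  have Xeq: "xT t = T.Xs x0 xT uT t" if t: "t \<in> {0..T}" for t
  proof -
    have "((\<lambda>s. f (x s) (u (s - \<tau>))) has_integral (x t - x 0)) {0..t}"
      by (rule lipode_FTC[OF x_lipode]) (use t in simp)
    then have "((\<lambda>s. plant_trunc m (xT s) (uT (s - \<tau>))) has_integral (x t - x 0)) {0..t}"
    proof (rule has_integral_eq[rotated])
      fix s assume s: "s \<in> {0..t}"
      then have "xT s = x s" "uT (s - \<tau>) = u (s - \<tau>)" using t delays by (auto simp: xT_def intro!: window_eq ueq)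
      then show "f (x s) (u (s - \<tau>)) = plant_trunc m (xT s) (uT (s - \<tau>))" using trunc_eq(1)[OF bx[of s]] s t delays by simp
    qed
    then have "integral {0..t} (\<lambda>s. plant_trunc m (xT s) (uT (s - \<tau>))) = x t - x0 0" using x_init[of 0] delays by (simp add: integral_unique)
    then show ?thesis using t by (simp add: T.Xs_def xT_def window_eq)
  qed
  have Zeq: "zT t = T.Zs z0 zT wT uT t" if t: "t \<in> {0..T}" for t
  proof -
    have "((\<lambda>s. f (z s) (u (s - r - \<tau>)) + kh (z s) (w s) (u (s - r - \<tau>))) has_integral (z t - z 0)) {0..t}"
      by (rule lipode_FTC[OF z_lipode]) (use t in simp)
    then have "((\<lambda>s. observer_trunc m (zT s) (wT s) (uT (s - r - \<tau>))) has_integral (z t - z 0)) {0..t}"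
    proof (rule has_integral_eq[rotated])
      fix s assume s: "s \<in> {0..t}"
      then have "zT s = z s" "wT s = w s" "uT (s - r - \<tau>) = u (s - r - \<tau>)" using t delays by (auto simp: zT_def wT_def intro!: window_eq ueq)
      then show "f (z s) (u (s - r - \<tau>)) + kh (z s) (w s) (u (s - r - \<tau>)) = observer_trunc m (zT s) (wT s) (uT (s - r - \<tau>))"
        using trunc_eq(2)[OF bz[of s] bw[of s]] s t by simp
    qed
    then have "integral {0..t} (\<lambda>s. observer_trunc m (zT s) (wT s) (uT (s - r - \<tau>))) = z t - z0" using z_init by (simp add: integral_unique)
    then show ?thesis using t by (simp add: T.Zs_def zT_def window_eq)
  qed
  have Weq: "wT t = T.Ws x0 w0 e xT zT uT t" if t: "t \<in> {0..T}" for t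
  proof -
    define i where "i = sampling_index ts t"
    have i: "0 \<le> ts i" "ts i \<le> t" "t < ts (Suc i)"
      unfolding i_def using sampling_index_nonneg[OF ts] sampling_index_lower[OF ts] sampling_index_upper[OF ts] t by auto
    have "((\<lambda>s. drift_trunc m (zT s) (uT (s - r - \<tau>))) has_integral (w t - w (ts i))) {ts i..t}"
      using w_integral[OF i(2,3)]
    proof (rule has_integral_eq[rotated])
      fix s assume s: "s \<in> {ts i..t}"
      then have "zT s = z s" "uT (s - r - \<tau>) = u (s - r - \<tau>)" using t i delays by (auto simp: zT_def intro!: window_eq ueq)
      then show "jacobian h (at (z s)) *v f (z s) (u (s - r - \<tau>)) = drift_trunc m (zT s) (uT (s - r - \<tau>))"
        using trunc_eq(3)[OF bz[of s]] s t i by simp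
    qed
    then have I: "integral {ts i..t} (\<lambda>s. drift_trunc m (zT s) (uT (s - r - \<tau>))) = w t - w (ts i)" by (rule integral_unique)
    have "T.sample x0 w0 e xT i = w (ts i)"
    proof (cases "i = 0")
      case True then show ?thesis using w_init ts by (simp add: T.sample_def time_partition_def)
    next
      case False
      have v: "ts i - r \<in> {-r..T}" using i t delays by simp
      have "T.xhist x0 xT (ts i - r) = x (ts i - r)"
        using x_init[of "ts i - r"] v by (auto simp: T.xhist_def xT_def window_eq)
      then show ?thesis using False w_sample[of i] trunc_eq(4)[OF bx[OF v]] by (simp add: T.sample_def)
    qed
    then show ?thesis using t I by (simp add: T.Ws_def wT_def window_eq i_def)
  qed
  \<comment> \<open>Being reset at the samples, \<open>w\<close> gets its measurability from the
    formula \<open>Ws\<close> and not from continuity.\<close>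
  have wm: "wT \<in> borel_measurable lebesgue"
  proof -
    let ?g = "\<lambda>t. if t < 0 then 0 else T.Ws x0 w0 e xT zT uT t"
    have "?g \<in> borel_measurable lebesgue" by (rule T.Ws_meas[OF zm um uU])
    then have "(\<lambda>t. if t \<in> {0..T} then ?g t else 0) \<in> borel_measurable lebesgue"
      by (intro borel_measurable_if_I measurable_restrict_space1) auto
    moreover have "wT = (\<lambda>t. if t \<in> {0..T} then ?g t else 0)"
      using Weq by (intro ext) (auto simp: wT_def window_def)
    ultimately show ?thesis by (simp only:)
  qed
  have Peq: "xiT (Suc j) t = sat_trunc m (xiT j t) (zT t) + T.Ps (Suc j) (T.xihist (\<xi>0 (Suc j)) (xiT (Suc j))) zT uT t"
    if t: "t \<in> {0..T}" and j: "j < N" for t j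
  proof -
    have j1: "Suc j \<in> {1..N}" "j \<le> N" "Suc j \<le> N" using j by auto
    have "integral {0..\<delta>} (\<lambda>s. f (sat (\<xi> (Suc j) (t + s - \<delta>)) (z t)) (u (t + (real (Suc j) - 1) * \<delta> - \<tau> - r + s)))
      = T.Ps (Suc j) (T.xihist (\<xi>0 (Suc j)) (xiT (Suc j))) zT uT t"
      unfolding T.Ps_def
    proof (rule integral_cong)
      fix s assume s: "s \<in> {0..\<delta>}"
      have v: "t + s - \<delta> \<in> {-\<delta>..T}" using s t by auto
      have 1: "T.xihist (\<xi>0 (Suc j)) (xiT (Suc j)) (t + s - \<delta>) = \<xi> (Suc j) (t + s - \<delta>)"
        using v xi_init[OF j1(1), of "t + s - \<delta>"] by (auto simp: T.xihist_def xiT_def window_def)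
      have "real (Suc j) * \<delta> \<le> r + \<tau>" by (rule j\<delta>[OF j1(3)])
      then have "real j * \<delta> + s \<le> r + \<tau>" using s by (simp add: algebra_simps)
      then have 2: "uT (t + (real (Suc j) - 1) * \<delta> - \<tau> - r + s) = u (t + (real (Suc j) - 1) * \<delta> - \<tau> - r + s)"
        using s t \<delta>_nonneg mult_nonneg_nonneg[of "real j" \<delta>] by (intro ueq) auto
      have 3: "zT t = z t" using t by (simp add: zT_def window_eq)
      show "f (sat (\<xi> (Suc j) (t + s - \<delta>)) (z t)) (u (t + (real (Suc j) - 1) * \<delta> - \<tau> - r + s)) =
          predictor_trunc m (T.xihist (\<xi>0 (Suc j)) (xiT (Suc j)) (t + s - \<delta>)) (zT t) (uT (t + (real (Suc j) - 1) * \<delta> - \<tau> - r + s))"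
        unfolding 1 2 3 by (rule trunc_eq(6)[OF bz[OF t] bxi'[OF j1(1) v], symmetric])
    qed
    moreover have "sat_trunc m (xiT j t) (zT t) = sat (\<xi> j t) (z t)"
      using trunc_eq(5)[OF bz[OF t] bxi[OF j1(2) t]] t by (simp add: xiT_def zT_def window_eq)
    ultimately show ?thesis using xi_eq[OF j1(1), of t] t by (simp add: xiT_def window_eq)
  qed
  have st: "T.gs_step T x0 z0 w0 \<xi>0 u0 e xT zT wT xiT xT zT wT xiT"
    unfolding T.gs_step_def uT_def[symmetric]
  proof (intro ballI conjI allI impI)
    fix t assume t: "t \<in> {0..T}"
    show "xT t = T.Xs x0 xT uT t" "zT t = T.Zs z0 zT wT uT t" "wT t = T.Ws x0 w0 e xT zT uT t"
      by (fact Xeq[OF t], fact Zeq[OF t], fact Weq[OF t])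
    show "xiT 0 t = zT t" using t xi0[of t] by (simp add: xiT_def zT_def window_eq)
    show "xiT (Suc j) t = sat_trunc m (xiT j t) (zT t) + T.Ps (Suc j) (T.xihist (\<xi>0 (Suc j)) (xiT (Suc j))) zT uT t" if "j < N" for j
      by (rule Peq[OF t that])
  qed
  have me: "T.meas_state xT zT wT xiT" using xm zm wm xim by (simp add: T.meas_state_def)
  have dc: "T.close_data S T x0 z0 w0 \<xi>0 u0 e (\<lambda>_. 0) 0 0 (\<lambda>_ _. 0) (\<lambda>_. 0) (\<lambda>_. 0)"
    using d by (simp add: T.close_data_def data_bound_def)
  have Me: "a \<le> m * exp (T.rate * v)" if "a \<le> m" "v \<in> {0..T}" for a v
  proof -
    have "m * 1 \<le> m * exp (T.rate * v)" using m T.rate_ge_1 that by (intro mult_left_mono) auto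
    then show ?thesis using that by simp
  qed
  have bd: "T.close_state T.rate m T xT zT wT xiT (\<lambda>_. 0) (\<lambda>_. 0) (\<lambda>_. 0) (\<lambda>_ _. 0)"
    unfolding T.close_state_def
  proof (intro ballI conjI)
    fix t assume t: "t \<in> {0..T}"
    show "norm (xT t - 0) \<le> m * exp (T.rate * t)" using Me[OF bx t] t delays by (simp add: xT_def window_eq)
    show "norm (zT t - 0) \<le> m * exp (T.rate * t)" using Me[OF bz[OF t] t] t by (simp add: zT_def window_eq)
    show "norm (wT t - 0) \<le> m * exp (T.rate * t)" using Me[OF bw[OF t] t] t by (simp add: wT_def window_eq)
    show "norm (xiT j t - 0) \<le> m * exp (T.rate * t)" if "j \<in> {1..N}" for j using Me[OF bxi[of j, OF _ t] t] t that by (simp add: xiT_def window_eq)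
  qed
  have res: "T.close_state T.rate (2 * step_gain (trunc_lipschitz n) \<delta> N * S) T xT zT wT xiT (\<lambda>_. 0) (\<lambda>_. 0) (\<lambda>_. 0) (\<lambda>_ _. 0)"
    by (rule T.linear_bound[OF trunc_zero[OF m] kf(3) S(1) ad me dc st bd m])
  have A: "T.rate = transient_rate n" "2 * step_gain (trunc_lipschitz n) \<delta> N = transient_rate n" by (simp_all add: T.rate_def transient_rate_def)
  note res' = res[unfolded A T.close_state_def, rule_format, OF l]
  show "norm (x l) \<le> transient_rate n * S * exp (transient_rate n * l)" "norm (z l) \<le> transient_rate n * S * exp (transient_rate n * l)"
    "norm (w l) \<le> transient_rate n * S * exp (transient_rate n * l)" using res' l by (simp_all add: xT_def zT_def wT_def window_eq)
  show "norm (\<xi> j l) \<le> transient_rate n * S * exp (transient_rate n * l)" if "j \<in> {1..N}" using res' l that by (simp add: xiT_def window_eq)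
qed

end

section \<open>Existence of solutions\<close>

context closed_loop_setup
begin

lemma data_bounded:
  assumes e: "Linf_fun {0..} UNIV e" and \<xi>0: "\<forall>j\<in>{1..N}. Linf_fun {-\<delta>..<0} UNIV (\<xi>0 j)"
    and x0: "continuous_on {-r..0} x0" and u0: "Linf_fun {-r-\<tau>..<0} U u0"
  shows "\<exists>n\<ge>0. \<forall>T. data_bound n T x0 z0 w0 \<xi>0 u0 e"
proof -
  obtain B1 where B1: "\<forall>v\<in>{0..}. norm (e v) \<le> B1" using e unfolding Linf_fun_def bounded_iff by blast
  have "\<forall>j\<in>{1..N}. \<exists>B. \<forall>v\<in>{-\<delta>..<0}. norm (\<xi>0 j v) \<le> B" using \<xi>0 unfolding Linf_fun_def bounded_iff by blast
  then obtain B2 where B2: "\<forall>j\<in>{1..N}. \<forall>v\<in>{-\<delta>..<0}. norm (\<xi>0 j v) \<le> B2 j" by metis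
  have "compact (x0 ` {-r..0})" using x0 by (rule compact_continuous_image) simp
  then have "bounded (x0 ` {-r..0})" by (rule compact_imp_bounded)
  then obtain B3 where B3: "\<forall>v\<in>{-r..0}. norm (x0 v) \<le> B3" unfolding bounded_iff by blast
  obtain B4 where B4: "\<forall>v\<in>{-r-\<tau>..<0}. norm (u0 v) \<le> B4" using u0 unfolding Linf_fun_def bounded_iff by blast
  define n where "n = \<bar>B1\<bar> + (\<Sum>j=1..N. \<bar>B2 j\<bar>) + \<bar>B3\<bar> + \<bar>B4\<bar> + norm z0 + norm w0"
  have s0: "0 \<le> (\<Sum>j=1..N. \<bar>B2 j\<bar>)" by (intro sum_nonneg) simp
  have s: "\<bar>B2 j\<bar> \<le> (\<Sum>j=1..N. \<bar>B2 j\<bar>)" if "j \<in> {1..N}" for j using that by (intro member_le_sum) auto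
  have n0: "0 \<le> n" unfolding n_def using s0 by (intro add_nonneg_nonneg) auto
  have "data_bound n T x0 z0 w0 \<xi>0 u0 e" for T
    unfolding data_bound_def
  proof (intro conjI ballI)
    show "norm (x0 v) \<le> n" if "v \<in> {-r..0}" for v using B3[rule_format, OF that] s0 norm_ge_zero[of z0] norm_ge_zero[of w0] unfolding n_def by linarith
    show "norm (u0 v) \<le> n" if "v \<in> {-r-\<tau>..<0}" for v using B4[rule_format, OF that] s0 norm_ge_zero[of z0] norm_ge_zero[of w0] unfolding n_def by linarith
    show "norm (e v) \<le> n" if "v \<in> {0..T}" for v
    proof -
      have "norm (e v) \<le> B1" using B1 that by simp
      then show ?thesis using s0 norm_ge_zero[of z0] norm_ge_zero[of w0] unfolding n_def by linarith
    qed
    show "norm (\<xi>0 j v) \<le> n" if "j \<in> {1..N}" "v \<in> {-\<delta>..<0}" for j v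
    proof -
      have "norm (\<xi>0 j v) \<le> B2 j" using B2 that by blast
      then show ?thesis using s[OF that(1)] norm_ge_zero[of z0] norm_ge_zero[of w0] unfolding n_def by linarith
    qed
    show "norm z0 \<le> n" "norm w0 \<le> n" using s0 unfolding n_def by auto
  qed
  then show ?thesis using n0 by blast
qed

text \<open>Solve the truncated system and show afterwards that the truncation was never active. The
  a priori bounds are derived for the truncated solution in their order of dependence:
  \<open>x\<close> and \<open>z\<close> from \<open>V\<close>, then \<open>w\<close>, then the
  predictors.\<close>

lemma solution_exists:
  assumes ts: "time_partition ts" and gaps: "\<And>i. ts (Suc i) - ts i \<le> Ts"
    and e: "Linf_fun {0..} UNIV e" and \<xi>0: "\<And>j. j \<in> {1..N} \<Longrightarrow> Linf_fun {-\<delta>..<0} UNIV (\<xi>0 j)"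
    and x0: "continuous_on {-r..0} x0" and u0: "Linf_fun {-r-\<tau>..<0} U u0"
  shows "\<exists>x z w \<xi> u. closed_loop_solution f h kh kf q \<psi> \<tau> r N ts e x0 z0 w0 \<xi>0 u0 x z w \<xi> u"
proof -
  obtain n where n: "0 \<le> n" "\<forall>T. data_bound n T x0 z0 w0 \<xi>0 u0 e" using data_bounded[OF e _ x0 u0] \<xi>0 by blast
  define m where "m = radius n"
  obtain m0 where ap: "apriori n m0 m" using radius[OF n(1)] unfolding m_def by blast
  obtain Mh Bf where ap': "n \<le> m0" "m0 \<le> m" "\<And>v v0. norm v0 \<le> n \<Longrightarrow> V v \<le> max (V v0) b \<Longrightarrow> norm v \<le> m0"
     "0 \<le> Mh" "0 \<le> Bf" "\<And>v. norm v \<le> m0 \<Longrightarrow> norm (h v) \<le> Mh"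
     "\<And>v u. norm v \<le> m0 \<Longrightarrow> u \<in> U \<Longrightarrow> norm (jacobian h (at v) *v f v u) \<le> Bf" "n + Mh + n + Bf * Ts \<le> m"
     "\<And>v. norm v \<le> m0 \<Longrightarrow> K * \<psi> v + \<delta> * \<rho> (K * \<psi> v) \<le> m" using ap unfolding apriori_def by blast
  have d': "\<And>v. v \<in> {-r..0} \<Longrightarrow> norm (x0 v) \<le> n" "norm z0 \<le> n" "norm w0 \<le> n" "\<And>v. 0 \<le> v \<Longrightarrow> norm (e v) \<le> n"
    "\<And>j v. j \<in> {1..N} \<Longrightarrow> v \<in> {-\<delta>..<0} \<Longrightarrow> norm (\<xi>0 j v) \<le> n"
  proof -
    show "norm (e v) \<le> n" if "0 \<le> v" for v using n(2)[rule_format, of v] that unfolding data_bound_def by simp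
  qed (use n(2)[rule_format, of 0] in \<open>auto simp: data_bound_def\<close>)
  obtain B where "lip_system (plant_trunc m) (observer_trunc m) (drift_trunc m) (output_trunc m) (sat_trunc m) (predictor_trunc m) kf U (trunc_lipschitz n) B \<tau> r N \<delta> ts"
    using trunc_lipschitz[OF n(1)] ts unfolding m_def by blast
  then interpret T: lip_system "plant_trunc m" "observer_trunc m" "drift_trunc m" "output_trunc m" "sat_trunc m" "predictor_trunc m" kf U "trunc_lipschitz n" B \<tau> r N \<delta> ts .
  have ad: "T.admissible \<xi>0 u0"
    using u0 \<xi>0 unfolding T.admissible_def Linf_fun_def by auto
  obtain x z w \<xi> where me: "T.meas_state x z w \<xi>" and st: "\<forall>T. T.gs_step T x0 z0 w0 \<xi>0 u0 e x z w \<xi> x z w \<xi>"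
    using T.mild_solution_exists[of \<xi>0 u0 e n x0 z0 w0, OF ad d'(4)] by blast
  define u where "u = T.uhist u0 (\<xi> N)"
  note st' = st[rule_format, unfolded T.gs_step_def, folded u_def, rule_format]
  have Xe: "x t = T.Xs x0 x u t" and Ze: "z t = T.Zs z0 z w u t" and We: "w t = T.Ws x0 w0 e x z u t" and X0e: "\<xi> 0 t = z t"
    and Pe: "j < N \<Longrightarrow> \<xi> (Suc j) t = sat_trunc m (\<xi> j t) (z t) + T.Ps (Suc j) (T.xihist (\<xi>0 (Suc j)) (\<xi> (Suc j))) z u t" if "0 \<le> t" for t j
    using st'[of t t] that by auto
  have xm: "x \<in> borel_measurable lebesgue" "z \<in> borel_measurable lebesgue" "w \<in> borel_measurable lebesgue"
    and xim: "\<And>j. j \<in> {1..N} \<Longrightarrow> \<xi> j \<in> borel_measurable lebesgue"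
    using me by (auto simp: T.meas_state_def)
  have N1: "N \<in> {1..N}" using N by simp
  have um: "u \<in> borel_measurable lebesgue"
    unfolding u_def using ad xim[OF N1] by (intro T.uhist_meas) (auto simp: T.admissible_def)
  have uU: "u v \<in> U" for v
    unfolding u_def using ad by (intro T.uhist_U) (auto simp: T.admissible_def)
  \<comment> \<open>The mild solution does not carry the initial functions of plant and predictors;
    they are spliced in before time 0.\<close>
  define x' where "x' = T.xhist x0 x"
  define \<xi>' where "\<xi>' = (\<lambda>j. if j = 0 then z else T.xihist (\<xi>0 j) (\<xi> j))"
  have x'x: "x' t = x t" if "0 \<le> t" for t
    using Xe[of 0] that by (cases "t = 0") (auto simp: x'_def T.xhist_def T.Xs_def)
  have \<xi>'\<xi>: "\<xi>' j t = \<xi> j t" if "0 \<le> t" for j t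
    using that X0e[OF that] by (auto simp: \<xi>'_def T.xihist_def)
  define g1 where "g1 = (\<lambda>s. plant_trunc m (x s) (u (s - \<tau>)))"
  define g2 where "g2 = (\<lambda>s. observer_trunc m (z s) (w s) (u (s - r - \<tau>)))"
  define g3 where "g3 = (\<lambda>s. drift_trunc m (z s) (u (s - r - \<tau>)))"
  have gm: "g1 \<in> borel_measurable lebesgue" "g2 \<in> borel_measurable lebesgue" "g3 \<in> borel_measurable lebesgue"
    unfolding g1_def g2_def g3_def diff_diff_eq
    using T.integrand_meas(1)[OF xm(1) um uU] T.integrand_meas(4)[OF xm(2) um uU xm(3)] T.integrand_meas(2)[OF xm(2) um uU] by auto
  have gB: "norm (g1 s) \<le> B" "norm (g2 s) \<le> B" "norm (g3 s) \<le> B" for s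
    unfolding g1_def g2_def g3_def by (rule T.bds(1)[OF uU], rule T.bds(2)[OF uU], rule T.bds(3)[OF uU])
  have op: "open ({0..} - {0::real})" and op': "open ({a..<b'} - {a::real})" for a b'
  proof -
    have "{0..} - {0::real} = {0<..}" "{a..<b'} - {a} = {a<..<b'}" by auto
    then show "open ({0..} - {0::real})" "open ({a..<b'} - {a::real})" by (simp_all only: open_greaterThan open_greaterThanLessThan)
  qed
  have xI: "x' t = x0 0 + integral {0..t} g1" if "t \<in> {0..}" for t
    using that x'x[of t] Xe[of t] by (simp add: T.Xs_def g1_def)
  have zI: "z t = z0 + integral {0..t} g2" if "t \<in> {0..}" for t
    using that Ze[of t] by (simp add: T.Zs_def g2_def)
  have wI: "w t = T.sample x0 w0 e x i + integral {ts i..t} g3" if "t \<in> {ts i..<ts (Suc i)}" for t i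
  proof -
    have t: "ts i \<le> t" "t < ts (Suc i)" using that by auto
    have "0 \<le> t" using sampling_index_nonneg[OF ts, of i] t by simp
    then show ?thesis using We[of t] sampling_index_eq[OF ts t] by (simp add: T.Ws_def g3_def)
  qed
  have xs: "B-lipschitz_on {0..} x'" "\<exists>S. negligible S \<and> (\<forall>t\<in>{0..} - S. (x' has_vector_derivative g1 t) (at t))"
    by (rule indefinite_integral_ode[OF gm(1) gB(1) xI order_refl order_refl op], assumption)+
  have zs: "B-lipschitz_on {0..} z" "\<exists>S. negligible S \<and> (\<forall>t\<in>{0..} - S. (z has_vector_derivative g2 t) (at t))"
    by (rule indefinite_integral_ode[OF gm(2) gB(2) zI order_refl order_refl op], assumption)+
  have ws: "B-lipschitz_on {ts i..<ts (Suc i)} w" "\<exists>S. negligible S \<and> (\<forall>t\<in>{ts i..<ts (Suc i)} - S. (w has_vector_derivative g3 t) (at t))" for i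
  proof -
    have sub: "{ts i..<ts (Suc i)} \<subseteq> {ts i..}" by auto
    show "B-lipschitz_on {ts i..<ts (Suc i)} w" "\<exists>S. negligible S \<and> (\<forall>t\<in>{ts i..<ts (Suc i)} - S. (w has_vector_derivative g3 t) (at t))"
      by (rule indefinite_integral_ode[OF gm(3) gB(3) wI sampling_index_nonneg[OF ts] sub op'], assumption)+
  qed
  have lip: "lipode 0 t y g" if y: "B-lipschitz_on {0..} y" "\<exists>S. negligible S \<and> (\<forall>t\<in>{0..} - S. (y has_vector_derivative g t) (at t))"
    for t and y :: "real \<Rightarrow> real^'n" and g
  proof -
    obtain S where S: "negligible S" "\<forall>t\<in>{0..} - S. (y has_vector_derivative g t) (at t)" using y(2) by blast
    show ?thesis by (rule lipodeI[OF lipschitz_on_subset[OF y(1)] S(1)]) (use S(2) in auto)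
  qed
  \<comment> \<open>Where the cutoff is positive, the clip at radius \<open>m + 1\<close> is the
    identity, so the sign of the derivative of \<open>V\<close> has to be checked for the original
    field only.\<close>
  have cut: "cutoff m v * a' \<le> 0" if "norm v \<le> m + 1 \<Longrightarrow> a' \<le> 0" for v :: "real^'n" and a' :: real
  proof (cases "norm v \<le> m + 1")
    case True then show ?thesis using that cutoff_simps(1)[of m v] by (simp add: mult_nonneg_nonpos)
  next
    case False then show ?thesis using cutoff_simps(3)[of m v] by simp
  qed
  have Vx: "V (x' t) \<le> max (V (x' 0)) R" if "0 \<le> t" for t
  proof (rule absorbing_level(1)[OF lipode_chain[OF lip[OF xs] V_blip grad_has_derivative[OF V1]] that order_refl])
    fix l assume l: "l \<in> {0..t}" "R < V (x' l)"
    have e: "x' l = x l" using l by (intro x'x) simp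
    have "cutoff m (x l) * (grad V (x l) \<bullet> f (clip (m + 1) (x l)) (u (l - \<tau>))) \<le> 0"
    proof (rule cut)
      assume "norm (x l) \<le> m + 1"
      then have "clip (m + 1) (x l) = x l" by (rule clip_id)
      moreover have "grad V (x l) \<bullet> f (x l) (u (l - \<tau>)) \<le> - W (x l)" using l(2) e uU by (intro gradV_f) auto
      ultimately show "grad V (x l) \<bullet> f (clip (m + 1) (x l)) (u (l - \<tau>)) \<le> 0" using W(2)[rule_format, of "x l"] by simp
    qed
    then show "grad V (x' l) \<bullet> g1 l \<le> - 0" unfolding e g1_def plant_trunc_def by simp
  qed
  have Vz: "V (z t) \<le> max (V (z 0)) b" if "0 \<le> t" for t
  proof (rule absorbing_level(1)[OF lipode_chain[OF lip[OF zs] V_blip grad_has_derivative[OF V1]] that order_refl])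
    fix l assume l: "l \<in> {0..t}" "b < V (z l)"
    let ?u = "u (l - r - \<tau>)"
    have "cutoff m (z l) * (grad V (z l) \<bullet> (f (clip (m + 1) (z l)) ?u + kh (clip (m + 1) (z l)) (clip m (w l)) ?u)) \<le> 0"
    proof (rule cut)
      assume "norm (z l) \<le> m + 1"
      then have "clip (m + 1) (z l) = z l" by (rule clip_id)
      \<comment> \<open>The estimate holds for every output value, hence also for the clipped
        \<open>w\<close>, on which no bound is known yet.\<close>
      moreover have "grad V (z l) \<bullet> (f (z l) ?u + kh (z l) (clip m (w l)) ?u) \<le> - W (z l)" using l(2) uU by (intro gradV_kh) auto
      ultimately show "grad V (z l) \<bullet> (f (clip (m + 1) (z l)) ?u + kh (clip (m + 1) (z l)) (clip m (w l)) ?u) \<le> 0"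
        using W(2)[rule_format, of "z l"] by simp
    qed
    then show "grad V (z l) \<bullet> g2 l \<le> - 0" unfolding g2_def observer_trunc_def by simp
  qed
  have z00: "z 0 = z0" using zI[of 0] by simp
  have x00: "x' 0 = x0 0" using xI[of 0] by simp
  have bz0: "norm (z t) \<le> m0" if "0 \<le> t" for t
    by (rule ap'(3)[OF d'(2)]) (use Vz[OF that] z00 in simp)
  have bx0: "norm (x' t) \<le> m0" if "- r \<le> t" for t
  proof (cases "0 \<le> t")
    case True
    have "norm (x0 0) \<le> n" using d'(1)[of 0] delays by simp
    then show ?thesis by (rule ap'(3)) (use Vx[OF True] x00 consts3 in auto)
  next
    case False
    then have "x' t = x0 t" by (simp add: x'_def T.xhist_def)
    then show ?thesis using d'(1)[of t] False that ap'(1) by simp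
  qed
  have bz: "norm (z t) \<le> m" if "0 \<le> t" for t using bz0[OF that] ap'(2) by simp
  have bx: "norm (x' t) \<le> m" if "- r \<le> t" for t using bx0[OF that] ap'(2) by simp
  have g3e: "g3 s = jacobian h (at (z s)) *v f (z s) (u (s - r - \<tau>))" if "0 \<le> s" for s
    unfolding g3_def by (rule trunc_eq(3)[OF bz[OF that]])
  have samp: "T.sample x0 w0 e x i = (if i = 0 then w0 else h (x' (ts i - r)) + e (ts i))" for i
  proof -
    have "- r \<le> ts i - r" using sampling_index_nonneg[OF ts, of i] by simp
    then show ?thesis using trunc_eq(4)[OF bx] by (simp add: T.sample_def x'_def)
  qed
  have bw: "norm (w t) \<le> m" if t: "0 \<le> t" for t
  proof -
    define i where "i = sampling_index ts t"
    have i: "0 \<le> ts i" "ts i \<le> t" "t < ts (Suc i)"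
      unfolding i_def using sampling_index_nonneg[OF ts] sampling_index_lower[OF ts t] sampling_index_upper[OF ts] by auto
    have "norm (integral {ts i..t} g3) \<le> Bf * (t - ts i)"
    proof (rule norm_integral_le[OF bounded_measurable_integrable[OF gm(3) gB(3)] i(2)])
      fix s assume "s \<in> {ts i..t}"
      then have s: "0 \<le> s" using i by simp
      show "norm (g3 s) \<le> Bf" unfolding g3e[OF s] by (rule ap'(7)[OF bz0[OF s] uU])
    qed
    also have "\<dots> \<le> Bf * Ts" using i gaps[of i] ap'(5) by (intro mult_left_mono) auto
    finally have 1: "norm (integral {ts i..t} g3) \<le> Bf * Ts" .
    have "norm (T.sample x0 w0 e x i) \<le> n + Mh + n"
    proof (cases "i = 0")
      case True then show ?thesis using samp[of i] d'(3) n(1) ap'(4) by simp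
    next
      case False
      have "norm (h (x' (ts i - r))) \<le> Mh" using i by (intro ap'(6) bx0) simp
      then have "norm (h (x' (ts i - r)) + e (ts i)) \<le> Mh + n" using d'(4)[OF i(1)] by (intro norm_triangle_mono)
      then show ?thesis using samp[of i] False n(1) by simp
    qed
    then have "norm (w t) \<le> n + Mh + n + Bf * Ts"
      using wI[of t i] i norm_triangle_ineq[of "T.sample x0 w0 e x i" "integral {ts i..t} g3"] 1 by simp
    then show ?thesis using ap'(8) by simp
  qed
  have Pint: "norm (T.Ps j y z u t) \<le> \<delta> * \<rho> (K * \<psi> (z t))" if t: "0 \<le> t" and y: "y \<in> borel_measurable lebesgue" for j y t
  proof -
    have "norm (T.Ps j y z u t) \<le> \<rho> (K * \<psi> (z t)) * (t - (t - \<delta>))"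
      unfolding T.Ps_shift
    proof (rule norm_integral_le)
      show "(\<lambda>v. predictor_trunc m (y v) (z t) (u (v + (real j * \<delta> - \<tau> - r)))) integrable_on {t - \<delta>..t}"
        using T.integrand_integrable(3)[OF y um uU, of 0 "z t"] by simp
      show "norm (predictor_trunc m (y v) (z t) (u (v + (real j * \<delta> - \<tau> - r)))) \<le> \<rho> (K * \<psi> (z t))" for v
      proof -
        have "clip m (z t) = z t" using bz[OF t] by (rule clip_id)
        then show ?thesis unfolding predictor_trunc_def sat_trunc_def using \<rho>_upper[OF sat_le_\<psi> uU] by metis
      qed
    qed (use \<delta>_nonneg in simp)
    then show ?thesis by (simp add: mult.commute)
  qed
  have xihm: "T.xihist (\<xi>0 j) (\<xi> j) \<in> borel_measurable lebesgue" if "j \<in> {1..N}" for j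
    using ad that by (intro T.xihist_meas xim) (auto simp: T.admissible_def)
  have bxi: "norm (\<xi> j t) \<le> m" if t: "0 \<le> t" and j: "j \<le> N" for j t
  proof (cases j)
    case 0 then show ?thesis using X0e[OF t] bz[OF t] by simp
  next
    case (Suc i)
    have c: "clip m (z t) = z t" using bz[OF t] by (rule clip_id)
    have "norm (sat_trunc m (\<xi> i t) (z t)) \<le> K * \<psi> (z t)" unfolding sat_trunc_def c by (rule sat_le_\<psi>)
    moreover have "norm (T.Ps (Suc i) (T.xihist (\<xi>0 (Suc i)) (\<xi> (Suc i))) z u t) \<le> \<delta> * \<rho> (K * \<psi> (z t))"
      using j Suc by (intro Pint t xihm) simp
    ultimately have "norm (sat_trunc m (\<xi> i t) (z t) + T.Ps (Suc i) (T.xihist (\<xi>0 (Suc i)) (\<xi> (Suc i))) z u t) \<le> K * \<psi> (z t) + \<delta> * \<rho> (K * \<psi> (z t))"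
      by (rule norm_triangle_mono)
    then show ?thesis using Pe[OF t, of i] Suc j ap'(9)[OF bz0[OF t]] by simp
  qed
  have bxi': "norm (\<xi>' j v) \<le> m" if "j \<in> {1..N}" "- \<delta> \<le> v" for j v
  proof (cases "v < 0")
    case True
    then have "\<xi>' j v = \<xi>0 j v" using that by (simp add: \<xi>'_def T.xihist_def)
    then show ?thesis using d'(5)[OF that(1), of v] True that ap' by simp
  next
    case False then show ?thesis using bxi[of v j] \<xi>'\<xi>[of v j] that by simp
  qed
  have "closed_loop_solution f h kh kf q \<psi> \<tau> r N ts e x0 z0 w0 \<xi>0 u0 x' z w \<xi>' u"
    unfolding closed_loop_solution_def Let_def \<delta>_def[symmetric]
  proof (intro conjI allI impI ballI)
    show "abs_cont_on {0..T} x'" if "0 \<le> T" for T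
      by (rule lipschitz_imp_abs_cont_on[OF lipschitz_on_subset[OF xs(1)]]) auto
    show "abs_cont_on {0..T} z" if "0 \<le> T" for T
      by (rule lipschitz_imp_abs_cont_on[OF lipschitz_on_subset[OF zs(1)]]) auto
    show "abs_cont_on {ts i..<ts (Suc i)} w" for i
      by (rule lipschitz_imp_abs_cont_on[OF ws(1)])
    show "ode_ae {0..} x' (\<lambda>t. f (x' t) (u (t - \<tau>)))"
    proof -
      obtain S where S: "negligible S" "\<forall>t\<in>{0..} - S. (x' has_vector_derivative g1 t) (at t)" using xs(2) by blast
      have "g1 t = f (x' t) (u (t - \<tau>))" if "t \<in> {0..}" for t
        using that delays x'x[of t] trunc_eq(1)[OF bx[of t]] by (simp add: g1_def)
      then show ?thesis by (intro ode_aeI[OF S(1)]) (use S(2) in auto)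
    qed
    show "ode_ae {0..} z (\<lambda>t. f (z t) (u (t - r - \<tau>)) + kh (z t) (w t) (u (t - r - \<tau>)))"
    proof -
      obtain S where S: "negligible S" "\<forall>t\<in>{0..} - S. (z has_vector_derivative g2 t) (at t)" using zs(2) by blast
      have "g2 t = f (z t) (u (t - r - \<tau>)) + kh (z t) (w t) (u (t - r - \<tau>))" if "t \<in> {0..}" for t
        using that trunc_eq(2)[OF bz[of t] bw[of t]] by (simp add: g2_def)
      then show ?thesis by (intro ode_aeI[OF S(1)]) (use S(2) in auto)
    qed
    show "ode_ae {ts i..<ts (Suc i)} w (\<lambda>t. jacobian h (at (z t)) *v f (z t) (u (t - r - \<tau>)))" for i
    proof -
      obtain S where S: "negligible S" "\<forall>t\<in>{ts i..<ts (Suc i)} - S. (w has_vector_derivative g3 t) (at t)" using ws(2) by blast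
      show ?thesis
      proof (rule ode_aeI[OF S(1)])
        fix t assume t: "t \<in> {ts i..<ts (Suc i)} - S"
        then have "0 \<le> t" using sampling_index_nonneg[OF ts, of i] by simp
        then show "(w has_vector_derivative jacobian h (at (z t)) *v f (z t) (u (t - r - \<tau>))) (at t)" using S(2) t g3e[of t] by metis
      qed simp
    qed
    show "w (ts i) = h (x' (ts i - r)) + e (ts i)" if "1 \<le> i" for i
    proof -
      have "ts i < ts (Suc i)" using ts by (simp add: time_partition_def strict_mono_less)
      then show ?thesis using wI[of "ts i" i] samp[of i] that by simp
    qed
    show "\<xi>' 0 t = z t" for t by (simp add: \<xi>'_def)
    show "Linf_fun {- \<delta>..T} UNIV (\<xi>' j)" if "j \<in> {1..N}" "0 \<le> T" for j T
      unfolding Linf_fun_def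
    proof (intro conjI)
      have "\<xi>' j = T.xihist (\<xi>0 j) (\<xi> j)" using that by (simp add: \<xi>'_def)
      then show "\<xi>' j \<in> borel_measurable (lebesgue_on {- \<delta>..T})" using xihm[OF that(1)] by (simp add: measurable_restrict_space1)
      show "bounded (\<xi>' j ` {- \<delta>..T})" unfolding bounded_iff by (intro exI[of _ m]) (use bxi'[OF that(1)] in auto)
    qed simp
    show "\<xi>' j t = q (norm (\<xi>' (j - 1) t) / \<psi> (z t)) *\<^sub>R \<xi>' (j - 1) t + integral {0..\<delta>} (\<lambda>s. f (q (norm (\<xi>' j (t + s - \<delta>)) / \<psi> (z t)) *\<^sub>R \<xi>' j (t + s - \<delta>))
              (u (t + (real j - 1) * \<delta> - \<tau> - r + s)))" if j: "j \<in> {1..N}" and t: "0 \<le> t" for j t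
    proof -
      obtain i where i: "j = Suc i" using j by (cases j) auto
      have ij: "i < N" "i \<le> N" "j - 1 = i" using i j by auto
      have xih: "T.xihist (\<xi>0 (Suc i)) (\<xi> (Suc i)) = \<xi>' j" using i by (simp add: \<xi>'_def)
      have "T.Ps j (\<xi>' j) z u t = integral {0..\<delta>} (\<lambda>s. f (sat (\<xi>' j (t + s - \<delta>)) (z t)) (u (t + (real j - 1) * \<delta> - \<tau> - r + s)))"
        unfolding T.Ps_def by (intro integral_cong trunc_eq(6)[OF bz[OF t] bxi'[OF j]]) (use t in auto)
      moreover have "sat_trunc m (\<xi> i t) (z t) = sat (\<xi>' (j - 1) t) (z t)" unfolding ij(3) \<xi>'\<xi>[OF t] by (rule trunc_eq(5)[OF bz[OF t] bxi[OF t ij(2)]])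
      ultimately show ?thesis using Pe[OF t ij(1), unfolded xih] \<xi>'\<xi>[OF t, of j] i unfolding sat_def by simp
    qed
    show "u t = kf (\<xi>' N t)" if "0 \<le> t" for t using that \<xi>'\<xi>[OF that, of N] by (simp add: u_def T.uhist_def)
    show "x' \<theta> = x0 \<theta>" if "\<theta> \<in> {- r..0}" for \<theta> using that by (simp add: x'_def T.xhist_def)
    show "z 0 = z0" by (fact z00)
    show "w 0 = w0"
    proof -
      have "ts 0 = 0" "0 < ts (Suc 0)" using ts strict_mono_less[of ts 0 "Suc 0"] by (auto simp: time_partition_def)
      then show ?thesis using wI[of 0 0] samp[of 0] by simp
    qed
    show "\<xi>' j \<theta> = \<xi>0 j \<theta>" if "j \<in> {1..N}" "\<theta> \<in> {- \<delta>..<0}" for j \<theta> using that by (simp add: \<xi>'_def T.xihist_def)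
    show "u \<theta> = u0 \<theta>" if "\<theta> \<in> {- r - \<tau>..<0}" for \<theta> using that by (simp add: u_def T.uhist_def)
  qed
  then show ?thesis by blast
qed

end

section \<open>The bound of class K-infinity\<close>

lemma norm_le_sup_norm: "bounded (g ` A) \<Longrightarrow> s \<in> A \<Longrightarrow> norm (g s) \<le> sup_norm A g"
  unfolding sup_norm_def by (auto intro!: cSUP_upper bounded_imp_bdd_above simp: image_image bounded_norm_comp)

lemma sup_norm_nonneg: "bounded (g ` A) \<Longrightarrow> 0 \<le> sup_norm A g"
proof (cases "A = {}")
  case False
  assume "bounded (g ` A)"
  obtain s where "s \<in> A" using False by blast
  from norm_le_sup_norm[OF \<open>bounded (g ` A)\<close> this] show ?thesis using norm_ge_zero[of "g s"] by linarith
qed (simp add: sup_norm_def)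

lemma blip_imp_locally_lipschitz_on: "blip g \<Longrightarrow> locally_lipschitz_on A g"
  unfolding locally_lipschitz_on_def
proof (intro ballI)
  fix x assume "blip g"
  then have "lipb (cball x 1 \<inter> A) g" by (rule blip_lipb) (simp add: bounded_Int)
  then show "\<exists>d>0. \<exists>M. M-lipschitz_on (cball x d \<inter> A) g" unfolding lipb_def by (intro exI[of _ 1]) auto
qed

text \<open>\<open>B\<close> is arbitrary. \<open>ramp k\<close> rises from 0 to 1 between
  \<open>k - 2\<close> and \<open>k - 1\<close>, so only finitely many terms of
  \<open>\<beta>\<close> are nonzero on a bounded set, and the \<open>k\<close>-th counts fully
  wherever the rounded argument equals \<open>k\<close>. The summand 1 in \<open>C\<close> makes it
  strictly increasing and unbounded.\<close>

lemma class_K_inf_majorant: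
  fixes B :: "nat \<Rightarrow> real"
  shows "\<exists>C. locally_lipschitz_on {0..} C \<and> class_K_inf C \<and> (\<forall>s\<ge>0. B (nat \<lceil>s\<rceil>) * s \<le> C s)"
proof -
  define ramp where "ramp k s = max 0 (min 1 (s - real k + 2))" for k s
  define \<beta> where "\<beta> s = (\<Sum>k. \<bar>B k\<bar> * ramp k s)" for s
  define C where "C s = s * (1 + \<beta> s)" for s
  have \<beta>: "\<beta> s = (\<Sum>k<n. \<bar>B k\<bar> * ramp k s)" if "s + 2 \<le> real n" for n s
    unfolding \<beta>_def
  proof (rule suminf_finite)
    fix k assume "k \<notin> {..<n}"
    then have "s + 2 \<le> real k" using that by simp
    then show "\<bar>B k\<bar> * ramp k s = 0" by (simp add: ramp_def)
  qed simp
  have ramp_mono: "ramp k s \<le> ramp k t" if "s \<le> t" for k s t using that by (auto simp: ramp_def)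
  have ramp0: "0 \<le> ramp k s" for k s by (simp add: ramp_def)
  have \<beta>_mono: "\<beta> s \<le> \<beta> t" if "s \<le> t" for s t
  proof -
    obtain n where n: "t + 2 \<le> real n" using real_arch_simple by blast
    have "(\<Sum>k<n. \<bar>B k\<bar> * ramp k s) \<le> (\<Sum>k<n. \<bar>B k\<bar> * ramp k t)"
      by (intro sum_mono mult_left_mono ramp_mono that) simp
    then show ?thesis using \<beta>[of s n] \<beta>[of t n] n that by simp
  qed
  have \<beta>_nonneg: "0 \<le> \<beta> s" for s
  proof -
    obtain n where "s + 2 \<le> real n" using real_arch_simple by blast
    then show ?thesis using \<beta> ramp0 by (simp add: sum_nonneg)
  qed
  have \<beta>_ge: "B (nat \<lceil>s\<rceil>) \<le> \<beta> s" if "0 \<le> s" for s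
  proof -
    let ?k = "nat \<lceil>s\<rceil>"
    obtain n where n: "s + 2 \<le> real n" using real_arch_simple by blast
    have k: "real ?k \<le> s + 1" using that by linarith
    then have "ramp ?k s = 1" by (simp add: ramp_def)
    then have "B ?k \<le> \<bar>B ?k\<bar> * ramp ?k s" by simp
    also have "\<dots> \<le> (\<Sum>k<n. \<bar>B k\<bar> * ramp k s)"
      using ramp0 k n by (intro member_le_sum) auto
    also have "\<dots> = \<beta> s" using \<beta>[OF n] by simp
    finally show ?thesis .
  qed
  have "blip C" unfolding blip_def
  proof (intro allI impI)
    fix A :: "real set" assume A: "bounded A"
    then obtain M where M: "\<forall>s\<in>A. norm s \<le> M" unfolding bounded_iff by blast
    obtain n where n: "M + 2 \<le> real n" using real_arch_simple by blast
    have r: "lipb A (ramp k)" for k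
    proof (rule lipbI[of _ _ 1 1])
      show "norm (ramp k x - ramp k y) \<le> 1 * dist x y" for x y by (auto simp: ramp_def dist_real_def)
    qed (auto simp: ramp_def)
    have "lipb A (\<lambda>s. s * (1 + (\<Sum>k<n. \<bar>B k\<bar> * ramp k s)))"
      by (intro lipb_mult lipb_add lipb_const lipb_sum r lipb_bounded_linear[OF A bounded_linear_ident] finite_lessThan)
    moreover have "C s = s * (1 + (\<Sum>k<n. \<bar>B k\<bar> * ramp k s))" if "s \<in> A" for s
      using \<beta>[of s n] M n that by (force simp: C_def)
    ultimately show "lipb A C" unfolding lipb_def by (simp cong: lipschitz_on_cong image_cong)
  qed
  moreover have "class_K_inf C" unfolding class_K_inf_def
  proof (intro conjI allI impI)
    show "strict_mono_on {0..} C"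
    proof (rule strict_mono_onI)
      fix s t :: real assume st: "s \<in> {0..}" "s < t"
      have "s * (1 + \<beta> s) \<le> s * (1 + \<beta> t)" using st \<beta>_mono[of s t] by (intro mult_left_mono) auto
      also have "\<dots> < t * (1 + \<beta> t)" using st \<beta>_nonneg[of t] by (intro mult_strict_right_mono) auto
      finally show "C s < C t" by (simp add: C_def)
    qed
    show "continuous_on {0..} C" using blip_continuous[OF \<open>blip C\<close>] by (rule continuous_on_subset) simp
    show "0 \<le> C s" if "0 \<le> s" for s using that \<beta>_nonneg[of s] by (simp add: C_def)
    show "C 0 = 0" by (simp add: C_def)
    have "eventually (\<lambda>s. s \<le> C s) at_top"
      using eventually_ge_at_top[of 0]
    proof eventually_elim
      case (elim s)
      then show ?case using mult_left_mono[of 1 "1 + \<beta> s" s] \<beta>_nonneg[of s] by (simp add: C_def)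
    qed
    then show "filterlim C at_top at_top" by (rule filterlim_at_top_mono[OF filterlim_ident])
  qed
  moreover have "B (nat \<lceil>s\<rceil>) * s \<le> C s" if "0 \<le> s" for s
  proof -
    have "B (nat \<lceil>s\<rceil>) * s \<le> (1 + \<beta> s) * s" using \<beta>_ge[OF that] that by (intro mult_right_mono) auto
    then show ?thesis by (simp add: C_def mult.commute)
  qed
  ultimately show ?thesis using blip_imp_locally_lipschitz_on by blast
qed

section \<open>Gains as functions of the size of the data\<close>

context closed_loop_setup
begin

lemma entry_time_ex: "\<exists>T>0. \<exists>M w'. 0 < w' \<and> (\<forall>v. R < V v \<longrightarrow> V v \<le> M \<longrightarrow> w' \<le> W v) \<and>
    (\<forall>v. norm v \<le> n \<longrightarrow> V v \<le> M) \<and> b \<le> M \<and> M < w' * T"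
proof -
  obtain C where C: "\<forall>v. norm v \<le> n \<longrightarrow> V v \<le> C" using V_level by blast
  obtain w' where w: "0 < w'" "\<forall>v. R < V v \<and> V v \<le> max C b \<longrightarrow> w' \<le> W v" using W_lower by blast
  have "0 < max C b" using R(1) consts3 by simp
  then have "0 < (max C b + 1) / w'" "max C b < w' * ((max C b + 1) / w')" using w(1) by auto
  then show ?thesis using w C by (intro exI[of _ "(max C b + 1) / w'"] conjI exI[of _ "max C b"] exI[of _ w']) (auto simp: le_max_iff_disj)
qed

definition entry_time :: "real \<Rightarrow> real" where
  "entry_time n = (SOME T. T > 0 \<and> (\<exists>M w'. 0 < w' \<and> (\<forall>v. R < V v \<longrightarrow> V v \<le> M \<longrightarrow> w' \<le> W v) \<and>
    (\<forall>v. norm v \<le> n \<longrightarrow> V v \<le> M) \<and> b \<le> M \<and> M < w' * T))"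

lemma entry_time: "0 < entry_time n" "\<exists>M w'. 0 < w' \<and> (\<forall>v. R < V v \<longrightarrow> V v \<le> M \<longrightarrow> w' \<le> W v) \<and>
    (\<forall>v. norm v \<le> n \<longrightarrow> V v \<le> M) \<and> b \<le> M \<and> M < w' * entry_time n"
  using someI_ex[OF entry_time_ex[of n]] unfolding entry_time_def by blast+

text \<open>A delay \<open>r\<close> after the entry time also the delayed state
  \<open>x (t - r)\<close> lies in \<open>S1\<close>; the remaining terms are the start-up that
  \<open>final_phase\<close> asks for.\<close>

definition settling_time :: "real \<Rightarrow> real" where "settling_time n = entry_time n + r + Ts + 3 * (r + \<tau>)"

text \<open>The absolute values and the summand 1 make the gain at least 1, so that it also bounds
  the initial functions.\<close>

definition transient_gain :: "real \<Rightarrow> real" where "transient_gain n = (1 + \<bar>transient_rate n\<bar>) * exp (\<bar>transient_rate n\<bar> * settling_time n)"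

text \<open>During the transient \<open>x\<close>, \<open>w\<close>, \<open>z\<close> and each
  predictor count once and the input \<open>1 + feedback_lipschitz\<close> times. After it, the
  errors on the start-up windows are differences of two bounded states, which explains the factor
  2.\<close>

definition overall_gain :: "real \<Rightarrow> real" where
  "overall_gain n = exp (\<sigma> * settling_time n) * transient_gain n * (4 + real N + feedback_lipschitz + 2 * ultimate_gain)"

lemma settling_time_pos: "0 < settling_time n"
  unfolding settling_time_def using entry_time(1)[of n] Ts_\<sigma> delays by (intro add_pos_nonneg) auto

lemma transient_gain_ge_1: "1 \<le> transient_gain n"
proof -
  have "1 * 1 \<le> (1 + \<bar>transient_rate n\<bar>) * exp (\<bar>transient_rate n\<bar> * settling_time n)" using settling_time_pos[of n] by (intro mult_mono) auto
  then show ?thesis by (simp add: transient_gain_def)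
qed

end

section \<open>The estimate for all times\<close>

context closed_loop_solution_locale
begin

lemma entered:
  assumes n: "norm (x0 0) \<le> n" "norm z0 \<le> n" and l: "entry_time n \<le> l"
  shows "V (x l) \<le> R" "V (z l) \<le> b"
proof -
  obtain M w' where M: "0 < w'" "\<And>v. R < V v \<Longrightarrow> V v \<le> M \<Longrightarrow> w' \<le> W v"
    "\<And>v. norm v \<le> n \<Longrightarrow> V v \<le> M" "b \<le> M" "M < w' * entry_time n" using entry_time(2)[of n] by blast
  have "w' * entry_time n \<le> w' * l" using l M(1) by (intro mult_left_mono) auto
  then have "M < w' * l" "0 \<le> l" using M(5) entry_time(1)[of n] l by auto
  moreover have "V (x 0) \<le> M" "V (z 0) \<le> M" using M(3) n x_init[of 0] z_init delays by auto
  ultimately show "V (x l) \<le> R" "V (z l) \<le> b" using entry[OF M(1,2) _ _ M(4)] by auto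
qed

lemma uniform_transient:
  assumes n: "0 \<le> n" and d: "data_bound S T x0 z0 w0 \<xi>0 u0 e" and S: "0 \<le> S" "S \<le> n" and T: "0 \<le> T" "T \<le> settling_time n"
  shows "l \<in> {-r..T} \<Longrightarrow> norm (x l) \<le> transient_gain n * S" "l \<in> {0..T} \<Longrightarrow> norm (z l) \<le> transient_gain n * S"
    "l \<in> {0..T} \<Longrightarrow> norm (w l) \<le> transient_gain n * S" "j \<in> {1..N} \<Longrightarrow> l \<in> {-\<delta>..T} \<Longrightarrow> norm (\<xi> j l) \<le> transient_gain n * S"
    "l \<in> {-r-\<tau>..T} \<Longrightarrow> norm (u l) \<le> (1 + feedback_lipschitz) * (transient_gain n * S)"
proof -
  have le: "transient_rate n * S * exp (transient_rate n * l) \<le> transient_gain n * S" if "l \<in> {0..T}" for l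
  proof -
    have "transient_rate n * l \<le> \<bar>transient_rate n\<bar> * l" using that by (intro mult_right_mono) auto
    also have "\<dots> \<le> \<bar>transient_rate n\<bar> * settling_time n" using that T by (intro mult_left_mono) auto
    finally have "exp (transient_rate n * l) \<le> exp (\<bar>transient_rate n\<bar> * settling_time n)" by simp
    then have "transient_rate n * exp (transient_rate n * l) \<le> transient_gain n"
      unfolding transient_gain_def by (intro mult_mono) auto
    then show ?thesis using mult_right_mono[OF _ S(1), of "transient_rate n * exp (transient_rate n * l)" "transient_gain n"] by (simp add: mult_ac)
  qed
  have S': "S \<le> transient_gain n * S" using mult_right_mono[OF transient_gain_ge_1[of n] S(1)] by simp
  have d': "\<And>v. v \<in> {-r..0} \<Longrightarrow> norm (x0 v) \<le> S" "\<And>v. v \<in> {-r-\<tau>..<0} \<Longrightarrow> norm (u0 v) \<le> S"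
    "\<And>j v. j \<in> {1..N} \<Longrightarrow> v \<in> {-\<delta>..<0} \<Longrightarrow> norm (\<xi>0 j v) \<le> S"
    using d unfolding data_bound_def by auto
  note tr = transient[OF n d S]
  show "norm (x l) \<le> transient_gain n * S" if l: "l \<in> {-r..T}"
  proof (cases "0 \<le> l")
    case True then show ?thesis using order_trans[OF tr(1) le, of l] l by simp
  next
    case False then show ?thesis using x_init[of l] d'(1)[of l] S' l by simp
  qed
  show "norm (z l) \<le> transient_gain n * S" "norm (w l) \<le> transient_gain n * S" if l: "l \<in> {0..T}"
    using order_trans[OF tr(2)[OF l] le[OF l]] order_trans[OF tr(3)[OF l] le[OF l]] by auto
  have X: "norm (\<xi> j l) \<le> transient_gain n * S" if j: "j \<in> {1..N}" and l: "l \<in> {-\<delta>..T}" for j l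
  proof (cases "0 \<le> l")
    case True
    then have "l \<in> {0..T}" using l by simp
    then show ?thesis using order_trans[OF tr(4)[OF _ j] le] by blast
  next
    case False then show ?thesis using xi_init[OF j, of l] d'(3)[OF j, of l] S' l by simp
  qed
  then show "j \<in> {1..N} \<Longrightarrow> l \<in> {-\<delta>..T} \<Longrightarrow> norm (\<xi> j l) \<le> transient_gain n * S" .
  show "norm (u l) \<le> (1 + feedback_lipschitz) * (transient_gain n * S)" if l: "l \<in> {-r-\<tau>..T}"
  proof -
    have GS: "0 \<le> transient_gain n * S" using S S' by simp
    have CG: "0 \<le> feedback_lipschitz * (transient_gain n * S)" using feedback_lipschitz(1) GS by (rule mult_nonneg_nonneg)
    show ?thesis
    proof (cases "0 \<le> l")
      case True
      have "norm (\<xi> N l) \<le> transient_gain n * S" using X[of N l] True l N \<delta>_nonneg by simp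
      then have "feedback_lipschitz * norm (\<xi> N l) \<le> feedback_lipschitz * (transient_gain n * S)" using feedback_lipschitz(1) by (rule mult_left_mono)
      then show ?thesis using u_eq[OF True] feedback_lipschitz(2)[of "\<xi> N l"] GS by (simp add: distrib_right)
    next
      case False
      then have "norm (u l) \<le> S" using u_init[of l] d'(2)[of l] l by simp
      then show ?thesis using S' CG by (simp add: distrib_right)
    qed
  qed
qed

text \<open>Up to the settling time the transient bound may be multiplied by
  \<open>exp (\<sigma> * (settling_time n - t))\<close>, which is at least 1. Later
  \<open>final_bound\<close> applies; its start-up constant is the transient bound, doubled for
  differences and weighted at the settling time.\<close>

lemma total_bound:
  assumes n: "0 \<le> n" and d: "data_bound S t x0 z0 w0 \<xi>0 u0 e" and S: "0 \<le> S" "S \<le> n" and t: "0 \<le> t"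
    and \<epsilon>: "\<And>l. l \<in> {0..t} \<Longrightarrow> norm (e l) \<le> \<epsilon>" "0 \<le> \<epsilon>"
  shows "sup_norm {-r..0} (\<lambda>s. x (t + s)) + norm (w t) + norm (z t)
     + (\<Sum>j=1..N. sup_norm {-\<delta>..<0} (\<lambda>s. \<xi> j (t + s))) + sup_norm {-r-\<tau>..<0} (\<lambda>s. u (t + s))
   \<le> exp (- \<sigma> * t) * (overall_gain n * S) + ultimate_gain * \<epsilon>" (is "?lhs \<le> _")
proof -
  define G where "G = transient_gain n * S"
  define E where "E = exp (\<sigma> * settling_time n)"
  have G: "0 \<le> G" unfolding G_def using transient_gain_ge_1[of n] S(1) by simp
  have overall_gain: "overall_gain n * S = E * ((4 + real N + feedback_lipschitz + 2 * ultimate_gain) * G)" by (simp add: overall_gain_def G_def E_def)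
  show ?thesis
  proof (cases "t \<le> settling_time n")
    case True
    note tr = uniform_transient[OF n d S t True, folded G_def]
    have CG: "0 \<le> (1 + feedback_lipschitz) * G" using feedback_lipschitz(1) G by simp
    have "sup_norm {-r..0} (\<lambda>s. x (t + s)) \<le> G"
      by (rule sup_norm_le[OF G], rule tr(1)) (use t in auto)
    moreover have "norm (w t) \<le> G" "norm (z t) \<le> G" using tr(2,3)[of t] t by auto
    moreover have "(\<Sum>j=1..N. sup_norm {-\<delta>..<0} (\<lambda>s. \<xi> j (t + s))) \<le> (\<Sum>j=1..N. G)"
      by (rule sum_mono, rule sup_norm_le[OF G], rule tr(4)) (use t in auto)
    moreover have "sup_norm {-r-\<tau>..<0} (\<lambda>s. u (t + s)) \<le> (1 + feedback_lipschitz) * G"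
      by (rule sup_norm_le[OF CG], rule tr(5)) (use t in auto)
    ultimately have "?lhs \<le> (4 + real N + feedback_lipschitz) * G" by (simp add: algebra_simps)
    also have "\<dots> \<le> (4 + real N + feedback_lipschitz + 2 * ultimate_gain) * G" using ultimate_gain_nonneg G by (intro mult_right_mono) auto
    also have "\<dots> = 1 * \<dots>" by simp
    also have "\<dots> \<le> exp (- \<sigma> * t + \<sigma> * settling_time n) * ((4 + real N + feedback_lipschitz + 2 * ultimate_gain) * G)"
      using True Ts_\<sigma> ultimate_gain_nonneg feedback_lipschitz(1) G by (intro mult_right_mono) auto
    also have "\<dots> = exp (- \<sigma> * t) * (overall_gain n * S)" unfolding overall_gain by (simp only: E_def exp_add mult.assoc)
    also have "\<dots> \<le> exp (- \<sigma> * t) * (overall_gain n * S) + ultimate_gain * \<epsilon>" using ultimate_gain_nonneg \<epsilon>(2) by simp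
    finally show ?thesis .
  next
    case False
    then have Tt: "settling_time n \<le> t" by simp
    define T0 where "T0 = entry_time n + r"
    have T0e: "T0 + Ts + 3 * (r + \<tau>) = settling_time n" by (simp add: T0_def settling_time_def)
    have dT: "data_bound S (settling_time n) x0 z0 w0 \<xi>0 u0 e" using d Tt unfolding data_bound_def by auto
    note tr = uniform_transient[OF n dT S less_imp_le[OF settling_time_pos] order_refl, folded G_def]
    have T0p: "0 < T0" "r \<le> T0" unfolding T0_def using entry_time(1)[of n] delays by auto
    have Tsp: "0 \<le> Ts" using Ts_\<sigma> by simp
    have init: "norm (x0 0) \<le> n" "norm z0 \<le> n" 
    proof -
      have "norm (x0 0) \<le> S" "norm z0 \<le> S" using d delays unfolding data_bound_def by simp_all
      then show "norm (x0 0) \<le> n" "norm z0 \<le> n" using S(2) by linarith+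
    qed
    have \<delta>le: "\<delta> \<le> r + \<tau>" using j\<delta>[of 1] N by simp
    have El: "exp (\<sigma> * l) * y \<le> E * (2 * G)" if "l \<le> settling_time n" "y \<le> 2 * G" "0 \<le> y" for l y
      unfolding E_def using that Ts_\<sigma> by (intro mult_mono) auto
    interpret F: final_phase U \<tau> r f h V W P R \<mu> K1 kf Q L \<omega> a b c p q K \<psi> N \<delta> \<rho> S1 S2 S3 S4 M1q M1f G1 G2 Pt K2 Ts \<sigma>
      ts e x0 z0 w0 \<xi>0 u0 x z w \<xi> u T0 "E * (2 * G)" \<epsilon> t
    proof unfold_locales
      show "r \<le> T0" "0 < T0" using T0p by auto
      show "V (x l) \<le> R" if "T0 - r \<le> l" for l by (rule entered(1)[OF init]) (use that in \<open>simp add: T0_def\<close>)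
      show "V (z l) \<le> b" if "T0 \<le> l" for l by (rule entered(2)[OF init]) (use that delays in \<open>simp add: T0_def\<close>)
      show "exp (\<sigma> * l) * norm (z l - x (l - r)) \<le> E * (2 * G)" if l: "l \<in> {T0..T0 + Ts}" for l
      proof (rule El)
        show "l \<le> settling_time n" using l T0e delays by simp
        have "norm (z l) \<le> G" "norm (x (l - r)) \<le> G" using l T0e delays T0p by (intro tr(2), simp, intro tr(1), simp)
        then show "norm (z l - x (l - r)) \<le> 2 * G" using norm_triangle_ineq4[of "z l" "x (l - r)"] by simp
      qed simp
      show "exp (\<sigma> * l) * norm (\<xi> j l - x (l - r + real j * \<delta>)) \<le> E * (2 * G)" if j: "j \<in> {1..N}" and l: "l \<in> {T0..T0 + \<delta>}" for j l
      proof (rule El)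
        have jd: "0 \<le> real j * \<delta>" "real j * \<delta> \<le> r + \<tau>" using j\<delta>[of j] j \<delta>_nonneg by auto
        show "l \<le> settling_time n" using l T0e delays \<delta>le Tsp by simp
        then have "norm (\<xi> j l) \<le> G" using l T0p \<delta>_nonneg by (intro tr(4)[OF j]) simp
        moreover have "norm (x (l - r + real j * \<delta>)) \<le> G" using l T0e delays T0p jd \<delta>le Tsp by (intro tr(1)) simp
        ultimately show "norm (\<xi> j l - x (l - r + real j * \<delta>)) \<le> 2 * G" using norm_triangle_ineq4[of "\<xi> j l" "x (l - r + real j * \<delta>)"] by simp
      qed simp
      show "exp (\<sigma> * T0) * norm (x (T0 + \<tau>)) \<le> E * (2 * G)"
      proof (rule El)
        show "T0 \<le> settling_time n" using T0e delays Tsp by simp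
        have "norm (x (T0 + \<tau>)) \<le> G" using T0e delays T0p Tsp by (intro tr(1)) simp
        then show "norm (x (T0 + \<tau>)) \<le> 2 * G" using G by simp
      qed simp
      show "0 \<le> E * (2 * G)" using G by (simp add: E_def)
      show "T0 + Ts + 3 * (r + \<tau>) \<le> t" using T0e Tt by simp
    qed (use \<epsilon> in auto)
    have "?lhs \<le> ultimate_gain * (exp (- \<sigma> * t) * (E * (2 * G)) + \<epsilon>)" by (rule F.final_bound)
    also have "\<dots> = exp (- \<sigma> * t) * (E * ((2 * ultimate_gain) * G)) + ultimate_gain * \<epsilon>" by (simp add: algebra_simps)
    also have "\<dots> \<le> exp (- \<sigma> * t) * (E * ((4 + real N + feedback_lipschitz + 2 * ultimate_gain) * G)) + ultimate_gain * \<epsilon>"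
      using G feedback_lipschitz(1) by (intro add_right_mono mult_left_mono mult_right_mono) (auto simp: E_def)
    finally show ?thesis by (simp add: overall_gain)
  qed
qed

end

theorem theorem2p2:
  fixes U :: "(real^'m) set" and \<tau> r :: real
    and f :: "real^'n \<Rightarrow> real^'m \<Rightarrow> real^'n" and h :: "real^'n \<Rightarrow> real^'k"
    and V W P :: "real^'n \<Rightarrow> real" and R \<mu> K1 :: real and kf :: "real^'n \<Rightarrow> real^'m"
    and Q :: "real^'n^'n" and L :: "real^'k^'n" and \<omega> a b c :: real
    and p q :: "real \<Rightarrow> real" and K :: real and \<psi> :: "real^'n \<Rightarrow> real"
    and N :: nat and \<delta> :: real and \<rho> :: "real \<Rightarrow> real"
    and S1 S2 S3 S4 :: "(real^'n) set"
    and M1q M1f G1 G2 Pt K2 Ts \<sigma> :: real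
  \<comment> \<open>setting\<close>
  assumes U: "U \<noteq> {}" "compact U" "0 \<in> U"
    and delays: "\<tau> \<ge> 0" "r \<ge> 0"
    and f: "smooth (\<lambda>(x, u). f x u)" "f 0 0 = 0"
    and h: "smooth h" "h 0 = 0"
  \<comment> \<open>hypothesis 1; \<open>nbhd\<close> makes explicit that \<open>S\<^sub>1\<close> is a neighbourhood of the equilibrium: for
      \<open>f x u = -x\<^sup>3\<close>, \<open>V x = 1 + x\<^sup>2\<close>, \<open>W x = 2 x\<^sup>4\<close>, \<open>R = 1\<close> all other hypotheses can be met with
      \<open>S\<^sub>1 = {0}\<close>, and the conclusion fails\<close>
    and V: "Ck 2 V" "\<forall>x. V x \<ge> 0" "radially_unbounded V"
    and W: "Ck 1 W" "\<forall>x. W x \<ge> 0" "positive_definite_fun W"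
    and R: "R > 0" "\<forall>x. \<forall>u\<in>U. V x \<ge> R \<longrightarrow> grad V x \<bullet> f x u \<le> - W x"
    and nbhd: "0 \<in> interior {x. V x \<le> R}"
  \<comment> \<open>hypothesis 2\<close>
    and P: "Ck 2 P" "\<forall>x. P x \<ge> 0" "positive_definite_fun P"
    and consts2: "\<mu> > 0" "K1 > 0"
    and PK1: "\<forall>x. V x \<le> R \<longrightarrow> K1 * (norm x)\<^sup>2 \<le> P x"
    and kf: "\<exists>M. M-lipschitz_on UNIV kf" "\<forall>x. kf x \<in> U" "kf 0 = 0"
    and Pdecay: "\<forall>x. V x \<le> R \<longrightarrow> grad P x \<bullet> f x (kf x) \<le> - 2 * \<mu> * (norm x)\<^sup>2"
  \<comment> \<open>hypothesis 3\<close>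
    and Q: "transpose Q = Q" "\<forall>x. x \<noteq> 0 \<longrightarrow> x \<bullet> (Q *v x) > 0"
    and consts3: "\<omega> > 0" "b > R"
    and observer: "\<forall>u\<in>U. \<forall>z x. V z \<le> b \<and> V x \<le> R \<longrightarrow>
        (z - x) \<bullet> (Q *v (f z u + L *v (h z - h x) - f x u)) \<le> - \<omega> * (norm (z - x))\<^sup>2"
  \<comment> \<open>hypothesis 4\<close>
    and consts4: "0 < c" "c < 1" "R \<le> a" "a < b"
    and correction: "\<forall>u\<in>U. \<forall>z x.
        a < V z \<and> V z \<le> b \<and> grad V z \<bullet> (Q *v (z - x)) < 0 \<and> V x \<le> R \<longrightarrow>
        grad V z \<bullet> (f z u + L *v (h z - h x))
          \<le> - W z + (1 - c) * (norm (grad V z))\<^sup>2 *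
              (((z - x) \<bullet> (Q *v (f z u + L *v (h z - h x) - f x u)))
                / (grad V z \<bullet> (Q *v (z - x))))"
  \<comment> \<open>auxiliary functions and constants\<close>
    and p: "locally_lipschitz_on {0..} p" "\<forall>s\<ge>0. 0 \<le> p s \<and> p s \<le> 1"
           "\<forall>s\<ge>b. p s = 1" "\<forall>s. 0 \<le> s \<and> s \<le> a \<longrightarrow> p s = 0"
    and q: "Ck 1 q" "\<forall>s. q s \<ge> 0" "\<forall>s\<le>1. q s = 1" "K \<ge> 1" "\<forall>s\<ge>1. s * q s \<le> K"
    and \<psi>: "smooth \<psi>" "\<forall>z. \<psi> z \<ge> 1" "\<forall>x z. V x \<le> max (V z) b \<longrightarrow> norm x \<le> \<psi> z"
    and N: "N > 0"
    and \<delta>_def: "\<delta> = (r + \<tau>) / real N"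
    and \<rho>_def: "\<rho> = (\<lambda>s. Sup {norm (f z u) | z u. u \<in> U \<and> norm z \<le> s})"
    and S1_def: "S1 = {x. V x \<le> R}"
    and S2_def: "S2 = {x. V x \<le> b}"
    and S3_def: "S3 = {x. \<exists>z\<in>S2. norm x \<le> K * \<psi> z + \<delta> * \<rho> (K * \<psi> z)}"
    and S4_def: "S4 = {x. \<exists>z\<in>S2. norm x \<le> K * \<psi> z}"
    and M1q_def: "M1q = Sup {norm (q (norm \<xi> / \<psi> z) *\<^sub>R \<xi> - q (norm x / \<psi> z) *\<^sub>R x) / norm (x - \<xi>) | x \<xi> z.
                     x \<in> S1 \<and> \<xi> \<in> S3 \<and> z \<in> S2 \<and> x \<noteq> \<xi>}"
    and M1f_def: "M1f = Sup {norm (f x u - f \<xi> u) / norm (x - \<xi>) | x \<xi> u.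
                     x \<in> S1 \<and> \<xi> \<in> S4 \<and> u \<in> U \<and> x \<noteq> \<xi>}"
    and G1_def: "G1 = Sup {norm (jacobian h (at x) *v f x u - jacobian h (at z) *v f z u)
                     / norm (x - z) | x z u. x \<in> S1 \<and> z \<in> S2 \<and> u \<in> U \<and> x \<noteq> z}"
    and G2_def: "G2 = Sup {norm (khat f h V W p L R z y u - khat f h V W p L R z w u)
                     / norm (y - w) | y w z u. z \<in> S2 \<and> u \<in> U \<and> y \<noteq> w}"
    and Pt_def: "Pt = Sup {matnorm (hessian P x) | x. x \<in> convex hull S1}"
    and K2: "0 < K2" "K2 \<le> matnorm Q" "\<forall>x. K2 * (norm x)\<^sup>2 \<le> x \<bullet> (Q *v x)"
    and Ts_\<sigma>: "Ts > 0" "\<sigma> > 0"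
    and \<sigma>_le: "\<sigma> \<le> min (\<mu> / (sqrt (real CARD('n)) * Pt)) (c * \<omega> / (4 * matnorm Q))"
    and predictor_gain: "\<delta> * M1q * M1f * exp (\<sigma> * \<delta>) < 1"
    and sampling_gain: "Ts * G1 * exp (\<sigma> * Ts) * sqrt (2 * matnorm Q / K2)
                          * (G2 * matnorm Q / (c * \<omega>)) < 1"
  shows "\<exists>\<Gamma>>0. \<exists>C. locally_lipschitz_on {0..} C \<and> class_K_inf C \<and>
    (\<forall>(ts :: nat \<Rightarrow> real) (e :: real \<Rightarrow> real^'k) (\<xi>0 :: nat \<Rightarrow> real \<Rightarrow> real^'n)
       (z0 :: real^'n) (w0 :: real^'k) (x0 :: real \<Rightarrow> real^'n) (u0 :: real \<Rightarrow> real^'m).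
       time_partition ts \<and> (\<forall>i. ts (Suc i) - ts i \<le> Ts) \<and>
       Linf_fun {0..} UNIV e \<and> (\<forall>j\<in>{1..N}. Linf_fun {-\<delta>..<0} UNIV (\<xi>0 j)) \<and>
       continuous_on {-r..0} x0 \<and> Linf_fun {-r-\<tau>..<0} U u0 \<longrightarrow>
       (\<exists>x z w \<xi> u. closed_loop_solution f h (khat f h V W p L R) kf q \<psi> \<tau> r N ts e
          x0 z0 w0 \<xi>0 u0 x z w \<xi> u) \<and>
       (\<forall>x z w \<xi> u. closed_loop_solution f h (khat f h V W p L R) kf q \<psi> \<tau> r N ts e
          x0 z0 w0 \<xi>0 u0 x z w \<xi> u \<longrightarrow>
          (\<forall>t\<ge>0.
             sup_norm {-r..0} (\<lambda>s. x (t + s)) + norm (w t) + norm (z t)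
               + (\<Sum>j=1..N. sup_norm {-\<delta>..<0} (\<lambda>s. \<xi> j (t + s)))
               + sup_norm {-r-\<tau>..<0} (\<lambda>s. u (t + s))
             \<le> exp (- \<sigma> * t) *
                 C (sup_norm {-r..0} x0 + norm z0 + norm w0
                    + (\<Sum>j=1..N. sup_norm {-\<delta>..<0} (\<xi>0 j))
                    + sup_norm {-r-\<tau>..<0} u0 + sup_norm {0..t} e)
               + \<Gamma> * sup_norm {0..t} e)))"
proof -
  interpret closed_loop_setup U \<tau> r f h V W P R \<mu> K1 kf Q L \<omega> a b c p q K \<psi> N \<delta> \<rho> S1 S2 S3 S4 M1q M1f G1 G2 Pt K2 Ts \<sigma>
    by (rule closed_loop_setup.intro[OF assms])
  \<comment> \<open>The gains are chosen separately for every \<open>n\<close>, with no regularity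
    in \<open>n\<close>; hence only their values at integers are majorized.\<close>
  obtain C where C: "locally_lipschitz_on {0..} C" "class_K_inf C" "\<And>s. 0 \<le> s \<Longrightarrow> overall_gain (real (nat \<lceil>s\<rceil>)) * s \<le> C s"
    using class_K_inf_majorant[of "\<lambda>k. overall_gain (real k)"] by blast
  show ?thesis
  \<comment> \<open>\<open>ultimate_gain\<close> is known to be nonnegative; the \<open>+ 1\<close>
    makes the constant positive.\<close>
  proof (rule exI[of _ "ultimate_gain + 1"], rule conjI, goal_cases)
    case 1 show ?case using ultimate_gain_nonneg by simp
  next
    case 2
    show ?case
    proof (rule exI[of _ C], intro conjI C(1,2) allI impI, goal_cases)
      case (1 ts e \<xi>0 z0 w0 x0 u0)
      then show ?case by (intro solution_exists) blast+
    next
      case (2 ts e \<xi>0 z0 w0 x0 u0 x z w \<xi> u t)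
      then have ax: "time_partition ts" "\<forall>i. ts (Suc i) - ts i \<le> Ts" "Linf_fun {0..} UNIV e" "\<forall>j\<in>{1..N}. Linf_fun {-\<delta>..<0} UNIV (\<xi>0 j)"
        "continuous_on {-r..0} x0" "Linf_fun {-r-\<tau>..<0} U u0"
        "closed_loop_solution f h kh kf q \<psi> \<tau> r N ts e x0 z0 w0 \<xi>0 u0 x z w \<xi> u"
        by simp_all
      interpret S: closed_loop_solution_locale U \<tau> r f h V W P R \<mu> K1 kf Q L \<omega> a b c p q K \<psi> N \<delta> \<rho> S1 S2 S3 S4 M1q M1f G1 G2 Pt K2 Ts \<sigma>
          ts e x0 z0 w0 \<xi>0 u0 x z w \<xi> u
        by unfold_locales (use ax in simp_all)
      have t: "0 \<le> t" using 2 by blast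
      let ?s = "sup_norm {-r..0} x0 + norm z0 + norm w0 + (\<Sum>j=1..N. sup_norm {-\<delta>..<0} (\<xi>0 j))
                    + sup_norm {-r-\<tau>..<0} u0 + sup_norm {0..t} e"
      have bd: "bounded (x0 ` {-r..0})" "bounded (u0 ` {-r-\<tau>..<0})" "bounded (e ` {0..t})"
        "\<And>j. j \<in> {1..N} \<Longrightarrow> bounded (\<xi>0 j ` {-\<delta>..<0})"
      proof -
        show "bounded (x0 ` {-r..0})" by (rule compact_imp_bounded[OF compact_continuous_image[OF S.x0 compact_Icc]])
        show "bounded (u0 ` {-r-\<tau>..<0})" using S.u0 unfolding Linf_fun_def by blast
        have "bounded (e ` {0..})" using S.e unfolding Linf_fun_def by blast
        then show "bounded (e ` {0..t})" by (rule bounded_subset) auto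
        show "bounded (\<xi>0 j ` {-\<delta>..<0})" if "j \<in> {1..N}" for j using S.\<xi>0[OF that] unfolding Linf_fun_def by blast
      qed
      note nn = sup_norm_nonneg[OF bd(1)] sup_norm_nonneg[OF bd(2)] sup_norm_nonneg[OF bd(3)] norm_ge_zero[of z0] norm_ge_zero[of w0]
      have sn: "0 \<le> sup_norm {-\<delta>..<0} (\<xi>0 j)" if "j \<in> {1..N}" for j by (rule sup_norm_nonneg[OF bd(4)[OF that]])
      have sum0: "0 \<le> (\<Sum>j=1..N. sup_norm {-\<delta>..<0} (\<xi>0 j))" using sn by (rule sum_nonneg)
      have s0: "0 \<le> ?s" using nn sum0 by linarith
      have d: "data_bound ?s t x0 z0 w0 \<xi>0 u0 e" unfolding data_bound_def
      proof (intro conjI ballI)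
        show "norm (x0 v) \<le> ?s" if "v \<in> {-r..0}" for v using norm_le_sup_norm[OF bd(1) that] nn sum0 by linarith
        show "norm (u0 v) \<le> ?s" if "v \<in> {-r-\<tau>..<0}" for v using norm_le_sup_norm[OF bd(2) that] nn sum0 by linarith
        show "norm (e v) \<le> ?s" if "v \<in> {0..t}" for v using norm_le_sup_norm[OF bd(3) that] nn sum0 by linarith
        show "norm (\<xi>0 j v) \<le> ?s" if j: "j \<in> {1..N}" "v \<in> {-\<delta>..<0}" for j v
        proof -
          have "norm (\<xi>0 j v) \<le> sup_norm {-\<delta>..<0} (\<xi>0 j)" by (rule norm_le_sup_norm[OF bd(4)[OF j(1)] j(2)])
          also have "\<dots> \<le> (\<Sum>j=1..N. sup_norm {-\<delta>..<0} (\<xi>0 j))" by (rule member_le_sum[OF j(1)]) (use sn in auto)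
          finally show ?thesis using nn by linarith
        qed
        show "norm z0 \<le> ?s" "norm w0 \<le> ?s" using nn sum0 by linarith+
      qed
      \<comment> \<open>The size of the data rounded up serves as \<open>n\<close>, and the exact
        size as \<open>S\<close>.\<close>
      have sl: "?s \<le> real (nat \<lceil>?s\<rceil>)" using s0 by linarith
      have "exp (- \<sigma> * t) * (overall_gain (real (nat \<lceil>?s\<rceil>)) * ?s) + ultimate_gain * sup_norm {0..t} e \<le> exp (- \<sigma> * t) * C ?s + (ultimate_gain + 1) * sup_norm {0..t} e"
        using C(3)[OF s0] nn(3) by (intro add_mono mult_left_mono mult_right_mono) auto
      with S.total_bound[OF of_nat_0_le_iff d s0 sl t norm_le_sup_norm[OF bd(3)] nn(3)] show ?case by (rule order_trans)
    qed
  qed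
qed
end
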